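(* Let $k$ be an algebraically closed field of characteristic $0$, and let $A$ be a complete local Noetherian Cohen-Macaulay $k$-algebra with residue field $k$ that is an isolated singularity, of dimension $d \ge 1$. Assume that either $d = 1$ and $A$ is Gorenstein, or $d \ge 2$ and $A$ is $\mathbf{Q}$-Gorenstein. Then the canonical module $\omega_A$ admits an integrable connection.
   Context: $A$ is an isolated singularity if $A_p$ is a regular local ring for all prime ideals $p$ different from the maximal ideal of $A$. In particular, if $d \ge 2$, then $A$ is normal. The canonical module $\omega_A$ is the (unique up to isomorphism) maximal Cohen-Macaulay $A$-module (i.e. finitely generated with $\operatorname{depth} = \dim A$) of finite injective dimension with $\dim_k \operatorname{Ext}^d_A(k, \omega_A) = 1$, $d = \dim(A)$. When $d \ge 2$, $A$ is called $\mathbf{Q}$-Gorenstein if for some integer $n \ge 1$ one has $\omega_A^{[n]} := (\omega_A \otimes_A \dots \otimes_A \omega_A)^{\vee\vee} \cong A$ ($n$ tensor factors), where $(-)^\vee = \operatorname{Hom}_A(-, A)$. A connection on an $A$-module $M$ is an $A$-linear map $\nabla: \operatorname{Der}_k(A) \to \operatorname{End}_k(M)$, $D \mapsto \nabla_D$, such that $\nabla_D(am) = a \nabla_D(m) + D(a) m$ for all $D \in \operatorname{Der}_k(A)$, $a \in A$, $m \in M$. It is integrable if $[\nabla_D, \nabla_{D'}] = \nabla_{[D,D']}$ for all $D, D' \in \operatorname{Der}_k(A)$. *)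

theory Defs
  imports
    "HOL-Library.Extended_Nat" "HOL-Algebra.Algebraic_Closure" "HOL-Algebra.Ideal_Product" "HOL-Algebra.QuotRing" "HOL-Algebra.Module"
begin

section \<open>Modules\<close>

text \<open>
  Linear maps and all other module-valued functions are taken extensional, so that equality of
  maps is equality of HOL functions. The fields \<^const>\<open>monoid.mult\<close> and \<^const>\<open>one\<close> of a record of type
  \<^typ>\<open>('a, 'm) module\<close> play no role for modules and are left undefined below.
\<close>

definition lin_maps ::
  "('a, 'r) ring_scheme \<Rightarrow> ('a, 'm, 's) module_scheme \<Rightarrow> ('a, 'n, 't) module_scheme \<Rightarrow> ('m \<Rightarrow> 'n) set"
  where "lin_maps R M N = {f \<in> carrier M \<rightarrow>\<^sub>E carrier N.
    (\<forall>x\<in>carrier M. \<forall>y\<in>carrier M. f (x \<oplus>\<^bsub>M\<^esub> y) = f x \<oplus>\<^bsub>N\<^esub> f y) \<and>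
    (\<forall>a\<in>carrier R. \<forall>x\<in>carrier M. f (a \<odot>\<^bsub>M\<^esub> x) = a \<odot>\<^bsub>N\<^esub> f x)}"

definition mod_iso ::
  "('a, 'r) ring_scheme \<Rightarrow> ('a, 'm, 's) module_scheme \<Rightarrow> ('a, 'n, 't) module_scheme \<Rightarrow> bool"
  where "mod_iso R M N \<longleftrightarrow> (\<exists>f \<in> lin_maps R M N. bij_betw f (carrier M) (carrier N))"

definition mod_span ::
  "('a, 'r) ring_scheme \<Rightarrow> ('a, 'm, 's) module_scheme \<Rightarrow> 'm set \<Rightarrow> 'm set"
  where "mod_span R M S = \<Inter>{H. submodule H R M \<and> S \<subseteq> H}"

definition fin_gen :: "('a, 'r) ring_scheme \<Rightarrow> ('a, 'm, 's) module_scheme \<Rightarrow> bool"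
  where "fin_gen R M \<longleftrightarrow> (\<exists>S. finite S \<and> S \<subseteq> carrier M \<and> mod_span R M S = carrier M)"

definition self_module :: "('a, 'r) ring_scheme \<Rightarrow> ('a, 'a) module"
  where "self_module R = \<lparr>carrier = carrier R, monoid.mult = monoid.mult R, one = one R,
    zero = zero R, add = add R, smult = monoid.mult R\<rparr>"

definition quot_module ::
  "('a, 'r) ring_scheme \<Rightarrow> ('a, 'm, 's) module_scheme \<Rightarrow> 'm set \<Rightarrow> ('a, 'm set) module"
  where "quot_module R M N = \<lparr>carrier = a_rcosets\<^bsub>M\<^esub> N, monoid.mult = undefined, one = undefined,
    zero = N, add = set_add M, smult = (\<lambda>a C. \<Union>x\<in>C. N +>\<^bsub>M\<^esub> (a \<odot>\<^bsub>M\<^esub> x))\<rparr>"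

text \<open>A set \<open>H\<close> of \<open>N\<close>-valued functions on \<open>I\<close> with the pointwise operations.\<close>

definition fun_module :: "'x set \<Rightarrow> ('x \<Rightarrow> 'n) set \<Rightarrow> ('a, 'n, 's) module_scheme \<Rightarrow> ('a, 'x \<Rightarrow> 'n) module"
  where "fun_module I H N = \<lparr>carrier = H, monoid.mult = undefined, one = undefined,
    zero = (\<lambda>x\<in>I. \<zero>\<^bsub>N\<^esub>), add = (\<lambda>f g. \<lambda>x\<in>I. f x \<oplus>\<^bsub>N\<^esub> g x), smult = (\<lambda>a f. \<lambda>x\<in>I. a \<odot>\<^bsub>N\<^esub> f x)\<rparr>"

definition hom_module ::
  "('a, 'r) ring_scheme \<Rightarrow> ('a, 'm, 's) module_scheme \<Rightarrow> ('a, 'n, 't) module_scheme \<Rightarrow> ('a, 'm \<Rightarrow> 'n) module"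
  where "hom_module R M N = fun_module (carrier M) (lin_maps R M N) N"

definition dual_module ::
  "('a, 'r) ring_scheme \<Rightarrow> ('a, 'm, 's) module_scheme \<Rightarrow> ('a, 'm \<Rightarrow> 'a) module"
  where "dual_module R M = hom_module R M (self_module R)"

definition free_module :: "('a, 'r) ring_scheme \<Rightarrow> 'x set \<Rightarrow> ('a, 'x \<Rightarrow> 'a) module"
  where "free_module R I =
    fun_module I {f \<in> I \<rightarrow>\<^sub>E carrier R. finite {x \<in> I. f x \<noteq> \<zero>\<^bsub>R\<^esub>}} (self_module R)"

definition free_gen :: "('a, 'r) ring_scheme \<Rightarrow> 'x set \<Rightarrow> 'x \<Rightarrow> 'x \<Rightarrow> 'a"
  where "free_gen R I x = (\<lambda>y\<in>I. if y = x then \<one>\<^bsub>R\<^esub> else \<zero>\<^bsub>R\<^esub>)"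

text \<open>
  The \<open>n\<close>-fold tensor power: the free module on the \<open>n\<close>-tuples of elements of \<open>M\<close>,
  modulo the relations of multilinearity.
\<close>

definition tensor_rels :: "('a, 'r) ring_scheme \<Rightarrow> ('a, 'm, 's) module_scheme \<Rightarrow> nat \<Rightarrow> ((nat \<Rightarrow> 'm) \<Rightarrow> 'a) set"
  where "tensor_rels R M n =
    (let I = {..<n} \<rightarrow>\<^sub>E carrier M; F = free_module R I; e = free_gen R I in
      {e (x(i := u \<oplus>\<^bsub>M\<^esub> v)) \<ominus>\<^bsub>F\<^esub> (e (x(i := u)) \<oplus>\<^bsub>F\<^esub> e (x(i := v))) | x i u v.
         x \<in> I \<and> i < n \<and> u \<in> carrier M \<and> v \<in> carrier M} \<union>
      {e (x(i := a \<odot>\<^bsub>M\<^esub> u)) \<ominus>\<^bsub>F\<^esub> (a \<odot>\<^bsub>F\<^esub> e (x(i := u))) | x i a u.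
         x \<in> I \<and> i < n \<and> a \<in> carrier R \<and> u \<in> carrier M})"

definition tensor_power ::
  "('a, 'r) ring_scheme \<Rightarrow> ('a, 'm, 's) module_scheme \<Rightarrow> nat \<Rightarrow> ('a, ((nat \<Rightarrow> 'm) \<Rightarrow> 'a) set) module"
  where "tensor_power R M n =
    (let F = free_module R ({..<n} \<rightarrow>\<^sub>E carrier M) in
      quot_module R F (mod_span R F (tensor_rels R M n)))"

definition restrict_scalars ::
  "('k, 'a, 's) module_scheme \<Rightarrow> ('a, 'm) module \<Rightarrow> ('k, 'm) module"
  where "restrict_scalars A M = \<lparr>carrier = carrier M, monoid.mult = monoid.mult M, one = one M,
    zero = zero M, add = add M, smult = (\<lambda>c x. (c \<odot>\<^bsub>A\<^esub> \<one>\<^bsub>A\<^esub>) \<odot>\<^bsub>M\<^esub> x)\<rparr>"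

definition is_basis :: "('k, 'r) ring_scheme \<Rightarrow> ('k, 'm, 's) module_scheme \<Rightarrow> 'm set \<Rightarrow> bool"
  where "is_basis K V B \<longleftrightarrow> finite B \<and> B \<subseteq> carrier V \<and>
    (\<forall>v\<in>carrier V. \<exists>!c. c \<in> B \<rightarrow>\<^sub>E carrier K \<and> v = (\<Oplus>\<^bsub>V\<^esub>b\<in>B. c b \<odot>\<^bsub>V\<^esub> b))"

definition has_dim :: "('k, 'r) ring_scheme \<Rightarrow> ('k, 'm, 's) module_scheme \<Rightarrow> nat \<Rightarrow> bool"
  where "has_dim K V n \<longleftrightarrow> (\<exists>B. is_basis K V B \<and> card B = n)"


section \<open>Local rings\<close>

definition local_ring :: "('a, 'r) ring_scheme \<Rightarrow> bool"
  where "local_ring R \<longleftrightarrow> cring R \<and> (\<exists>!m. maximalideal m R)"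

definition max_ideal :: "('a, 'r) ring_scheme \<Rightarrow> 'a set"
  where "max_ideal R = (THE m. maximalideal m R)"

definition krull_dim :: "('a, 'r) ring_scheme \<Rightarrow> enat"
  where "krull_dim R = Sup {enat n | n.
    \<exists>P. (\<forall>i\<le>n. primeideal (P i) R) \<and> (\<forall>i<n. P i \<subset> P (Suc i))}"

definition emb_dim :: "('a, 'r) ring_scheme \<Rightarrow> nat"
  where "emb_dim R = (LEAST n. \<exists>S. finite S \<and> card S = n \<and> S \<subseteq> carrier R \<and> Idl\<^bsub>R\<^esub> S = max_ideal R)"

definition regular_local_ring :: "('a, 'r) ring_scheme \<Rightarrow> bool"
  where "regular_local_ring R \<longleftrightarrow>
    noetherian_ring R \<and> local_ring R \<and> krull_dim R = enat (emb_dim R)"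

text \<open>The fraction \<open>a / s\<close> is the class of all pairs \<open>(b, t)\<close> with \<open>u (t a - s b) = 0\<close> for some \<open>u \<in> S\<close>.\<close>

definition fraction :: "('a, 'r) ring_scheme \<Rightarrow> 'a set \<Rightarrow> 'a \<Rightarrow> 'a \<Rightarrow> ('a \<times> 'a) set"
  where "fraction R S a s = {(b, t). b \<in> carrier R \<and> t \<in> S \<and>
    (\<exists>u\<in>S. u \<otimes>\<^bsub>R\<^esub> (t \<otimes>\<^bsub>R\<^esub> a) = u \<otimes>\<^bsub>R\<^esub> (s \<otimes>\<^bsub>R\<^esub> b))}"

definition localization :: "('a, 'r) ring_scheme \<Rightarrow> 'a set \<Rightarrow> (('a \<times> 'a) set) ring"
  where "localization R S = \<lparr>carrier = {fraction R S a s | a s. a \<in> carrier R \<and> s \<in> S},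
    monoid.mult = (\<lambda>C D. \<Union>(a, s)\<in>C. \<Union>(b, t)\<in>D. fraction R S (a \<otimes>\<^bsub>R\<^esub> b) (s \<otimes>\<^bsub>R\<^esub> t)),
    one = fraction R S \<one>\<^bsub>R\<^esub> \<one>\<^bsub>R\<^esub>,
    zero = fraction R S \<zero>\<^bsub>R\<^esub> \<one>\<^bsub>R\<^esub>,
    add = (\<lambda>C D. \<Union>(a, s)\<in>C. \<Union>(b, t)\<in>D.
      fraction R S ((t \<otimes>\<^bsub>R\<^esub> a) \<oplus>\<^bsub>R\<^esub> (s \<otimes>\<^bsub>R\<^esub> b)) (s \<otimes>\<^bsub>R\<^esub> t))\<rparr>"

definition isolated_singularity :: "('a, 'r) ring_scheme \<Rightarrow> bool"
  where "isolated_singularity R \<longleftrightarrow>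
    (\<forall>p. primeideal p R \<and> p \<noteq> max_ideal R \<longrightarrow> regular_local_ring (localization R (carrier R - p)))"

text \<open>
  Bijectivity of \<open>R \<rightarrow> lim R / m\<^sup>n\<close>: the first condition is injectivity; in the second one the
  sequences \<open>x\<close> represent the elements of the inverse limit.
\<close>

definition complete_local_ring :: "('a, 'r) ring_scheme \<Rightarrow> bool"
  where "complete_local_ring R \<longleftrightarrow> local_ring R \<and>
    (let I = (\<lambda>n::nat. max_ideal R [^]\<^bsub>ideals_set R\<^esub> n) in
      (\<Inter>n. I n) = {\<zero>\<^bsub>R\<^esub>} \<and>
      (\<forall>x. (\<forall>n. x n \<in> carrier R \<and> x (Suc n) \<ominus>\<^bsub>R\<^esub> x n \<in> I n) \<longrightarrow>
        (\<exists>y\<in>carrier R. \<forall>n. y \<ominus>\<^bsub>R\<^esub> x n \<in> I n)))"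

definition has_residue_field :: "('k, 'r) ring_scheme \<Rightarrow> ('k, 'a) module \<Rightarrow> bool"
  where "has_residue_field K A \<longleftrightarrow>
    bij_betw (\<lambda>c. max_ideal A +>\<^bsub>A\<^esub> (c \<odot>\<^bsub>A\<^esub> \<one>\<^bsub>A\<^esub>)) (carrier K) (carrier (A Quot max_ideal A))"

definition regular_sequence :: "('a, 'r) ring_scheme \<Rightarrow> ('a, 'm, 's) module_scheme \<Rightarrow> 'a list \<Rightarrow> bool"
  where "regular_sequence R M xs \<longleftrightarrow> set xs \<subseteq> carrier R \<and>
    (let IM = (\<lambda>ys. mod_span R M {y \<odot>\<^bsub>M\<^esub> v | y v. y \<in> set ys \<and> v \<in> carrier M}) in
      (\<forall>i<length xs. \<forall>v\<in>carrier M. xs ! i \<odot>\<^bsub>M\<^esub> v \<in> IM (take i xs) \<longrightarrow> v \<in> IM (take i xs)) \<and>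
      IM xs \<noteq> carrier M)"

definition depth :: "('a, 'r) ring_scheme \<Rightarrow> ('a, 'm, 's) module_scheme \<Rightarrow> enat"
  where "depth R M = Sup {enat (length xs) | xs. regular_sequence R M xs \<and> set xs \<subseteq> max_ideal R}"

definition max_cohen_macaulay :: "('a, 'r) ring_scheme \<Rightarrow> ('a, 'm, 's) module_scheme \<Rightarrow> bool"
  where "max_cohen_macaulay R M \<longleftrightarrow> module R M \<and> fin_gen R M \<and> depth R M = krull_dim R"

definition cohen_macaulay_ring :: "('a, 'r) ring_scheme \<Rightarrow> bool"
  where "cohen_macaulay_ring R \<longleftrightarrow> depth R (self_module R) = krull_dim R"


section \<open>Injective dimension and Ext\<close>

text \<open>
  The test modules \<open>P\<close> and \<open>Q\<close> range over all modules with elements in the type of \<open>R\<close>. These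
  include the ideals of \<open>R\<close> and \<open>R\<close> itself, so by Baer's criterion the size of the test modules
  is no restriction.
\<close>

definition injective_module :: "('a, 'r) ring_scheme \<Rightarrow> ('a, 'e) module \<Rightarrow> bool"
  where "injective_module R E \<longleftrightarrow> module R E \<and>
    (\<forall>(P :: ('a, 'a) module) (Q :: ('a, 'a) module) f g.
      module R P \<and> module R Q \<and> f \<in> lin_maps R P Q \<and> inj_on f (carrier P) \<and> g \<in> lin_maps R P E \<longrightarrow>
      (\<exists>h \<in> lin_maps R Q E. \<forall>x\<in>carrier P. h (f x) = g x))"

definition injective_resolution ::
  "('a, 'r) ring_scheme \<Rightarrow> ('a, 'm, 's) module_scheme \<Rightarrow> (nat \<Rightarrow> ('a, 'e) module) \<Rightarrow>
    ('m \<Rightarrow> 'e) \<Rightarrow> (nat \<Rightarrow> 'e \<Rightarrow> 'e) \<Rightarrow> bool"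
  where "injective_resolution R M E \<eta> \<delta> \<longleftrightarrow>
    (\<forall>i. injective_module R (E i)) \<and>
    \<eta> \<in> lin_maps R M (E 0) \<and> inj_on \<eta> (carrier M) \<and>
    (\<forall>i. \<delta> i \<in> lin_maps R (E i) (E (Suc i))) \<and>
    \<eta> ` carrier M = {x \<in> carrier (E 0). \<delta> 0 x = \<zero>\<^bsub>E 1\<^esub>} \<and>
    (\<forall>i. \<delta> i ` carrier (E i) = {x \<in> carrier (E (Suc i)). \<delta> (Suc i) x = \<zero>\<^bsub>E (Suc (Suc i))\<^esub>})"

text \<open>
  HOL has no quantification over types inside a formula; the first argument is the type in which
  the terms of the resolution live. It is a free type variable wherever the notion is used as a
  hypothesis, so that there it ranges over all types.
\<close>

definition finite_injdim ::
  "'e itself \<Rightarrow> ('a, 'r) ring_scheme \<Rightarrow> ('a, 'm, 's) module_scheme \<Rightarrow> bool"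
  where "finite_injdim _ R M \<longleftrightarrow>
    (\<exists>(E :: nat \<Rightarrow> ('a, 'e) module) \<eta> \<delta> r. injective_resolution R M E \<eta> \<delta> \<and>
      (\<forall>i>r. carrier (E i) = {\<zero>\<^bsub>E i\<^esub>}))"

text \<open>A resolution \<open>\<dots> \<rightarrow> R\<^sup>n\<^sup>1 \<rightarrow> R\<^sup>n\<^sup>0 \<rightarrow> N \<rightarrow> 0\<close> by finitely generated free modules, with augmentation \<open>\<epsilon>\<close>.\<close>

definition free_resolution ::
  "('a, 'r) ring_scheme \<Rightarrow> ('a, 'n, 's) module_scheme \<Rightarrow>
    (nat \<Rightarrow> nat) \<times> (nat \<Rightarrow> (nat \<Rightarrow> 'a) \<Rightarrow> nat \<Rightarrow> 'a) \<times> ((nat \<Rightarrow> 'a) \<Rightarrow> 'n) \<Rightarrow> bool"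
  where "free_resolution R N = (\<lambda>(n, \<delta>, \<epsilon>).
    (let F = (\<lambda>i. free_module R {..<n i}) in
      \<epsilon> \<in> lin_maps R (F 0) N \<and> \<epsilon> ` carrier (F 0) = carrier N \<and>
      (\<forall>i. \<delta> i \<in> lin_maps R (F (Suc i)) (F i)) \<and>
      \<delta> 0 ` carrier (F 1) = {x \<in> carrier (F 0). \<epsilon> x = \<zero>\<^bsub>N\<^esub>} \<and>
      (\<forall>i. \<delta> (Suc i) ` carrier (F (Suc (Suc i))) =
        {x \<in> carrier (F (Suc i)). \<delta> i x = \<zero>\<^bsub>F i\<^esub>})))"

text \<open>
  \<open>Ext\<^sup>i(N, M)\<close> as the cohomology of \<open>Hom(F, M)\<close> for a chosen free resolution \<open>F\<close> of \<open>N\<close> as above.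
  Such a resolution exists for \<open>R\<close> Noetherian and \<open>N\<close> finitely generated; the notion
  is meaningful in this case only.
\<close>

definition ext_module ::
  "('a, 'r) ring_scheme \<Rightarrow> nat \<Rightarrow> ('a, 'n, 's) module_scheme \<Rightarrow> ('a, 'm, 't) module_scheme \<Rightarrow>
    ('a, ((nat \<Rightarrow> 'a) \<Rightarrow> 'm) set) module"
  where "ext_module R i N M =
    (case SOME F. free_resolution R N F of (n, \<delta>, \<epsilon>) \<Rightarrow>
      let F = (\<lambda>i. free_module R {..<n i});
          Z = {\<phi> \<in> lin_maps R (F i) M. \<forall>x\<in>carrier (F (Suc i)). \<phi> (\<delta> i x) = \<zero>\<^bsub>M\<^esub>};
          B = (case i of 0 \<Rightarrow> {\<lambda>x\<in>carrier (F 0). \<zero>\<^bsub>M\<^esub>}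
               | Suc j \<Rightarrow> {\<lambda>x\<in>carrier (F i). \<psi> (\<delta> j x) | \<psi>. \<psi> \<in> lin_maps R (F j) M})
      in quot_module R (fun_module (carrier (F i)) Z M) B)"


section \<open>Canonical modules\<close>

definition residue_module :: "('a, 'r) ring_scheme \<Rightarrow> ('a, 'a set) module"
  where "residue_module R = quot_module R (self_module R) (max_ideal R)"

definition canonical_module ::
  "'e itself \<Rightarrow> ('k, 'r) ring_scheme \<Rightarrow> ('k, 'a) module \<Rightarrow> ('a, 'm) module \<Rightarrow> bool"
  where "canonical_module T K A W \<longleftrightarrow>
    max_cohen_macaulay A W \<and> finite_injdim T A W \<and>
    has_dim K (restrict_scalars A (ext_module A (the_enat (krull_dim A)) (residue_module A) W)) 1"

definition gorenstein_ring :: "'e itself \<Rightarrow> ('a, 'r) ring_scheme \<Rightarrow> bool"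
  where "gorenstein_ring T R \<longleftrightarrow>
    noetherian_ring R \<and> local_ring R \<and> finite_injdim T R (self_module R)"

text \<open>\<open>W\<close> is meant to be the canonical module of \<open>R\<close>.\<close>

definition Q_gorenstein :: "('a, 'r) ring_scheme \<Rightarrow> ('a, 'm, 's) module_scheme \<Rightarrow> bool"
  where "Q_gorenstein R W \<longleftrightarrow>
    (\<exists>n\<ge>1. mod_iso R (dual_module R (dual_module R (tensor_power R W n))) (self_module R))"


section \<open>Connections\<close>

definition derivations :: "('k, 'r) ring_scheme \<Rightarrow> ('k, 'a) module \<Rightarrow> ('a \<Rightarrow> 'a) set"
  where "derivations K A = {D \<in> lin_maps K A A.
    \<forall>a\<in>carrier A. \<forall>b\<in>carrier A. D (a \<otimes>\<^bsub>A\<^esub> b) = (a \<otimes>\<^bsub>A\<^esub> D b) \<oplus>\<^bsub>A\<^esub> (D a \<otimes>\<^bsub>A\<^esub> b)}"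

definition der_module :: "('k, 'r) ring_scheme \<Rightarrow> ('k, 'a) module \<Rightarrow> ('a, 'a \<Rightarrow> 'a) module"
  where "der_module K A = fun_module (carrier A) (derivations K A) (self_module A)"

text \<open>The \<open>k\<close>-linear endomorphisms of the \<open>A\<close>-module \<open>M\<close>, with \<open>A\<close> acting on the values.\<close>

definition end_module :: "('k, 'r) ring_scheme \<Rightarrow> ('k, 'a) module \<Rightarrow> ('a, 'm) module \<Rightarrow> ('a, 'm \<Rightarrow> 'm) module"
  where "end_module K A M =
    fun_module (carrier M) (lin_maps K (restrict_scalars A M) (restrict_scalars A M)) M"

definition commutator :: "('m, 's) ring_scheme \<Rightarrow> ('m \<Rightarrow> 'm) \<Rightarrow> ('m \<Rightarrow> 'm) \<Rightarrow> 'm \<Rightarrow> 'm"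
  where "commutator M f g = (\<lambda>x\<in>carrier M. f (g x) \<ominus>\<^bsub>M\<^esub> g (f x))"

definition connection ::
  "('k, 'r) ring_scheme \<Rightarrow> ('k, 'a) module \<Rightarrow> ('a, 'm) module \<Rightarrow> (('a \<Rightarrow> 'a) \<Rightarrow> 'm \<Rightarrow> 'm) \<Rightarrow> bool"
  where "connection K A M nabla \<longleftrightarrow>
    nabla \<in> lin_maps A (der_module K A) (end_module K A M) \<and>
    (\<forall>D\<in>derivations K A. \<forall>a\<in>carrier A. \<forall>x\<in>carrier M.
      nabla D (a \<odot>\<^bsub>M\<^esub> x) = (a \<odot>\<^bsub>M\<^esub> nabla D x) \<oplus>\<^bsub>M\<^esub> (D a \<odot>\<^bsub>M\<^esub> x))"

definition integrable_connection ::
  "('k, 'r) ring_scheme \<Rightarrow> ('k, 'a) module \<Rightarrow> ('a, 'm) module \<Rightarrow> (('a \<Rightarrow> 'a) \<Rightarrow> 'm \<Rightarrow> 'm) \<Rightarrow> bool"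
  where "integrable_connection K A M nabla \<longleftrightarrow> connection K A M nabla \<and>
    (\<forall>D\<in>derivations K A. \<forall>D'\<in>derivations K A.
      commutator M (nabla D) (nabla D') = nabla (commutator A D D'))"

end

theory Submission
  imports Defs
begin

text \<open>
  Everything rests on one elementary vanishing statement for \<open>Ext\<^sup>1\<close>: if \<open>M / N\<close> has a regular sequence
  of length \<open>t + 1\<close> and the primes containing the ideal \<open>J\<close> form no chain of length \<open>t\<close>, then every
  linear map \<open>J \<rightarrow> M / N\<close> is the multiplication by an element.

  Let \<open>d \<ge> 2\<close>. Applied to \<open>P + ann P\<close> for an associated prime \<open>P\<close>, the statement shows that \<open>A\<close> is a
  domain. As \<open>W\<close> is \<open>\<rat>\<close>-Gorenstein, all multilinear forms on \<open>W\<^sup>n\<close> are multiples of a single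
  one, \<open>\<mu>\<close>. Hence \<open>W\<close> has rank one, a nonzero linear form \<open>g\<close> on \<open>W\<close> is injective, and
  \<open>g (w\<^sub>1) \<cdots> g (w\<^sub>n) = F \<mu> (w\<^sub>1, \<dots>, w\<^sub>n)\<close> for some \<open>F\<close>. On fractions,
  \<open>D \<mapsto> D - (1 / n) (D F / F)\<close> is an integrable connection. It preserves the ideal \<open>g W\<close>: by the vanishing
  statement it suffices to check this at the primes of height one, where \<open>A\<close> is regular, \<open>W\<close> is
  free on some \<open>w\<^sub>0\<close>, and \<open>\<mu> (w\<^sub>0, \<dots>, w\<^sub>0)\<close> is a unit.

  Let \<open>d = 1\<close>, and let \<open>x\<close> be a regular parameter. As \<open>A\<close> is Gorenstein, \<open>A / x A\<close> is
  injective over itself, with simple socle generated by some \<open>s\<close>. The finite injective resolution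
  of \<open>W\<close> shows that \<open>s (W / x W)\<close> is the socle of \<open>W / x W\<close>, and \<open>Ext\<^sup>1(k, W)\<close> shows that it is
  one-dimensional. Therefore \<open>W / x W\<close> is isomorphic to \<open>A / x A\<close>, so that \<open>W\<close> is isomorphic to \<open>A\<close>, on which the
  derivations themselves are an integrable connection.
\<close>

section \<open>Ascending chains\<close>

text \<open>The argument is arranged so that neither Ext groups nor localized modules have to be
  manipulated. A map from an ideal to \<open>M / N\<close> is kept as a relation between
  \<open>R\<close> and \<open>M\<close>, whose domain may grow and which may be divided by
  \<open>x\<close> while \<open>M\<close> stays fixed. Localization at \<open>p\<close> is used only
  to extract statements with cleared denominators: at height one some \<open>q\<close> in
  \<open>p\<close> satisfies \<open>t r = b q\<close> with \<open>t\<close> outside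
  \<open>p\<close>, for each \<open>r\<close> in \<open>p\<close>; at height zero
  \<open>t r = 0\<close>.

  Membership in an ideal is tested by its denominators: they form an ideal, and either some prime of
  height one contains it or the vanishing statement applies to it.

  The correction \<open>(1/n) (D F / F)\<close> comes from asking that \<mu> be horizontal: under
  \<open>g\<close> the value of \<mu> at \<open>(z, ..., z)\<close> is \<open>z^n / F\<close>, so
  \<open>F^(1/n)\<close> has to be killed.

  In dimension one no uniqueness of canonical modules is invoked. A finite injective resolution
  makes the kernel of \<open>x\<close> on the first cosyzygy injective over \<open>A / x A\<close>,
  and the connecting map carries this back to \<open>A / x A\<close> and to
  \<open>W / x W\<close>.\<close>

definition acc_on :: "'x set set \<Rightarrow> bool"
  where "acc_on F \<longleftrightarrow> (\<forall>H :: nat \<Rightarrow> 'x set. (\<forall>i. H i \<in> F \<and> H i \<subseteq> H (Suc i)) \<longrightarrow> (\<exists>n. \<forall>i\<ge>n. H i = H n))"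

lemma acc_onD:
  assumes "acc_on F" "\<And>i :: nat. H i \<in> F" "\<And>i. H i \<subseteq> H (Suc i)"
  shows "\<exists>n. \<forall>i\<ge>n. H i = H n"
  using assms unfolding acc_on_def by blast

lemma acc_on_subset: "acc_on F \<Longrightarrow> G \<subseteq> F \<Longrightarrow> acc_on G"
  unfolding acc_on_def by blast

lemma acc_on_maximal:
  assumes "acc_on F" "G \<subseteq> F" "K \<in> G"
  shows "\<exists>H\<in>G. \<forall>L\<in>G. H \<subseteq> L \<longrightarrow> L = H"
proof (rule ccontr)
  assume "\<not> ?thesis"
  then have "\<forall>H. \<exists>L. H \<in> G \<longrightarrow> L \<in> G \<and> H \<subset> L" by blast
  then obtain f where f: "\<And>H. H \<in> G \<Longrightarrow> f H \<in> G \<and> H \<subset> f H" by metis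
  define h where "h n = (f ^^ n) K" for n
  have h: "h n \<in> G" for n
    by (induction n) (auto simp: h_def f assms(3))
  have hs: "h n \<subset> h (Suc n)" for n
    using f[OF h[of n]] by (simp add: h_def)
  obtain n where "\<forall>i\<ge>n. h i = h n"
    using acc_onD[OF assms(1), of h] h hs assms(2) by blast
  then show False using hs[of n] by (metis le_Suc_eq order_refl psubset_eq)
qed

text \<open>What gets maximized is usually an element, a pair or a graph rather than a set;
  \<open>f\<close> attaches to it the ideal or submodule by which it is ranked, and maximality is
  only up to equality of these.\<close>

lemma acc_on_maximal_image:
  assumes "acc_on F" "P s0" "\<And>s. P s \<Longrightarrow> f s \<in> F"
  shows "\<exists>s. P s \<and> (\<forall>t. P t \<longrightarrow> f s \<subseteq> f t \<longrightarrow> f t = f s)"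
proof -
  have "f ` Collect P \<subseteq> F" "f s0 \<in> f ` Collect P" using assms by auto
  from acc_on_maximal[OF assms(1) this] show ?thesis by blast
qed

section \<open>Ideals and submodules\<close>

text \<open>This says \<open>dim R / J >= t\<close>. Its negation serves as the dimension bound on
  ideals, so that Krull dimensions of quotient rings never appear.\<close>

definition prime_chain :: "('a, 'r) ring_scheme \<Rightarrow> 'a set \<Rightarrow> nat \<Rightarrow> bool"
  where "prime_chain R J t \<longleftrightarrow>
    (\<exists>P. (\<forall>i\<le>t. primeideal (P i) R) \<and> (\<forall>i<t. P i \<subset> P (Suc i)) \<and> J \<subseteq> P 0)"

lemma (in cring) idealI':
  assumes "I \<subseteq> carrier R" "\<zero> \<in> I" "\<And>a b. a \<in> I \<Longrightarrow> b \<in> I \<Longrightarrow> a \<oplus> b \<in> I"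
    "\<And>a x. a \<in> carrier R \<Longrightarrow> x \<in> I \<Longrightarrow> a \<otimes> x \<in> I"
  shows "ideal I R"
proof (rule idealI[OF ring_axioms])
  show "subgroup I (add_monoid R)"
  proof (rule add.subgroupI)
    fix a assume a: "a \<in> I"
    then have "\<ominus> a = (\<ominus> \<one>) \<otimes> a" using assms(1) by (auto simp: l_minus)
    then show "\<ominus> a \<in> I" using a assms(4) by simp
  qed (use assms in auto)
  fix a x assume a: "a \<in> I" "x \<in> carrier R"
  show "x \<otimes> a \<in> I" using assms(4)[OF a(2,1)] .
  then show "a \<otimes> x \<in> I" using a assms(1) m_comm[of x a] by auto
qed

section \<open>Submodules \<open>N + x M\<close> and \<open>N + R w\<close>, colon ideals, finite
  generation\<close>

context module
begin

abbreviation madd (infixl \<open>\<boxplus>\<close> 65) where "x \<boxplus> y \<equiv> x \<oplus>\<^bsub>M\<^esub> y"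
abbreviation mdiff (infixl \<open>\<boxminus>\<close> 65) where "x \<boxminus> y \<equiv> x \<ominus>\<^bsub>M\<^esub> y"
abbreviation mscale (infixr \<open>\<bullet>\<close> 70) where "a \<bullet> y \<equiv> a \<odot>\<^bsub>M\<^esub> y"
abbreviation msub where "msub N \<equiv> submodule N R M"

lemma minus_zero_M [simp]: "\<ominus>\<^bsub>M\<^esub> \<zero>\<^bsub>M\<^esub> = \<zero>\<^bsub>M\<^esub>"
  by (simp add: a_inv_def)

text \<open>Makes the \<open>algebra\<close> method decide identities that mix scalars and vectors;
  iterated scalar multiplications are collected into one.\<close>

lemmas module_simprules
  [algebra add: module "zero R" "add R" "a_inv R" "a_minus R" "one R" "monoid.mult R" "smult M"] =
  R.cring_simprules
  M.a_closed M.zero_closed M.a_inv_closed M.minus_closed smult_closed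
  M.a_assoc M.l_zero M.l_neg M.a_comm M.minus_eq
  M.r_zero M.r_neg M.r_neg2 M.r_neg1 M.minus_add M.minus_minus minus_zero_M
  M.a_lcomm smult_l_distr smult_r_distr smult_assoc1[symmetric] smult_one smult_l_null smult_r_null
  smult_l_minus smult_r_minus

lemma sub_carr [intro]: "msub N \<Longrightarrow> x \<in> N \<Longrightarrow> x \<in> carrier M"
  using submoduleE(1) by blast
lemma sub_zero [intro, simp]: "msub N \<Longrightarrow> \<zero>\<^bsub>M\<^esub> \<in> N"
  by (metis submoduleE(2,4) sub_carr R.zero_closed smult_l_null ex_in_conv)
lemma sub_add [intro]: "msub N \<Longrightarrow> x \<in> N \<Longrightarrow> y \<in> N \<Longrightarrow> x \<boxplus> y \<in> N"
  using submoduleE(5) by blast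
lemma sub_neg [intro]: "msub N \<Longrightarrow> x \<in> N \<Longrightarrow> \<ominus>\<^bsub>M\<^esub> x \<in> N"
  using submoduleE(3) by blast
lemma sub_diff [intro]: "msub N \<Longrightarrow> x \<in> N \<Longrightarrow> y \<in> N \<Longrightarrow> x \<boxminus> y \<in> N"
  by (simp add: M.minus_eq sub_add sub_neg)
lemma sub_smult [intro]: "msub N \<Longrightarrow> a \<in> carrier R \<Longrightarrow> x \<in> N \<Longrightarrow> a \<bullet> x \<in> N"
  using submoduleE(4) by blast

lemma sub_add_iff: "msub N \<Longrightarrow> x \<in> N \<Longrightarrow> y \<in> carrier M \<Longrightarrow> x \<boxplus> y \<in> N \<longleftrightarrow> y \<in> N"
proof
  assume a: "msub N" "x \<in> N" "y \<in> carrier M" "x \<boxplus> y \<in> N"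
  have "y = (x \<boxplus> y) \<boxminus> x" using a(3) sub_carr[OF a(1,2)] by algebra
  then show "y \<in> N" using sub_diff[OF a(1,4,2)] by simp
qed blast

lemma submoduleI':
  assumes "H \<subseteq> carrier M" "\<zero>\<^bsub>M\<^esub> \<in> H" "\<And>a b. a \<in> H \<Longrightarrow> b \<in> H \<Longrightarrow> a \<boxplus> b \<in> H"
    "\<And>a x. a \<in> carrier R \<Longrightarrow> x \<in> H \<Longrightarrow> a \<bullet> x \<in> H"
  shows "msub H"
proof (rule submoduleI)
  fix a assume "a \<in> H"
  moreover have "\<ominus>\<^bsub>M\<^esub> a = (\<ominus> \<one>) \<bullet> a" using calculation assms(1) by (auto simp: smult_l_minus)
  ultimately show "\<ominus>\<^bsub>M\<^esub> a \<in> H" using assms(4) by simp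
qed (use assms in auto)

lemma zero_sub [simp]: "msub {\<zero>\<^bsub>M\<^esub>}"
  by (rule submoduleI') auto

text \<open>Passing from \<open>M / N\<close> to its quotient by \<open>x\<close> becomes a change
  of \<open>N\<close> inside a fixed \<open>M\<close>.\<close>

definition plus_mult :: "'c set \<Rightarrow> 'a \<Rightarrow> 'c set"
  where "plus_mult N x = {n \<boxplus> x \<bullet> v | n v. n \<in> N \<and> v \<in> carrier M}"

definition plus_cyclic :: "'c set \<Rightarrow> 'c \<Rightarrow> 'c set"
  where "plus_cyclic N w = {n \<boxplus> a \<bullet> w | n a. n \<in> N \<and> a \<in> carrier R}"

lemma plus_multI: "n \<in> N \<Longrightarrow> v \<in> carrier M \<Longrightarrow> n \<boxplus> x \<bullet> v \<in> plus_mult N x"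
  by (auto simp: plus_mult_def)

lemma plus_cyclicI: "n \<in> N \<Longrightarrow> a \<in> carrier R \<Longrightarrow> n \<boxplus> a \<bullet> w \<in> plus_cyclic N w"
  by (auto simp: plus_cyclic_def)

lemma plus_mult_sub:
  assumes N: "msub N" and x: "x \<in> carrier R"
  shows "msub (plus_mult N x)"
proof (rule submoduleI')
  show "plus_mult N x \<subseteq> carrier M" using N x by (auto simp: plus_mult_def)
  have "\<zero>\<^bsub>M\<^esub> = \<zero>\<^bsub>M\<^esub> \<boxplus> x \<bullet> \<zero>\<^bsub>M\<^esub>" using x by simp
  then show "\<zero>\<^bsub>M\<^esub> \<in> plus_mult N x" using N plus_multI[of "\<zero>\<^bsub>M\<^esub>" N "\<zero>\<^bsub>M\<^esub>" x] by simp
next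
  fix a b assume "a \<in> plus_mult N x" "b \<in> plus_mult N x"
  then obtain n v n' v' where *: "a = n \<boxplus> x \<bullet> v" "b = n' \<boxplus> x \<bullet> v'" "n \<in> N" "n' \<in> N"
    "v \<in> carrier M" "v' \<in> carrier M" by (auto simp: plus_mult_def)
  have c: "n \<in> carrier M" "n' \<in> carrier M" using * N by auto
  have "a \<boxplus> b = (n \<boxplus> n') \<boxplus> x \<bullet> (v \<boxplus> v')" unfolding *(1,2) using c *(5,6) x by algebra
  then show "a \<boxplus> b \<in> plus_mult N x" using * N plus_multI[of "n \<boxplus> n'" N "v \<boxplus> v'" x] by auto
next
  fix r a assume r: "r \<in> carrier R" and "a \<in> plus_mult N x"
  then obtain n v where *: "a = n \<boxplus> x \<bullet> v" "n \<in> N" "v \<in> carrier M" by (auto simp: plus_mult_def)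
  have c: "n \<in> carrier M" using * N by auto
  have "r \<bullet> a = r \<bullet> n \<boxplus> x \<bullet> (r \<bullet> v)" unfolding *(1) using c r *(3) x by algebra
  then show "r \<bullet> a \<in> plus_mult N x" using * N r plus_multI[of "r \<bullet> n" N "r \<bullet> v" x] by auto
qed

lemma plus_cyclic_sub:
  assumes N: "msub N" and x: "x \<in> carrier M"
  shows "msub (plus_cyclic N x)"
proof (rule submoduleI')
  show "plus_cyclic N x \<subseteq> carrier M" using N x by (auto simp: plus_cyclic_def)
  have "\<zero>\<^bsub>M\<^esub> = \<zero>\<^bsub>M\<^esub> \<boxplus> \<zero> \<bullet> x" using x by simp
  then show "\<zero>\<^bsub>M\<^esub> \<in> plus_cyclic N x" using N plus_cyclicI[of "\<zero>\<^bsub>M\<^esub>" N "\<zero>" x] by simp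
next
  fix a b assume "a \<in> plus_cyclic N x" "b \<in> plus_cyclic N x"
  then obtain n v n' v' where *: "a = n \<boxplus> v \<bullet> x" "b = n' \<boxplus> v' \<bullet> x" "n \<in> N" "n' \<in> N"
    "v \<in> carrier R" "v' \<in> carrier R" by (auto simp: plus_cyclic_def)
  have c: "n \<in> carrier M" "n' \<in> carrier M" using * N by auto
  have "a \<boxplus> b = (n \<boxplus> n') \<boxplus> (v \<oplus> v') \<bullet> x" unfolding *(1,2) using c *(5,6) x by algebra
  then show "a \<boxplus> b \<in> plus_cyclic N x" using * N plus_cyclicI[of "n \<boxplus> n'" N "v \<oplus> v'" x] by auto
next
  fix r a assume r: "r \<in> carrier R" and "a \<in> plus_cyclic N x"
  then obtain n v where *: "a = n \<boxplus> v \<bullet> x" "n \<in> N" "v \<in> carrier R" by (auto simp: plus_cyclic_def)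
  have c: "n \<in> carrier M" using * N by auto
  have "r \<bullet> a = r \<bullet> n \<boxplus> (r \<otimes> v) \<bullet> x" unfolding *(1) using c r *(3) x by algebra
  then show "r \<bullet> a \<in> plus_cyclic N x" using * N r plus_cyclicI[of "r \<bullet> n" N "r \<otimes> v" x] by auto
qed

lemma plus_mult_superset: "msub N \<Longrightarrow> x \<in> carrier R \<Longrightarrow> N \<subseteq> plus_mult N x"
  using plus_multI[of _ N "\<zero>\<^bsub>M\<^esub>" x] by (auto simp: sub_carr)

lemma plus_cyclic_superset: "msub N \<Longrightarrow> x \<in> carrier M \<Longrightarrow> N \<subseteq> plus_cyclic N x"
  using plus_cyclicI[of _ N "\<zero>" x] by (auto simp: sub_carr)

lemma plus_mult_mem: "msub N \<Longrightarrow> x \<in> carrier R \<Longrightarrow> v \<in> carrier M \<Longrightarrow> x \<bullet> v \<in> plus_mult N x"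
  using plus_multI[of "\<zero>\<^bsub>M\<^esub>" N v x] by auto

lemma plus_cyclic_mem: "msub N \<Longrightarrow> w \<in> carrier M \<Longrightarrow> w \<in> plus_cyclic N w"
  using plus_cyclicI[of "\<zero>\<^bsub>M\<^esub>" N \<one> w] by auto

text \<open>The annihilator of the class of \<open>v\<close> in \<open>M / N\<close>.\<close>

definition colon :: "'c set \<Rightarrow> 'c \<Rightarrow> 'a set"
  where "colon N v = {r \<in> carrier R. r \<bullet> v \<in> N}"

lemma colon_ideal:
  assumes N: "msub N" and v: "v \<in> carrier M" shows "ideal (colon N v) R"
proof (rule R.idealI')
  fix a b assume "a \<in> colon N v" "b \<in> colon N v"
  then show "a \<oplus> b \<in> colon N v" using N v by (auto simp: colon_def smult_l_distr)
next
  fix a x assume "a \<in> carrier R" "x \<in> colon N v"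
  then show "a \<otimes> x \<in> colon N v" using N v by (auto simp: colon_def smult_assoc1)
qed (use N v in \<open>auto simp: colon_def\<close>)

lemma mod_span_sub: "S \<subseteq> carrier M \<Longrightarrow> msub (mod_span R M S)"
  unfolding mod_span_def
  by (rule submoduleI') (use carrier_is_submodule in auto)

lemma mod_span_min: "msub H \<Longrightarrow> S \<subseteq> H \<Longrightarrow> mod_span R M S \<subseteq> H"
  unfolding mod_span_def by blast

lemma mod_span_superset: "S \<subseteq> mod_span R M S"
  unfolding mod_span_def by blast

text \<open>Induction on the generators. When \<open>w\<close> is added to a span \<open>U\<close>,
  a chain of submodules is controlled by two chains that become stationary: its intersections with
  \<open>U\<close>, and the ideals of coefficients of \<open>w\<close> modulo
  \<open>U\<close>.\<close>

lemma acc_fin_gen: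
  assumes acc: "acc_on {I. ideal I R}" and fg: "fin_gen R M"
  shows "acc_on {N. msub N}"
proof -
  have "acc_on {H. msub H \<and> H \<subseteq> mod_span R M S}" if "finite S" "S \<subseteq> carrier M" for S
    using that
  proof (induction S)
    case empty
    have "mod_span R M {} \<subseteq> {\<zero>\<^bsub>M\<^esub>}" by (rule mod_span_min) auto
    then have "H = {\<zero>\<^bsub>M\<^esub>}" if "msub H" "H \<subseteq> mod_span R M {}" for H using that by blast
    then have "{H. msub H \<and> H \<subseteq> mod_span R M {}} \<subseteq> {{\<zero>\<^bsub>M\<^esub>}}" by blast
    then have "H i = H 0" if "\<And>i. H i \<in> {H. msub H \<and> H \<subseteq> mod_span R M {}}" for H :: "nat \<Rightarrow> 'c set" and i
      using that by blast
    then show ?case unfolding acc_on_def by (intro allI impI exI[of _ 0]) (simp (no_asm_use), metis)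
  next
    case (insert w S)
    let ?U = "mod_span R M S"
    have U: "msub ?U" and w: "w \<in> carrier M" using insert mod_span_sub by auto
    have span: "mod_span R M (insert w S) \<subseteq> plus_cyclic ?U w"
      using plus_cyclic_mem[OF U w] plus_cyclic_superset[OF U w] mod_span_superset[of S]
      by (intro mod_span_min plus_cyclic_sub U w) auto
    show ?case unfolding acc_on_def
    proof (intro allI impI)
      fix H :: "nat \<Rightarrow> 'c set"
      assume H: "\<forall>i. H i \<in> {H. msub H \<and> H \<subseteq> mod_span R M (insert w S)} \<and> H i \<subseteq> H (Suc i)"
      then have Hs: "\<And>i. msub (H i)" by blast
      have mono: "H i \<subseteq> H j" if "i \<le> j" for i j using lift_Suc_mono_le[of H i j] H that by blast
      define I where "I i = {a \<in> carrier R. \<exists>u\<in>?U. u \<boxplus> a \<bullet> w \<in> H i}" for i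
      have I: "ideal (I i) R" for i
      proof (rule R.idealI')
        show "\<zero> \<in> I i" using U w Hs unfolding I_def by (auto intro!: bexI[of _ "\<zero>\<^bsub>M\<^esub>"])
      next
          fix a b assume "a \<in> I i" "b \<in> I i"
          then obtain u v where a: "a \<in> carrier R" "u \<in> ?U" "u \<boxplus> a \<bullet> w \<in> H i"
            and b: "b \<in> carrier R" "v \<in> ?U" "v \<boxplus> b \<bullet> w \<in> H i" by (auto simp: I_def)
          then have "(u \<boxplus> a \<bullet> w) \<boxplus> (v \<boxplus> b \<bullet> w) \<in> H i" using Hs by auto
          moreover have "(u \<boxplus> a \<bullet> w) \<boxplus> (v \<boxplus> b \<bullet> w) = (u \<boxplus> v) \<boxplus> (a \<oplus> b) \<bullet> w"
            using a b w sub_carr[OF U a(2)] sub_carr[OF U b(2)] by algebra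
          ultimately have "u \<boxplus> v \<in> ?U \<and> (u \<boxplus> v) \<boxplus> (a \<oplus> b) \<bullet> w \<in> H i" using a b U by auto
          then show "a \<oplus> b \<in> I i" using a b unfolding I_def by auto
      next
        fix r a assume ar: "r \<in> carrier R" "a \<in> I i"
        then obtain u where a: "a \<in> carrier R" "u \<in> ?U" "u \<boxplus> a \<bullet> w \<in> H i" by (auto simp: I_def)
        then have "r \<bullet> (u \<boxplus> a \<bullet> w) \<in> H i" using Hs ar by auto
        moreover have "r \<bullet> (u \<boxplus> a \<bullet> w) = r \<bullet> u \<boxplus> (r \<otimes> a) \<bullet> w" using a w sub_carr[OF U a(2)] ar by algebra
        ultimately show "r \<otimes> a \<in> I i" using a U ar by (auto simp: I_def)
      qed (auto simp: I_def)
      have "I i \<subseteq> I (Suc i)" for i using H unfolding I_def by blast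
      then obtain n1 where n1: "\<forall>i\<ge>n1. I i = I n1" using acc_onD[OF acc, of I] I by blast
      have "acc_on {H. msub H \<and> H \<subseteq> ?U}" using insert by auto
      moreover have "msub (H i \<inter> ?U)" for i
        using Hs U by (intro submoduleI') auto
      ultimately obtain n2 where n2: "\<forall>i\<ge>n2. H i \<inter> ?U = H n2 \<inter> ?U"
        using acc_onD[of "{H. msub H \<and> H \<subseteq> ?U}" "\<lambda>i. H i \<inter> ?U"] H by blast
      let ?n = "max n1 n2"
      have "H i \<subseteq> H ?n" if i: "i \<ge> ?n" for i
      proof
        fix h assume h: "h \<in> H i"
        then have "h \<in> plus_cyclic ?U w" using H span by blast
        then obtain u a where ua: "h = u \<boxplus> a \<bullet> w" "u \<in> ?U" "a \<in> carrier R" by (auto simp: plus_cyclic_def)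
        then have "a \<in> I i" using h by (auto simp: I_def)
        then have "a \<in> I ?n" using n1 i by (metis max.bounded_iff max.cobounded1)
        \<comment> \<open>An element of the smaller submodule with the same coefficient of
          \<open>w\<close>; its difference from \<open>h\<close> lies in \<open>U\<close>.\<close>
        then obtain u' where u': "u' \<in> ?U" "u' \<boxplus> a \<bullet> w \<in> H ?n" by (auto simp: I_def)
        then have "h \<boxminus> (u' \<boxplus> a \<bullet> w) \<in> H i" using h mono[OF i] Hs by blast
        moreover have e: "h \<boxminus> (u' \<boxplus> a \<bullet> w) = u \<boxminus> u'"
          unfolding ua(1) using ua w sub_carr[OF U ua(2)] sub_carr[OF U u'(1)] by algebra
        moreover have "u \<boxminus> u' \<in> ?U" using U ua u' by blast
        ultimately have "u \<boxminus> u' \<in> H i \<inter> ?U" by simp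
        moreover have "H i \<inter> ?U = H ?n \<inter> ?U" using n2 i by (metis max.bounded_iff max.cobounded2)
        ultimately have "u \<boxminus> u' \<in> H ?n" by blast
        moreover have "h = (u \<boxminus> u') \<boxplus> (u' \<boxplus> a \<bullet> w)"
          unfolding ua(1) using ua w sub_carr[OF U ua(2)] sub_carr[OF U u'(1)] by algebra
        ultimately show "h \<in> H ?n" using u' Hs by auto
      qed
      then show "\<exists>n. \<forall>i\<ge>n. H i = H n" using mono by blast
    qed
  qed
  moreover obtain S where "finite S" "S \<subseteq> carrier M" "mod_span R M S = carrier M"
    using fg unfolding fin_gen_def by blast
  ultimately have "acc_on {H. msub H \<and> H \<subseteq> carrier M}" by metis
  then show ?thesis by (rule acc_on_subset) auto
qed

end

section \<open>Ideals as submodules of the ring; primes and chains of primes\<close>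

context cring
begin

lemma self_module_simps [simp]:
  "carrier (self_module R) = carrier R" "zero (self_module R) = \<zero>" "add (self_module R) = add R"
  "smult (self_module R) = monoid.mult R" "monoid.mult (self_module R) = monoid.mult R" "one (self_module R) = \<one>"
  "a_inv (self_module R) = a_inv R" "a_minus (self_module R) = a_minus R"
  by (simp_all add: self_module_def a_inv_def a_minus_def m_inv_def fun_eq_iff)

lemma module_self: "module R (self_module R)"
proof (rule moduleI)
  show "abelian_group (self_module R)"
    by (rule abelian_groupI) (auto simp: a_ac intro: bexI[of _ "\<ominus> _"] l_neg)
qed (auto simp: l_distr r_distr m_assoc is_cring)

lemma submodule_self_iff: "submodule I R (self_module R) \<longleftrightarrow> ideal I R"
proof
  interpret S: module R "self_module R" by (rule module_self)
  assume *: "submodule I R (self_module R)"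
  show "ideal I R"
    using S.submoduleE[OF *] S.sub_zero[OF *] by (intro idealI') auto
next
  interpret S: module R "self_module R" by (rule module_self)
  assume *: "ideal I R"
  show "submodule I R (self_module R)"
    using ideal.Icarr[OF *] additive_subgroup.zero_closed[OF ideal.axioms(1)[OF *]]
      additive_subgroup.a_closed[OF ideal.axioms(1)[OF *]] ideal.I_l_closed[OF *]
    by (intro S.submoduleI') auto
qed

lemma ideal_zero: "ideal I R \<Longrightarrow> \<zero> \<in> I"
  by (simp add: additive_subgroup.zero_closed ideal.axioms(1))
lemma ideal_add: "ideal I R \<Longrightarrow> a \<in> I \<Longrightarrow> b \<in> I \<Longrightarrow> a \<oplus> b \<in> I"
  by (simp add: additive_subgroup.a_closed ideal.axioms(1))
lemma ideal_carr: "ideal I R \<Longrightarrow> a \<in> I \<Longrightarrow> a \<in> carrier R"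
  by (simp add: ideal.Icarr)
lemma ideal_one: "ideal I R \<Longrightarrow> \<one> \<in> I \<Longrightarrow> I = carrier R"
  by (rule ideal.one_imp_carrier)

lemma primeideal_props:
  assumes "primeideal p R"
  shows "ideal p R" "\<one> \<notin> p" "p \<noteq> carrier R"
    "\<And>a b. a \<in> carrier R \<Longrightarrow> b \<in> carrier R \<Longrightarrow> a \<otimes> b \<in> p \<Longrightarrow> a \<in> p \<or> b \<in> p"
proof -
  show i: "ideal p R" using assms by (simp add: primeideal.axioms)
  show "p \<noteq> carrier R" using assms primeideal.I_notcarr by blast
  then show "\<one> \<notin> p" using ideal_one[OF i] by blast
  show "\<And>a b. a \<in> carrier R \<Longrightarrow> b \<in> carrier R \<Longrightarrow> a \<otimes> b \<in> p \<Longrightarrow> a \<in> p \<or> b \<in> p"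
    by (rule primeideal.I_prime[OF assms])
qed

lemma prime_chain_prime: "primeideal p R \<Longrightarrow> J \<subseteq> p \<Longrightarrow> prime_chain R J 0"
  unfolding prime_chain_def by (intro exI[of _ "\<lambda>_. p"]) simp

lemma prime_chain_Suc:
  assumes "primeideal p R" "J \<subseteq> p" "prime_chain R J' t" "p \<subset> J'"
  shows "prime_chain R J (Suc t)"
proof -
  obtain P where P: "\<forall>i\<le>t. primeideal (P i) R" "\<forall>i<t. P i \<subset> P (Suc i)" "J' \<subseteq> P 0"
    using assms(3) unfolding prime_chain_def by blast
  show ?thesis unfolding prime_chain_def
    by (rule exI[of _ "\<lambda>i. case i of 0 \<Rightarrow> p | Suc j \<Rightarrow> P j"])
       (use P assms in \<open>auto split: nat.split simp: less_Suc_eq_0_disj\<close>)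
qed

lemma prime_chain_mono: "prime_chain R J t \<Longrightarrow> I \<subseteq> J \<Longrightarrow> prime_chain R I t"
  unfolding prime_chain_def by blast

lemma acc_ideals:
  assumes "noetherian_ring R" shows "acc_on {I. ideal I R}"
  unfolding acc_on_def
proof (intro allI impI)
  fix H :: "nat \<Rightarrow> 'a set" assume H: "\<forall>i. H i \<in> {I. ideal I R} \<and> H i \<subseteq> H (Suc i)"
  then have mono: "i \<le> j \<Longrightarrow> H i \<subseteq> H j" for i j using lift_Suc_mono_le[of H i j] by blast
  have "\<Union>(range H) \<in> range H"
  proof (rule noetherian_ring.ideal_chain_is_trivial[OF assms])
    have "H x \<subseteq> H y \<or> H y \<subseteq> H x" for x y using mono linear[of x y] by blast
    then show "subset.chain {I. ideal I R} (range H)"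
      using H unfolding pred_on.chain_def by blast
  qed auto
  then obtain n where "\<Union>(range H) = H n" by blast
  then have "\<forall>i\<ge>n. H i = H n" using mono by blast
  then show "\<exists>n. \<forall>i\<ge>n. H i = H n" ..
qed

end

text \<open>Among the multiples of \<open>v\<close> outside \<open>N\<close> one with the largest
  annihilator modulo \<open>N\<close> is taken. If \<open>a\<close> does not kill it, its multiple
  by \<open>a\<close> has the same annihilator, so that \<open>b\<close> kills it whenever
  \<open>a b\<close> does.\<close>

lemma (in module) associated_prime:
  assumes acc: "acc_on {I. ideal I R}" and N: "msub N" and v: "v \<in> carrier M" "v \<notin> N"
  shows "\<exists>c\<in>carrier R. c \<bullet> v \<notin> N \<and> primeideal (colon N (c \<bullet> v)) R"
proof -
  have "\<exists>c. (c \<in> carrier R \<and> c \<bullet> v \<notin> N) \<and> (\<forall>b. b \<in> carrier R \<and> b \<bullet> v \<notin> N \<longrightarrow>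
    colon N (c \<bullet> v) \<subseteq> colon N (b \<bullet> v) \<longrightarrow> colon N (b \<bullet> v) = colon N (c \<bullet> v))"
    by (rule acc_on_maximal_image[OF acc, of _ \<one>]) (use colon_ideal[OF N] v in auto)
  then obtain c where c: "c \<in> carrier R" "c \<bullet> v \<notin> N"
    and max: "\<And>b. b \<in> carrier R \<Longrightarrow> b \<bullet> v \<notin> N \<Longrightarrow> colon N (c \<bullet> v) \<subseteq> colon N (b \<bullet> v) \<Longrightarrow>
      colon N (b \<bullet> v) = colon N (c \<bullet> v)"
    by blast
  let ?p = "colon N (c \<bullet> v)"
  have cv: "c \<bullet> v \<in> carrier M" using c v by simp
  have "primeideal ?p R"
  proof (rule primeidealI[OF colon_ideal[OF N cv] R.is_cring])
    have "\<one> \<notin> ?p" using c cv by (simp add: colon_def)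
    then show "carrier R \<noteq> ?p" by auto
  next
    fix a b assume ab: "a \<in> carrier R" "b \<in> carrier R" "a \<otimes> b \<in> ?p"
    show "a \<in> ?p \<or> b \<in> ?p"
    proof (rule disj_imp[THEN iffD2, OF impI])
      assume "a \<notin> ?p"
      then have a: "(a \<otimes> c) \<bullet> v \<notin> N" using ab c v by (simp add: colon_def smult_assoc1)
      have "colon N ((a \<otimes> c) \<bullet> v) = ?p"
      proof (rule max)
        show "?p \<subseteq> colon N ((a \<otimes> c) \<bullet> v)"
        proof
          fix r assume r: "r \<in> ?p"
          then have "a \<bullet> (r \<bullet> c \<bullet> v) \<in> N" using N ab by (auto simp: colon_def)
          moreover have "r \<bullet> (a \<otimes> c) \<bullet> v = a \<bullet> (r \<bullet> c \<bullet> v)"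
            using r ab c v unfolding colon_def by (simp add: smult_assoc1[symmetric] R.m_ac)
          ultimately show "r \<in> colon N ((a \<otimes> c) \<bullet> v)" using r by (simp add: colon_def)
        qed
      qed (use a ab c in auto)
      moreover have "b \<in> colon N ((a \<otimes> c) \<bullet> v)"
        using ab c v by (simp add: colon_def smult_assoc1[symmetric] R.m_ac)
      ultimately show "b \<in> ?p" by simp
    qed
  qed
  then show ?thesis using c by blast
qed

section \<open>Modules over a Noetherian local ring\<close>

locale noeth_local = cring R for R (structure) and mm +
  assumes noeth: "noetherian_ring R"
    and mm_ideal: "ideal mm R" and one_notin_mm: "\<one> \<notin> mm"
    and nonunits: "\<And>a. a \<in> carrier R \<Longrightarrow> a \<notin> mm \<Longrightarrow> a \<in> Units R"
begin

lemma acc: "acc_on {I. ideal I R}" by (rule acc_ideals[OF noeth])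

lemma mm_carr: "x \<in> mm \<Longrightarrow> x \<in> carrier R" by (rule ideal_carr[OF mm_ideal])

lemma proper_ideal_mm: assumes "ideal I R" "I \<noteq> carrier R" shows "I \<subseteq> mm"
proof
  fix a assume a: "a \<in> I"
  show "a \<in> mm"
  proof (rule ccontr)
    assume "a \<notin> mm"
    then have "a \<in> Units R" using nonunits a ideal_carr[OF assms(1)] by blast
    then have "\<one> \<in> I" using a ideal.I_l_closed[OF assms(1) a, of "inv a"] by (simp add: Units_l_inv)
    then show False using ideal_one assms by blast
  qed
qed

lemma prime_mm: "primeideal p R \<Longrightarrow> p \<subseteq> mm"
  using proper_ideal_mm primeideal_props by blast

lemma primeideal_mm: "primeideal mm R"
proof (rule primeidealI[OF mm_ideal is_cring])
  show "carrier R \<noteq> mm" using one_notin_mm by auto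
  fix a b assume ab: "a \<in> carrier R" "b \<in> carrier R" "a \<otimes> b \<in> mm"
  show "a \<in> mm \<or> b \<in> mm"
  proof (rule ccontr)
    assume "\<not> ?thesis"
    then have "a \<otimes> b \<in> Units R" using nonunits ab by blast
    then have "\<one> \<in> mm" using ab(3) ideal.I_l_closed[OF mm_ideal ab(3), of "inv (a \<otimes> b)"]
      by (simp add: Units_l_inv)
    then show False using one_notin_mm by simp
  qed
qed

lemma one_minus_unit: assumes "x \<in> mm" "a \<in> carrier R" shows "\<one> \<ominus> a \<otimes> x \<in> Units R"
proof (rule nonunits)
  show "\<one> \<ominus> a \<otimes> x \<in> carrier R" using assms mm_carr by simp
  show "\<one> \<ominus> a \<otimes> x \<notin> mm"
  proof
    assume "\<one> \<ominus> a \<otimes> x \<in> mm"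
    then have "(\<one> \<ominus> a \<otimes> x) \<oplus> a \<otimes> x \<in> mm"
      using assms mm_ideal by (intro ideal_add) (auto simp: ideal.I_l_closed)
    moreover have "(\<one> \<ominus> a \<otimes> x) \<oplus> a \<otimes> x = \<one>" using assms mm_carr by algebra
    ultimately show False using one_notin_mm by simp
  qed
qed

lemma unit_cases: "c \<in> carrier R \<Longrightarrow> c \<in> Units R \<or> \<one> \<ominus> c \<in> Units R"
  using one_minus_unit[of c \<one>] nonunits[of c] by (cases "c \<in> mm") simp_all

end

locale noeth_local_module = R?: noeth_local R mm + module R M for R (structure) and M (structure) and mm +
  assumes acc_M: "acc_on {N. submodule N R M}"
begin

lemma unit_smult_mem:
  assumes "msub N" "u \<in> Units R" "v \<in> carrier M" "u \<bullet> v \<in> N" shows "v \<in> N"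
proof -
  have "inv u \<bullet> (u \<bullet> v) \<in> N" using assms by auto
  moreover have "inv u \<bullet> (u \<bullet> v) = v" using assms by (simp add: smult_assoc1[symmetric] R.Units_l_inv R.Units_closed)
  ultimately show ?thesis by simp
qed

text \<open>\<open>K\<close> is merely a set closed under one step of division by \<open>x\<close>
  modulo \<open>N\<close>. For \<open>k\<close> in \<open>K\<close> outside \<open>N\<close> with
  \<open>N + R k\<close> maximal, \<open>k = n + x k'\<close> gives
  \<open>N + R k <= N + R k'\<close>, hence equality, and substituting for \<open>k'\<close> puts
  \<open>(1 - a x) k\<close> into \<open>N\<close>.\<close>

lemma nakayama:
  assumes N: "msub N" and x: "x \<in> mm" and K: "K \<subseteq> carrier M"
    and dec: "\<And>k. k \<in> K \<Longrightarrow> \<exists>n\<in>N. \<exists>k'\<in>K. k = n \<boxplus> x \<bullet> k'"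
  shows "K \<subseteq> N"
proof (rule ccontr)
  assume "\<not> K \<subseteq> N"
  then obtain k0 where k0: "k0 \<in> K" "k0 \<notin> N" by blast
  have xc: "x \<in> carrier R" using x mm_carr by simp
  have "\<exists>k. (k \<in> K \<and> k \<notin> N) \<and> (\<forall>l. l \<in> K \<and> l \<notin> N \<longrightarrow>
    plus_cyclic N k \<subseteq> plus_cyclic N l \<longrightarrow> plus_cyclic N l = plus_cyclic N k)"
    by (rule acc_on_maximal_image[OF acc_M, of _ k0]) (use plus_cyclic_sub[OF N] k0 K in auto)
  then obtain k where k: "k \<in> K" "k \<notin> N"
    and max: "\<And>l. l \<in> K \<Longrightarrow> l \<notin> N \<Longrightarrow> plus_cyclic N k \<subseteq> plus_cyclic N l \<Longrightarrow> plus_cyclic N l = plus_cyclic N k"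
    by blast
  obtain n k' where *: "n \<in> N" "k' \<in> K" "k = n \<boxplus> x \<bullet> k'" using dec k by blast
  have kc: "k \<in> carrier M" "k' \<in> carrier M" "n \<in> carrier M" using k * K N by auto
  have k': "k' \<notin> N" using * k N xc by auto
  have "k \<in> plus_cyclic N k'" using * xc plus_cyclicI by simp
  then have "plus_cyclic N k \<subseteq> plus_cyclic N k'"
    using plus_cyclic_sub[OF N kc(2)] plus_cyclic_superset[OF N kc(2)]
    unfolding plus_cyclic_def[of N k] by blast
  then have "plus_cyclic N k' = plus_cyclic N k" using max * k' by blast
  then have "k' \<in> plus_cyclic N k" using plus_cyclic_mem[OF N kc(2)] by simp
  then obtain n' a where n': "n' \<in> N" "a \<in> carrier R" "k' = n' \<boxplus> a \<bullet> k" by (auto simp: plus_cyclic_def)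
  have n'c: "n' \<in> carrier M" using N n' by auto
  have "(\<one> \<ominus> a \<otimes> x) \<bullet> k = k \<boxminus> a \<bullet> x \<bullet> k" using n' xc kc by algebra
  also have "\<dots> = (n \<boxplus> x \<bullet> k') \<boxminus> a \<bullet> x \<bullet> k" using *(3) by simp
  also have "\<dots> = (n \<boxplus> x \<bullet> (n' \<boxplus> a \<bullet> k)) \<boxminus> a \<bullet> x \<bullet> k" using n'(3) by simp
  also have "\<dots> = n \<boxplus> x \<bullet> n'" using n'(2) n'c xc kc by algebra
  finally have "(\<one> \<ominus> a \<otimes> x) \<bullet> k \<in> N" using *(1) n'(1) xc N by auto
  then show False using unit_smult_mem[OF N one_minus_unit[OF x n'(2)] kc(1)] k by blast
qed

text \<open>A regular sequence on \<open>M / N\<close>, with the successive quotients recorded as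
  growing submodules of \<open>M\<close>. That a quotient is nonzero is expressed separately, by an
  element outside the submodule.\<close>

fun rel_regular :: "'c set \<Rightarrow> 'a list \<Rightarrow> bool" where
  "rel_regular N [] \<longleftrightarrow> True"
| "rel_regular N (x # xs) \<longleftrightarrow> x \<in> mm \<and> (\<forall>v\<in>carrier M. x \<bullet> v \<in> N \<longrightarrow> v \<in> N) \<and> rel_regular (plus_mult N x) xs"

text \<open>For a nonzero class of \<open>v\<close> this is
  \<open>dim R / Ann v >= depth (M / N)\<close>. An associated prime \<open>p\<close> above
  \<open>J\<close> misses the first regular element \<open>x\<close>, and Nakayama's lemma finds an
  element that \<open>p\<close> and \<open>x\<close> kill in the nonzero part of
  \<open>M / (N + x M)\<close>. The induction continues there, and \<open>p\<close> is put in front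
  of the chain it yields.\<close>

lemma prime_chain_of_annihilator:
  assumes "msub N" "rel_regular N xs" "v \<in> carrier M" "v \<notin> N" "\<And>r. r \<in> J \<Longrightarrow> r \<in> carrier R \<and> r \<bullet> v \<in> N"
  shows "prime_chain R J (length xs)"
  using assms
proof (induction xs arbitrary: N v J)
  case Nil
  obtain c where c: "c \<in> carrier R" "c \<bullet> v \<notin> N" "primeideal (colon N (c \<bullet> v)) R"
    using associated_prime[OF acc Nil(1,3,4)] by blast
  have "J \<subseteq> colon N (c \<bullet> v)"
  proof
    fix r assume r: "r \<in> J"
    then have "c \<bullet> r \<bullet> v \<in> N" using Nil c by auto
    moreover have "c \<bullet> r \<bullet> v = r \<bullet> c \<bullet> v" using Nil(3) Nil(5)[OF r] c by (simp add: smult_assoc1[symmetric] R.m_comm)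
    ultimately show "r \<in> colon N (c \<bullet> v)" using Nil(5)[OF r] by (simp add: colon_def)
  qed
  then show ?case using prime_chain_prime c by simp
next
  case (Cons x xs)
  note N = Cons.prems(1)
  obtain c where c: "c \<in> carrier R" "c \<bullet> v \<notin> N" "primeideal (colon N (c \<bullet> v)) R"
    using associated_prime[OF acc N Cons.prems(3,4)] by blast
  let ?p = "colon N (c \<bullet> v)"
  have x: "x \<in> mm" "x \<in> carrier R" "\<And>v. v \<in> carrier M \<Longrightarrow> x \<bullet> v \<in> N \<Longrightarrow> v \<in> N"
    "rel_regular (plus_mult N x) xs" using Cons.prems mm_carr by auto
  have cv: "c \<bullet> v \<in> carrier M" using c Cons.prems by auto
  have Jp: "J \<subseteq> ?p"
  proof
    fix r assume r: "r \<in> J"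
    then have "c \<bullet> r \<bullet> v \<in> N" using Cons.prems c by auto
    moreover have "c \<bullet> r \<bullet> v = r \<bullet> c \<bullet> v" using Cons.prems(3,5) r c by (simp add: smult_assoc1[symmetric] R.m_comm)
    ultimately show "r \<in> ?p" using Cons.prems(5)[OF r] by (simp add: colon_def)
  qed
  have xp: "x \<notin> ?p" using x(3)[OF cv] c by (auto simp: colon_def)
  \<comment> \<open>The elements killed by \<open>p\<close> modulo \<open>N\<close>. If they were
    all in \<open>N + x M\<close>, cancelling \<open>x\<close> would show the cofactors to be killed
    by \<open>p\<close> too, so that \<open>K\<close> would be closed under division by
    \<open>x\<close>.\<close>
  define K where "K = {w \<in> carrier M. \<forall>r\<in>?p. r \<bullet> w \<in> N}"
  have Nx: "msub (plus_mult N x)" using plus_mult_sub[OF N x(2)] .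
  have pc: "r \<in> carrier R" if "r \<in> ?p" for r using that by (simp add: colon_def)
  have "\<not> K \<subseteq> plus_mult N x"
  proof
    assume a: "K \<subseteq> plus_mult N x"
    have "K \<subseteq> N"
    proof (rule nakayama[OF N x(1)])
      fix k assume k: "k \<in> K"
      then obtain n w where nw: "k = n \<boxplus> x \<bullet> w" "n \<in> N" "w \<in> carrier M" using a by (auto simp: plus_mult_def)
      have "w \<in> K" unfolding K_def
      proof (intro CollectI conjI ballI)
        fix r assume r: "r \<in> ?p"
        have "r \<bullet> k \<in> N" using k r by (simp add: K_def)
        moreover have "r \<bullet> k = r \<bullet> n \<boxplus> x \<bullet> r \<bullet> w"
          using nw sub_carr[OF N nw(2)] pc[OF r] x(2) unfolding nw(1) by algebra
        ultimately have "x \<bullet> r \<bullet> w \<in> N"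
          using sub_add_iff[OF N, of "r \<bullet> n" "x \<bullet> r \<bullet> w"] sub_smult[OF N pc[OF r] nw(2)] nw(3) pc[OF r] x(2) by simp
        then show "r \<bullet> w \<in> N" using x(3) pc[OF r] nw(3) by auto
      qed (use nw in auto)
      then show "\<exists>n\<in>N. \<exists>k'\<in>K. k = n \<boxplus> x \<bullet> k'" using nw by blast
    qed (auto simp: K_def)
    moreover have "c \<bullet> v \<in> K" using cv by (auto simp: K_def colon_def)
    ultimately show False using c by blast
  qed
  then obtain w where w: "w \<in> carrier M" "\<forall>r\<in>?p. r \<bullet> w \<in> N" "w \<notin> plus_mult N x" by (auto simp: K_def)
  let ?J = "insert x ?p"
  have "prime_chain R ?J (length xs)"
  proof (rule Cons.IH[OF Nx x(4) w(1,3)])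
    fix r assume "r \<in> ?J"
    then show "r \<in> carrier R \<and> r \<bullet> w \<in> plus_mult N x"
      using plus_mult_mem[OF N x(2) w(1)] x(2) w(2) plus_mult_superset[OF N x(2)] pc by auto
  qed
  then show ?case using prime_chain_Suc[OF c(3) Jp] xp by auto
qed

end

section \<open>Linear maps from ideals to quotient modules\<close>

context module
begin

definition cong_mod :: "'c set \<Rightarrow> 'c \<Rightarrow> 'c \<Rightarrow> bool"
  where "cong_mod N x y \<longleftrightarrow> x \<in> carrier M \<and> y \<in> carrier M \<and> x \<boxminus> y \<in> N"

lemma cong_refl: "msub N \<Longrightarrow> x \<in> carrier M \<Longrightarrow> cong_mod N x x"
  by (auto simp: cong_mod_def M.r_neg M.minus_eq)

lemma cong_sym:
  assumes "msub N" "cong_mod N x y" shows "cong_mod N y x"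
proof -
  have c: "x \<in> carrier M" "y \<in> carrier M" "x \<boxminus> y \<in> N" using assms by (auto simp: cong_mod_def)
  have "\<ominus>\<^bsub>M\<^esub> (x \<boxminus> y) \<in> N" using assms c by auto
  moreover have "\<ominus>\<^bsub>M\<^esub> (x \<boxminus> y) = y \<boxminus> x" using c(1,2) by algebra
  ultimately show ?thesis using c by (simp add: cong_mod_def)
qed

lemma cong_trans:
  assumes "msub N" "cong_mod N x y" "cong_mod N y z" shows "cong_mod N x z"
proof -
  have c: "x \<in> carrier M" "y \<in> carrier M" "z \<in> carrier M" "x \<boxminus> y \<in> N" "y \<boxminus> z \<in> N"
    using assms by (auto simp: cong_mod_def)
  have "(x \<boxminus> y) \<boxplus> (y \<boxminus> z) \<in> N" using assms c by auto
  moreover have "(x \<boxminus> y) \<boxplus> (y \<boxminus> z) = x \<boxminus> z" using c(1-3) by algebra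
  ultimately show ?thesis using c by (simp add: cong_mod_def)
qed

lemma cong_add:
  assumes "msub N" "cong_mod N x y" "cong_mod N x' y'" shows "cong_mod N (x \<boxplus> x') (y \<boxplus> y')"
proof -
  have c: "x \<in> carrier M" "y \<in> carrier M" "x' \<in> carrier M" "y' \<in> carrier M" "x \<boxminus> y \<in> N" "x' \<boxminus> y' \<in> N"
    using assms by (auto simp: cong_mod_def)
  have "(x \<boxminus> y) \<boxplus> (x' \<boxminus> y') \<in> N" using assms c by auto
  moreover have "(x \<boxminus> y) \<boxplus> (x' \<boxminus> y') = (x \<boxplus> x') \<boxminus> (y \<boxplus> y')" using c(1-4) by algebra
  ultimately show ?thesis using c by (simp add: cong_mod_def)
qed

lemma cong_smult:
  assumes "msub N" "a \<in> carrier R" "cong_mod N x y" shows "cong_mod N (a \<bullet> x) (a \<bullet> y)"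
proof -
  have c: "x \<in> carrier M" "y \<in> carrier M" "x \<boxminus> y \<in> N" using assms by (auto simp: cong_mod_def)
  have "a \<bullet> (x \<boxminus> y) \<in> N" using assms c by auto
  moreover have "a \<bullet> (x \<boxminus> y) = a \<bullet> x \<boxminus> a \<bullet> y" using c(1,2) assms(2) by algebra
  ultimately show ?thesis using c assms by (simp add: cong_mod_def)
qed

lemma cong_neg:
  assumes "msub N" "cong_mod N x y" shows "cong_mod N (\<ominus>\<^bsub>M\<^esub> x) (\<ominus>\<^bsub>M\<^esub> y)"
proof -
  have "x \<in> carrier M" "y \<in> carrier M" using assms by (auto simp: cong_mod_def)
  then have "\<ominus>\<^bsub>M\<^esub> x = (\<ominus> \<one>) \<bullet> x" "\<ominus>\<^bsub>M\<^esub> y = (\<ominus> \<one>) \<bullet> y" by (auto simp: smult_l_minus)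
  then show ?thesis using cong_smult[OF assms(1) _ assms(2), of "\<ominus> \<one>"] by simp
qed

lemma cong_diff:
  assumes "msub N" "cong_mod N x y" "cong_mod N x' y'" shows "cong_mod N (x \<boxminus> x') (y \<boxminus> y')"
  unfolding M.minus_eq by (intro cong_add cong_neg assms)

lemma cong_zero_iff: "msub N \<Longrightarrow> cong_mod N x \<zero>\<^bsub>M\<^esub> \<longleftrightarrow> x \<in> N"
proof
  assume a: "msub N" "cong_mod N x \<zero>\<^bsub>M\<^esub>"
  then show "x \<in> N" by (auto simp: cong_mod_def M.minus_eq)
next
  assume a: "msub N" "x \<in> N"
  then show "cong_mod N x \<zero>\<^bsub>M\<^esub>" using sub_carr[OF a] by (simp add: cong_mod_def M.minus_eq)
qed

lemma cong_mem:
  assumes "msub N" "cong_mod N x y" "y \<in> N" shows "x \<in> N"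
  using cong_trans[OF assms(1,2), of "\<zero>\<^bsub>M\<^esub>"] assms(3) by (simp add: cong_zero_iff[OF assms(1)])

text \<open>A linear map from an ideal to a quotient of \<open>M\<close> is encoded by a submodule of \<open>R \<times> M\<close>.\<close>

definition lin_graph :: "('a \<times> 'c) set \<Rightarrow> bool"
  where "lin_graph G \<longleftrightarrow> G \<subseteq> carrier R \<times> carrier M \<and> (\<zero>, \<zero>\<^bsub>M\<^esub>) \<in> G \<and>
    (\<forall>r w r' w'. (r, w) \<in> G \<longrightarrow> (r', w') \<in> G \<longrightarrow> (r \<oplus> r', w \<boxplus> w') \<in> G) \<and>
    (\<forall>a r w. a \<in> carrier R \<longrightarrow> (r, w) \<in> G \<longrightarrow> (a \<otimes> r, a \<bullet> w) \<in> G)"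

lemma lin_graphD:
  assumes "lin_graph G"
  shows "(r, w) \<in> G \<Longrightarrow> r \<in> carrier R" "(r, w) \<in> G \<Longrightarrow> w \<in> carrier M" "(\<zero>, \<zero>\<^bsub>M\<^esub>) \<in> G"
    "(r, w) \<in> G \<Longrightarrow> (r', w') \<in> G \<Longrightarrow> (r \<oplus> r', w \<boxplus> w') \<in> G"
    "a \<in> carrier R \<Longrightarrow> (r, w) \<in> G \<Longrightarrow> (a \<otimes> r, a \<bullet> w) \<in> G"
proof -
  note G = assms[unfolded lin_graph_def]
  have sub: "G \<subseteq> carrier R \<times> carrier M" using G by (rule conjunct1)
  show "(r, w) \<in> G \<Longrightarrow> r \<in> carrier R" using sub by (rule SigmaD1[OF subsetD])
  show "(r, w) \<in> G \<Longrightarrow> w \<in> carrier M" using sub by (rule SigmaD2[OF subsetD])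
  show "(\<zero>, \<zero>\<^bsub>M\<^esub>) \<in> G" using G by simp
  show "(r, w) \<in> G \<Longrightarrow> (r', w') \<in> G \<Longrightarrow> (r \<oplus> r', w \<boxplus> w') \<in> G" using G by simp
  show "a \<in> carrier R \<Longrightarrow> (r, w) \<in> G \<Longrightarrow> (a \<otimes> r, a \<bullet> w) \<in> G" using G by simp
qed

lemma lin_graph_diff:
  assumes G: "lin_graph G" and "(r, w) \<in> G" "(r', w') \<in> G"
  shows "(r \<ominus> r', w \<boxminus> w') \<in> G"
proof -
  have c: "r' \<in> carrier R" "w' \<in> carrier M" using lin_graphD(1,2)[OF G assms(3)] .
  have "((\<ominus> \<one>) \<otimes> r', (\<ominus> \<one>) \<bullet> w') \<in> G" by (rule lin_graphD(5)[OF G _ assms(3)]) simp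
  then have "(\<ominus> r', \<ominus>\<^bsub>M\<^esub> w') \<in> G" using c by (simp add: smult_l_minus R.l_minus)
  then show ?thesis unfolding M.minus_eq R.minus_eq using lin_graphD(4)[OF G assms(2)] by blast
qed

lemma lin_graph_dom_ideal:
  assumes G: "lin_graph G" shows "ideal (fst ` G) R"
proof (rule R.idealI')
  show "\<zero> \<in> fst ` G" using lin_graphD(3)[OF G] by force
  fix a b assume "a \<in> fst ` G" "b \<in> fst ` G"
  then show "a \<oplus> b \<in> fst ` G" using lin_graphD(4)[OF G] by force
next
  fix a x assume "a \<in> carrier R" "x \<in> fst ` G"
  then show "a \<otimes> x \<in> fst ` G" using lin_graphD(5)[OF G] by force
qed (use lin_graphD(1)[OF G] in auto)

text \<open>The relation is single-valued modulo \<open>N\<close>, hence defines a linear map from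
  its domain to \<open>M / N\<close>.\<close>

definition functional_mod :: "'c set \<Rightarrow> ('a \<times> 'c) set \<Rightarrow> bool"
  where "functional_mod N G \<longleftrightarrow> (\<forall>w. (\<zero>, w) \<in> G \<longrightarrow> w \<in> N)"

text \<open>The map extends from its domain \<open>J\<close> to all of \<open>R\<close>, which means
  that its class in \<open>Ext^1(R / J, M / N)\<close> is zero.\<close>

definition trivial_mod :: "'c set \<Rightarrow> ('a \<times> 'c) set \<Rightarrow> bool"
  where "trivial_mod N G \<longleftrightarrow> (\<exists>v\<in>carrier M. \<forall>r w. (r, w) \<in> G \<longrightarrow> cong_mod N w (r \<bullet> v))"

lemma functional_modD:
  assumes "lin_graph G" "functional_mod N G" "(r, w) \<in> G" "(r, w') \<in> G"
  shows "cong_mod N w w'"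
proof -
  have c: "r \<in> carrier R" "w \<in> carrier M" "w' \<in> carrier M" using lin_graphD(1,2)[OF assms(1)] assms(3,4) by auto
  have "(r \<ominus> r, w \<boxminus> w') \<in> G" by (rule lin_graph_diff[OF assms(1,3,4)])
  moreover have "r \<ominus> r = \<zero>" using c(1) by algebra
  ultimately have "w \<boxminus> w' \<in> N" using assms(2) unfolding functional_mod_def by simp
  then show ?thesis using c by (simp add: cong_mod_def)
qed

text \<open>The Noetherian property of powers of \<open>M\<close>: at each place \<open>j\<close> the leading entries, of the
  functions in \<open>H i\<close> that vanish before \<open>j\<close>, form an ascending chain of submodules of \<open>M\<close>.\<close>

lemma acc_functions:
  fixes H :: "nat \<Rightarrow> (nat \<Rightarrow> 'c) set"
  assumes acc: "acc_on {N. msub N}" and N: "msub N"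
    and carr: "\<And>i f l. f \<in> H i \<Longrightarrow> f l \<in> carrier M"
    and zero: "\<And>i. (\<lambda>l. \<zero>\<^bsub>M\<^esub>) \<in> H i"
    and add: "\<And>i f g. f \<in> H i \<Longrightarrow> g \<in> H i \<Longrightarrow> (\<lambda>l. f l \<boxplus> g l) \<in> H i"
    and smult: "\<And>i a f. a \<in> carrier R \<Longrightarrow> f \<in> H i \<Longrightarrow> (\<lambda>l. a \<bullet> f l) \<in> H i"
    and mono: "\<And>i. H i \<subseteq> H (Suc i)"
  shows "\<exists>n. \<forall>f\<in>H (Suc n). \<exists>g\<in>H n. \<forall>l<s. cong_mod N (f l) (g l)"
proof -
  define e where "e j i = {w. \<exists>f\<in>H i. (\<forall>l<j. f l \<in> N) \<and> cong_mod N (f j) w}" for i and j :: nat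
  have e: "msub (e j i)" for i j
  proof (rule submoduleI')
    show "e j i \<subseteq> carrier M" by (auto simp: e_def cong_mod_def)
    show "\<zero>\<^bsub>M\<^esub> \<in> e j i" unfolding e_def using zero[of i] N cong_refl[OF N, of "\<zero>\<^bsub>M\<^esub>"] by (force intro!: bexI[OF _ zero])
  next
    fix a b assume "a \<in> e j i" "b \<in> e j i"
    then obtain f g where f: "f \<in> H i" "\<forall>l<j. f l \<in> N" "cong_mod N (f j) a"
      and g: "g \<in> H i" "\<forall>l<j. g l \<in> N" "cong_mod N (g j) b" by (auto simp: e_def)
    show "a \<boxplus> b \<in> e j i" unfolding e_def
      using add[OF f(1) g(1)] cong_add[OF N f(3) g(3)] f(2) g(2) sub_add[OF N]
      by (intro CollectI bexI[of _ "\<lambda>l. f l \<boxplus> g l"]) auto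
  next
    fix r a assume r: "r \<in> carrier R" and "a \<in> e j i"
    then obtain f where f: "f \<in> H i" "\<forall>l<j. f l \<in> N" "cong_mod N (f j) a" by (auto simp: e_def)
    show "r \<bullet> a \<in> e j i" unfolding e_def
      using smult[OF r f(1)] cong_smult[OF N r f(3)] f(2) sub_smult[OF N r]
      by (intro CollectI bexI[of _ "\<lambda>l. r \<bullet> f l"]) auto
  qed
  have "e j i \<subseteq> e j (Suc i)" for i j using mono[of i] unfolding e_def by blast
  then have "\<exists>n. \<forall>i\<ge>n. e j i = e j n" for j
    using acc_onD[OF acc, of "e j"] e by blast
  then obtain n0 where n0: "\<And>j i. i \<ge> n0 j \<Longrightarrow> e j i = e j (n0 j)" by metis
  \<comment> \<open>An index from which the leading entries at all of the finitely many places are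
    stable. The approximation \<open>g\<close> is then improved place by place.\<close>
  define n where "n = Max (insert 0 (n0 ` {..<s}))"
  have eq: "e j (Suc n) = e j n" if "j < s" for j
  proof -
    have "n0 j \<le> n" unfolding n_def using that by (intro Max_ge) auto
    then show ?thesis using n0[of j n] n0[of j "Suc n"] by simp
  qed
  have "\<forall>f\<in>H (Suc n). \<exists>g\<in>H n. \<forall>l<j. cong_mod N (f l) (g l)" if "j \<le> s" for j
    using that
  proof (induction j)
    case 0 show ?case using zero by blast
  next
    case (Suc j)
    show ?case
    proof
      fix f assume f: "f \<in> H (Suc n)"
      obtain g where g: "g \<in> H n" "\<And>l. l < j \<Longrightarrow> cong_mod N (f l) (g l)" using Suc f by auto
      \<comment> \<open>The part of \<open>f\<close> still to be matched: it vanishes modulo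
        \<open>N\<close> before \<open>j\<close>, so its entry at \<open>j\<close> is a leading
        entry and is already reached in \<open>H n\<close>.\<close>
      define h where "h l = f l \<boxplus> (\<ominus> \<one>) \<bullet> g l" for l
      have g': "g \<in> H (Suc n)" using g mono by blast
      have h: "h \<in> H (Suc n)" unfolding h_def by (intro add smult f g') simp
      have hd: "h l = f l \<boxminus> g l" for l
        using carr[OF f, of l] carr[OF g', of l] by (simp add: h_def smult_l_minus M.minus_eq)
      have "\<forall>l<j. h l \<in> N" using g(2) unfolding hd cong_mod_def by blast
      then have "h j \<in> e j (Suc n)" unfolding e_def using h cong_refl[OF N carr[OF h]] by blast
      then have "h j \<in> e j n" using eq Suc by simp
      then obtain g1 where g1: "g1 \<in> H n" "\<forall>l<j. g1 l \<in> N" "cong_mod N (g1 j) (h j)" by (auto simp: e_def)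
      show "\<exists>g\<in>H n. \<forall>l<Suc j. cong_mod N (f l) (g l)"
      proof (intro bexI allI impI)
        show "(\<lambda>l. g l \<boxplus> g1 l) \<in> H n" by (intro add g g1)
        fix l assume "l < Suc j"
        then consider "l < j" | "l = j" by linarith
        then have "cong_mod N (h l) (g1 l)"
        proof cases
          case 1
          then have "h l \<in> N" "g1 l \<in> N" using \<open>\<forall>l<j. h l \<in> N\<close> g1 by auto
          then show ?thesis using N carr[OF h] carr[OF g1(1)] by (auto simp: cong_mod_def)
        qed (use g1 cong_sym[OF N] in auto)
        then have "cong_mod N (g l \<boxplus> h l) (g l \<boxplus> g1 l)"
          by (intro cong_add N cong_refl carr[OF g(1)])
        moreover have "g l \<boxplus> h l = f l" unfolding hd using carr[OF f, of l] carr[OF g', of l] by algebra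
        ultimately show "cong_mod N (f l) (g l \<boxplus> g1 l)" by simp
      qed
    qed
  qed
  then show ?thesis by blast
qed

end

lemma (in module) trivial_modI:
  "v \<in> carrier M \<Longrightarrow> (\<And>r w. (r, w) \<in> G \<Longrightarrow> cong_mod N w (r \<bullet> v)) \<Longrightarrow> trivial_mod N G"
  unfolding trivial_mod_def by blast

text \<open>The map is glued with \<open>c \<mapsto> v\<close>. By \<open>tr\<close> the two
  prescriptions agree on the multiples of \<open>c\<close> in the old domain, which makes the result
  single-valued.\<close>

lemma (in module) lin_graph_extend:
  assumes G: "lin_graph G" and c: "c \<in> carrier R" and v: "v \<in> carrier M" and N: "msub N"
    and fn: "functional_mod N G"
    and tr: "\<And>r w. r \<in> carrier R \<Longrightarrow> (r \<otimes> c, w) \<in> G \<Longrightarrow> cong_mod N w (r \<bullet> v)"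
  defines "G' \<equiv> {(r \<oplus> a \<otimes> c, w \<boxplus> a \<bullet> v) |r w a. (r, w) \<in> G \<and> a \<in> carrier R}"
  shows "lin_graph G'" "functional_mod N G'" "G \<subseteq> G'" "c \<in> fst ` G'"
proof -
  have I: "(r \<oplus> a \<otimes> c, w \<boxplus> a \<bullet> v) \<in> G'" if "(r, w) \<in> G" "a \<in> carrier R" for r w a
    using that unfolding G'_def by blast
  note D = lin_graphD[OF G]
  show sub: "G \<subseteq> G'"
  proof (rule subsetI, unfold split_paired_all)
    fix r w assume rw: "(r, w) \<in> G"
    show "(r, w) \<in> G'" using I[OF rw R.zero_closed] D(1,2)[OF rw] c v by simp
  qed
  show "c \<in> fst ` G'" using I[OF D(3) R.one_closed] c by force
  show "lin_graph G'" unfolding lin_graph_def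
  proof (intro conjI allI impI)
    show "G' \<subseteq> carrier R \<times> carrier M" using D(1,2) c v unfolding G'_def by auto
    show "(\<zero>, \<zero>\<^bsub>M\<^esub>) \<in> G'" using sub D(3) by blast
  next
    fix r w r' w' assume "(r, w) \<in> G'" "(r', w') \<in> G'"
    then obtain s u a s' u' a' where 1: "r = s \<oplus> a \<otimes> c" "w = u \<boxplus> a \<bullet> v" "(s, u) \<in> G" "a \<in> carrier R"
      and 2: "r' = s' \<oplus> a' \<otimes> c" "w' = u' \<boxplus> a' \<bullet> v" "(s', u') \<in> G" "a' \<in> carrier R"
      unfolding G'_def by blast
    note k = D(1,2)[OF 1(3)] D(1,2)[OF 2(3)] 1(4) 2(4) c v
    have "r \<oplus> r' = (s \<oplus> s') \<oplus> (a \<oplus> a') \<otimes> c" unfolding 1(1) 2(1) using k by algebra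
    moreover have "w \<boxplus> w' = (u \<boxplus> u') \<boxplus> (a \<oplus> a') \<bullet> v" unfolding 1(2) 2(2) using k by algebra
    ultimately show "(r \<oplus> r', w \<boxplus> w') \<in> G'" using I[OF D(4)[OF 1(3) 2(3)], of "a \<oplus> a'"] 1(4) 2(4) by simp
  next
    fix b r w assume b: "b \<in> carrier R" and "(r, w) \<in> G'"
    then obtain s u a where 1: "r = s \<oplus> a \<otimes> c" "w = u \<boxplus> a \<bullet> v" "(s, u) \<in> G" "a \<in> carrier R"
      unfolding G'_def by blast
    note k = D(1,2)[OF 1(3)] 1(4) c v b
    have "b \<otimes> r = b \<otimes> s \<oplus> (b \<otimes> a) \<otimes> c" unfolding 1(1) using k by algebra
    moreover have "b \<bullet> w = b \<bullet> u \<boxplus> (b \<otimes> a) \<bullet> v" unfolding 1(2) using k by algebra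
    ultimately show "(b \<otimes> r, b \<bullet> w) \<in> G'" using I[OF D(5)[OF b 1(3)], of "b \<otimes> a"] 1(4) b by simp
  qed
  show "functional_mod N G'" unfolding functional_mod_def
  proof (intro allI impI)
    fix w assume "(\<zero>, w) \<in> G'"
    then obtain s u a where 1: "\<zero> = s \<oplus> a \<otimes> c" "w = u \<boxplus> a \<bullet> v" "(s, u) \<in> G" "a \<in> carrier R"
      unfolding G'_def by blast
    note k = D(1,2)[OF 1(3)] 1(4) c v
    have "(\<ominus> \<one>) \<otimes> s = a \<otimes> c \<ominus> (s \<oplus> a \<otimes> c)" using k by algebra
    also have "\<dots> = a \<otimes> c" using k unfolding 1(1)[symmetric] by algebra
    finally have "(a \<otimes> c, (\<ominus> \<one>) \<bullet> u) \<in> G" using D(5)[OF _ 1(3), of "\<ominus> \<one>"] by simp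
    then have "cong_mod N ((\<ominus> \<one>) \<bullet> u) (a \<bullet> v)" using tr 1(4) by blast
    then have "cong_mod N ((\<ominus> \<one>) \<bullet> ((\<ominus> \<one>) \<bullet> u) \<boxplus> a \<bullet> v) ((\<ominus> \<one>) \<bullet> (a \<bullet> v) \<boxplus> a \<bullet> v)"
      using k by (intro cong_add cong_smult cong_refl N) auto
    moreover have "(\<ominus> \<one>) \<bullet> ((\<ominus> \<one>) \<bullet> u) \<boxplus> a \<bullet> v = w" unfolding 1(2) using k by algebra
    moreover have "(\<ominus> \<one>) \<bullet> (a \<bullet> v) \<boxplus> a \<bullet> v = \<zero>\<^bsub>M\<^esub>" using k by algebra
    ultimately show "w \<in> N" using cong_zero_iff[OF N] by simp
  qed
qed

text \<open>To extend all maps from ideals with a property \<open>P\<close> it suffices to treat prime ideals: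
  a map without extension whose domain \<open>J\<close> is maximal induces one on each prime \<open>(J : c)\<close>.\<close>

lemma (in module) trivial_mod_devissage:
  assumes acc: "acc_on {I. ideal I R}" and N: "msub N"
    and up: "\<And>G G'. P G \<Longrightarrow> G \<subseteq> G' \<Longrightarrow> P G'"
    and colon: "\<And>G c. lin_graph G \<Longrightarrow> P G \<Longrightarrow> c \<in> carrier R \<Longrightarrow> P {(r, w). r \<in> carrier R \<and> (r \<otimes> c, w) \<in> G}"
    and prime: "\<And>G. lin_graph G \<Longrightarrow> functional_mod N G \<Longrightarrow> P G \<Longrightarrow> primeideal (fst ` G) R \<Longrightarrow> trivial_mod N G"
    and G0: "lin_graph G0" "functional_mod N G0" "P G0"
  shows "trivial_mod N G0"
proof (rule ccontr)
  assume nt: "\<not> trivial_mod N G0"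
  define bad where "bad G \<longleftrightarrow> lin_graph G \<and> functional_mod N G \<and> P G \<and> \<not> trivial_mod N G" for G
  have "\<exists>G. bad G \<and> (\<forall>G'. bad G' \<longrightarrow> fst ` G \<subseteq> fst ` G' \<longrightarrow> fst ` G' = fst ` G)"
    by (rule acc_on_maximal_image[OF acc, of _ G0]) (use nt G0 lin_graph_dom_ideal in \<open>auto simp: bad_def\<close>)
  then obtain G where bad: "bad G" and max: "\<And>G'. bad G' \<Longrightarrow> fst ` G \<subseteq> fst ` G' \<Longrightarrow> fst ` G' = fst ` G"
    by blast
  have G: "lin_graph G" "functional_mod N G" "P G" "\<not> trivial_mod N G" using bad by (auto simp: bad_def)
  note D = lin_graphD[OF G(1)]
  let ?J = "fst ` G"
  have J: "ideal ?J R" by (rule lin_graph_dom_ideal[OF G(1)])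
  have "\<one> \<notin> ?J"
  proof
    assume "\<one> \<in> ?J"
    then obtain v where v: "(\<one>, v) \<in> G" by force
    have "trivial_mod N G"
    proof (rule trivial_modI)
      show vc: "v \<in> carrier M" using D(2)[OF v] .
      fix r w assume rw: "(r, w) \<in> G"
      have "(r, r \<bullet> v) \<in> G" using D(5)[OF D(1)[OF rw] v] D(1)[OF rw] by simp
      then show "cong_mod N w (r \<bullet> v)" using functional_modD[OF G(1,2) rw] by blast
    qed
    then show False using G by blast
  qed
  interpret S: module R "self_module R" by (rule R.module_self)
  have Js: "submodule ?J R (self_module R)" using J R.submodule_self_iff by simp
  obtain c where c: "c \<in> carrier R" "c \<notin> ?J" and p: "primeideal (S.colon ?J c) R"
    using S.associated_prime[OF acc Js, of \<one>] \<open>\<one> \<notin> ?J\<close> by auto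
  \<comment> \<open>The induced map on \<open>(J : c)\<close> sends \<open>r\<close> to the value of
    \<open>G\<close> at \<open>r c\<close>. A multiplier \<open>v\<close> for it is the value that
    \<open>c\<close> must receive in an extension of \<open>G\<close> to \<open>J + R c\<close>, and
    such an extension contradicts maximality.\<close>
  define Gp where "Gp = {(r, w). r \<in> carrier R \<and> (r \<otimes> c, w) \<in> G}"
  have lin: "lin_graph Gp" unfolding lin_graph_def
  proof (intro conjI allI impI)
    show "Gp \<subseteq> carrier R \<times> carrier M" using D(2) by (auto simp: Gp_def)
    show "(\<zero>, \<zero>\<^bsub>M\<^esub>) \<in> Gp" using D(3) c by (simp add: Gp_def)
  next
    fix r w r' w' assume "(r, w) \<in> Gp" "(r', w') \<in> Gp"
    then show "(r \<oplus> r', w \<boxplus> w') \<in> Gp" using D(4) c by (auto simp: Gp_def R.l_distr)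
  next
    fix a r w assume "a \<in> carrier R" "(r, w) \<in> Gp"
    then show "(a \<otimes> r, a \<bullet> w) \<in> Gp" using D(5) c by (auto simp: Gp_def R.m_assoc)
  qed
  have fn: "functional_mod N Gp"
    using G(2) c by (auto simp: Gp_def functional_mod_def)
  have dom: "fst ` Gp = S.colon ?J c"
  proof
    show "fst ` Gp \<subseteq> S.colon ?J c" by (force simp: Gp_def S.colon_def)
    show "S.colon ?J c \<subseteq> fst ` Gp" by (force simp: Gp_def S.colon_def)
  qed
  have "P Gp" unfolding Gp_def by (rule colon[OF G(1,3) c(1)])
  then have "trivial_mod N Gp" using prime[OF lin fn] p dom by simp
  then obtain v where v: "v \<in> carrier M" "\<And>r w. (r, w) \<in> Gp \<Longrightarrow> cong_mod N w (r \<bullet> v)"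
    unfolding trivial_mod_def by blast
  note ext = lin_graph_extend[OF G(1) c(1) v(1) N G(2)]
  define G' where "G' = {(r \<oplus> a \<otimes> c, w \<boxplus> a \<bullet> v) |r w a. (r, w) \<in> G \<and> a \<in> carrier R}"
  have tr: "r \<in> carrier R \<Longrightarrow> (r \<otimes> c, w) \<in> G \<Longrightarrow> cong_mod N w (r \<bullet> v)" for r w
    using v(2) by (simp add: Gp_def)
  have G': "lin_graph G'" "functional_mod N G'" "G \<subseteq> G'" "c \<in> fst ` G'"
    unfolding G'_def by (rule ext, erule (1) tr)+
  then have "?J \<subseteq> fst ` G'" by blast
  then have "\<not> bad G'" using max c(2) G'(4) by blast
  then have "trivial_mod N G'" using G' up[OF G(3) G'(3)] by (simp add: bad_def)
  then have "trivial_mod N G" using G'(3) unfolding trivial_mod_def by blast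
  then show False using G(4) by blast
qed

text \<open>Guarantees that a bound on the chains of primes above the domain survives the passage to
  \<open>(J : c)\<close>.\<close>

lemma (in module) lin_graph_colon:
  assumes "lin_graph G" "c \<in> carrier R"
  shows "fst ` G \<subseteq> fst ` {(r, w). r \<in> carrier R \<and> (r \<otimes> c, w) \<in> G}"
proof (rule subsetI, elim imageE, unfold split_paired_all)
  fix q r w assume "q = fst (r, w)" "(r, w) \<in> G"
  moreover from this have "(r \<otimes> c, c \<bullet> w) \<in> G"
    using lin_graphD(1,5)[OF assms(1)] assms(2) R.m_comm by metis
  ultimately show "q \<in> fst ` {(r, w). r \<in> carrier R \<and> (r \<otimes> c, w) \<in> G}"
    using lin_graphD(1)[OF assms(1)] by force
qed

section \<open>Extension of maps from prime ideals, and vanishing by induction on depth\<close>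

context noeth_local_module
begin

text \<open>Iterating the step gives maps \<open>G\<^sub>0 = G\<close> and \<open>G\<^sub>n = v\<^sub>n + x G\<^sub>n\<^sub>+\<^sub>1\<close>. By the ascending chain
  condition \<open>G\<^sub>n\<^sub>+\<^sub>1 = a G\<^sub>n + v\<close> for some \<open>n\<close>, \<open>a\<close> and \<open>v\<close>, and \<open>1 - a x\<close> is a unit.\<close>

lemma trivial_mod_divide:
  assumes N: "msub N" and x: "x \<in> mm"
    and step: "\<And>G. lin_graph G \<Longrightarrow> functional_mod N G \<Longrightarrow> fst ` G = p \<Longrightarrow>
      \<exists>v\<in>carrier M. \<exists>G'. lin_graph G' \<and> functional_mod N G' \<and> fst ` G' = p \<and>
        (\<forall>r w. (r, w) \<in> G \<longrightarrow> (\<exists>w'. (r, w') \<in> G' \<and> cong_mod N w (r \<bullet> v \<boxplus> x \<bullet> w')))"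
    and G: "lin_graph G" "functional_mod N G" "fst ` G = p"
  shows "trivial_mod N G"
proof -
  have xc: "x \<in> carrier R" using x mm_carr by simp
  let ?P = "\<lambda>n H. lin_graph H \<and> functional_mod N H \<and> fst ` H = p \<and> (n = (0::nat) \<longrightarrow> H = G)"
  let ?Q = "\<lambda>_ H H'. \<exists>v\<in>carrier M. \<forall>r w. (r, w) \<in> H \<longrightarrow> (\<exists>w'. (r, w') \<in> H' \<and> cong_mod N w (r \<bullet> v \<boxplus> x \<bullet> w'))"
  have "\<exists>F. \<forall>n. ?P n (F n) \<and> ?Q n (F n) (F (Suc n))"
  proof (rule dependent_nat_choice)
    show "\<exists>H. ?P 0 H" using G by blast
    fix H n assume "?P n H"
    then show "\<exists>H'. ?P (Suc n) H' \<and> ?Q n H H'" using step[of H] by auto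
  qed
  then obtain F where FF: "\<forall>n. ?P n (F n) \<and> ?Q n (F n) (F (Suc n))" ..
  have F: "\<And>n. lin_graph (F n)" "\<And>n. functional_mod N (F n)" "\<And>n. fst ` F n = p" "F 0 = G"
    using FF by simp_all
  have "\<forall>n. ?Q n (F n) (F (Suc n))" using FF by simp
  then obtain V where V: "\<And>n. V n \<in> carrier M"
    and FV: "\<And>n r w. (r, w) \<in> F n \<Longrightarrow> \<exists>w'. (r, w') \<in> F (Suc n) \<and> cong_mod N w (r \<bullet> V n \<boxplus> x \<bullet> w')"
    by metis
  note D = lin_graphD[OF F(1)]
  have p: "ideal p R" using lin_graph_dom_ideal[OF F(1)[of 0]] F(3) by simp
  obtain S where S: "S \<subseteq> carrier R" "finite S" "p = Idl S" using noetherian_ring.finetely_gen[OF noeth p] by blast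
  obtain rs where rs: "set rs = S" using finite_list[OF S(2)] by blast
  have rsp: "rs ! l \<in> p" if "l < length rs" for l
    using R.genideal_self[OF S(1)] that rs S(3) by auto
  have rsc: "rs ! l \<in> carrier R" if "l < length rs" for l using rsp[OF that] R.ideal_carr[OF p] by blast
  let ?s = "length rs"
  \<comment> \<open>A map on \<open>p\<close> is recorded by its values at the generators
    \<open>rs\<close>. Modulo \<open>N\<close>, \<open>rep i f a v\<close> says that these are the
    values of \<open>a G_i + v\<close>, so \<open>H i\<close> is spanned by \<open>G_i\<close> and
    the multiplications.\<close>
  define rep where "rep i f a v \<longleftrightarrow> (\<forall>l. f l \<in> carrier M) \<and> a \<in> carrier R \<and> v \<in> carrier M \<and>
    (\<forall>l<?s. \<forall>w. (rs ! l, w) \<in> F i \<longrightarrow> cong_mod N (f l) (a \<bullet> w \<boxplus> (rs ! l) \<bullet> v))" for i f a v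
  have repD: "f l \<in> carrier M" "a \<in> carrier R" "v \<in> carrier M"
    "l < ?s \<Longrightarrow> (rs ! l, w) \<in> F i \<Longrightarrow> cong_mod N (f l) (a \<bullet> w \<boxplus> (rs ! l) \<bullet> v)" if "rep i f a v" for i f a v l w
    using that by (simp_all add: rep_def)
  define H where "H i = {f. \<exists>a v. rep i f a v}" for i
  have HI: "f \<in> H i" if "rep i f a v" for f i a v using that by (auto simp: H_def)
  have "\<exists>n. \<forall>f\<in>H (Suc n). \<exists>g\<in>H n. \<forall>l<?s. cong_mod N (f l) (g l)"
  proof (rule acc_functions[OF acc_M N])
    fix i f l assume "f \<in> H i" then show "f l \<in> carrier M" by (auto simp: H_def rep_def)
  next
    fix i
    have "cong_mod N \<zero>\<^bsub>M\<^esub> (\<zero> \<bullet> w \<boxplus> (rs ! l) \<bullet> \<zero>\<^bsub>M\<^esub>)" if "l < ?s" "(rs ! l, w) \<in> F i" for l w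
      using D(2)[OF that(2)] rsc[OF that(1)] cong_refl[OF N, of "\<zero>\<^bsub>M\<^esub>"] by simp
    then have "rep i (\<lambda>l. \<zero>\<^bsub>M\<^esub>) \<zero> \<zero>\<^bsub>M\<^esub>" by (simp add: rep_def)
    then show "(\<lambda>l. \<zero>\<^bsub>M\<^esub>) \<in> H i" by (rule HI)
  next
    fix i f g assume "f \<in> H i" "g \<in> H i"
    then obtain a v b u where "rep i f a v" "rep i g b u" by (auto simp: H_def)
    note f = repD[OF this(1)] and g = repD[OF this(2)]
    have "cong_mod N (f l \<boxplus> g l) ((a \<oplus> b) \<bullet> w \<boxplus> (rs ! l) \<bullet> (v \<boxplus> u))" if l: "l < ?s" and w: "(rs ! l, w) \<in> F i" for l w
    proof -
      have "cong_mod N (f l \<boxplus> g l) ((a \<bullet> w \<boxplus> (rs ! l) \<bullet> v) \<boxplus> (b \<bullet> w \<boxplus> (rs ! l) \<bullet> u))"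
        using l w by (intro cong_add N f g)
      moreover have "(a \<bullet> w \<boxplus> (rs ! l) \<bullet> v) \<boxplus> (b \<bullet> w \<boxplus> (rs ! l) \<bullet> u) = (a \<oplus> b) \<bullet> w \<boxplus> (rs ! l) \<bullet> (v \<boxplus> u)"
        using f(2,3) g(2,3) D(1,2)[OF w] by algebra
      ultimately show ?thesis by simp
    qed
    then have "rep i (\<lambda>l. f l \<boxplus> g l) (a \<oplus> b) (v \<boxplus> u)" unfolding rep_def using f(1-3) g(1-3) by simp
    then show "(\<lambda>l. f l \<boxplus> g l) \<in> H i" by (rule HI)
  next
    fix i c f assume c: "c \<in> carrier R" and "f \<in> H i"
    then obtain a v where "rep i f a v" by (auto simp: H_def)
    note f = repD[OF this]
    have "cong_mod N (c \<bullet> f l) ((c \<otimes> a) \<bullet> w \<boxplus> (rs ! l) \<bullet> (c \<bullet> v))" if l: "l < ?s" and w: "(rs ! l, w) \<in> F i" for l w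
    proof -
      have "cong_mod N (c \<bullet> f l) (c \<bullet> (a \<bullet> w \<boxplus> (rs ! l) \<bullet> v))" by (rule cong_smult[OF N c f(4)[OF l w]])
      moreover have "c \<bullet> (a \<bullet> w \<boxplus> (rs ! l) \<bullet> v) = (c \<otimes> a) \<bullet> w \<boxplus> (rs ! l) \<bullet> (c \<bullet> v)"
        using f(2,3) c D(1,2)[OF w] by algebra
      ultimately show ?thesis by simp
    qed
    then have "rep i (\<lambda>l. c \<bullet> f l) (c \<otimes> a) (c \<bullet> v)" unfolding rep_def using f(1-3) c by simp
    then show "(\<lambda>l. c \<bullet> f l) \<in> H i" by (rule HI)
  next
    \<comment> \<open>Substituting \<open>G_i = V_i + x G_{i+1}\<close> turns
      \<open>a G_i + v\<close> into \<open>a x G_{i+1} + (v + a V_i)\<close>.\<close>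
    fix i show "H i \<subseteq> H (Suc i)"
    proof
      fix f assume "f \<in> H i"
      then obtain a v where "rep i f a v" by (auto simp: H_def)
    note f = repD[OF this]
      have "cong_mod N (f l) ((a \<otimes> x) \<bullet> w' \<boxplus> (rs ! l) \<bullet> (v \<boxplus> a \<bullet> V i))"
        if l: "l < ?s" and w': "(rs ! l, w') \<in> F (Suc i)" for l w'
      proof -
        obtain w where w: "(rs ! l, w) \<in> F i" using rsp[OF l] F(3)[of i] by force
        obtain w1 where w1: "(rs ! l, w1) \<in> F (Suc i)" "cong_mod N w (rs ! l \<bullet> V i \<boxplus> x \<bullet> w1)" using FV[OF w] by blast
        have c: "w \<in> carrier M" "w' \<in> carrier M" "w1 \<in> carrier M" "rs ! l \<in> carrier R" "V i \<in> carrier M"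
          using D(1,2)[OF w] D(2)[OF w'] D(2)[OF w1(1)] V by auto
        have "cong_mod N w1 w'" by (rule functional_modD[OF F(1,2) w1(1) w'])
        then have "cong_mod N (rs ! l \<bullet> V i \<boxplus> x \<bullet> w1) (rs ! l \<bullet> V i \<boxplus> x \<bullet> w')"
          using c xc by (intro cong_add cong_smult cong_refl N) auto
        then have "cong_mod N w (rs ! l \<bullet> V i \<boxplus> x \<bullet> w')" using cong_trans[OF N w1(2)] by blast
        then have "cong_mod N (a \<bullet> w \<boxplus> (rs ! l) \<bullet> v) (a \<bullet> (rs ! l \<bullet> V i \<boxplus> x \<bullet> w') \<boxplus> (rs ! l) \<bullet> v)"
          using c f(2,3) by (intro cong_add cong_smult cong_refl N) auto
        then have "cong_mod N (f l) (a \<bullet> (rs ! l \<bullet> V i \<boxplus> x \<bullet> w') \<boxplus> (rs ! l) \<bullet> v)"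
          using cong_trans[OF N f(4)[OF l w]] by blast
        moreover have "a \<bullet> (rs ! l \<bullet> V i \<boxplus> x \<bullet> w') \<boxplus> (rs ! l) \<bullet> v = (a \<otimes> x) \<bullet> w' \<boxplus> (rs ! l) \<bullet> (v \<boxplus> a \<bullet> V i)"
          using c f(2,3) xc by algebra
        ultimately show ?thesis by simp
      qed
      then have "rep (Suc i) f (a \<otimes> x) (v \<boxplus> a \<bullet> V i)" unfolding rep_def using f(1-3) xc V[of i] by simp
      then show "f \<in> H (Suc i)" by (rule HI)
    qed
  qed
  then obtain n where n: "\<And>f. f \<in> H (Suc n) \<Longrightarrow> \<exists>g\<in>H n. \<forall>l<?s. cong_mod N (f l) (g l)" by blast
  \<comment> \<open>The values of \<open>G_{n+1}\<close> itself, which lie in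
    \<open>H (n + 1)\<close> with \<open>a = 1\<close> and \<open>v = 0\<close>. By the choice of
    \<open>n\<close> they are congruent to those of some \<open>a G_n + v\<close>.\<close>
  define f where "f l = (if l < ?s then SOME w. (rs ! l, w) \<in> F (Suc n) else \<zero>\<^bsub>M\<^esub>)" for l
  have fF: "(rs ! l, f l) \<in> F (Suc n)" if "l < ?s" for l
  proof -
    have "\<exists>w. (rs ! l, w) \<in> F (Suc n)" using rsp[OF that] F(3)[of "Suc n"] by force
    then have "(rs ! l, SOME w. (rs ! l, w) \<in> F (Suc n)) \<in> F (Suc n)" by (rule someI_ex)
    then show ?thesis unfolding f_def using that by simp
  qed
  have fc: "f l \<in> carrier M" for l
  proof (cases "l < ?s")
    case True then show ?thesis using D(2)[OF fF] by blast
  qed (simp add: f_def)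
  have "cong_mod N (f l) (\<one> \<bullet> w \<boxplus> (rs ! l) \<bullet> \<zero>\<^bsub>M\<^esub>)" if "l < ?s" "(rs ! l, w) \<in> F (Suc n)" for l w
    using functional_modD[OF F(1,2) fF[OF that(1)] that(2)] D(2)[OF that(2)] rsc[OF that(1)] by simp
  then have "rep (Suc n) f \<one> \<zero>\<^bsub>M\<^esub>" unfolding rep_def using fc by simp
  then have "f \<in> H (Suc n)" by (rule HI)
  then obtain g where "g \<in> H n" and fg: "\<And>l. l < ?s \<Longrightarrow> cong_mod N (f l) (g l)" using n by blast
  then obtain a v where "rep n g a v" by (auto simp: H_def)
    note g = repD[OF this]
  \<comment> \<open>From \<open>G_{n+1} = a G_n + v\<close> and \<open>G_n = V_n + x G_{n+1}\<close>
    follows \<open>(1 - a x) G_{n+1} = a V_n + v\<close>, which determines the multiplier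
    \<open>v'\<close>.\<close>
  define u where "u = \<one> \<ominus> a \<otimes> x"
  have u: "u \<in> Units R" unfolding u_def by (rule one_minus_unit[OF x g(2)])
  define v' where "v' = inv u \<bullet> (a \<bullet> V n \<boxplus> v)"
  have v': "v' \<in> carrier M" unfolding v'_def using u g V by auto
  have "cong_mod N (f l) ((rs ! l) \<bullet> v')" if l: "l < ?s" for l
  proof -
    obtain w where w: "(rs ! l, w) \<in> F n" using rsp[OF l] F(3)[of n] by force
    obtain w1 where w1: "(rs ! l, w1) \<in> F (Suc n)" "cong_mod N w (rs ! l \<bullet> V n \<boxplus> x \<bullet> w1)" using FV[OF w] by blast
    have c: "w \<in> carrier M" "f l \<in> carrier M" "w1 \<in> carrier M" "rs ! l \<in> carrier R" "V n \<in> carrier M"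
      using D(1,2)[OF w] D(2)[OF w1(1)] V fc by auto
    have "cong_mod N w1 (f l)" by (rule functional_modD[OF F(1,2) w1(1) fF[OF l]])
    then have "cong_mod N (rs ! l \<bullet> V n \<boxplus> x \<bullet> w1) (rs ! l \<bullet> V n \<boxplus> x \<bullet> f l)"
      using c xc by (intro cong_add cong_smult cong_refl N) auto
    then have "cong_mod N w (rs ! l \<bullet> V n \<boxplus> x \<bullet> f l)" using cong_trans[OF N w1(2)] by blast
    then have "cong_mod N (a \<bullet> w \<boxplus> (rs ! l) \<bullet> v) (a \<bullet> (rs ! l \<bullet> V n \<boxplus> x \<bullet> f l) \<boxplus> (rs ! l) \<bullet> v)"
      using c g(2,3) by (intro cong_add cong_smult cong_refl N) auto
    then have "cong_mod N (f l) (a \<bullet> (rs ! l \<bullet> V n \<boxplus> x \<bullet> f l) \<boxplus> (rs ! l) \<bullet> v)"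
      using cong_trans[OF N cong_trans[OF N fg[OF l] g(4)[OF l w]]] by blast
    then have "cong_mod N (f l \<boxminus> (a \<otimes> x) \<bullet> f l)
        ((a \<bullet> (rs ! l \<bullet> V n \<boxplus> x \<bullet> f l) \<boxplus> (rs ! l) \<bullet> v) \<boxminus> (a \<otimes> x) \<bullet> f l)"
      using c g(2) xc by (intro cong_diff cong_refl N) auto
    moreover have "(a \<bullet> (rs ! l \<bullet> V n \<boxplus> x \<bullet> f l) \<boxplus> (rs ! l) \<bullet> v) \<boxminus> (a \<otimes> x) \<bullet> f l = (rs ! l) \<bullet> (a \<bullet> V n \<boxplus> v)"
      using c g(2,3) xc by algebra
    moreover have "f l \<boxminus> (a \<otimes> x) \<bullet> f l = u \<bullet> f l" unfolding u_def using c g(2) xc by algebra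
    ultimately have "cong_mod N (u \<bullet> f l) ((rs ! l) \<bullet> (a \<bullet> V n \<boxplus> v))" by simp
    then have "cong_mod N (inv u \<bullet> (u \<bullet> f l)) (inv u \<bullet> ((rs ! l) \<bullet> (a \<bullet> V n \<boxplus> v)))"
      using u by (intro cong_smult N) auto
    moreover have "inv u \<bullet> (u \<bullet> f l) = f l" using u c by (simp add: smult_assoc1[symmetric] R.Units_l_inv R.Units_closed)
    moreover have "inv u \<bullet> ((rs ! l) \<bullet> (a \<bullet> V n \<boxplus> v)) = (rs ! l) \<bullet> v'"
      unfolding v'_def using u c g(2,3) by (simp add: smult_assoc1[symmetric] R.m_comm)
    ultimately show ?thesis by simp
  qed
  note fv = this
  have tn: "trivial_mod N (F (Suc n))"
  proof (rule trivial_modI[OF v'])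
    \<comment> \<open>So far the congruence is known at the generators; the elements at which it
      holds form an ideal.\<close>
    define K where "K = {r \<in> p. \<forall>w. (r, w) \<in> F (Suc n) \<longrightarrow> cong_mod N w (r \<bullet> v')}"
    have "ideal K R"
    proof (rule R.idealI')
      show "K \<subseteq> carrier R" using R.ideal_carr[OF p] by (auto simp: K_def)
      show "\<zero> \<in> K" using R.ideal_zero[OF p] F(2)[of "Suc n"] v' cong_zero_iff[OF N]
        by (auto simp: K_def functional_mod_def)
    next
      fix r s assume rs: "r \<in> K" "s \<in> K"
      obtain w1 w2 where w: "(r, w1) \<in> F (Suc n)" "(s, w2) \<in> F (Suc n)" using rs F(3)[of "Suc n"] by (force simp: K_def)
      have c: "r \<in> carrier R" "s \<in> carrier R" using D(1) w by auto
      have "cong_mod N (w1 \<boxplus> w2) (r \<bullet> v' \<boxplus> s \<bullet> v')" using rs w by (intro cong_add N) (auto simp: K_def)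
      then have *: "cong_mod N (w1 \<boxplus> w2) ((r \<oplus> s) \<bullet> v')" using c v' by (simp add: smult_l_distr)
      have "cong_mod N w ((r \<oplus> s) \<bullet> v')" if "(r \<oplus> s, w) \<in> F (Suc n)" for w
        by (rule cong_trans[OF N functional_modD[OF F(1,2) that D(4)[OF w]] *])
      then show "r \<oplus> s \<in> K" using rs R.ideal_add[OF p] by (auto simp: K_def)
    next
      fix b r assume b: "b \<in> carrier R" and r: "r \<in> K"
      obtain w1 where w: "(r, w1) \<in> F (Suc n)" using r F(3)[of "Suc n"] by (force simp: K_def)
      have c: "r \<in> carrier R" using D(1) w by auto
      have "cong_mod N (b \<bullet> w1) (b \<bullet> r \<bullet> v')" using r w b by (intro cong_smult N) (auto simp: K_def)
      then have *: "cong_mod N (b \<bullet> w1) ((b \<otimes> r) \<bullet> v')" using c b v' by (simp add: smult_assoc1)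
      have "cong_mod N w ((b \<otimes> r) \<bullet> v')" if "(b \<otimes> r, w) \<in> F (Suc n)" for w
        by (rule cong_trans[OF N functional_modD[OF F(1,2) that D(5)[OF b w]] *])
      then show "b \<otimes> r \<in> K" using r b ideal.I_l_closed[OF p] by (auto simp: K_def)
    qed
    moreover have "S \<subseteq> K"
    proof
      fix r assume "r \<in> S"
      then obtain l where l: "l < ?s" "r = rs ! l" using rs by (metis in_set_conv_nth)
      then show "r \<in> K" unfolding K_def
        using rsp[OF l(1)] cong_trans[OF N functional_modD[OF F(1,2) _ fF[OF l(1)]] fv[OF l(1)]] by auto
    qed
    ultimately have "p \<subseteq> K" using S(3) R.genideal_minimal by blast
    then show "cong_mod N w (r \<bullet> v')" if "(r, w) \<in> F (Suc n)" for r w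
      using that F(3)[of "Suc n"] by (force simp: K_def)
  qed
  \<comment> \<open>If \<open>G_{i+1}\<close> is the multiplication by \<open>y\<close>, then
    \<open>G_i\<close> is that by \<open>V_i + x y\<close>. This leads back to
    \<open>G\<close>.\<close>
  have down: "trivial_mod N (F i)" if t: "trivial_mod N (F (Suc i))" for i
  proof -
    obtain y where y: "y \<in> carrier M" "\<And>r w. (r, w) \<in> F (Suc i) \<Longrightarrow> cong_mod N w (r \<bullet> y)"
      using t unfolding trivial_mod_def by blast
    show ?thesis
    proof (rule trivial_modI)
      show "V i \<boxplus> x \<bullet> y \<in> carrier M" using y V xc by simp
      fix r w assume rw: "(r, w) \<in> F i"
      obtain w1 where w1: "(r, w1) \<in> F (Suc i)" "cong_mod N w (r \<bullet> V i \<boxplus> x \<bullet> w1)" using FV[OF rw] by blast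
      have c: "r \<in> carrier R" "V i \<in> carrier M" using D(1)[OF rw] V by auto
      have "cong_mod N (r \<bullet> V i \<boxplus> x \<bullet> w1) (r \<bullet> V i \<boxplus> x \<bullet> r \<bullet> y)"
        using c xc y(2)[OF w1(1)] by (intro cong_add cong_smult cong_refl N) auto
      then have "cong_mod N w (r \<bullet> V i \<boxplus> x \<bullet> r \<bullet> y)" using cong_trans[OF N w1(2)] by blast
      moreover have "r \<bullet> V i \<boxplus> x \<bullet> r \<bullet> y = r \<bullet> (V i \<boxplus> x \<bullet> y)" using c xc y(1) by algebra
      ultimately show "cong_mod N w (r \<bullet> (V i \<boxplus> x \<bullet> y))" by simp
    qed
  qed
  have "trivial_mod N (F (Suc n - i))" if "i \<le> Suc n" for i
    using that
  proof (induction i)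
    case (Suc i)
    then have "Suc n - i = Suc (Suc n - Suc i)" by simp
    then show ?case using down[of "Suc n - Suc i"] Suc by simp
  qed (use tn in simp)
  from this[of "Suc n"] show ?thesis using F(4) by simp
qed

text \<open>Devissage with the property \<open>dim R / J < t\<close>: larger domains and the ideals
  \<open>(J : c)\<close> have only fewer primes above them.\<close>

lemma trivial_mod_induct_chain [consumes 4, case_names prime]:
  assumes G0: "msub N" "lin_graph G0" "functional_mod N G0" "\<not> prime_chain R (fst ` G0) t"
    and prime: "\<And>G. lin_graph G \<Longrightarrow> functional_mod N G \<Longrightarrow> \<not> prime_chain R (fst ` G) t \<Longrightarrow>
      primeideal (fst ` G) R \<Longrightarrow> trivial_mod N G"
  shows "trivial_mod N G0"
proof (rule trivial_mod_devissage[where P = "\<lambda>G. \<not> prime_chain R (fst ` G) t", OF acc G0(1) _ _ prime G0(2,3,4)])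
  show "\<not> prime_chain R (fst ` G') t" if "\<not> prime_chain R (fst ` G) t" "G \<subseteq> G'" for G G' :: "('a \<times> 'c) set"
    using R.prime_chain_mono[OF _ image_mono[OF that(2), of fst]] that(1) by blast
  show "\<not> prime_chain R (fst ` {(r, w). r \<in> carrier R \<and> (r \<otimes> c, w) \<in> G}) t"
    if "lin_graph G" "\<not> prime_chain R (fst ` G) t" "c \<in> carrier R" for G c
    using R.prime_chain_mono[OF _ lin_graph_colon[OF that(1,3)]] that(2) by blast
qed

text \<open>This is the vanishing of \<open>Ext\<^sup>1(R / J, M / N)\<close> when \<open>dim R / J < depth (M / N) - 1\<close>.\<close>

lemma trivial_mod_of_regular:
  assumes "msub N" "rel_regular N (x # xs)" "lin_graph G" "functional_mod N G"
    "\<not> prime_chain R (fst ` G) (length xs)"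
  shows "trivial_mod N G"
  using assms
proof (induction xs arbitrary: N x G)
  case Nil
  \<comment> \<open>Here the hypothesis says that no prime contains the domain, so the prime case is
    void.\<close>
  show ?case
    by (rule trivial_mod_induct_chain[OF Nil(1,3,4), of 0]) (use Nil(5) R.prime_chain_prime in auto)
next
  case (Cons y ys)
  note N = Cons.prems(1)
  have x: "x \<in> mm" "x \<in> carrier R" "\<And>v. v \<in> carrier M \<Longrightarrow> x \<bullet> v \<in> N \<Longrightarrow> v \<in> N"
    and reg: "rel_regular (plus_mult N x) (y # ys)" using Cons.prems(2) mm_carr by auto
  let ?Nx = "plus_mult N x"
  have Nx: "msub ?Nx" using plus_mult_sub[OF N x(2)] .
  have NNx: "N \<subseteq> ?Nx" using plus_mult_superset[OF N x(2)] .
  let ?t = "length (y # ys)"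
  show ?case
  proof (rule trivial_mod_induct_chain[OF N Cons.prems(3,4,5)])
    fix G assume G: "lin_graph G" "functional_mod N G" "\<not> prime_chain R (fst ` G) ?t" "primeideal (fst ` G) R"
    define p where "p = fst ` G"
    have nc: "\<not> prime_chain R p ?t" and p: "primeideal p R" using G by (auto simp: p_def)
    note D = lin_graphD[OF G(1)]
    show "trivial_mod N G"
    proof (cases "x \<in> p")
      \<comment> \<open>The map is determined by its value \<open>w0\<close> at \<open>x\<close>,
        because \<open>x w = r w0\<close> and \<open>x\<close> is regular. As \<open>p\<close> kills
        \<open>w0\<close> modulo \<open>N + x M\<close>, a nonzero class there would give a chain of
        length \<open>t\<close> above \<open>p\<close>. So \<open>w0\<close> is divisible by
        \<open>x\<close> modulo \<open>N\<close>, and the quotient is the multiplier.\<close>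
      case True
      then obtain w0 where w0: "(x, w0) \<in> G" by (force simp: p_def)
      have key: "cong_mod N (x \<bullet> w) (r \<bullet> w0)" if "(r, w) \<in> G" for r w
      proof -
        have "(x \<otimes> r, x \<bullet> w) \<in> G" "(r \<otimes> x, r \<bullet> w0) \<in> G" using D(5)[OF x(2) that] D(5)[OF D(1)[OF that] w0] .
        then show ?thesis using functional_modD[OF G(1,2)] R.m_comm[OF x(2) D(1)[OF that]] by simp
      qed
      have "w0 \<in> ?Nx"
      proof (rule ccontr)
        assume "w0 \<notin> ?Nx"
        have "prime_chain R p ?t"
        proof (rule prime_chain_of_annihilator[OF Nx reg D(2)[OF w0] \<open>w0 \<notin> ?Nx\<close>])
          fix r assume "r \<in> p"
          then obtain w where rw: "(r, w) \<in> G" by (force simp: p_def)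
          have "cong_mod N (r \<bullet> w0) (x \<bullet> w)" using cong_sym[OF N key[OF rw]] .
          then have "cong_mod ?Nx (r \<bullet> w0) (x \<bullet> w)" using NNx by (auto simp: cong_mod_def)
          then show "r \<in> carrier R \<and> r \<bullet> w0 \<in> ?Nx"
            using cong_mem[OF Nx] plus_mult_mem[OF N x(2) D(2)[OF rw]] D(1)[OF rw] by blast
        qed
        then show False using nc by blast
      qed
      then obtain n v where nv: "w0 = n \<boxplus> x \<bullet> v" "n \<in> N" "v \<in> carrier M" by (auto simp: plus_mult_def)
      have nc': "n \<in> carrier M" using N nv by auto
      show ?thesis
      proof (rule trivial_modI[OF nv(3)])
        fix r w assume rw: "(r, w) \<in> G"
        have c: "r \<in> carrier R" "w \<in> carrier M" using D(1,2)[OF rw] .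
        have "x \<bullet> w \<boxminus> r \<bullet> w0 \<in> N" using key[OF rw] by (simp add: cong_mod_def)
        moreover have "r \<bullet> n \<in> N" using c nv N by auto
        ultimately have "(x \<bullet> w \<boxminus> r \<bullet> w0) \<boxplus> r \<bullet> n \<in> N" using N by auto
        moreover have "(x \<bullet> w \<boxminus> r \<bullet> w0) \<boxplus> r \<bullet> n = x \<bullet> (w \<boxminus> r \<bullet> v)"
          unfolding nv(1) using c nv(3) nc' x(2) by algebra
        ultimately show "cong_mod N w (r \<bullet> v)" using x(3) c nv(3) by (simp add: cong_mod_def)
      qed
    next
      case False
      show ?thesis
      proof (rule trivial_mod_divide[OF N x(1) _ G(1,2) p_def[symmetric]])
        fix G assume G: "lin_graph G" "functional_mod N G" "fst ` G = p"
        note D = lin_graphD[OF G(1)]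
        have fnx: "functional_mod ?Nx G" using G(2) NNx by (auto simp: functional_mod_def)
        \<comment> \<open>Modulo \<open>N + x M\<close> the map is extended to
          \<open>p + R x\<close> by sending \<open>x\<close> to 0. This is consistent because
          \<open>r x\<close> in \<open>p\<close> forces \<open>r\<close> in \<open>p\<close>. The
          chains of primes above the larger ideal are shorter by one, so the induction hypothesis
          applies.\<close>
        define G' where "G' = {(r \<oplus> a \<otimes> x, w \<boxplus> a \<bullet> \<zero>\<^bsub>M\<^esub>) |r w a. (r, w) \<in> G \<and> a \<in> carrier R}"
        have tr: "cong_mod ?Nx w (r \<bullet> \<zero>\<^bsub>M\<^esub>)" if r: "r \<in> carrier R" and rw: "(r \<otimes> x, w) \<in> G" for r w
        proof -
          have "r \<otimes> x \<in> p" using rw G(3) by force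
          then have "r \<in> p" using R.primeideal_props(4)[OF p r x(2)] False by blast
          then obtain w1 where w1: "(r, w1) \<in> G" using G(3) by force
          have "(r \<otimes> x, x \<bullet> w1) \<in> G" using D(5)[OF x(2) w1] R.m_comm[OF r x(2)] by simp
          then have "cong_mod N w (x \<bullet> w1)" by (rule functional_modD[OF G(1,2) rw])
          then have "cong_mod ?Nx w (x \<bullet> w1)" using NNx by (auto simp: cong_mod_def)
          then have "w \<in> ?Nx" using cong_mem[OF Nx] plus_mult_mem[OF N x(2) D(2)[OF w1]] by blast
          then show ?thesis using r by (simp add: cong_zero_iff[OF Nx])
        qed
        note ext = lin_graph_extend[OF G(1) x(2) M.zero_closed Nx fnx]
        have G': "lin_graph G'" "functional_mod ?Nx G'" "G \<subseteq> G'" "x \<in> fst ` G'"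
          unfolding G'_def by (rule ext, erule (1) tr)+
        have "p \<subset> fst ` G'" using G' G(3) False by blast
        then have "\<not> prime_chain R (fst ` G') (length ys)"
          using R.prime_chain_Suc[OF p order_refl] nc by auto
        then have "trivial_mod ?Nx G'" using Cons.IH[OF Nx reg G'(1,2)] by blast
        then obtain v where v: "v \<in> carrier M" "\<And>r w. (r, w) \<in> G \<Longrightarrow> cong_mod ?Nx w (r \<bullet> v)"
          using G'(3) unfolding trivial_mod_def by blast
        \<comment> \<open>The quotient \<open>(G - v) / x\<close>, a map of the same kind on the
          same \<open>p\<close>; this is the step that \<open>trivial_mod_divide\<close>
          iterates.\<close>
        define G1 where "G1 = {(r, w'). w' \<in> carrier M \<and> (\<exists>w. (r, w) \<in> G \<and> cong_mod N w (r \<bullet> v \<boxplus> x \<bullet> w'))}"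
        have ex: "\<exists>w'. (r, w') \<in> G1 \<and> cong_mod N w (r \<bullet> v \<boxplus> x \<bullet> w')" if rw: "(r, w) \<in> G" for r w
        proof -
          have c: "r \<in> carrier R" "w \<in> carrier M" using D(1,2)[OF rw] .
          have "w \<boxminus> r \<bullet> v \<in> ?Nx" using v(2)[OF rw] by (simp add: cong_mod_def)
          then obtain n w' where nw: "w \<boxminus> r \<bullet> v = n \<boxplus> x \<bullet> w'" "n \<in> N" "w' \<in> carrier M" by (auto simp: plus_mult_def)
          have nc': "n \<in> carrier M" using nw N by auto
          have "w \<boxminus> (r \<bullet> v \<boxplus> x \<bullet> w') = (w \<boxminus> r \<bullet> v) \<boxminus> x \<bullet> w'" using c v(1) nw(3) x(2) by algebra
          also have "\<dots> = n" unfolding nw(1) using nw(3) nc' x(2) by algebra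
          finally have "cong_mod N w (r \<bullet> v \<boxplus> x \<bullet> w')" using nw c v(1) x(2) by (simp add: cong_mod_def)
          then show ?thesis using rw nw(3) unfolding G1_def by blast
        qed
        have lin1: "lin_graph G1" unfolding lin_graph_def
        proof (intro conjI allI impI)
          show "G1 \<subseteq> carrier R \<times> carrier M" using D(1) by (auto simp: G1_def)
          have "cong_mod N \<zero>\<^bsub>M\<^esub> (\<zero> \<bullet> v \<boxplus> x \<bullet> \<zero>\<^bsub>M\<^esub>)" using v(1) x(2) cong_refl[OF N, of "\<zero>\<^bsub>M\<^esub>"] by simp
          then show "(\<zero>, \<zero>\<^bsub>M\<^esub>) \<in> G1" using D(3) by (auto simp: G1_def)
        next
          fix r w r' w' assume "(r, w) \<in> G1" "(r', w') \<in> G1"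
          then obtain s s' where 1: "w \<in> carrier M" "(r, s) \<in> G" "cong_mod N s (r \<bullet> v \<boxplus> x \<bullet> w)"
            and 2: "w' \<in> carrier M" "(r', s') \<in> G" "cong_mod N s' (r' \<bullet> v \<boxplus> x \<bullet> w')" by (auto simp: G1_def)
          have c: "r \<in> carrier R" "r' \<in> carrier R" using D(1) 1(2) 2(2) by auto
          have "cong_mod N (s \<boxplus> s') ((r \<bullet> v \<boxplus> x \<bullet> w) \<boxplus> (r' \<bullet> v \<boxplus> x \<bullet> w'))" by (rule cong_add[OF N 1(3) 2(3)])
          moreover have "(r \<bullet> v \<boxplus> x \<bullet> w) \<boxplus> (r' \<bullet> v \<boxplus> x \<bullet> w') = (r \<oplus> r') \<bullet> v \<boxplus> x \<bullet> (w \<boxplus> w')"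
            using c v(1) 1(1) 2(1) x(2) by algebra
          ultimately have "cong_mod N (s \<boxplus> s') ((r \<oplus> r') \<bullet> v \<boxplus> x \<bullet> (w \<boxplus> w'))" by simp
          then show "(r \<oplus> r', w \<boxplus> w') \<in> G1" using D(4)[OF 1(2) 2(2)] 1(1) 2(1) by (auto simp: G1_def)
        next
          fix a r w assume a: "a \<in> carrier R" and "(r, w) \<in> G1"
          then obtain s where 1: "w \<in> carrier M" "(r, s) \<in> G" "cong_mod N s (r \<bullet> v \<boxplus> x \<bullet> w)" by (auto simp: G1_def)
          have c: "r \<in> carrier R" using D(1) 1(2) by auto
          have "cong_mod N (a \<bullet> s) (a \<bullet> (r \<bullet> v \<boxplus> x \<bullet> w))" by (rule cong_smult[OF N a 1(3)])
          moreover have "a \<bullet> (r \<bullet> v \<boxplus> x \<bullet> w) = (a \<otimes> r) \<bullet> v \<boxplus> x \<bullet> (a \<bullet> w)" using c v(1) 1(1) x(2) a by algebra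
          ultimately have "cong_mod N (a \<bullet> s) ((a \<otimes> r) \<bullet> v \<boxplus> x \<bullet> (a \<bullet> w))" by simp
          then show "(a \<otimes> r, a \<bullet> w) \<in> G1" using D(5)[OF a 1(2)] 1(1) a by (auto simp: G1_def)
        qed
        have fn1: "functional_mod N G1" unfolding functional_mod_def
        proof (intro allI impI)
          fix w assume "(\<zero>, w) \<in> G1"
          then obtain s where 1: "w \<in> carrier M" "(\<zero>, s) \<in> G" "cong_mod N s (\<zero> \<bullet> v \<boxplus> x \<bullet> w)" by (auto simp: G1_def)
          then have "s \<in> N" "cong_mod N s (x \<bullet> w)" using G(2) v(1) x(2) by (auto simp: functional_mod_def)
          then have "x \<bullet> w \<in> N" using cong_mem[OF N cong_sym[OF N]] by blast
          then show "w \<in> N" using x(3) 1 by blast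
        qed
        have "fst ` G1 = p"
        proof
          show "fst ` G1 \<subseteq> p" using G(3) by (force simp: G1_def)
          show "p \<subseteq> fst ` G1" using G(3) ex by force
        qed
        then show "\<exists>v\<in>carrier M. \<exists>G'. lin_graph G' \<and> functional_mod N G' \<and> fst ` G' = p \<and>
          (\<forall>r w. (r, w) \<in> G \<longrightarrow> (\<exists>w'. (r, w') \<in> G' \<and> cong_mod N w (r \<bullet> v \<boxplus> x \<bullet> w')))"
          using lin1 fn1 ex v(1) by blast
      qed
    qed
  qed
qed

end

text \<open>A proper ideal containing a given non-unit is enlarged by the chain condition to a
  maximal ideal, which uniqueness identifies with \<open>max_ideal R\<close>.\<close>

lemma local_ring_noeth_local:
  fixes R (structure)
  assumes l: "local_ring R" and n: "noetherian_ring R"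
  shows "noeth_local R (max_ideal R)"
proof -
  interpret cring R using l by (simp add: local_ring_def)
  have ex: "\<exists>!m. maximalideal m R" using l by (simp add: local_ring_def)
  have m: "maximalideal (max_ideal R) R" unfolding max_ideal_def by (rule theI'[OF ex])
  have uniq: "m' = max_ideal R" if "maximalideal m' R" for m' using ex m that by blast
  note acc = acc_ideals[OF n]
  show ?thesis
  proof (intro noeth_local.intro noeth_local_axioms.intro)
    show "cring R" by (rule is_cring)
    show "noetherian_ring R" by (rule n)
    show i: "ideal (max_ideal R) R" using m by (simp add: maximalideal.axioms)
    show "\<one> \<notin> max_ideal R" using ideal_one[OF i] maximalideal.I_notcarr[OF m] by auto
    fix a assume a: "a \<in> carrier R" "a \<notin> max_ideal R"
    show "a \<in> Units R"
    proof (rule ccontr)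
      assume nu: "a \<notin> Units R"
      let ?P = "\<lambda>I. ideal I R \<and> I \<noteq> carrier R \<and> a \<in> I"
      have "PIdl a \<noteq> carrier R"
      proof
        assume "PIdl a = carrier R"
        then have "\<one> \<in> PIdl a" by simp
        then obtain b where "b \<in> carrier R" "\<one> = b \<otimes> a" by (auto simp: cgenideal_def)
        then have "a \<in> Units R" using a m_comm unfolding Units_def by auto
        then show False using nu by blast
      qed
      then have "?P (PIdl a)" using a cgenideal_ideal cgenideal_self by blast
      then have "\<exists>I. ?P I \<and> (\<forall>J. ?P J \<longrightarrow> I \<subseteq> J \<longrightarrow> J = I)"
        by (rule acc_on_maximal_image[OF acc, of ?P _ "\<lambda>I. I"]) auto
      then obtain I where I: "?P I" and max: "\<And>J. ?P J \<Longrightarrow> I \<subseteq> J \<Longrightarrow> J = I" by blast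
      have "maximalideal I R"
      proof (rule maximalidealI)
        show "ideal I R" "carrier R \<noteq> I" using I by auto
        fix J assume "ideal J R" "I \<subseteq> J" "J \<subseteq> carrier R"
        then show "J = I \<or> J = carrier R" using max I by blast
      qed
      then show False using uniq I a by blast
    qed
  qed
qed

section \<open>Localization at a prime ideal\<close>

context cring
begin

context
  fixes p
  assumes p: "primeideal p R"
begin

abbreviation (input) "frc \<equiv> fraction R (carrier R - p)"
abbreviation (input) "Rp \<equiv> localization R (carrier R - p)"

lemma compl_prime:
  shows "\<one> \<in> carrier R - p" "\<And>s t. s \<in> carrier R - p \<Longrightarrow> t \<in> carrier R - p \<Longrightarrow> s \<otimes> t \<in> carrier R - p"
proof -
  show "\<one> \<in> carrier R - p" using primeideal_props[OF p] by auto
  show "\<And>s t. s \<in> carrier R - p \<Longrightarrow> t \<in> carrier R - p \<Longrightarrow> s \<otimes> t \<in> carrier R - p"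
    using primeideal_props(4)[OF p] by auto
qed

lemma frac_mem:
  "(b, t) \<in> frc a s \<longleftrightarrow> b \<in> carrier R \<and> t \<in> carrier R - p \<and> (\<exists>u\<in>carrier R - p. u \<otimes> (t \<otimes> a) = u \<otimes> (s \<otimes> b))"
  by (auto simp: fraction_def)

lemma frac_self: "a \<in> carrier R \<Longrightarrow> s \<in> carrier R - p \<Longrightarrow> (a, s) \<in> frc a s"
  using compl_prime(1) by (auto simp: frac_mem)

lemma frac_subset:
  assumes a: "a \<in> carrier R" and s: "s \<in> carrier R - p" and bt: "(b, t) \<in> frc a s"
  shows "frc b t \<subseteq> frc a s"
proof (rule subsetI, unfold split_paired_all)
  fix c r assume cr: "(c, r) \<in> frc b t"
  obtain u where u: "u \<in> carrier R - p" "u \<otimes> (t \<otimes> a) = u \<otimes> (s \<otimes> b)" and b: "b \<in> carrier R" "t \<in> carrier R - p"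
    using bt by (auto simp: frac_mem)
  obtain v where v: "v \<in> carrier R - p" "v \<otimes> (r \<otimes> b) = v \<otimes> (t \<otimes> c)" and c: "c \<in> carrier R" "r \<in> carrier R - p"
    using cr by (auto simp: frac_mem)
  have k: "u \<in> carrier R" "v \<in> carrier R" "a \<in> carrier R" "s \<in> carrier R" "b \<in> carrier R" "t \<in> carrier R"
     "c \<in> carrier R" "r \<in> carrier R" using u(1) v(1) a s b c by auto
  have "(u \<otimes> v \<otimes> t) \<otimes> (r \<otimes> a) = v \<otimes> r \<otimes> (u \<otimes> (t \<otimes> a))" using k by algebra
  also have "\<dots> = u \<otimes> s \<otimes> (v \<otimes> (r \<otimes> b))" unfolding u(2) using k by algebra
  also have "\<dots> = (u \<otimes> v \<otimes> t) \<otimes> (s \<otimes> c)" unfolding v(2) using k by algebra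
  finally show "(c, r) \<in> frc a s"
    using c compl_prime(2)[OF compl_prime(2)[OF u(1) v(1)] b(2)] by (auto simp: frac_mem)
qed

lemma frac_eqI:
  assumes a: "a \<in> carrier R" and s: "s \<in> carrier R - p" and bt: "(b, t) \<in> frc a s"
  shows "frc b t = frc a s"
proof
  show "frc b t \<subseteq> frc a s" by (rule frac_subset[OF assms])
  obtain u where u: "u \<in> carrier R - p" "u \<otimes> (t \<otimes> a) = u \<otimes> (s \<otimes> b)" and b: "b \<in> carrier R" "t \<in> carrier R - p"
    using bt by (auto simp: frac_mem)
  have "(a, s) \<in> frc b t" using a s u by (auto simp: frac_mem intro!: bexI[of _ u])
  then show "frc a s \<subseteq> frc b t" using frac_subset b by blast
qed

lemma frac_eq_iff:
  assumes "a \<in> carrier R" "s \<in> carrier R - p" "b \<in> carrier R" "t \<in> carrier R - p"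
  shows "frc b t = frc a s \<longleftrightarrow> (\<exists>u\<in>carrier R - p. u \<otimes> (t \<otimes> a) = u \<otimes> (s \<otimes> b))"
proof
  assume "frc b t = frc a s"
  then have "(b, t) \<in> frc a s" using frac_self[OF assms(3,4)] by simp
  then show "\<exists>u\<in>carrier R - p. u \<otimes> (t \<otimes> a) = u \<otimes> (s \<otimes> b)" unfolding frac_mem by blast
next
  assume "\<exists>u\<in>carrier R - p. u \<otimes> (t \<otimes> a) = u \<otimes> (s \<otimes> b)"
  then have "(b, t) \<in> frc a s" unfolding frac_mem using assms by blast
  then show "frc b t = frc a s" by (rule frac_eqI[OF assms(1,2)])
qed

lemma localization_carrier: "carrier Rp = {frc a s |a s. a \<in> carrier R \<and> s \<in> carrier R - p}"
  and localization_one: "one Rp = frc \<one> \<one>" and localization_zero: "zero Rp = frc \<zero> \<one>"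
  by (auto simp: localization_def)

text \<open>The union in the definition runs over all representatives; as each pair of them yields
  the same class, it collapses to that class.\<close>

lemma localization_mult:
  assumes "a \<in> carrier R" "s \<in> carrier R - p" "b \<in> carrier R" "t \<in> carrier R - p"
  shows "frc a s \<otimes>\<^bsub>Rp\<^esub> frc b t = frc (a \<otimes> b) (s \<otimes> t)"
proof -
  have "frc (a' \<otimes> b') (s' \<otimes> t') = frc (a \<otimes> b) (s \<otimes> t)" if 1: "(a', s') \<in> frc a s" and 2: "(b', t') \<in> frc b t" for a' s' b' t'
  proof (rule frac_eqI)
    obtain u where u: "u \<in> carrier R - p" "u \<otimes> (s' \<otimes> a) = u \<otimes> (s \<otimes> a')" "a' \<in> carrier R" "s' \<in> carrier R - p"
      using 1 by (auto simp: frac_mem)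
    obtain v where v: "v \<in> carrier R - p" "v \<otimes> (t' \<otimes> b) = v \<otimes> (t \<otimes> b')" "b' \<in> carrier R" "t' \<in> carrier R - p"
      using 2 by (auto simp: frac_mem)
    have k: "u \<in> carrier R" "v \<in> carrier R" "a \<in> carrier R" "s \<in> carrier R" "b \<in> carrier R" "t \<in> carrier R"
     "a' \<in> carrier R" "b' \<in> carrier R" "s' \<in> carrier R" "t' \<in> carrier R" using u v assms by auto
    have "(u \<otimes> v) \<otimes> ((s' \<otimes> t') \<otimes> (a \<otimes> b)) = (u \<otimes> (s' \<otimes> a)) \<otimes> (v \<otimes> (t' \<otimes> b))" using k by algebra
    also have "\<dots> = (u \<otimes> v) \<otimes> ((s \<otimes> t) \<otimes> (a' \<otimes> b'))" unfolding u(2) v(2) using k by algebra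
    finally show "(a' \<otimes> b', s' \<otimes> t') \<in> frc (a \<otimes> b) (s \<otimes> t)"
      using u v compl_prime(2)[OF u(1) v(1)] compl_prime(2)[OF u(4) v(4)]
      by (auto simp: frac_mem)
  qed (use assms compl_prime(2) in auto)
  note claim = this
  have "(\<Union>(a', s')\<in>frc a s. \<Union>(b', t')\<in>frc b t. frc (a' \<otimes> b') (s' \<otimes> t')) = frc (a \<otimes> b) (s \<otimes> t)"
  proof (rule equalityI)
    show "(\<Union>(a', s')\<in>frc a s. \<Union>(b', t')\<in>frc b t. frc (a' \<otimes> b') (s' \<otimes> t')) \<subseteq> frc (a \<otimes> b) (s \<otimes> t)"
      by (auto simp: claim)
    show "frc (a \<otimes> b) (s \<otimes> t) \<subseteq> (\<Union>(a', s')\<in>frc a s. \<Union>(b', t')\<in>frc b t. frc (a' \<otimes> b') (s' \<otimes> t'))"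
      using frac_self[OF assms(1,2)] frac_self[OF assms(3,4)]
      by (auto intro!: bexI[of _ "(a, s)"] bexI[of _ "(b, t)"])
  qed
  then show ?thesis by (simp add: localization_def)
qed

lemma localization_add:
  assumes "a \<in> carrier R" "s \<in> carrier R - p" "b \<in> carrier R" "t \<in> carrier R - p"
  shows "frc a s \<oplus>\<^bsub>Rp\<^esub> frc b t = frc (t \<otimes> a \<oplus> s \<otimes> b) (s \<otimes> t)"
proof -
  have "frc (t' \<otimes> a' \<oplus> s' \<otimes> b') (s' \<otimes> t') = frc (t \<otimes> a \<oplus> s \<otimes> b) (s \<otimes> t)"
    if 1: "(a', s') \<in> frc a s" and 2: "(b', t') \<in> frc b t" for a' s' b' t'
  proof (rule frac_eqI)
    obtain u where u: "u \<in> carrier R - p" "u \<otimes> (s' \<otimes> a) = u \<otimes> (s \<otimes> a')" "a' \<in> carrier R" "s' \<in> carrier R - p"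
      using 1 by (auto simp: frac_mem)
    obtain v where v: "v \<in> carrier R - p" "v \<otimes> (t' \<otimes> b) = v \<otimes> (t \<otimes> b')" "b' \<in> carrier R" "t' \<in> carrier R - p"
      using 2 by (auto simp: frac_mem)
    have k: "u \<in> carrier R" "v \<in> carrier R" "a \<in> carrier R" "s \<in> carrier R" "b \<in> carrier R" "t \<in> carrier R"
     "a' \<in> carrier R" "b' \<in> carrier R" "s' \<in> carrier R" "t' \<in> carrier R" using u v assms by auto
    have "(u \<otimes> v) \<otimes> ((s' \<otimes> t') \<otimes> (t \<otimes> a \<oplus> s \<otimes> b)) =
      v \<otimes> t \<otimes> t' \<otimes> (u \<otimes> (s' \<otimes> a)) \<oplus> u \<otimes> s \<otimes> s' \<otimes> (v \<otimes> (t' \<otimes> b))" using k by algebra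
    also have "\<dots> = (u \<otimes> v) \<otimes> ((s \<otimes> t) \<otimes> (t' \<otimes> a' \<oplus> s' \<otimes> b'))" unfolding u(2) v(2) using k by algebra
    finally show "(t' \<otimes> a' \<oplus> s' \<otimes> b', s' \<otimes> t') \<in> frc (t \<otimes> a \<oplus> s \<otimes> b) (s \<otimes> t)"
      using u v compl_prime(2)[OF u(1) v(1)] compl_prime(2)[OF u(4) v(4)]
      by (auto simp: frac_mem)
  qed (use assms compl_prime(2) in auto)
  note claim = this
  have "(\<Union>(a', s')\<in>frc a s. \<Union>(b', t')\<in>frc b t. frc (t' \<otimes> a' \<oplus> s' \<otimes> b') (s' \<otimes> t')) = frc (t \<otimes> a \<oplus> s \<otimes> b) (s \<otimes> t)"
  proof (rule equalityI)
    show "(\<Union>(a', s')\<in>frc a s. \<Union>(b', t')\<in>frc b t. frc (t' \<otimes> a' \<oplus> s' \<otimes> b') (s' \<otimes> t')) \<subseteq> frc (t \<otimes> a \<oplus> s \<otimes> b) (s \<otimes> t)"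
      by (auto simp: claim)
    show "frc (t \<otimes> a \<oplus> s \<otimes> b) (s \<otimes> t) \<subseteq> (\<Union>(a', s')\<in>frc a s. \<Union>(b', t')\<in>frc b t. frc (t' \<otimes> a' \<oplus> s' \<otimes> b') (s' \<otimes> t'))"
      using frac_self[OF assms(1,2)] frac_self[OF assms(3,4)]
      by (auto intro!: bexI[of _ "(a, s)"] bexI[of _ "(b, t)"])
  qed
  then show ?thesis by (simp add: localization_def)
qed

lemma frac_in_localization: "a \<in> carrier R \<Longrightarrow> s \<in> carrier R - p \<Longrightarrow> frc a s \<in> carrier Rp"
  by (auto simp: localization_carrier)

lemma frac_as_mult: "a \<in> carrier R \<Longrightarrow> s \<in> carrier R - p \<Longrightarrow> frc a s = frc a \<one> \<otimes>\<^bsub>Rp\<^esub> frc \<one> s"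
  using localization_mult[of a \<one> \<one> s] compl_prime(1) by simp

lemma frac_unit: "a \<in> carrier R - p \<Longrightarrow> s \<in> carrier R - p \<Longrightarrow> frc a s \<otimes>\<^bsub>Rp\<^esub> frc s a = one Rp"
  using localization_mult[of a s s a] compl_prime(1)
  by (simp add: localization_one frac_eq_iff compl_prime(2)[simplified]) (auto simp: m_comm intro!: bexI[of _ \<one>])

lemma contract_prime:
  assumes cL: "cring Rp" and P: "primeideal P Rp"
  shows "primeideal {r \<in> carrier R. frc r \<one> \<in> P} R" "{r \<in> carrier R. frc r \<one> \<in> P} \<subseteq> p"
proof -
  interpret Rp: cring Rp by (rule cL)
  note PL = Rp.primeideal_props[OF P]
  let ?C = "{r \<in> carrier R. frc r \<one> \<in> P}"
  have 1: "\<one> \<in> carrier R - p" by (rule compl_prime)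
  show sub: "?C \<subseteq> p"
  proof
    fix r assume r: "r \<in> ?C"
    show "r \<in> p"
    proof (rule ccontr)
      assume "r \<notin> p"
      then have "frc r \<one> \<otimes>\<^bsub>Rp\<^esub> frc \<one> r = one Rp" using frac_unit r 1 by blast
      moreover have "frc r \<one> \<otimes>\<^bsub>Rp\<^esub> frc \<one> r \<in> P"
        using ideal.I_r_closed[OF PL(1)] r \<open>r \<notin> p\<close> frac_in_localization 1 by blast
      ultimately show False using PL(2) by simp
    qed
  qed
  show "primeideal ?C R"
  proof (rule primeidealI[OF _ is_cring])
    show "ideal ?C R"
    proof (rule idealI')
      show "\<zero> \<in> ?C" using Rp.ideal_zero[OF PL(1)] by (simp add: localization_zero)
    next
      fix a b assume "a \<in> ?C" "b \<in> ?C"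
      moreover have "frc a \<one> \<oplus>\<^bsub>Rp\<^esub> frc b \<one> = frc (a \<oplus> b) \<one>" if "a \<in> carrier R" "b \<in> carrier R"
        using localization_add[OF that(1) 1 that(2) 1] that by simp
      ultimately show "a \<oplus> b \<in> ?C" using Rp.ideal_add[OF PL(1)] by force
    next
      fix a b assume a: "a \<in> carrier R" and b: "b \<in> ?C"
      have "frc a \<one> \<otimes>\<^bsub>Rp\<^esub> frc b \<one> = frc (a \<otimes> b) \<one>" using localization_mult[OF a 1 _ 1] b by simp
      moreover have "frc a \<one> \<otimes>\<^bsub>Rp\<^esub> frc b \<one> \<in> P" using ideal.I_l_closed[OF PL(1)] b frac_in_localization[OF a 1] by blast
      ultimately show "a \<otimes> b \<in> ?C" using a b by simp
    qed auto
    show "carrier R \<noteq> ?C" using sub 1 by auto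
  next
    fix a b assume ab: "a \<in> carrier R" "b \<in> carrier R" "a \<otimes> b \<in> ?C"
    have "frc a \<one> \<otimes>\<^bsub>Rp\<^esub> frc b \<one> \<in> P" using localization_mult[OF ab(1) 1 ab(2) 1] ab(3) by simp
    then show "a \<in> ?C \<or> b \<in> ?C" using PL(4)[OF frac_in_localization[OF ab(1) 1] frac_in_localization[OF ab(2) 1]] ab by blast
  qed
qed

text \<open>A fraction \<open>a / s\<close> and \<open>a / 1\<close> lie in the same ideals of the
  localization, so numerators alone separate two primes.\<close>

lemma contract_strict:
  assumes cL: "cring Rp" and P: "primeideal P Rp" and Q: "primeideal Q Rp" and PQ: "P \<subset> Q"
  shows "{r \<in> carrier R. frc r \<one> \<in> P} \<subset> {r \<in> carrier R. frc r \<one> \<in> Q}"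
proof -
  interpret Rp: cring Rp by (rule cL)
  have 1: "\<one> \<in> carrier R - p" by (rule compl_prime)
  obtain x where x: "x \<in> Q" "x \<notin> P" using PQ by blast
  then have "x \<in> carrier Rp" using Rp.ideal_carr Rp.primeideal_props(1)[OF Q] by blast
  then obtain a s where as: "x = frc a s" "a \<in> carrier R" "s \<in> carrier R - p" by (auto simp: localization_carrier)
  have "frc a \<one> = frc a s \<otimes>\<^bsub>Rp\<^esub> frc s \<one>"
  proof -
    have "frc a s \<otimes>\<^bsub>Rp\<^esub> frc s \<one> = (frc a \<one> \<otimes>\<^bsub>Rp\<^esub> frc \<one> s) \<otimes>\<^bsub>Rp\<^esub> frc s \<one>"
      by (subst frac_as_mult[OF as(2,3)]) simp
    also have "\<dots> = frc a \<one> \<otimes>\<^bsub>Rp\<^esub> (frc \<one> s \<otimes>\<^bsub>Rp\<^esub> frc s \<one>)" using as 1 by (intro Rp.m_assoc frac_in_localization) auto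
    also have "\<dots> = frc a \<one>" using frac_unit[OF 1 as(3)] frac_in_localization[OF as(2) 1] by simp
    finally show ?thesis by simp
  qed
  then have "frc a \<one> \<in> Q"
    using x as ideal.I_r_closed[OF Rp.primeideal_props(1)[OF Q]] frac_in_localization[of s \<one>] 1 by auto
  moreover have "frc a \<one> \<notin> P"
  proof
    assume "frc a \<one> \<in> P"
    then have "frc a \<one> \<otimes>\<^bsub>Rp\<^esub> frc \<one> s \<in> P"
      using ideal.I_r_closed[OF Rp.primeideal_props(1)[OF P]] frac_in_localization[of \<one> s] as by auto
    then show False using frac_as_mult[OF as(2,3)] as x by simp
  qed
  ultimately show ?thesis using as PQ by blast
qed

text \<open>Chains of primes in the localization contract to strict chains inside \<open>p\<close>,
  so \<open>h\<close> bounds the dimension by \<open>n\<close>; regularity converts this into a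
  bound on the number of generators of the maximal ideal.\<close>

lemma regular_localization_generators:
  assumes reg: "regular_local_ring Rp"
    and h: "\<And>C k. (\<forall>i\<le>k. primeideal (C i) R) \<Longrightarrow> (\<forall>i<k. C i \<subset> C (Suc i)) \<Longrightarrow> C k \<subseteq> p \<Longrightarrow> k \<le> n"
  shows "\<exists>S. finite S \<and> card S \<le> n \<and> S \<subseteq> carrier Rp \<and> Idl\<^bsub>Rp\<^esub> S = max_ideal Rp"
proof -
  have cL: "cring Rp" and nL: "noetherian_ring Rp" and lL: "local_ring Rp" and dim: "krull_dim Rp = enat (emb_dim Rp)"
    using reg by (auto simp: regular_local_ring_def local_ring_def)
  interpret N: noeth_local Rp "max_ideal Rp" by (rule local_ring_noeth_local[OF lL nL])
  have "krull_dim Rp \<le> enat n" unfolding krull_dim_def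
  proof (rule Sup_least)
    fix e assume "e \<in> {enat n |n. \<exists>P. (\<forall>i\<le>n. primeideal (P i) Rp) \<and> (\<forall>i<n. P i \<subset> P (Suc i))}"
    then obtain k P where e: "e = enat k" and P: "\<forall>i\<le>k. primeideal (P i) Rp" "\<forall>i<k. P i \<subset> P (Suc i)" by blast
    have "k \<le> n"
    proof (rule h[of k "\<lambda>i. {r \<in> carrier R. frc r \<one> \<in> P i}"])
      show "\<forall>i\<le>k. primeideal {r \<in> carrier R. frc r \<one> \<in> P i} R" using P contract_prime[OF cL] by blast
      show "{r \<in> carrier R. frc r \<one> \<in> P k} \<subseteq> p" using P contract_prime[OF cL] by blast
      show "\<forall>i<k. {r \<in> carrier R. frc r \<one> \<in> P i} \<subset> {r \<in> carrier R. frc r \<one> \<in> P (Suc i)}"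
        using P contract_strict[OF cL] by (meson Suc_leI less_imp_le)
    qed
    then show "e \<le> enat n" using e by simp
  qed
  then have le: "emb_dim Rp \<le> n" using dim by simp
  have "\<exists>n S. finite S \<and> card S = n \<and> S \<subseteq> carrier Rp \<and> Idl\<^bsub>Rp\<^esub> S = max_ideal Rp"
    using noetherian_ring.finetely_gen[OF nL N.mm_ideal] by metis
  then have "\<exists>S. finite S \<and> card S = emb_dim Rp \<and> S \<subseteq> carrier Rp \<and> Idl\<^bsub>Rp\<^esub> S = max_ideal Rp"
    unfolding emb_dim_def by (rule LeastI_ex)
  then show ?thesis using le by auto
qed

text \<open>Clears the denominators in \<open>r / 1 = y (q / s)\<close>. The fraction
  \<open>r / 1\<close> is in the maximal ideal because an element of \<open>p\<close> cannot become
  a unit.\<close>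

lemma regular_localization_max_ideal:
  assumes reg: "regular_local_ring Rp" and r: "r \<in> p" and f: "f \<in> carrier Rp" and M: "max_ideal Rp \<subseteq> PIdl\<^bsub>Rp\<^esub> f"
    and q: "f = frc q s" "q \<in> carrier R" "s \<in> carrier R - p"
  shows "\<exists>t\<in>carrier R - p. \<exists>b\<in>carrier R. t \<otimes> r = b \<otimes> q"
proof -
  have cL: "cring Rp" and nL: "noetherian_ring Rp" and lL: "local_ring Rp"
    using reg by (auto simp: regular_local_ring_def local_ring_def)
  interpret N: noeth_local Rp "max_ideal Rp" by (rule local_ring_noeth_local[OF lL nL])
  have 1: "\<one> \<in> carrier R - p" by (rule compl_prime)
  have ip: "ideal p R" using primeideal_props(1)[OF p] .
  have rc: "r \<in> carrier R" using r ideal_carr[OF ip] by simp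
  have "frc r \<one> \<notin> Units Rp"
  proof
    assume "frc r \<one> \<in> Units Rp"
    then obtain y where y: "y \<in> carrier Rp" "frc r \<one> \<otimes>\<^bsub>Rp\<^esub> y = one Rp" using N.Units_r_inv_ex by blast
    then obtain b t where bt: "y = frc b t" "b \<in> carrier R" "t \<in> carrier R - p" by (auto simp: localization_carrier)
    have "frc (r \<otimes> b) t = frc \<one> \<one>" using y localization_mult[OF rc 1 bt(2,3)] bt by (simp add: localization_one)
    then obtain u where u: "u \<in> carrier R - p" "u \<otimes> (t \<otimes> \<one>) = u \<otimes> (\<one> \<otimes> (r \<otimes> b))"
      using frac_eq_iff[OF one_closed 1, of "r \<otimes> b" t] bt rc by auto
    have "u \<otimes> (\<one> \<otimes> (r \<otimes> b)) \<in> p"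
      using u(1) bt(2) r rc ideal.I_l_closed[OF ip] ideal.I_r_closed[OF ip] by auto
    then have "u \<otimes> t \<in> p" using u bt by auto
    then show False using compl_prime(2)[OF u(1) bt(3)] by blast
  qed
  then have "frc r \<one> \<in> max_ideal Rp" using N.nonunits frac_in_localization[OF rc 1] by blast
  then have "frc r \<one> \<in> PIdl\<^bsub>Rp\<^esub> f" using M by blast
  then obtain y where y: "y \<in> carrier Rp" "frc r \<one> = y \<otimes>\<^bsub>Rp\<^esub> f" by (auto simp: cgenideal_def)
  then obtain b t where bt: "y = frc b t" "b \<in> carrier R" "t \<in> carrier R - p" by (auto simp: localization_carrier)
  have "frc r \<one> = frc (b \<otimes> q) (t \<otimes> s)" using y localization_mult[OF bt(2,3) q(2,3)] q bt by simp
  then obtain u where u: "u \<in> carrier R - p" "u \<otimes> (\<one> \<otimes> (b \<otimes> q)) = u \<otimes> ((t \<otimes> s) \<otimes> r)"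
    using frac_eq_iff[OF _ compl_prime(2)[OF bt(3) q(3)] rc 1, of "b \<otimes> q"] bt q by auto
  have k: "u \<in> carrier R" "t \<in> carrier R" "s \<in> carrier R" using u q bt by auto
  have "(u \<otimes> (t \<otimes> s)) \<otimes> r = u \<otimes> ((t \<otimes> s) \<otimes> r)" using k rc by algebra
  also have "\<dots> = (u \<otimes> b) \<otimes> q" unfolding u(2)[symmetric] using k bt(2) q(2) by algebra
  finally show ?thesis using compl_prime(2)[OF u(1) compl_prime(2)[OF bt(3) q(3)]] k bt(2)
    by (intro bexI[of _ "u \<otimes> (t \<otimes> s)"] bexI[of _ "u \<otimes> b"]) auto
qed

text \<open>By \<open>h\<close> the height of \<open>p\<close> is at most one, so the maximal ideal
  of the localization is principal, and \<open>q\<close> is a numerator of its generator.\<close>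

lemma regular_height_one:
  assumes reg: "regular_local_ring Rp"
    and h: "\<And>q0 q1. primeideal q0 R \<Longrightarrow> primeideal q1 R \<Longrightarrow> q0 \<subset> q1 \<Longrightarrow> \<not> q1 \<subset> p"
  shows "\<exists>q\<in>p. \<forall>r\<in>p. \<exists>t\<in>carrier R - p. \<exists>b\<in>carrier R. t \<otimes> r = b \<otimes> q"
proof -
  have cL: "cring Rp" and nL: "noetherian_ring Rp" and lL: "local_ring Rp"
    using reg by (auto simp: regular_local_ring_def local_ring_def)
  interpret N: noeth_local Rp "max_ideal Rp" by (rule local_ring_noeth_local[OF lL nL])
  have "\<exists>S. finite S \<and> card S \<le> 1 \<and> S \<subseteq> carrier Rp \<and> Idl\<^bsub>Rp\<^esub> S = max_ideal Rp"
  proof (rule regular_localization_generators[OF reg])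
    fix C :: "nat \<Rightarrow> 'a set" and k
    assume C: "\<forall>i\<le>k. primeideal (C i) R" "\<forall>i<k. C i \<subset> C (Suc i)" "C k \<subseteq> p"
    show "k \<le> 1"
    proof (rule ccontr)
      assume "\<not> k \<le> 1"
      then have k: "2 \<le> k" by simp
      have "C 2 \<subseteq> C j" if "2 \<le> j" "j \<le> k" for j
        using that
      proof (induction j rule: dec_induct)
        case (step j)
        then have "C j \<subset> C (Suc j)" using C(2) by simp
        then show ?case using step by auto
      qed simp
      then have "C 2 \<subseteq> p" using k C(3) by blast
      moreover have "C 0 \<subset> C 1" "C 1 \<subset> C 2" using C(2) k by (auto simp: numeral_2_eq_2)
      ultimately show False using h[of "C 0" "C 1"] C(1) k by auto
    qed
  qed
  then obtain S where S: "finite S" "card S \<le> 1" "S \<subseteq> carrier Rp" "Idl\<^bsub>Rp\<^esub> S = max_ideal Rp" by blast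
  obtain f where f: "f \<in> max_ideal Rp" "max_ideal Rp \<subseteq> PIdl\<^bsub>Rp\<^esub> f"
  proof (cases "S = {}")
    \<comment> \<open>The localization is a field here, and zero generates its maximal
      ideal.\<close>
    case True
    then have "max_ideal Rp \<subseteq> PIdl\<^bsub>Rp\<^esub> (zero Rp)"
      using N.genideal_minimal[of "PIdl\<^bsub>Rp\<^esub> (zero Rp)" S] N.cgenideal_ideal[of "zero Rp"] S(4) by simp
    then show ?thesis using that N.ideal_zero[OF N.mm_ideal] by blast
  next
    case False
    then obtain f where "S = {f}" using S(1,2) by (metis card_1_singletonE card_gt_0_iff le_antisym less_eq_Suc_le One_nat_def)
    then show ?thesis using that S(3,4) N.cgenideal_eq_genideal[of f] N.cgenideal_self[of f] by auto
  qed
  have fc: "f \<in> carrier Rp" using N.mm_carr f by blast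
  then obtain q s where q: "f = frc q s" "q \<in> carrier R" "s \<in> carrier R - p" by (auto simp: localization_carrier)
  have "q \<in> p"
  proof (rule ccontr)
    assume "q \<notin> p"
    then have "f \<otimes>\<^bsub>Rp\<^esub> frc s q = one Rp" using frac_unit[of q s] q by simp
    then have "one Rp \<in> max_ideal Rp"
      using ideal.I_r_closed[OF N.mm_ideal f(1), of "frc s q"] frac_in_localization[of s q] q \<open>q \<notin> p\<close> by auto
    then show False using N.one_notin_mm by blast
  qed
  then show ?thesis using regular_localization_max_ideal[OF reg _ fc f(2) q] by blast
qed

lemma regular_height_zero:
  assumes reg: "regular_local_ring Rp"
    and h: "\<And>q. primeideal q R \<Longrightarrow> \<not> q \<subset> p" and r: "r \<in> p"
  shows "\<exists>t\<in>carrier R - p. t \<otimes> r = \<zero>"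
proof -
  have cL: "cring Rp" and nL: "noetherian_ring Rp" and lL: "local_ring Rp"
    using reg by (auto simp: regular_local_ring_def local_ring_def)
  interpret N: noeth_local Rp "max_ideal Rp" by (rule local_ring_noeth_local[OF lL nL])
  have 1: "\<one> \<in> carrier R - p" by (rule compl_prime)
  have "\<exists>S. finite S \<and> card S \<le> 0 \<and> S \<subseteq> carrier Rp \<and> Idl\<^bsub>Rp\<^esub> S = max_ideal Rp"
  proof (rule regular_localization_generators[OF reg])
    fix C :: "nat \<Rightarrow> 'a set" and k
    assume C: "\<forall>i\<le>k. primeideal (C i) R" "\<forall>i<k. C i \<subset> C (Suc i)" "C k \<subseteq> p"
    show "k \<le> 0"
    proof (cases k)
      case (Suc j)
      then have "C j \<subset> p" using C by blast
      then show ?thesis using h[of "C j"] C(1) Suc by auto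
    qed simp
  qed
  then have "Idl\<^bsub>Rp\<^esub> {} = max_ideal Rp" by auto
  then have "max_ideal Rp \<subseteq> PIdl\<^bsub>Rp\<^esub> (zero Rp)"
    using N.genideal_minimal[of "PIdl\<^bsub>Rp\<^esub> (zero Rp)" "{}"] N.cgenideal_ideal[of "zero Rp"] by simp
  then obtain t b where "t \<in> carrier R - p" "b \<in> carrier R" "t \<otimes> r = b \<otimes> \<zero>"
    using regular_localization_max_ideal[OF reg r _ _ localization_zero zero_closed 1] by auto
  then show ?thesis by auto
qed

end
end

section \<open>Depth and dimension\<close>

text \<open>The supremum of the empty set is 0, so \<open>d >= 1\<close> makes the set nonempty. A
  finite supremum in \<open>enat\<close> makes it finite, and then the supremum is a
  maximum.\<close>

lemma enat_Sup_attained: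
  assumes "Sup {enat (f x) |x. P x} = enat d" "d \<ge> 1"
  shows "\<exists>x. P x \<and> f x = d"
proof -
  let ?A = "{enat (f x) |x. P x}"
  have "?A \<noteq> {}" "finite ?A" "Max ?A = enat d"
    using assms by (auto simp: Sup_enat_def zero_enat_def split: if_splits)
  then have "enat d \<in> ?A" using Max_in by metis
  then show ?thesis by auto
qed

lemma prime_chain_le_dim:
  assumes "krull_dim R = enat d" "prime_chain R J n"
  shows "n \<le> d"
proof -
  have "enat n \<le> krull_dim R" unfolding krull_dim_def
    by (rule Sup_upper) (use assms(2) in \<open>auto simp: prime_chain_def\<close>)
  then show ?thesis using assms(1) by simp
qed

context noeth_local_module
begin

text \<open>Appending \<open>y\<close> to an initial segment changes the submodule it generates by
  \<open>plus_mult\<close>, which matches the recursion of \<open>rel_regular\<close>.\<close>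

lemma rel_regular_of_regular_sequence:
  assumes reg: "regular_sequence R M xs" and xs: "set xs \<subseteq> mm"
  shows "rel_regular {\<zero>\<^bsub>M\<^esub>} xs"
proof -
  define IM where "IM ys = mod_span R M {y \<bullet> v |y v. y \<in> set ys \<and> v \<in> carrier M}" for ys
  have xc: "set xs \<subseteq> carrier R" using xs mm_carr by blast
  have gen: "{y \<bullet> v |y v. y \<in> set ys \<and> v \<in> carrier M} \<subseteq> carrier M" if "set ys \<subseteq> set xs" for ys using that xc by auto
  have IM: "msub (IM ys)" if "set ys \<subseteq> set xs" for ys unfolding IM_def by (rule mod_span_sub[OF gen[OF that]])
  have snoc: "IM (ys @ [y]) = plus_mult (IM ys) y" if "set (ys @ [y]) \<subseteq> set xs" for ys y
  proof
    have ys: "set ys \<subseteq> set xs" and y: "y \<in> carrier R" using that xc by auto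
    have sup: "{y \<bullet> v |y v. y \<in> set zs \<and> v \<in> carrier M} \<subseteq> IM zs" for zs unfolding IM_def by (rule mod_span_superset)
    show "IM (ys @ [y]) \<subseteq> plus_mult (IM ys) y" unfolding IM_def[of "ys @ [y]"]
    proof (rule mod_span_min[OF plus_mult_sub[OF IM[OF ys] y]])
      show "{z \<bullet> v |z v. z \<in> set (ys @ [y]) \<and> v \<in> carrier M} \<subseteq> plus_mult (IM ys) y"
        using sup[of ys] plus_mult_superset[OF IM[OF ys] y] plus_mult_mem[OF IM[OF ys] y] by auto
    qed
    have "IM ys \<subseteq> IM (ys @ [y])" unfolding IM_def[of ys]
      by (rule mod_span_min[OF IM[OF that]]) (use sup[of "ys @ [y]"] in auto)
    moreover have "y \<bullet> v \<in> IM (ys @ [y])" if "v \<in> carrier M" for v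
      using that by (intro subsetD[OF sup]) auto
    ultimately show "plus_mult (IM ys) y \<subseteq> IM (ys @ [y])"
      using sub_add[OF IM[OF that]] unfolding plus_mult_def by auto
  qed
  have r: "\<And>i v. i < length xs \<Longrightarrow> v \<in> carrier M \<Longrightarrow> xs ! i \<bullet> v \<in> IM (take i xs) \<Longrightarrow> v \<in> IM (take i xs)"
    using reg unfolding regular_sequence_def IM_def[symmetric] Let_def by simp
  have "rel_regular (IM (take i xs)) (drop i xs)" if "i \<le> length xs" for i
    using that
  proof (induction i rule: inc_induct)
    case (step i)
    have "drop i xs = xs ! i # drop (Suc i) xs" using step by (simp add: Cons_nth_drop_Suc)
    moreover have t: "take (Suc i) xs = take i xs @ [xs ! i]" using step by (simp add: take_Suc_conv_app_nth)
    moreover have "IM (take (Suc i) xs) = plus_mult (IM (take i xs)) (xs ! i)"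
      unfolding t by (rule snoc) (metis t set_take_subset)
    ultimately show ?case using step r xs nth_mem[of i xs] by auto
  qed simp
  from this[of 0] have "rel_regular (IM []) xs" by simp
  moreover have "IM [] = {\<zero>\<^bsub>M\<^esub>}"
    using mod_span_min[OF zero_sub, of "{}"] sub_zero[OF IM[of "[]"]] unfolding IM_def by auto
  ultimately show ?thesis by simp
qed

end

section \<open>Isolated Cohen-Macaulay singularities\<close>

context noeth_local
begin

lemma noeth_local_self: "noeth_local_module R (self_module R) mm"
proof (intro noeth_local_module.intro noeth_local_module_axioms.intro)
  show "noeth_local R mm" by (rule noeth_local_axioms)
  show "module R (self_module R)" by (rule module_self)
  show "acc_on {N. submodule N R (self_module R)}" using acc by (simp add: submodule_self_iff)
qed

text \<open>At \<open>p\<close> the maximal ideal is generated by \<open>q\<close>, and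
  \<open>q\<close> is not in the prime \<open>P\<close>. So \<open>P = q P\<close> after
  localization, and Nakayama's lemma makes \<open>P\<close> vanish there; the argument is carried
  out with cleared denominators.\<close>

lemma vanishes_at_prime:
  assumes p: "primeideal p R" and P: "primeideal P R" "P \<subset> p"
    and q: "q \<in> p" "\<And>r. r \<in> p \<Longrightarrow> \<exists>t\<in>carrier R - p. \<exists>b\<in>carrier R. t \<otimes> r = b \<otimes> q"
  shows "\<exists>t\<in>carrier R - p. \<forall>r\<in>P. t \<otimes> r = \<zero>"
proof -
  note pp = primeideal_props[OF p] and PP = primeideal_props[OF P(1)]
  have 1: "\<one> \<in> carrier R - p" by (rule compl_prime(1)[OF p])
  have mul: "s \<otimes> t \<in> carrier R - p" if "s \<in> carrier R - p" "t \<in> carrier R - p" for s t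
    using compl_prime(2)[OF p that] .
  have qc: "q \<in> carrier R" using ideal_carr[OF pp(1) q(1)] .
  have Pc: "r \<in> carrier R" if "r \<in> P" for r using ideal_carr[OF PP(1) that] .
  have qP: "q \<notin> P"
  proof
    assume "q \<in> P"
    have "r \<in> P" if r: "r \<in> p" for r
    proof -
      obtain t b where tb: "t \<in> carrier R - p" "b \<in> carrier R" "t \<otimes> r = b \<otimes> q" using q(2)[OF r] by blast
      then have "t \<otimes> r \<in> P" using ideal.I_l_closed[OF PP(1) \<open>q \<in> P\<close>] by simp
      then show "r \<in> P" using PP(4)[of t r] tb(1) ideal_carr[OF pp(1) r] P(2) by blast
    qed
    then show False using P(2) by blast
  qed
  have each: "\<exists>u\<in>carrier R - p. u \<otimes> r = \<zero>" if "r \<in> P" for r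
  proof (rule ccontr)
    assume nr: "\<not> (\<exists>u\<in>carrier R - p. u \<otimes> r = \<zero>)"
    let ?B = "\<lambda>r. r \<in> P \<and> \<not> (\<exists>u\<in>carrier R - p. u \<otimes> r = \<zero>)"
    \<comment> \<open>\<open>K r\<close> is the contraction to \<open>R\<close> of the ideal
      generated by \<open>r\<close> at \<open>p\<close>. A counterexample \<open>r\<close> with
      \<open>K r\<close> maximal is divided by \<open>q\<close>, which gives a counterexample
      \<open>b\<close> with \<open>K r <= K b\<close>.\<close>
    define K where "K r = {x \<in> carrier R. \<exists>t\<in>carrier R - p. \<exists>y\<in>carrier R. t \<otimes> x = r \<otimes> y}" for r
    have K: "ideal (K r) R" if r: "r \<in> carrier R" for r
    proof (rule idealI')
      show "\<zero> \<in> K r" unfolding K_def using 1 r by (auto intro!: bexI[of _ \<one>] bexI[of _ \<zero>])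
    next
      fix x x' assume "x \<in> K r" "x' \<in> K r"
      then obtain t y t' y' where h: "x \<in> carrier R" "t \<in> carrier R - p" "y \<in> carrier R" "t \<otimes> x = r \<otimes> y"
        "x' \<in> carrier R" "t' \<in> carrier R - p" "y' \<in> carrier R" "t' \<otimes> x' = r \<otimes> y'" by (auto simp: K_def)
      have c: "t \<in> carrier R" "t' \<in> carrier R" using h by auto
      have "(t \<otimes> t') \<otimes> (x \<oplus> x') = t' \<otimes> (t \<otimes> x) \<oplus> t \<otimes> (t' \<otimes> x')" using h(1,5) c by algebra
      also have "\<dots> = r \<otimes> (t' \<otimes> y \<oplus> t \<otimes> y')" unfolding h(4,8) using h(3,7) c r by algebra
      finally show "x \<oplus> x' \<in> K r" unfolding K_def using h mul[OF h(2,6)] c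
        by (intro CollectI conjI bexI[of _ "t \<otimes> t'"] bexI[of _ "t' \<otimes> y \<oplus> t \<otimes> y'"]) auto
    next
      fix a x assume a: "a \<in> carrier R" and "x \<in> K r"
      then obtain t y where h: "x \<in> carrier R" "t \<in> carrier R - p" "y \<in> carrier R" "t \<otimes> x = r \<otimes> y"
        by (auto simp: K_def)
      have c: "t \<in> carrier R" using h by auto
      have "t \<otimes> (a \<otimes> x) = a \<otimes> (t \<otimes> x)" using h(1) c a by algebra
      also have "\<dots> = r \<otimes> (a \<otimes> y)" unfolding h(4) using h(3) a r by algebra
      finally show "a \<otimes> x \<in> K r" unfolding K_def using h a
        by (intro CollectI conjI bexI[of _ t] bexI[of _ "a \<otimes> y"]) auto
    qed (auto simp: K_def)
    have "\<exists>r. ?B r \<and> (\<forall>s. ?B s \<longrightarrow> K r \<subseteq> K s \<longrightarrow> K s = K r)"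
      by (rule acc_on_maximal_image[OF acc, of ?B r]) (use that nr K Pc in auto)
    then obtain r where r: "r \<in> P" "\<not> (\<exists>u\<in>carrier R - p. u \<otimes> r = \<zero>)"
      and max: "\<And>s. ?B s \<Longrightarrow> K r \<subseteq> K s \<Longrightarrow> K s = K r" by blast
    have rc: "r \<in> carrier R" using Pc[OF r(1)] .
    obtain t b where tb: "t \<in> carrier R - p" "b \<in> carrier R" "t \<otimes> r = b \<otimes> q" using q(2) r P(2) by blast
    have tc: "t \<in> carrier R" using tb by simp
    have "b \<otimes> q \<in> P" using tb(3) ideal.I_l_closed[OF PP(1) r(1) tc] by simp
    then have bP: "b \<in> P" using PP(4)[OF tb(2) qc] qP by blast
    have "?B b"
    proof (intro conjI bP notI)
      assume "\<exists>u\<in>carrier R - p. u \<otimes> b = \<zero>"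
      then obtain u where u: "u \<in> carrier R - p" "u \<otimes> b = \<zero>" by blast
      have uc: "u \<in> carrier R" using u by simp
      have "(u \<otimes> t) \<otimes> r = u \<otimes> (t \<otimes> r)" using uc tc rc by algebra
      also have "\<dots> = (u \<otimes> b) \<otimes> q" unfolding tb(3) using uc tb(2) qc by algebra
      also have "\<dots> = \<zero>" unfolding u(2) using qc by simp
      finally show False using r(2) mul[OF u(1) tb(1)] by blast
    qed
    moreover have "K r \<subseteq> K b"
    proof
      fix x assume "x \<in> K r"
      then obtain s y where h: "x \<in> carrier R" "s \<in> carrier R - p" "y \<in> carrier R" "s \<otimes> x = r \<otimes> y"
        by (auto simp: K_def)
      have c: "s \<in> carrier R" using h by auto
      have "(t \<otimes> s) \<otimes> x = t \<otimes> (s \<otimes> x)" using h(1) c tc by algebra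
      also have "\<dots> = (t \<otimes> r) \<otimes> y" unfolding h(4) using tc rc h(3) by algebra
      also have "\<dots> = b \<otimes> (q \<otimes> y)" unfolding tb(3) using tb(2) qc h(3) by algebra
      finally show "x \<in> K b" unfolding K_def using h mul[OF tb(1) h(2)] qc
        by (intro CollectI conjI bexI[of _ "t \<otimes> s"] bexI[of _ "q \<otimes> y"]) auto
    qed
    ultimately have "K b = K r" by (rule max)
    moreover have "b \<in> K b" unfolding K_def using tb(2) 1 by (intro CollectI conjI bexI[of _ \<one>]) auto
    ultimately have "b \<in> K r" by simp
    then obtain s y where h: "s \<in> carrier R - p" "y \<in> carrier R" "s \<otimes> b = r \<otimes> y"
      by (auto simp: K_def)
    have sc: "s \<in> carrier R" using h by simp
    \<comment> \<open>From \<open>s b = r y\<close> and \<open>t r = b q\<close> follows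
      \<open>(s t - y q) r = 0\<close>, where the first factor is a unit at
      \<open>p\<close>.\<close>
    have "s \<otimes> t \<ominus> y \<otimes> q \<notin> p"
    proof
      assume "s \<otimes> t \<ominus> y \<otimes> q \<in> p"
      then have "(s \<otimes> t \<ominus> y \<otimes> q) \<oplus> y \<otimes> q \<in> p"
        using ideal_add[OF pp(1)] ideal.I_l_closed[OF pp(1) q(1) h(2)] by blast
      moreover have "(s \<otimes> t \<ominus> y \<otimes> q) \<oplus> y \<otimes> q = s \<otimes> t" using sc tc h(2) qc by algebra
      ultimately show False using mul[OF h(1) tb(1)] by simp
    qed
    moreover have "(s \<otimes> t \<ominus> y \<otimes> q) \<otimes> r = \<zero>"
    proof -
      have "(s \<otimes> t \<ominus> y \<otimes> q) \<otimes> r = s \<otimes> (t \<otimes> r) \<ominus> y \<otimes> q \<otimes> r" using sc tc h(2) qc rc by algebra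
      also have "\<dots> = q \<otimes> (s \<otimes> b) \<ominus> y \<otimes> q \<otimes> r" unfolding tb(3) using sc tb(2) h(2) qc rc by algebra
      also have "\<dots> = \<zero>" unfolding h(3) using h(2) qc rc by algebra
      finally show ?thesis .
    qed
    moreover have "s \<otimes> t \<ominus> y \<otimes> q \<in> carrier R" using sc tc h(2) qc by simp
    ultimately show False using r(2) by blast
  qed
  \<comment> \<open>With finitely many generators of \<open>P\<close>, the product of denominators
    that kill them kills all of \<open>P\<close>.\<close>
  obtain F where F: "F \<subseteq> carrier R" "finite F" "P = Idl F" using noetherian_ring.finetely_gen[OF noeth PP(1)] by blast
  have "\<exists>t\<in>carrier R - p. \<forall>r\<in>F'. t \<otimes> r = \<zero>" if "finite F'" "F' \<subseteq> P" for F'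
    using that
  proof (induction F')
    case empty then show ?case using 1 by blast
  next
    case (insert r F')
    then obtain t u where tu: "t \<in> carrier R - p" "\<forall>r\<in>F'. t \<otimes> r = \<zero>" "u \<in> carrier R - p" "u \<otimes> r = \<zero>"
      using each[of r] by auto
    have "(t \<otimes> u) \<otimes> s = \<zero>" if "s \<in> insert r F'" for s
    proof -
      have c: "t \<in> carrier R" "u \<in> carrier R" "s \<in> carrier R" using tu that insert.prems Pc by auto
      have "(t \<otimes> u) \<otimes> s = t \<otimes> (u \<otimes> s)" "(t \<otimes> u) \<otimes> s = u \<otimes> (t \<otimes> s)" using c by (simp_all add: m_ac)
      then show ?thesis using that tu c by auto
    qed
    then show ?case using mul[OF tu(1,3)] by blast
  qed
  then obtain t where t: "t \<in> carrier R - p" "\<forall>r\<in>F. t \<otimes> r = \<zero>" using F genideal_self[OF F(1)] by blast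
  have tc: "t \<in> carrier R" using t by simp
  have "ideal {r \<in> carrier R. t \<otimes> r = \<zero>} R"
  proof (rule idealI')
    fix a x assume "a \<in> carrier R" "x \<in> {r \<in> carrier R. t \<otimes> r = \<zero>}"
    moreover have "t \<otimes> (a \<otimes> x) = a \<otimes> (t \<otimes> x)" if "a \<in> carrier R" "x \<in> carrier R" using that tc by algebra
    ultimately show "a \<otimes> x \<in> {r \<in> carrier R. t \<otimes> r = \<zero>}" by auto
  qed (use tc in \<open>auto simp: r_distr\<close>)
  then have "P \<subseteq> {r \<in> carrier R. t \<otimes> r = \<zero>}" unfolding F(3) by (rule genideal_minimal) (use t F in auto)
  then show ?thesis using t(1) by blast
qed

end

text \<open>Dimension enters as the bound \<open>chain_le\<close>, depth as a regular sequence of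
  the same length \<open>d\<close>. Heights of primes are bounded through the chains above
  them.\<close>

locale isolated_cm = noeth_local R mm for R (structure) and mm +
  fixes d :: nat and xs
  assumes chain_le: "prime_chain R J n \<Longrightarrow> n \<le> d"
    and xs_regular: "noeth_local_module.rel_regular (self_module R) mm {\<zero>} xs"
    and xs_length: "length xs = d"
    and d_pos: "d \<ge> 1"
    and isolated: "primeideal p R \<Longrightarrow> p \<noteq> mm \<Longrightarrow> regular_local_ring (localization R (carrier R - p))"
begin

sublocale S: noeth_local_module R "self_module R" mm by (rule noeth_local_self)

text \<open>A chain of length \<open>d - 1\<close> above \<open>p\<close> leaves no room for two
  primes below it; this is how height at most one is recognized.\<close>

lemma no_chain_below:
  assumes "prime_chain R p (d - 1)" "primeideal q0 R" "primeideal q1 R" "q0 \<subset> q1" "q1 \<subset> p"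
  shows False
proof -
  have "prime_chain R q1 (Suc (d - 1))" by (rule prime_chain_Suc[OF assms(3) order_refl assms(1,5)])
  then have "prime_chain R q0 (Suc (Suc (d - 1)))" by (rule prime_chain_Suc[OF assms(2) order_refl _ assms(4)])
  then show False using chain_le d_pos by force
qed

lemma no_prime_below:
  assumes "prime_chain R p d" "primeideal q R" "q \<subset> p"
  shows False
  using chain_le[OF prime_chain_Suc[OF assms(2) order_refl assms(1,3)]] by simp

lemma chain_not_mm: "prime_chain R p n \<Longrightarrow> n \<ge> 1 \<Longrightarrow> p \<noteq> mm"
proof
  assume "prime_chain R p n" "n \<ge> 1" "p = mm"
  then obtain P where P: "\<forall>i\<le>n. primeideal (P i) R" "\<forall>i<n. P i \<subset> P (Suc i)" "mm \<subseteq> P 0"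
    unfolding prime_chain_def by blast
  then have "P 0 \<subset> P 1" "P 1 \<subseteq> mm" using \<open>n \<ge> 1\<close> prime_mm[of "P 1"] by auto
  then show False using P(3) by blast
qed

lemma height_one_local:
  assumes "primeideal p R" "prime_chain R p (d - 1)" "p \<noteq> mm"
  shows "\<exists>q\<in>p. \<forall>r\<in>p. \<exists>t\<in>carrier R - p. \<exists>b\<in>carrier R. t \<otimes> r = b \<otimes> q"
  by (rule regular_height_one[OF assms(1) isolated[OF assms(1,3)]]) (use no_chain_below[OF assms(2)] in blast)

lemma height_zero_local:
  assumes "primeideal p R" "prime_chain R p d" "r \<in> p"
  shows "\<exists>t\<in>carrier R - p. t \<otimes> r = \<zero>"
  by (rule regular_height_zero[OF assms(1) isolated[OF assms(1) chain_not_mm[OF assms(2) d_pos]] _ assms(3)])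
     (use no_prime_below[OF assms(2)] in blast)

text \<open>The annihilator \<open>p\<close> of a suitable multiple \<open>c b\<close> is prime and,
  by the depth, has a chain of length \<open>d\<close> above it. So it is minimal, and the ring is a
  field at \<open>p\<close>. As \<open>b\<close> is in \<open>p\<close>, some \<open>t\<close>
  outside \<open>p\<close> kills \<open>b\<close> and hence \<open>c b\<close>.\<close>

lemma reduced:
  assumes b: "b \<in> carrier R" "b \<otimes> b = \<zero>" shows "b = \<zero>"
proof (rule ccontr)
  assume nz: "b \<noteq> \<zero>"
  have z: "submodule {\<zero>} R (self_module R)" using S.zero_sub by simp
  obtain c where c: "c \<in> carrier R" "c \<otimes> b \<noteq> \<zero>" "primeideal (S.colon {\<zero>} (c \<otimes> b)) R"
    using S.associated_prime[OF acc z, of b] b nz by auto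
  let ?p = "S.colon {\<zero>} (c \<otimes> b)"
  have mem: "r \<in> ?p \<longleftrightarrow> r \<in> carrier R \<and> r \<otimes> (c \<otimes> b) = \<zero>" for r by (simp add: S.colon_def)
  have "prime_chain R ?p (length xs)"
    by (rule S.prime_chain_of_annihilator[OF z xs_regular, of "c \<otimes> b"]) (use b c mem in auto)
  then have ch: "prime_chain R ?p d" using xs_length by simp
  have "b \<otimes> (c \<otimes> b) = c \<otimes> (b \<otimes> b)" using b(1) c(1) by algebra
  then have "b \<in> ?p" unfolding mem using b c by simp
  then obtain t where t: "t \<in> carrier R - ?p" "t \<otimes> b = \<zero>" using height_zero_local[OF c(3) ch] by blast
  have "t \<otimes> (c \<otimes> b) = c \<otimes> (t \<otimes> b)" using t b(1) c(1) by (simp add: m_lcomm)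
  then show False using t c b mem by simp
qed

text \<open>Let \<open>P\<close> be a nonzero associated prime and \<open>Q\<close> its annihilator. If the map \<open>r + s \<mapsto> s\<close> on \<open>P + Q\<close>
  is the multiplication by \<open>v\<close>, then \<open>v\<close> kills \<open>P\<close> and \<open>1 - v\<close> kills \<open>Q\<close>, but one of them is a unit. Otherwise some
  prime \<open>p\<close> of height one contains \<open>P + Q\<close>. But \<open>P\<close> vanishes at \<open>p\<close>, so \<open>Q\<close> is not contained in \<open>p\<close>.\<close>

lemma integral:
  assumes d: "d \<ge> 2" and ab: "a \<in> carrier R" "b \<in> carrier R" "a \<otimes> b = \<zero>"
  shows "a = \<zero> \<or> b = \<zero>"
proof (rule ccontr)
  assume "\<not> ?thesis"
  then have nz: "a \<noteq> \<zero>" "b \<noteq> \<zero>" by auto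
  have z: "submodule {\<zero>} R (self_module R)" using S.zero_sub by simp
  obtain c where c: "c \<in> carrier R" "c \<otimes> b \<noteq> \<zero>" "primeideal (S.colon {\<zero>} (c \<otimes> b)) R"
    using S.associated_prime[OF acc z, of b] ab nz by auto
  \<comment> \<open>\<open>P\<close> will be the annihilator of \<open>e\<close>. It contains
    \<open>a\<close>, and its annihilator \<open>Q\<close> contains \<open>e\<close>, so both are
    nonzero; as the ring is reduced, \<open>e\<close> is not in \<open>P\<close>.\<close>
  define e where "e = c \<otimes> b"
  have e: "e \<in> carrier R" "e \<noteq> \<zero>" using c ab by (auto simp: e_def)
  define P where "P = S.colon {\<zero>} e"
  have P: "primeideal P R" using c by (simp add: P_def e_def)
  note PP = primeideal_props[OF P]
  have memP: "r \<in> P \<longleftrightarrow> r \<in> carrier R \<and> r \<otimes> e = \<zero>" for r by (simp add: P_def S.colon_def)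
  have "a \<otimes> e = c \<otimes> (a \<otimes> b)" unfolding e_def using ab(1,2) c(1) by algebra
  then have aP: "a \<in> P" using ab c by (simp add: memP)
  have eP: "e \<notin> P" using reduced[OF e(1)] e by (auto simp: memP)
  define Q where "Q = {s \<in> carrier R. \<forall>r\<in>P. s \<otimes> r = \<zero>}"
  have eQ: "e \<in> Q" unfolding Q_def using e memP by (auto simp: m_comm)
  define G where "G = {(r \<oplus> s, s) |r s. r \<in> P \<and> s \<in> Q}"
  have Pc: "r \<in> P \<Longrightarrow> r \<in> carrier R" and Qc: "s \<in> Q \<Longrightarrow> s \<in> carrier R" for r s
    by (auto simp: memP Q_def)
  have GI: "(r \<oplus> s, s) \<in> G" if "r \<in> P" "s \<in> Q" for r s using that by (auto simp: G_def)
  have lin: "S.lin_graph G" unfolding S.lin_graph_def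
  proof (intro conjI allI impI; simp)
    show "G \<subseteq> carrier R \<times> carrier R" using Pc Qc by (auto simp: G_def)
    have "\<zero> \<in> Q" by (auto simp: Q_def memP)
    then show "(\<zero>, \<zero>) \<in> G" using GI[of \<zero> \<zero>] ideal_zero[OF PP(1)] by simp
  next
    fix r w r' w' assume "(r, w) \<in> G" "(r', w') \<in> G"
    then obtain u u' where 1: "r = u \<oplus> w" "u \<in> P" "w \<in> Q" "r' = u' \<oplus> w'" "u' \<in> P" "w' \<in> Q" by (auto simp: G_def)
    have "w \<oplus> w' \<in> Q" using 1 Pc by (auto simp: Q_def l_distr)
    then have "((u \<oplus> u') \<oplus> (w \<oplus> w'), w \<oplus> w') \<in> G" using GI 1 ideal_add[OF PP(1)] by blast
    moreover have "(u \<oplus> u') \<oplus> (w \<oplus> w') = r \<oplus> r'" unfolding 1(1,4) using Pc Qc 1 by (simp add: a_ac)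
    ultimately show "(r \<oplus> r', w \<oplus> w') \<in> G" by simp
  next
    fix a r w assume a: "a \<in> carrier R" and "(r, w) \<in> G"
    then obtain u where 1: "r = u \<oplus> w" "u \<in> P" "w \<in> Q" by (auto simp: G_def)
    have "a \<otimes> w \<in> Q" using 1 Pc a by (auto simp: Q_def m_assoc)
    then have "(a \<otimes> u \<oplus> a \<otimes> w, a \<otimes> w) \<in> G" using GI 1 ideal.I_l_closed[OF PP(1) _ a] by blast
    then show "(a \<otimes> r, a \<otimes> w) \<in> G" unfolding 1(1) using Pc Qc 1 a by (simp add: r_distr)
  qed
  \<comment> \<open>An element of both \<open>P\<close> and \<open>Q\<close> has square zero. So the
    sum \<open>P + Q\<close> is direct and the projection is well defined.\<close>
  have fn: "S.functional_mod {\<zero>} G" unfolding S.functional_mod_def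
  proof (intro allI impI)
    fix w assume "(\<zero>, w) \<in> G"
    then obtain u where 1: "\<zero> = u \<oplus> w" "u \<in> P" "w \<in> Q" by (auto simp: G_def)
    have c: "u \<in> carrier R" "w \<in> carrier R" using 1 Pc Qc by auto
    have "w \<otimes> u = \<zero>" using 1 by (auto simp: Q_def)
    moreover have "w \<otimes> (u \<oplus> w) = w \<otimes> u \<oplus> w \<otimes> w" using c by algebra
    ultimately have "w \<otimes> w = \<zero>" using 1(1)[symmetric] c by simp
    then show "w \<in> {\<zero>}" using reduced[OF c(2)] by simp
  qed
  obtain x ys where xys: "xs = x # ys" "length ys = d - 1" using xs_length d by (cases xs) auto
  show False
  proof (cases "prime_chain R (fst ` G) (d - 1)")
    case False
    have "S.trivial_mod {\<zero>} G"
      by (rule S.trivial_mod_of_regular[OF z _ lin fn]) (use xs_regular xys False in auto)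
    then obtain v where v: "v \<in> carrier R" "\<And>r w. (r, w) \<in> G \<Longrightarrow> w \<ominus> r \<otimes> v = \<zero>"
      unfolding S.trivial_mod_def S.cong_mod_def by auto
    have "\<zero> \<in> Q" by (auto simp: Q_def memP)
    then have *: "\<zero> \<ominus> (a \<oplus> \<zero>) \<otimes> v = \<zero>" by (intro v(2) GI aP)
    have "v \<otimes> a = \<ominus> (\<zero> \<ominus> (a \<oplus> \<zero>) \<otimes> v)" using ab(1) v(1) by algebra
    then have av: "v \<otimes> a = \<zero>" unfolding * by simp
    have *: "e \<ominus> (\<zero> \<oplus> e) \<otimes> v = \<zero>" by (intro v(2) GI ideal_zero[OF PP(1)] eQ)
    have "(\<one> \<ominus> v) \<otimes> e = e \<ominus> (\<zero> \<oplus> e) \<otimes> v" using e(1) v(1) by algebra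
    then have ev: "(\<one> \<ominus> v) \<otimes> e = \<zero>" unfolding * .
    from unit_cases[OF v(1)] show False
    proof
      assume u: "v \<in> Units R"
      have "a = inv v \<otimes> (v \<otimes> a)" using u ab v by (simp add: m_assoc[symmetric])
      then show False using av nz u by simp
    next
      assume u: "\<one> \<ominus> v \<in> Units R"
      have "e = inv (\<one> \<ominus> v) \<otimes> ((\<one> \<ominus> v) \<otimes> e)" using u e v by (simp add: m_assoc[symmetric])
      then show False using ev e u by simp
    qed
  next
    case True
    then obtain C where C: "\<forall>i\<le>d - 1. primeideal (C i) R" "\<forall>i<d - 1. C i \<subset> C (Suc i)" "fst ` G \<subseteq> C 0"
      unfolding prime_chain_def by blast
    define p where "p = C 0"
    have p: "primeideal p R" "prime_chain R p (d - 1)" using C by (auto simp: p_def prime_chain_def)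
    have "p \<noteq> mm" by (rule chain_not_mm[OF p(2)]) (use d in simp)
    have zQ: "\<zero> \<in> Q" by (auto simp: Q_def memP)
    have Pp: "P \<subseteq> p"
    proof
      fix r assume r: "r \<in> P"
      then have "r \<oplus> \<zero> \<in> fst ` G" using GI[OF r zQ] by force
      then show "r \<in> p" using C(3) Pc[OF r] by (auto simp: p_def)
    qed
    have Qp: "Q \<subseteq> p"
    proof
      fix s assume s: "s \<in> Q"
      then have "\<zero> \<oplus> s \<in> fst ` G" using GI[OF ideal_zero[OF PP(1)] s] by force
      then show "s \<in> p" using C(3) Qc[OF s] by (auto simp: p_def)
    qed
    obtain q where q: "q \<in> p" "\<And>r. r \<in> p \<Longrightarrow> \<exists>t\<in>carrier R - p. \<exists>b\<in>carrier R. t \<otimes> r = b \<otimes> q"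
      using height_one_local[OF p \<open>p \<noteq> mm\<close>] by blast
    have "P \<subset> p" using Pp Qp eQ eP by blast
    then obtain t where "t \<in> carrier R - p" "\<forall>r\<in>P. t \<otimes> r = \<zero>" using vanishes_at_prime[OF p(1) P _ q] by blast
    then show False using Qp by (auto simp: Q_def)
  qed
qed

end

section \<open>Quotient modules and modules of functions\<close>

context module
begin

lemma sub_abelian_subgroup: "msub N \<Longrightarrow> abelian_subgroup N M"
  using M.abelian_group_axioms
  by (intro abelian_subgroupI3 additive_subgroupI) (auto simp: submodule_def)

lemma quot_carrier: "carrier (quot_module R M N) = (\<lambda>v. N +>\<^bsub>M\<^esub> v) ` carrier M"
  by (auto simp: quot_module_def A_RCOSETS_def RCOSETS_def a_r_coset_def)

lemma quot_zero: "\<zero>\<^bsub>quot_module R M N\<^esub> = N" by (simp add: quot_module_def)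

lemma coset_eq_iff:
  assumes N: "msub N" and v: "v \<in> carrier M" and w: "w \<in> carrier M"
  shows "N +>\<^bsub>M\<^esub> v = N +>\<^bsub>M\<^esub> w \<longleftrightarrow> v \<boxminus> w \<in> N"
proof -
  interpret N: abelian_subgroup N M by (rule sub_abelian_subgroup[OF N])
  show ?thesis
  proof
    assume "N +>\<^bsub>M\<^esub> v = N +>\<^bsub>M\<^esub> w"
    then have "v \<in> N +>\<^bsub>M\<^esub> w" using N.a_rcos_self[OF v] by simp
    then show "v \<boxminus> w \<in> N" using N.a_rcos_module_imp[OF w] by (simp add: M.minus_eq)
  next
    assume "v \<boxminus> w \<in> N"
    then have "v \<in> N +>\<^bsub>M\<^esub> w" using N.a_rcos_module_rev[OF w v] by (simp add: M.minus_eq)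
    then show "N +>\<^bsub>M\<^esub> v = N +>\<^bsub>M\<^esub> w" using N.a_repr_independence'[OF _ w] by simp
  qed
qed

lemma coset_zero: assumes N: "msub N" shows "N +>\<^bsub>M\<^esub> \<zero>\<^bsub>M\<^esub> = N"
proof -
  have "\<zero>\<^bsub>M\<^esub> \<in> N" using N by simp
  then show ?thesis using sub_carr[OF N] by (auto simp: a_r_coset_def')
qed

lemma coset_eq_self_iff: "msub N \<Longrightarrow> v \<in> carrier M \<Longrightarrow> N +>\<^bsub>M\<^esub> v = N \<longleftrightarrow> v \<in> N"
  using coset_eq_iff[of N v "\<zero>\<^bsub>M\<^esub>"] coset_zero[of N] by (simp add: M.minus_eq)

lemma quot_add:
  assumes "msub N" "v \<in> carrier M" "w \<in> carrier M"
  shows "(N +>\<^bsub>M\<^esub> v) \<oplus>\<^bsub>quot_module R M N\<^esub> (N +>\<^bsub>M\<^esub> w) = N +>\<^bsub>M\<^esub> (v \<boxplus> w)"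
  using abelian_subgroup.a_rcos_sum[OF sub_abelian_subgroup] assms by (simp add: quot_module_def)

lemma quot_smult:
  assumes N: "msub N" and a: "a \<in> carrier R" and v: "v \<in> carrier M"
  shows "a \<odot>\<^bsub>quot_module R M N\<^esub> (N +>\<^bsub>M\<^esub> v) = N +>\<^bsub>M\<^esub> (a \<bullet> v)"
proof -
  interpret N: abelian_subgroup N M by (rule sub_abelian_subgroup[OF N])
  have "N +>\<^bsub>M\<^esub> (a \<bullet> g) = N +>\<^bsub>M\<^esub> (a \<bullet> v)" if g: "g \<in> N +>\<^bsub>M\<^esub> v" for g
  proof -
    have gc: "g \<in> carrier M" by (rule N.a_elemrcos_carrier[OF v g])
    have "g \<boxminus> v \<in> N" using N.a_rcos_module_imp[OF v g] by (simp add: M.minus_eq)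
    then have "a \<bullet> (g \<boxminus> v) \<in> N" using sub_smult[OF N a] by blast
    moreover have "a \<bullet> (g \<boxminus> v) = a \<bullet> g \<boxminus> a \<bullet> v" using a gc v by algebra
    ultimately show ?thesis using coset_eq_iff[OF N, of "a \<bullet> g" "a \<bullet> v"] a gc v by simp
  qed
  then have "(\<Union>g\<in>N +>\<^bsub>M\<^esub> v. N +>\<^bsub>M\<^esub> (a \<bullet> g)) = N +>\<^bsub>M\<^esub> (a \<bullet> v)"
    using N.a_rcos_self[OF v] by blast
  then show ?thesis by (simp add: quot_module_def)
qed

lemma module_quot_module:
  assumes N: "msub N" shows "module R (quot_module R M N)"
proof -
  let ?Q = "quot_module R M N"
  have ex: "\<exists>v\<in>carrier M. p = N +>\<^bsub>M\<^esub> v" if "p \<in> carrier ?Q" for p using that quot_carrier by blast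
  have zero: "\<zero>\<^bsub>?Q\<^esub> = N +>\<^bsub>M\<^esub> \<zero>\<^bsub>M\<^esub>" using coset_zero[OF N] by (simp add: quot_zero)
  show ?thesis
  proof (rule moduleI[OF R.is_cring])
    show "abelian_group ?Q"
    proof (rule abelian_groupI)
      show "\<zero>\<^bsub>?Q\<^esub> \<in> carrier ?Q" unfolding zero quot_carrier by simp
    next
      fix p q assume "p \<in> carrier ?Q" "q \<in> carrier ?Q"
      then obtain v w where "v \<in> carrier M" "p = N +>\<^bsub>M\<^esub> v" "w \<in> carrier M" "q = N +>\<^bsub>M\<^esub> w" using ex by meson
      then show "p \<oplus>\<^bsub>?Q\<^esub> q \<in> carrier ?Q" "p \<oplus>\<^bsub>?Q\<^esub> q = q \<oplus>\<^bsub>?Q\<^esub> p"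
        using quot_add[OF N] by (auto simp: quot_carrier M.a_comm)
    next
      fix p q t assume "p \<in> carrier ?Q" "q \<in> carrier ?Q" "t \<in> carrier ?Q"
      then obtain v w y where "v \<in> carrier M" "p = N +>\<^bsub>M\<^esub> v" "w \<in> carrier M" "q = N +>\<^bsub>M\<^esub> w"
        "y \<in> carrier M" "t = N +>\<^bsub>M\<^esub> y" using ex by meson
      then show "p \<oplus>\<^bsub>?Q\<^esub> q \<oplus>\<^bsub>?Q\<^esub> t = p \<oplus>\<^bsub>?Q\<^esub> (q \<oplus>\<^bsub>?Q\<^esub> t)" using quot_add[OF N] by (simp add: M.a_assoc)
    next
      fix p assume "p \<in> carrier ?Q"
      then obtain v where v: "v \<in> carrier M" "p = N +>\<^bsub>M\<^esub> v" using ex by meson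
      then show "\<zero>\<^bsub>?Q\<^esub> \<oplus>\<^bsub>?Q\<^esub> p = p" unfolding zero using quot_add[OF N] by simp
      have "(N +>\<^bsub>M\<^esub> (\<ominus>\<^bsub>M\<^esub> v)) \<oplus>\<^bsub>?Q\<^esub> p = \<zero>\<^bsub>?Q\<^esub>" unfolding zero using quot_add[OF N] v by (simp add: M.l_neg)
      then show "\<exists>q\<in>carrier ?Q. q \<oplus>\<^bsub>?Q\<^esub> p = \<zero>\<^bsub>?Q\<^esub>" using v by (auto simp: quot_carrier)
    qed
  next
    fix a p assume a: "a \<in> carrier R" and "p \<in> carrier ?Q"
    then obtain v where v: "v \<in> carrier M" "p = N +>\<^bsub>M\<^esub> v" using ex by meson
    then show "a \<odot>\<^bsub>?Q\<^esub> p \<in> carrier ?Q" using quot_smult[OF N a] a by (auto simp: quot_carrier)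
    {
      fix b assume "b \<in> carrier R"
      then show "(a \<oplus> b) \<odot>\<^bsub>?Q\<^esub> p = a \<odot>\<^bsub>?Q\<^esub> p \<oplus>\<^bsub>?Q\<^esub> b \<odot>\<^bsub>?Q\<^esub> p" "a \<otimes> b \<odot>\<^bsub>?Q\<^esub> p = a \<odot>\<^bsub>?Q\<^esub> (b \<odot>\<^bsub>?Q\<^esub> p)"
        using a v quot_smult[OF N] quot_add[OF N] by (simp_all add: smult_l_distr smult_assoc1)
    }
    fix q assume "q \<in> carrier ?Q"
    then obtain w where "w \<in> carrier M" "q = N +>\<^bsub>M\<^esub> w" using ex by meson
    then show "a \<odot>\<^bsub>?Q\<^esub> (p \<oplus>\<^bsub>?Q\<^esub> q) = a \<odot>\<^bsub>?Q\<^esub> p \<oplus>\<^bsub>?Q\<^esub> a \<odot>\<^bsub>?Q\<^esub> q"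
      using a v quot_smult[OF N] quot_add[OF N] by (simp add: smult_r_distr)
  next
    fix p assume "p \<in> carrier ?Q"
    then obtain v where "v \<in> carrier M" "p = N +>\<^bsub>M\<^esub> v" using ex by meson
    then show "\<one> \<odot>\<^bsub>?Q\<^esub> p = p" using quot_smult[OF N] by simp
  qed
qed

lemma fun_module_simps:
  "carrier (fun_module I H M) = H" "zero (fun_module I H M) = (\<lambda>x\<in>I. \<zero>\<^bsub>M\<^esub>)"
  "add (fun_module I H M) = (\<lambda>f g. \<lambda>x\<in>I. f x \<boxplus> g x)"
  "smult (fun_module I H M) = (\<lambda>a f. \<lambda>x\<in>I. a \<bullet> f x)"
  by (simp_all add: fun_module_def)

lemma module_fun_module:
  assumes H: "H \<subseteq> I \<rightarrow>\<^sub>E carrier M" and zero: "(\<lambda>x\<in>I. \<zero>\<^bsub>M\<^esub>) \<in> H"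
    and add: "\<And>f g. f \<in> H \<Longrightarrow> g \<in> H \<Longrightarrow> (\<lambda>x\<in>I. f x \<boxplus> g x) \<in> H"
    and smult: "\<And>a f. a \<in> carrier R \<Longrightarrow> f \<in> H \<Longrightarrow> (\<lambda>x\<in>I. a \<bullet> f x) \<in> H"
  shows "module R (fun_module I H M)"
proof (rule moduleI[OF R.is_cring])
  let ?F = "fun_module I H M"
  have fc: "f x \<in> carrier M" if "f \<in> H" "x \<in> I" for f x using that H by blast
  have ext: "(\<lambda>x\<in>I. f x) = f" if "f \<in> H" for f
    by (rule PiE_restrict[OF subsetD[OF H that]])
  show "abelian_group ?F"
  proof (rule abelian_groupI; unfold fun_module_simps)
    fix f g assume f: "f \<in> H" and g: "g \<in> H"
    then show "(\<lambda>x\<in>I. f x \<boxplus> g x) \<in> H" by (rule add)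
    show "(\<lambda>x\<in>I. f x \<boxplus> g x) = (\<lambda>x\<in>I. g x \<boxplus> f x)"
      by (rule restrict_ext) (use f g fc in \<open>simp add: M.a_comm\<close>)
  next
    show "(\<lambda>x\<in>I. \<zero>\<^bsub>M\<^esub>) \<in> H" by (rule zero)
  next
    fix f g h assume "f \<in> H" "g \<in> H" "h \<in> H"
    then show "(\<lambda>x\<in>I. (\<lambda>x\<in>I. f x \<boxplus> g x) x \<boxplus> h x) = (\<lambda>x\<in>I. f x \<boxplus> (\<lambda>x\<in>I. g x \<boxplus> h x) x)"
      using fc by (intro restrict_ext) (simp add: M.a_assoc)
  next
    fix f assume f: "f \<in> H"
    have "(\<lambda>x\<in>I. (\<lambda>x\<in>I. \<zero>\<^bsub>M\<^esub>) x \<boxplus> f x) = (\<lambda>x\<in>I. f x)" by (rule restrict_ext) (use f fc in simp)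
    then show "(\<lambda>x\<in>I. (\<lambda>x\<in>I. \<zero>\<^bsub>M\<^esub>) x \<boxplus> f x) = f" using ext[OF f] by simp
    have "(\<lambda>x\<in>I. (\<lambda>x\<in>I. (\<ominus> \<one>) \<bullet> f x) x \<boxplus> f x) = (\<lambda>x\<in>I. \<zero>\<^bsub>M\<^esub>)"
      by (rule restrict_ext) (use f fc in \<open>simp add: smult_l_minus M.l_neg\<close>)
    then show "\<exists>g\<in>H. (\<lambda>x\<in>I. g x \<boxplus> f x) = (\<lambda>x\<in>I. \<zero>\<^bsub>M\<^esub>)"
      by (rule bexI[OF _ smult[OF R.a_inv_closed[OF R.one_closed] f]])
  qed
next
  fix f assume "f \<in> carrier (fun_module I H M)"
  then have f: "f \<in> I \<rightarrow>\<^sub>E carrier M" using H by (auto simp: fun_module_simps)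
  have "(\<lambda>x\<in>I. \<one> \<bullet> f x) = (\<lambda>x\<in>I. f x)" by (rule restrict_ext) (use PiE_mem[OF f] in auto)
  also have "\<dots> = f" by (rule PiE_restrict[OF f])
  finally show "\<one> \<odot>\<^bsub>fun_module I H M\<^esub> f = f" by (simp add: fun_module_simps)
qed (use H smult in \<open>auto simp: fun_module_simps smult_l_distr smult_r_distr smult_assoc1 PiE_def Pi_def subset_iff intro!: restrict_ext\<close>)

end

lemma lin_mapsD:
  assumes "f \<in> lin_maps R M N"
  shows "x \<in> carrier M \<Longrightarrow> f x \<in> carrier N"
    "x \<in> carrier M \<Longrightarrow> y \<in> carrier M \<Longrightarrow> f (x \<oplus>\<^bsub>M\<^esub> y) = f x \<oplus>\<^bsub>N\<^esub> f y"
    "a \<in> carrier R \<Longrightarrow> x \<in> carrier M \<Longrightarrow> f (a \<odot>\<^bsub>M\<^esub> x) = a \<odot>\<^bsub>N\<^esub> f x"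
  using assms by (auto simp: lin_maps_def)

lemma lin_maps_props:
  assumes M: "module R M" and N: "module R N" and f: "f \<in> lin_maps R M N"
  shows "x \<in> carrier M \<Longrightarrow> f x \<in> carrier N"
    "x \<in> carrier M \<Longrightarrow> y \<in> carrier M \<Longrightarrow> f (x \<oplus>\<^bsub>M\<^esub> y) = f x \<oplus>\<^bsub>N\<^esub> f y"
    "a \<in> carrier R \<Longrightarrow> x \<in> carrier M \<Longrightarrow> f (a \<odot>\<^bsub>M\<^esub> x) = a \<odot>\<^bsub>N\<^esub> f x"
    "f \<zero>\<^bsub>M\<^esub> = \<zero>\<^bsub>N\<^esub>"
    "x \<in> carrier M \<Longrightarrow> y \<in> carrier M \<Longrightarrow> f (x \<ominus>\<^bsub>M\<^esub> y) = f x \<ominus>\<^bsub>N\<^esub> f y"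
proof -
  interpret M: module R M by (rule M)
  interpret N: module R N by (rule N)
  note F = lin_mapsD[OF f]
  show "x \<in> carrier M \<Longrightarrow> f x \<in> carrier N" "x \<in> carrier M \<Longrightarrow> y \<in> carrier M \<Longrightarrow> f (x \<oplus>\<^bsub>M\<^esub> y) = f x \<oplus>\<^bsub>N\<^esub> f y"
    "a \<in> carrier R \<Longrightarrow> x \<in> carrier M \<Longrightarrow> f (a \<odot>\<^bsub>M\<^esub> x) = a \<odot>\<^bsub>N\<^esub> f x" by (fact F)+
  have "f (\<zero>\<^bsub>R\<^esub> \<odot>\<^bsub>M\<^esub> \<zero>\<^bsub>M\<^esub>) = \<zero>\<^bsub>R\<^esub> \<odot>\<^bsub>N\<^esub> f \<zero>\<^bsub>M\<^esub>" by (rule F(3)) simp_all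
  then show "f \<zero>\<^bsub>M\<^esub> = \<zero>\<^bsub>N\<^esub>" using F(1) by simp
  assume xy: "x \<in> carrier M" "y \<in> carrier M"
  have "f (x \<oplus>\<^bsub>M\<^esub> (\<ominus>\<^bsub>R\<^esub> \<one>\<^bsub>R\<^esub>) \<odot>\<^bsub>M\<^esub> y) = f x \<oplus>\<^bsub>N\<^esub> (\<ominus>\<^bsub>R\<^esub> \<one>\<^bsub>R\<^esub>) \<odot>\<^bsub>N\<^esub> f y"
    using F xy by simp
  then show "f (x \<ominus>\<^bsub>M\<^esub> y) = f x \<ominus>\<^bsub>N\<^esub> f y" using F xy
    by (simp add: M.smult_l_minus N.smult_l_minus M.M.minus_eq N.M.minus_eq)
qed

lemma lin_maps_closed:
  assumes M: "module R M" and N: "module R N" and f: "f \<in> lin_maps R M N"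
  shows "g \<in> lin_maps R M N \<Longrightarrow> (\<lambda>x\<in>carrier M. f x \<oplus>\<^bsub>N\<^esub> g x) \<in> lin_maps R M N"
    and "a \<in> carrier R \<Longrightarrow> (\<lambda>x\<in>carrier M. a \<odot>\<^bsub>N\<^esub> f x) \<in> lin_maps R M N"
proof -
  interpret M: module R M by (rule M)
  interpret N: module R N by (rule N)
  note F = lin_mapsD[OF f]
  show "(\<lambda>x\<in>carrier M. f x \<oplus>\<^bsub>N\<^esub> g x) \<in> lin_maps R M N" if g: "g \<in> lin_maps R M N"
    unfolding lin_maps_def using F lin_mapsD[OF g] by (auto simp: N.M.a_ac N.smult_r_distr)
  show "(\<lambda>x\<in>carrier M. a \<odot>\<^bsub>N\<^esub> f x) \<in> lin_maps R M N" if a: "a \<in> carrier R"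
  proof -
    have "a \<odot>\<^bsub>N\<^esub> (b \<odot>\<^bsub>N\<^esub> f x) = b \<odot>\<^bsub>N\<^esub> (a \<odot>\<^bsub>N\<^esub> f x)" if "b \<in> carrier R" "x \<in> carrier M" for b x
      using F(1)[OF that(2)] a that(1) by (simp add: N.smult_assoc1[symmetric] M.R.m_comm)
    then show ?thesis unfolding lin_maps_def using F a by (auto simp: N.smult_r_distr)
  qed
qed

lemma module_hom_module:
  assumes M: "module R M" and N: "module R N"
  shows "module R (hom_module R M N)"
proof -
  interpret M: module R M by (rule M)
  interpret N: module R N by (rule N)
  show ?thesis unfolding hom_module_def
    by (rule N.module_fun_module; (rule lin_maps_closed[OF M N])?) (auto simp: lin_maps_def)
qed

context module
begin

lemma lin_map_image_sub:
  assumes N: "module R N" and f: "f \<in> lin_maps R N M" shows "msub (f ` carrier N)"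
proof -
  interpret N: module R N by (rule N)
  note p = lin_maps_props[OF N module_axioms f]
  show ?thesis
  proof (rule submoduleI')
    show "\<zero>\<^bsub>M\<^esub> \<in> f ` carrier N" using p(4) by (metis N.M.zero_closed imageI)
    fix a b assume "a \<in> f ` carrier N" "b \<in> f ` carrier N"
    then show "a \<boxplus> b \<in> f ` carrier N" using p(2) by (auto simp: image_iff) (metis N.M.a_closed)
  next
    fix a b assume "a \<in> carrier R" "b \<in> f ` carrier N"
    then show "a \<bullet> b \<in> f ` carrier N" using p(3) by (auto simp: image_iff) (metis N.smult_closed)
  qed (use p(1) in auto)
qed

lemma lin_map_kernel_sub:
  assumes N: "module R N" and f: "f \<in> lin_maps R M N" shows "msub {v \<in> carrier M. f v = \<zero>\<^bsub>N\<^esub>}"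
proof -
  interpret N: module R N by (rule N)
  show ?thesis using lin_maps_props[OF module_axioms N f] by (intro submoduleI') auto
qed

end

section \<open>Multilinear maps and tensor powers\<close>

context cring
begin

lemma free_module_simps:
  "carrier (free_module R I) = {f \<in> I \<rightarrow>\<^sub>E carrier R. finite {x \<in> I. f x \<noteq> \<zero>}}"
  "zero (free_module R I) = (\<lambda>x\<in>I. \<zero>)"
  "add (free_module R I) = (\<lambda>f g. \<lambda>x\<in>I. f x \<oplus> g x)"
  "smult (free_module R I) = (\<lambda>a f. \<lambda>x\<in>I. a \<otimes> f x)"
  by (simp_all add: free_module_def fun_module_def)

lemma free_module_add_closed:
  assumes "f \<in> carrier (free_module R I)" "g \<in> carrier (free_module R I)"
  shows "(\<lambda>x\<in>I. f x \<oplus> g x) \<in> carrier (free_module R I)"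
proof -
  have "{x \<in> I. (\<lambda>x\<in>I. f x \<oplus> g x) x \<noteq> \<zero>} \<subseteq> {x \<in> I. f x \<noteq> \<zero>} \<union> {x \<in> I. g x \<noteq> \<zero>}" by auto
  then have "finite {x \<in> I. (\<lambda>x\<in>I. f x \<oplus> g x) x \<noteq> \<zero>}"
    by (rule finite_subset) (use assms in \<open>auto simp: free_module_simps\<close>)
  then show ?thesis using assms by (auto simp: free_module_simps)
qed

lemma free_module_smult_closed:
  assumes "f \<in> carrier (free_module R I)" "a \<in> carrier R"
  shows "(\<lambda>x\<in>I. a \<otimes> f x) \<in> carrier (free_module R I)"
proof -
  have "{x \<in> I. (\<lambda>x\<in>I. a \<otimes> f x) x \<noteq> \<zero>} \<subseteq> {x \<in> I. f x \<noteq> \<zero>}" using assms by auto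
  then have "finite {x \<in> I. (\<lambda>x\<in>I. a \<otimes> f x) x \<noteq> \<zero>}"
    by (rule finite_subset) (use assms in \<open>auto simp: free_module_simps\<close>)
  then show ?thesis using assms by (auto simp: free_module_simps)
qed

lemma free_module_funcset: "f \<in> carrier (free_module R I) \<Longrightarrow> f \<in> I \<rightarrow>\<^sub>E carrier R"
  by (simp add: free_module_simps)

lemma free_module_mem: "f \<in> carrier (free_module R I) \<Longrightarrow> x \<in> I \<Longrightarrow> f x \<in> carrier R"
  using free_module_funcset by blast

lemma free_module_eqI:
  "f \<in> I \<rightarrow>\<^sub>E S \<Longrightarrow> g \<in> I \<rightarrow>\<^sub>E T \<Longrightarrow> (\<And>x. x \<in> I \<Longrightarrow> f x = g x) \<Longrightarrow> f = g"
  by (rule ext) (metis PiE_E)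

lemma module_free_module: "module R (free_module R I)"
proof -
  interpret S: module R "self_module R" by (rule module_self)
  show ?thesis unfolding free_module_def
  proof (rule S.module_fun_module)
    fix f g a assume f: "f \<in> {f \<in> I \<rightarrow>\<^sub>E carrier R. finite {x \<in> I. f x \<noteq> \<zero>}}"
    show "(\<lambda>x\<in>I. f x \<oplus>\<^bsub>self_module R\<^esub> g x) \<in> {f \<in> I \<rightarrow>\<^sub>E carrier R. finite {x \<in> I. f x \<noteq> \<zero>}}"
      if "g \<in> {f \<in> I \<rightarrow>\<^sub>E carrier R. finite {x \<in> I. f x \<noteq> \<zero>}}"
      using free_module_add_closed[of f I g] f that by (simp add: free_module_simps(1))
    show "(\<lambda>x\<in>I. a \<odot>\<^bsub>self_module R\<^esub> f x) \<in> {f \<in> I \<rightarrow>\<^sub>E carrier R. finite {x \<in> I. f x \<noteq> \<zero>}}"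
      if "a \<in> carrier R"
      using free_module_smult_closed[of f I a] f that by (simp add: free_module_simps(1))
  qed auto
qed

lemma free_gen_carrier: "x \<in> I \<Longrightarrow> free_gen R I x \<in> carrier (free_module R I)"
proof -
  have "{y \<in> I. free_gen R I x y \<noteq> \<zero>} \<subseteq> {x}" by (auto simp: free_gen_def)
  then have "finite {y \<in> I. free_gen R I x y \<noteq> \<zero>}" by (rule finite_subset) simp
  then show ?thesis by (auto simp: free_module_simps free_gen_def)
qed

definition lin_ext :: "'x set \<Rightarrow> ('x \<Rightarrow> 'a) \<Rightarrow> ('x \<Rightarrow> 'a) \<Rightarrow> 'a"
  where "lin_ext I l f = (\<Oplus>x\<in>{x \<in> I. f x \<noteq> \<zero>}. f x \<otimes> l x)"

text \<open>Lets the sums for \<open>f\<close>, \<open>g\<close> and \<open>f + g\<close>, which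
  have different supports, be taken over one finite set.\<close>

lemma lin_ext_superset:
  assumes f: "f \<in> carrier (free_module R I)" and l: "l \<in> I \<rightarrow> carrier R"
    and B: "finite B" "{x \<in> I. f x \<noteq> \<zero>} \<subseteq> B" "B \<subseteq> I"
  shows "lin_ext I l f = (\<Oplus>x\<in>B. f x \<otimes> l x)"
  unfolding lin_ext_def
  by (rule add.finprod_mono_neutral_cong_left[OF B(1,2)])
     (use free_module_mem[OF f] funcset_mem[OF l] B in auto)

lemma lin_ext_closed:
  assumes f: "f \<in> carrier (free_module R I)" and l: "l \<in> I \<rightarrow> carrier R"
  shows "lin_ext I l f \<in> carrier R"
  unfolding lin_ext_def by (rule finsum_closed) (use free_module_funcset[OF f] l in auto)

lemma lin_ext_add:
  assumes f: "f \<in> carrier (free_module R I)" and g: "g \<in> carrier (free_module R I)" and l: "l \<in> I \<rightarrow> carrier R"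
  shows "lin_ext I l (f \<oplus>\<^bsub>free_module R I\<^esub> g) = lin_ext I l f \<oplus> lin_ext I l g"
proof -
  interpret F: module R "free_module R I" by (rule module_free_module)
  let ?h = "f \<oplus>\<^bsub>free_module R I\<^esub> g"
  have h: "?h \<in> carrier (free_module R I)" using f g by simp
  let ?B = "{x \<in> I. f x \<noteq> \<zero>} \<union> {x \<in> I. g x \<noteq> \<zero>} \<union> {x \<in> I. ?h x \<noteq> \<zero>}"
  have B: "finite ?B" "?B \<subseteq> I" using f g h by (auto simp: free_module_simps(1))
  have "lin_ext I l ?h = (\<Oplus>x\<in>?B. ?h x \<otimes> l x)" by (rule lin_ext_superset[OF h l B(1) _ B(2)]) auto
  also have "\<dots> = (\<Oplus>x\<in>?B. f x \<otimes> l x \<oplus> g x \<otimes> l x)"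
  proof (rule finsum_cong')
    fix x assume x: "x \<in> ?B"
    then have "x \<in> I" by blast
    then show "?h x \<otimes> l x = f x \<otimes> l x \<oplus> g x \<otimes> l x"
      using free_module_mem[OF f] free_module_mem[OF g] funcset_mem[OF l]
      by (simp add: free_module_simps(3) l_distr)
  qed (use free_module_mem[OF f] free_module_mem[OF g] funcset_mem[OF l] in auto)
  also have "\<dots> = (\<Oplus>x\<in>?B. f x \<otimes> l x) \<oplus> (\<Oplus>x\<in>?B. g x \<otimes> l x)"
    by (rule finsum_addf) (use free_module_mem[OF f] free_module_mem[OF g] funcset_mem[OF l] in auto)
  also have "(\<Oplus>x\<in>?B. f x \<otimes> l x) = lin_ext I l f" by (rule lin_ext_superset[OF f l B(1) _ B(2), symmetric]) auto
  also have "(\<Oplus>x\<in>?B. g x \<otimes> l x) = lin_ext I l g" by (rule lin_ext_superset[OF g l B(1) _ B(2), symmetric]) auto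
  finally show ?thesis .
qed

lemma lin_ext_smult:
  assumes f: "f \<in> carrier (free_module R I)" and a: "a \<in> carrier R" and l: "l \<in> I \<rightarrow> carrier R"
  shows "lin_ext I l (a \<odot>\<^bsub>free_module R I\<^esub> f) = a \<otimes> lin_ext I l f"
proof -
  interpret F: module R "free_module R I" by (rule module_free_module)
  let ?h = "a \<odot>\<^bsub>free_module R I\<^esub> f"
  have h: "?h \<in> carrier (free_module R I)" using f a by simp
  let ?B = "{x \<in> I. f x \<noteq> \<zero>} \<union> {x \<in> I. ?h x \<noteq> \<zero>}"
  have B: "finite ?B" "?B \<subseteq> I" using f h by (auto simp: free_module_simps(1))
  have "lin_ext I l ?h = (\<Oplus>x\<in>?B. ?h x \<otimes> l x)" by (rule lin_ext_superset[OF h l B(1) _ B(2)]) auto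
  also have "\<dots> = (\<Oplus>x\<in>?B. a \<otimes> (f x \<otimes> l x))"
  proof (rule finsum_cong')
    fix x assume x: "x \<in> ?B"
    then have "x \<in> I" by blast
    then show "?h x \<otimes> l x = a \<otimes> (f x \<otimes> l x)"
      using free_module_mem[OF f] funcset_mem[OF l] a
      by (simp add: free_module_simps(4) m_assoc)
  qed (use free_module_mem[OF f] funcset_mem[OF l] a in auto)
  also have "\<dots> = a \<otimes> (\<Oplus>x\<in>?B. f x \<otimes> l x)"
    by (rule finsum_rdistr[symmetric]) (use free_module_mem[OF f] funcset_mem[OF l] a B in auto)
  also have "(\<Oplus>x\<in>?B. f x \<otimes> l x) = lin_ext I l f" by (rule lin_ext_superset[OF f l B(1) _ B(2), symmetric]) auto
  finally show ?thesis .
qed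

lemma lin_ext_gen:
  assumes x: "x \<in> I" and l: "l \<in> I \<rightarrow> carrier R"
  shows "lin_ext I l (free_gen R I x) = l x"
proof -
  have "lin_ext I l (free_gen R I x) = (\<Oplus>y\<in>{x}. free_gen R I x y \<otimes> l y)"
    by (rule lin_ext_superset[OF free_gen_carrier[OF x] l]) (use x in \<open>auto simp: free_gen_def\<close>)
  also have "\<dots> = l x" using x funcset_mem[OF l x] by (subst finsum_insert) (auto simp: free_gen_def)
  finally show ?thesis .
qed

lemma lin_ext_diff:
  assumes f: "f \<in> carrier (free_module R I)" and g: "g \<in> carrier (free_module R I)" and l: "l \<in> I \<rightarrow> carrier R"
  shows "lin_ext I l (f \<ominus>\<^bsub>free_module R I\<^esub> g) = lin_ext I l f \<ominus> lin_ext I l g"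
proof -
  interpret F: module R "free_module R I" by (rule module_free_module)
  let ?F = "free_module R I"
  have d: "f \<ominus>\<^bsub>?F\<^esub> g \<in> carrier ?F" using f g by simp
  have "lin_ext I l f = lin_ext I l ((f \<ominus>\<^bsub>?F\<^esub> g) \<oplus>\<^bsub>?F\<^esub> g)" using f g by (simp add: F.M.minus_eq F.M.a_assoc F.M.l_neg)
  also have "\<dots> = lin_ext I l (f \<ominus>\<^bsub>?F\<^esub> g) \<oplus> lin_ext I l g" by (rule lin_ext_add[OF d g l])
  finally show ?thesis using lin_ext_closed[OF d l] lin_ext_closed[OF g l] by (simp add: minus_eq a_assoc r_neg)
qed

end

definition multilinear :: "('a, 'r) ring_scheme \<Rightarrow> ('a, 'm, 's) module_scheme \<Rightarrow> nat \<Rightarrow> ((nat \<Rightarrow> 'm) \<Rightarrow> 'a) \<Rightarrow> bool"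
  where "multilinear R M n l \<longleftrightarrow> (\<forall>x \<in> {..<n} \<rightarrow>\<^sub>E carrier M. l x \<in> carrier R \<and>
    (\<forall>i<n. \<forall>u\<in>carrier M.
      (\<forall>v\<in>carrier M. l (x(i := u \<oplus>\<^bsub>M\<^esub> v)) = l (x(i := u)) \<oplus>\<^bsub>R\<^esub> l (x(i := v))) \<and>
      (\<forall>a\<in>carrier R. l (x(i := a \<odot>\<^bsub>M\<^esub> u)) = a \<otimes>\<^bsub>R\<^esub> l (x(i := u)))))"

lemma fun_upd_PiE_lessThan:
  "x \<in> {..<n::nat} \<rightarrow>\<^sub>E S \<Longrightarrow> i < n \<Longrightarrow> u \<in> S \<Longrightarrow> x(i := u) \<in> {..<n} \<rightarrow>\<^sub>E S"
  by (auto simp: PiE_def extensional_def)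

lemma dual_module_simps:
  "carrier (dual_module R M) = lin_maps R M (self_module R)"
  "f \<oplus>\<^bsub>dual_module R M\<^esub> g = (\<lambda>x\<in>carrier M. f x \<oplus>\<^bsub>self_module R\<^esub> g x)"
  "a \<odot>\<^bsub>dual_module R M\<^esub> f = (\<lambda>x\<in>carrier M. a \<odot>\<^bsub>self_module R\<^esub> f x)"
  by (simp_all add: dual_module_def hom_module_def fun_module_def)

context module
begin

context
  fixes n :: nat
begin

abbreviation (input) "tuples \<equiv> {..<n} \<rightarrow>\<^sub>E carrier M"
abbreviation (input) "FM \<equiv> free_module R tuples"
abbreviation (input) "NM \<equiv> mod_span R FM (tensor_rels R M n)"
abbreviation (input) "TM \<equiv> tensor_power R M n"

lemma tensor_rels_carrier: "tensor_rels R M n \<subseteq> carrier FM"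
proof -
  interpret F: module R FM by (rule R.module_free_module)
  have e: "free_gen R tuples (x(i := u)) \<in> carrier FM" if "x \<in> tuples" "i < n" "u \<in> carrier M" for x i u
    by (rule R.free_gen_carrier[OF fun_upd_PiE_lessThan[OF that]])
  show ?thesis unfolding tensor_rels_def Let_def
    by (intro Un_least subsetI; elim CollectE exE conjE; hypsubst)
       (rule F.M.minus_closed F.M.a_closed F.smult_closed e M.a_closed smult_closed; assumption?)+
qed

lemma tensor_rels_submodule: "submodule NM R FM"
proof -
  interpret F: module R FM by (rule R.module_free_module)
  show ?thesis by (rule F.mod_span_sub[OF tensor_rels_carrier])
qed

lemma tensor_power_eq: "TM = quot_module R FM NM" by (simp add: tensor_power_def Let_def)

lemma module_tensor_power: "module R TM"
  unfolding tensor_power_eq by (rule module.module_quot_module[OF R.module_free_module tensor_rels_submodule])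

abbreviation (input) "tclass f \<equiv> NM +>\<^bsub>FM\<^esub> f"

lemma tensor_carrier: "carrier TM = tclass ` carrier FM"
  unfolding tensor_power_eq by (rule module.quot_carrier[OF R.module_free_module])

lemmas tensor_add = module.quot_add[OF R.module_free_module tensor_rels_submodule, folded tensor_power_eq]
  and tensor_smult = module.quot_smult[OF R.module_free_module tensor_rels_submodule, folded tensor_power_eq]
  and tclass_eq_iff = module.coset_eq_iff[OF R.module_free_module tensor_rels_submodule]

text \<open>The linear extension of \<open>l\<close> to the free module on tuples kills the
  relations because \<open>l\<close> is multilinear, so it descends to their quotient.\<close>

lemma tensor_universal:
  assumes l: "multilinear R M n l"
  shows "\<exists>h \<in> lin_maps R TM (self_module R). \<forall>x\<in>tuples. h (tclass (free_gen R tuples x)) = l x"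
proof -
  interpret F: module R FM by (rule R.module_free_module)
  have lc: "l \<in> tuples \<rightarrow> carrier R" using l by (auto simp: multilinear_def)
  let ?L = "R.lin_ext tuples l"
  let ?K = "{f \<in> carrier FM. ?L f = \<zero>}"
  have zero: "?L \<zero>\<^bsub>FM\<^esub> = \<zero>"
    using R.lin_ext_smult[OF F.M.zero_closed R.zero_closed lc] R.lin_ext_closed[OF F.M.zero_closed lc] by simp
  have "submodule ?K R FM"
    by (rule F.submoduleI') (auto simp: zero R.lin_ext_add lc R.lin_ext_smult)
  moreover have "tensor_rels R M n \<subseteq> ?K"
  proof
    fix f assume f: "f \<in> tensor_rels R M n"
    have fc: "f \<in> carrier FM" using f tensor_rels_carrier by blast
    let ?e = "free_gen R tuples"
    consider (1) x i u v where "f = ?e (x(i := u \<boxplus> v)) \<ominus>\<^bsub>FM\<^esub> (?e (x(i := u)) \<oplus>\<^bsub>FM\<^esub> ?e (x(i := v)))"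
        "x \<in> tuples" "i < n" "u \<in> carrier M" "v \<in> carrier M"
      | (2) x i a u where "f = ?e (x(i := a \<bullet> u)) \<ominus>\<^bsub>FM\<^esub> (a \<odot>\<^bsub>FM\<^esub> ?e (x(i := u)))"
        "x \<in> tuples" "i < n" "a \<in> carrier R" "u \<in> carrier M"
      using f unfolding tensor_rels_def Let_def by blast
    then have "?L f = \<zero>"
    proof cases
      case 1
      have t: "x(i := u \<boxplus> v) \<in> tuples" "x(i := u) \<in> tuples" "x(i := v) \<in> tuples"
        by (rule fun_upd_PiE_lessThan[OF 1(2,3) M.a_closed[OF 1(4,5)]], rule fun_upd_PiE_lessThan[OF 1(2,3,4)], rule fun_upd_PiE_lessThan[OF 1(2,3,5)])
      note e = R.free_gen_carrier[OF t(1)] R.free_gen_carrier[OF t(2)] R.free_gen_carrier[OF t(3)]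
      have c: "l (x(i := u)) \<in> carrier R" "l (x(i := v)) \<in> carrier R" using lc t by blast+
      have "?L f = l (x(i := u \<boxplus> v)) \<ominus> (l (x(i := u)) \<oplus> l (x(i := v)))"
        unfolding 1(1) R.lin_ext_diff[OF e(1) F.M.a_closed[OF e(2,3)] lc] R.lin_ext_add[OF e(2,3) lc]
        by (simp only: R.lin_ext_gen[OF t(1) lc] R.lin_ext_gen[OF t(2) lc] R.lin_ext_gen[OF t(3) lc])
      also have "l (x(i := u \<boxplus> v)) = l (x(i := u)) \<oplus> l (x(i := v))" using l 1 unfolding multilinear_def by blast
      also have "(l (x(i := u)) \<oplus> l (x(i := v))) \<ominus> (l (x(i := u)) \<oplus> l (x(i := v))) = \<zero>"
        unfolding R.minus_eq by (rule R.r_neg[OF R.a_closed[OF c]])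
      finally show ?thesis .
    next
      case 2
      have t: "x(i := a \<bullet> u) \<in> tuples" "x(i := u) \<in> tuples"
        by (rule fun_upd_PiE_lessThan[OF 2(2,3) smult_closed[OF 2(4,5)]], rule fun_upd_PiE_lessThan[OF 2(2,3,5)])
      note e = R.free_gen_carrier[OF t(1)] R.free_gen_carrier[OF t(2)]
      have c: "l (x(i := u)) \<in> carrier R" using lc t by blast
      have "?L f = l (x(i := a \<bullet> u)) \<ominus> a \<otimes> l (x(i := u))"
        unfolding 2(1) R.lin_ext_diff[OF e(1) F.smult_closed[OF 2(4) e(2)] lc] R.lin_ext_smult[OF e(2) 2(4) lc]
        by (simp only: R.lin_ext_gen[OF t(1) lc] R.lin_ext_gen[OF t(2) lc])
      also have "l (x(i := a \<bullet> u)) = a \<otimes> l (x(i := u))" using l 2 unfolding multilinear_def by blast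
      also have "a \<otimes> l (x(i := u)) \<ominus> a \<otimes> l (x(i := u)) = \<zero>"
        unfolding R.minus_eq by (rule R.r_neg[OF R.m_closed[OF 2(4) c]])
      finally show ?thesis .
    qed
    then show "f \<in> ?K" using fc by simp
  qed
  ultimately have NK: "NM \<subseteq> ?K" by (rule F.mod_span_min)
  define h where "h = (\<lambda>C\<in>carrier TM. ?L (SOME f. f \<in> carrier FM \<and> C = tclass f))"
  have h: "h (tclass f) = ?L f" if f: "f \<in> carrier FM" for f
  proof -
    have "\<exists>g. g \<in> carrier FM \<and> tclass f = tclass g" using f by blast
    then have g: "(SOME g. g \<in> carrier FM \<and> tclass f = tclass g) \<in> carrier FM \<and>
      tclass f = tclass (SOME g. g \<in> carrier FM \<and> tclass f = tclass g)" (is "?g \<in> _ \<and> _") by (rule someI_ex)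
    then have "f \<ominus>\<^bsub>FM\<^esub> ?g \<in> NM" using tclass_eq_iff[OF f, of ?g] by blast
    then have "?L (f \<ominus>\<^bsub>FM\<^esub> ?g) = \<zero>" using NK by blast
    then have "?L f \<ominus> ?L ?g = \<zero>" using R.lin_ext_diff[OF f _ lc] g by simp
    then have "?L f = ?L ?g" using R.lin_ext_closed[OF f lc] R.lin_ext_closed[OF _ lc, of ?g] g
      by (simp add: R.r_right_minus_eq)
    then show ?thesis using f by (simp add: h_def tensor_carrier)
  qed
  have "h \<in> lin_maps R TM (self_module R)" unfolding lin_maps_def
  proof (intro CollectI conjI ballI)
    show "h \<in> carrier TM \<rightarrow>\<^sub>E carrier (self_module R)"
    proof (rule PiE_I)
      fix C assume "C \<in> carrier TM"
      then obtain f where "f \<in> carrier FM" "C = tclass f" by (auto simp: tensor_carrier)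
      then show "h C \<in> carrier (self_module R)" using h R.lin_ext_closed[OF _ lc] by simp
    qed (simp add: h_def)
  next
    fix C D assume "C \<in> carrier TM" "D \<in> carrier TM"
    then obtain f g where f: "f \<in> carrier FM" "C = tclass f" "g \<in> carrier FM" "D = tclass g" by (auto simp: tensor_carrier)
    then show "h (C \<oplus>\<^bsub>TM\<^esub> D) = h C \<oplus>\<^bsub>self_module R\<^esub> h D"
      by (simp add: tensor_add h R.lin_ext_add lc)
  next
    fix a C assume a: "a \<in> carrier R" and "C \<in> carrier TM"
    then obtain f where f: "f \<in> carrier FM" "C = tclass f" by (auto simp: tensor_carrier)
    then show "h (a \<odot>\<^bsub>TM\<^esub> C) = a \<odot>\<^bsub>self_module R\<^esub> h C"
      using a by (simp add: tensor_smult h R.lin_ext_smult lc)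
  qed
  then show ?thesis using h[OF R.free_gen_carrier] R.lin_ext_gen[OF _ lc] by auto
qed

text \<open>If the bidual of the tensor power is free on one generator, then so is its dual, the
  module of multilinear forms.\<close>

lemma multilinear_generator:
  assumes iso: "mod_iso R (dual_module R (dual_module R TM)) (self_module R)"
  shows "\<exists>mu. multilinear R M n mu \<and>
    (\<forall>l. multilinear R M n l \<longrightarrow> (\<exists>b\<in>carrier R. \<forall>x\<in>tuples. l x = b \<otimes> mu x))"
proof -
  interpret F: module R FM by (rule R.module_free_module)
  let ?D = "dual_module R TM" and ?DD = "dual_module R (dual_module R TM)"
  obtain \<Phi> where \<Phi>: "\<Phi> \<in> lin_maps R ?DD (self_module R)" and bij: "bij_betw \<Phi> (carrier ?DD) (carrier (self_module R))"
    using iso unfolding mod_iso_def by blast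
  note P = lin_mapsD[OF \<Phi>]
  define ev where "ev C = (\<lambda>\<xi>\<in>carrier ?D. \<xi> C)" for C
  interpret T: module R TM by (rule module_tensor_power)
  interpret D: module R ?D unfolding dual_module_def by (rule module_hom_module[OF T.module_axioms R.module_self])
  interpret DD: module R ?DD unfolding dual_module_def[of R ?D] by (rule module_hom_module[OF D.module_axioms R.module_self])
  have ev: "ev C \<in> carrier ?DD" if C: "C \<in> carrier TM" for C
    unfolding dual_module_simps(1)[of R ?D] lin_maps_def
  proof (intro CollectI conjI ballI)
    show "ev C \<in> carrier ?D \<rightarrow>\<^sub>E carrier (self_module R)"
      using C by (auto simp: ev_def dual_module_simps(1) dest: lin_mapsD(1))
  next
    fix f g assume fg: "f \<in> carrier ?D" "g \<in> carrier ?D"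
    show "ev C (f \<oplus>\<^bsub>?D\<^esub> g) = ev C f \<oplus>\<^bsub>self_module R\<^esub> ev C g"
      using fg C D.M.a_closed[OF fg] by (simp add: ev_def) (simp add: dual_module_simps(2))
  next
    fix a f assume a: "a \<in> carrier R" and f: "f \<in> carrier ?D"
    show "ev C (a \<odot>\<^bsub>?D\<^esub> f) = a \<odot>\<^bsub>self_module R\<^esub> ev C f"
      using f a C D.smult_closed[OF a f] by (simp add: ev_def) (simp add: dual_module_simps(3))
  qed
  let ?e = "\<lambda>x. tclass (free_gen R tuples x)"
  have ec: "?e x \<in> carrier TM" if "x \<in> tuples" for x using R.free_gen_carrier[OF that] by (auto simp: tensor_carrier)
  have ev_add: "ev (C \<oplus>\<^bsub>TM\<^esub> D) = ev C \<oplus>\<^bsub>?DD\<^esub> ev D" if "C \<in> carrier TM" "D \<in> carrier TM" for C D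
    unfolding ev_def dual_module_simps(2) using that by (auto simp: dual_module_simps(1) lin_mapsD(2) intro!: restrict_ext)
  have ev_smult: "ev (a \<odot>\<^bsub>TM\<^esub> C) = a \<odot>\<^bsub>?DD\<^esub> ev C" if "C \<in> carrier TM" "a \<in> carrier R" for C a
    unfolding ev_def dual_module_simps(3) using that by (auto simp: dual_module_simps(1) lin_mapsD(3) intro!: restrict_ext)
  \<comment> \<open>\<Phi> is the coordinate on the bidual, and \<open>mu\<close> is the coordinate
    of the evaluation at a pure tensor.\<close>
  define mu where "mu x = \<Phi> (ev (?e x))" for x
  have mu: "multilinear R M n mu" unfolding multilinear_def
  proof (intro ballI conjI allI impI)
    fix x assume x: "x \<in> tuples"
    show "mu x \<in> carrier R" using P(1)[OF ev[OF ec[OF x]]] by (simp add: mu_def)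
    fix i u assume i: "i < n" and u: "u \<in> carrier M"
    {
      fix v assume v: "v \<in> carrier M"
      have t: "x(i := u \<boxplus> v) \<in> tuples" "x(i := u) \<in> tuples" "x(i := v) \<in> tuples"
        by (rule fun_upd_PiE_lessThan[OF x i M.a_closed[OF u v]], rule fun_upd_PiE_lessThan[OF x i u], rule fun_upd_PiE_lessThan[OF x i v])
      note e = R.free_gen_carrier[OF t(1)] R.free_gen_carrier[OF t(2)] R.free_gen_carrier[OF t(3)]
      have "free_gen R tuples (x(i := u \<boxplus> v)) \<ominus>\<^bsub>FM\<^esub>
        (free_gen R tuples (x(i := u)) \<oplus>\<^bsub>FM\<^esub> free_gen R tuples (x(i := v))) \<in> tensor_rels R M n"
        unfolding tensor_rels_def Let_def using x i u v by blast
      then have "?e (x(i := u \<boxplus> v)) = ?e (x(i := u)) \<oplus>\<^bsub>TM\<^esub> ?e (x(i := v))"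
        using tclass_eq_iff[OF e(1) F.M.a_closed[OF e(2,3)]] F.mod_span_superset tensor_add[OF e(2,3)] by auto
      then show "mu (x(i := u \<boxplus> v)) = mu (x(i := u)) \<oplus> mu (x(i := v))"
        using P(2)[OF ev[OF ec[OF t(2)]] ev[OF ec[OF t(3)]]] ev_add[OF ec[OF t(2)] ec[OF t(3)]]
        by (simp add: mu_def)
    }
    {
      fix a assume a: "a \<in> carrier R"
      have t: "x(i := a \<bullet> u) \<in> tuples" "x(i := u) \<in> tuples"
        by (rule fun_upd_PiE_lessThan[OF x i smult_closed[OF a u]], rule fun_upd_PiE_lessThan[OF x i u])
      note e = R.free_gen_carrier[OF t(1)] R.free_gen_carrier[OF t(2)]
      have "free_gen R tuples (x(i := a \<bullet> u)) \<ominus>\<^bsub>FM\<^esub>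
        (a \<odot>\<^bsub>FM\<^esub> free_gen R tuples (x(i := u))) \<in> tensor_rels R M n"
        unfolding tensor_rels_def Let_def using x i u a by blast
      then have "?e (x(i := a \<bullet> u)) = a \<odot>\<^bsub>TM\<^esub> ?e (x(i := u))"
        using tclass_eq_iff[OF e(1) F.smult_closed[OF a e(2)]] F.mod_span_superset tensor_smult[OF a e(2)] by auto
      then show "mu (x(i := a \<bullet> u)) = a \<otimes> mu (x(i := u))"
        using P(3)[OF a ev[OF ec[OF t(2)]]] ev_smult[OF ec[OF t(2)] a]
        by (simp add: mu_def)
    }
  qed
  have "\<one> \<in> \<Phi> ` carrier ?DD" using bij by (simp add: bij_betw_def)
  \<comment> \<open>The generator of the bidual, of coordinate 1. It is itself a function on linear
    forms, and its value at the form \<open>h\<close> induced by \<open>l\<close> is the factor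
    sought: \<open>l x = ev (e x) h = (mu x \<zeta>) h\<close>.\<close>
  then obtain \<zeta> where \<zeta>: "\<zeta> \<in> carrier ?DD" "\<Phi> \<zeta> = \<one>" by auto
  have gen: "\<xi> = \<Phi> \<xi> \<odot>\<^bsub>?DD\<^esub> \<zeta>" if \<xi>: "\<xi> \<in> carrier ?DD" for \<xi>
  proof -
    have a: "\<Phi> \<xi> \<in> carrier R" using P(1)[OF \<xi>] by simp
    have "\<Phi> (\<Phi> \<xi> \<odot>\<^bsub>?DD\<^esub> \<zeta>) = \<Phi> \<xi>" using P(3)[OF a \<zeta>(1)] a by (simp add: \<zeta>(2))
    moreover have "\<Phi> \<xi> \<odot>\<^bsub>?DD\<^esub> \<zeta> \<in> carrier ?DD" by (rule DD.smult_closed[OF a \<zeta>(1)])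
    ultimately show ?thesis using bij \<xi> unfolding bij_betw_def inj_on_def by metis
  qed
  show ?thesis
  proof (rule exI[of _ mu], rule conjI[OF mu], intro allI impI)
    fix l assume l: "multilinear R M n l"
    obtain h where "h \<in> lin_maps R TM (self_module R)" and hl: "\<forall>x\<in>tuples. h (?e x) = l x"
      using tensor_universal[OF l] by blast
    then have h: "h \<in> carrier ?D" by (simp only: dual_module_simps(1))
    have "\<zeta> \<in> lin_maps R ?D (self_module R)" using \<zeta>(1) by (simp only: dual_module_simps(1))
    then have b: "\<zeta> h \<in> carrier R" using lin_mapsD(1)[of \<zeta> R ?D "self_module R" h] h by simp
    have "l x = \<zeta> h \<otimes> mu x" if x: "x \<in> tuples" for x
    proof -
      have "l x = h (?e x)" by (rule hl[rule_format, OF x, symmetric])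
      also have "\<dots> = ev (?e x) h" unfolding ev_def restrict_apply'[OF h] ..
      also have "\<dots> = (\<Phi> (ev (?e x)) \<odot>\<^bsub>?DD\<^esub> \<zeta>) h" by (rule fun_cong[OF gen[OF ev[OF ec[OF x]]]])
      also have "\<dots> = (\<lambda>\<xi>\<in>carrier ?D. \<Phi> (ev (?e x)) \<odot>\<^bsub>self_module R\<^esub> \<zeta> \<xi>) h"
        by (rule fun_cong[OF dual_module_simps(3)])
      also have "\<dots> = mu x \<otimes> \<zeta> h" using h by (simp add: mu_def)
      also have "\<dots> = \<zeta> h \<otimes> mu x" by (rule R.m_comm[OF _ b]) (use P(1)[OF ev[OF ec[OF x]]] in \<open>simp add: mu_def\<close>)
      finally show ?thesis .
    qed
    then show "\<exists>b\<in>carrier R. \<forall>x\<in>tuples. l x = b \<otimes> mu x" using b by blast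
  qed
qed

end
end

section \<open>Forms on a torsion-free module\<close>

text \<open>Linear forms without the extensionality required in \<open>lin_maps\<close>.\<close>

definition is_form :: "('a, 'r) ring_scheme \<Rightarrow> ('a, 'm, 's) module_scheme \<Rightarrow> ('m \<Rightarrow> 'a) \<Rightarrow> bool"
  where "is_form R M h \<longleftrightarrow> (\<forall>x\<in>carrier M. h x \<in> carrier R) \<and>
    (\<forall>x\<in>carrier M. \<forall>y\<in>carrier M. h (x \<oplus>\<^bsub>M\<^esub> y) = h x \<oplus>\<^bsub>R\<^esub> h y) \<and>
    (\<forall>a\<in>carrier R. \<forall>x\<in>carrier M. h (a \<odot>\<^bsub>M\<^esub> x) = a \<otimes>\<^bsub>R\<^esub> h x)"

lemma is_formD:
  assumes "is_form R M h"
  shows "x \<in> carrier M \<Longrightarrow> h x \<in> carrier R"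
    "x \<in> carrier M \<Longrightarrow> y \<in> carrier M \<Longrightarrow> h (x \<oplus>\<^bsub>M\<^esub> y) = h x \<oplus>\<^bsub>R\<^esub> h y"
    "a \<in> carrier R \<Longrightarrow> x \<in> carrier M \<Longrightarrow> h (a \<odot>\<^bsub>M\<^esub> x) = a \<otimes>\<^bsub>R\<^esub> h x"
  using assms by (auto simp: is_form_def)

context module
begin

lemma form_zero: assumes "is_form R M h" shows "h \<zero>\<^bsub>M\<^esub> = \<zero>"
  using is_formD(3)[OF assms R.zero_closed M.zero_closed] is_formD(1)[OF assms M.zero_closed] by simp

lemma form_diff:
  assumes h: "is_form R M h" and "x \<in> carrier M" "y \<in> carrier M"
  shows "h (x \<boxminus> y) = h x \<ominus> h y"
proof -
  have "h (x \<boxplus> (\<ominus> \<one>) \<bullet> y) = h x \<oplus> (\<ominus> \<one>) \<otimes> h y"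
    using is_formD[OF h] assms(2,3) by simp
  then show ?thesis using assms is_formD(1)[OF h] by (simp add: M.minus_eq R.minus_eq smult_l_minus R.l_minus)
qed

text \<open>Each generator has its own multiplier, and the product of these finitely many works for
  all of \<open>M\<close>.\<close>

lemma common_multiplier:
  assumes fg: "fin_gen R M" and U: "msub U"
    and T: "T \<subseteq> carrier R" "\<one> \<in> T" "\<And>s t. s \<in> T \<Longrightarrow> t \<in> T \<Longrightarrow> s \<otimes> t \<in> T"
    and ex: "\<And>v. v \<in> carrier M \<Longrightarrow> \<exists>t\<in>T. t \<bullet> v \<in> U"
  shows "\<exists>t\<in>T. \<forall>v\<in>carrier M. t \<bullet> v \<in> U"
proof -
  obtain S where S: "finite S" "S \<subseteq> carrier M" "mod_span R M S = carrier M"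
    using fg unfolding fin_gen_def by blast
  have "\<exists>t\<in>T. \<forall>v\<in>S'. t \<bullet> v \<in> U" if "finite S'" "S' \<subseteq> carrier M" for S'
    using that
  proof (induction S')
    case empty then show ?case using T(2) by blast
  next
    case (insert w S')
    then obtain t s where ts: "t \<in> T" "\<forall>v\<in>S'. t \<bullet> v \<in> U" "s \<in> T" "s \<bullet> w \<in> U"
      using ex[of w] by auto
    have c: "t \<in> carrier R" "s \<in> carrier R" using ts T(1) by auto
    have "(t \<otimes> s) \<bullet> v \<in> U" if v: "v \<in> insert w S'" for v
    proof -
      have vc: "v \<in> carrier M" using v insert.prems by auto
      show ?thesis
      proof (cases "v = w")
        case True
        then show ?thesis using ts c vc sub_smult[OF U c(1)] by (simp add: smult_assoc1)
      next
        case False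
        then have "s \<bullet> t \<bullet> v \<in> U" using v ts sub_smult[OF U c(2)] by auto
        then show ?thesis using c vc by (simp add: smult_assoc1[symmetric] R.m_comm)
      qed
    qed
    then show ?case using T(3)[OF ts(1,3)] by blast
  qed
  then obtain t where t: "t \<in> T" "\<forall>v\<in>S. t \<bullet> v \<in> U" using S by blast
  have tc: "t \<in> carrier R" using t T by auto
  have "msub {v \<in> carrier M. t \<bullet> v \<in> U}"
  proof (rule submoduleI')
    fix a v assume a: "a \<in> carrier R" and v: "v \<in> {v \<in> carrier M. t \<bullet> v \<in> U}"
    have "t \<bullet> a \<bullet> v = a \<bullet> t \<bullet> v" using a v tc by (simp add: smult_assoc1[symmetric] R.m_comm)
    then show "a \<bullet> v \<in> {v \<in> carrier M. t \<bullet> v \<in> U}" using a v sub_smult[OF U a] by auto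
  qed (use tc U in \<open>auto simp: smult_r_distr\<close>)
  then have "mod_span R M S \<subseteq> {v \<in> carrier M. t \<bullet> v \<in> U}" by (rule mod_span_min) (use t S in auto)
  then show ?thesis using t(1) S(3) by blast
qed

lemma multilinear_product:
  assumes f: "\<And>i. i < n \<Longrightarrow> is_form R M (f i)"
  shows "multilinear R M n (\<lambda>x. \<Otimes>\<^bsub>R\<^esub>i\<in>{..<n}. f i (x i))"
  unfolding multilinear_def
proof (intro ballI conjI allI impI)
  fix x assume x: "x \<in> {..<n} \<rightarrow>\<^sub>E carrier M"
  have xc: "x i \<in> carrier M" if "i < n" for i using x that by auto
  have fc: "f i v \<in> carrier R" if "i < n" "v \<in> carrier M" for i v using is_formD(1)[OF f[OF that(1)] that(2)] .
  show "(\<Otimes>\<^bsub>R\<^esub>i\<in>{..<n}. f i (x i)) \<in> carrier R" using xc fc by (intro R.finprod_closed) auto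
  fix j u assume j: "j < n" and u: "u \<in> carrier M"
  let ?c = "\<Otimes>\<^bsub>R\<^esub>i\<in>{..<n} - {j}. f i (x i)"
  have c: "?c \<in> carrier R" using xc fc by (intro R.finprod_closed) auto
  have split: "(\<Otimes>\<^bsub>R\<^esub>i\<in>{..<n}. f i ((x(j := v)) i)) = f j v \<otimes> ?c" if v: "v \<in> carrier M" for v
  proof -
    have "{..<n} = insert j ({..<n} - {j})" using j by auto
    then have "(\<Otimes>\<^bsub>R\<^esub>i\<in>{..<n}. f i ((x(j := v)) i)) = (\<Otimes>\<^bsub>R\<^esub>i\<in>insert j ({..<n} - {j}). f i ((x(j := v)) i))"
      by simp
    also have "\<dots> = f j ((x(j := v)) j) \<otimes> (\<Otimes>\<^bsub>R\<^esub>i\<in>{..<n} - {j}. f i ((x(j := v)) i))"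
      by (rule R.finprod_insert) (use xc fc v j in auto)
    also have "(\<Otimes>\<^bsub>R\<^esub>i\<in>{..<n} - {j}. f i ((x(j := v)) i)) = ?c"
      by (rule R.finprod_cong') (use xc fc in auto)
    finally show ?thesis by simp
  qed
  {
    fix v assume v: "v \<in> carrier M"
    show "(\<Otimes>\<^bsub>R\<^esub>i\<in>{..<n}. f i ((x(j := u \<boxplus> v)) i)) =
      (\<Otimes>\<^bsub>R\<^esub>i\<in>{..<n}. f i ((x(j := u)) i)) \<oplus> (\<Otimes>\<^bsub>R\<^esub>i\<in>{..<n}. f i ((x(j := v)) i))"
      unfolding split[OF u] split[OF v] split[OF M.a_closed[OF u v]]
      using is_formD(2)[OF f[OF j] u v] fc[OF j] u v c by (simp add: R.l_distr)
  }
  {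
    fix a assume a: "a \<in> carrier R"
    show "(\<Otimes>\<^bsub>R\<^esub>i\<in>{..<n}. f i ((x(j := a \<bullet> u)) i)) = a \<otimes> (\<Otimes>\<^bsub>R\<^esub>i\<in>{..<n}. f i ((x(j := u)) i))"
      unfolding split[OF u] split[OF smult_closed[OF a u]]
      using is_formD(3)[OF f[OF j] a u] fc[OF j] a u c by (simp add: R.m_assoc)
  }
qed

end

locale cm_module = R?: isolated_cm R mm d xs + noeth_local_module R M mm
  for R (structure) and M (structure) and mm d xs +
  fixes ws
  assumes ws_regular: "rel_regular {\<zero>\<^bsub>M\<^esub>} ws" and ws_length: "length ws = d"
    and d2: "d \<ge> 2" and M_fin_gen: "fin_gen R M"
begin

lemma zero_prime: "primeideal {\<zero>} R"
proof (rule primeidealI[OF R.zeroideal R.is_cring])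
  show "carrier R \<noteq> {\<zero>}" using one_notin_mm R.ideal_zero[OF mm_ideal] R.one_closed by (metis singletonD)
qed (use integral[OF d2] in auto)

text \<open>If \<open>a\<close> kills a nonzero \<open>v\<close>, the depth of \<open>M\<close>
  produces a chain of length \<open>d\<close> of primes containing \<open>a\<close>. The zero ideal
  is prime and strictly smaller, which makes the chain too long.\<close>

lemma torsion_free:
  assumes a: "a \<in> carrier R" "a \<noteq> \<zero>" and v: "v \<in> carrier M" and av: "a \<bullet> v = \<zero>\<^bsub>M\<^esub>"
  shows "v = \<zero>\<^bsub>M\<^esub>"
proof (rule ccontr)
  assume nz: "v \<noteq> \<zero>\<^bsub>M\<^esub>"
  have "prime_chain R {a} (length ws)"
    by (rule prime_chain_of_annihilator[OF zero_sub ws_regular v]) (use a av nz in auto)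
  then obtain P where P: "\<forall>i\<le>d. primeideal (P i) R" "\<forall>i<d. P i \<subset> P (Suc i)" "{a} \<subseteq> P 0"
    unfolding prime_chain_def ws_length by blast
  have "\<zero> \<in> P 0" using P(1) R.primeideal_props(1) R.ideal_zero by blast
  then have "{\<zero>} \<subset> P 0" using P(3) a by blast
  moreover have "prime_chain R (P 0) d" using P unfolding prime_chain_def by blast
  ultimately show False using no_prime_below[OF _ zero_prime] by blast
qed

text \<open>A projection to \<open>R w\<close> is obtained from a maximal complement. If
  \<open>N\<close> is maximal with \<open>N\<close> and \<open>R w\<close> meeting in 0, then
  \<open>M / (N + R w)\<close> is torsion, so a single \<open>t\<close> sends \<open>M\<close> into
  \<open>N + R w\<close>, and \<open>h v\<close> is the coefficient of \<open>w\<close> in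
  \<open>t v\<close>. In particular \<open>h w = t\<close>.\<close>

lemma torsionless:
  assumes w: "w \<in> carrier M" "w \<noteq> \<zero>\<^bsub>M\<^esub>"
  shows "\<exists>h. is_form R M h \<and> h w \<noteq> \<zero>"
proof -
  let ?P = "\<lambda>N. msub N \<and> (\<forall>a\<in>carrier R. a \<bullet> w \<in> N \<longrightarrow> a = \<zero>)"
  have "?P {\<zero>\<^bsub>M\<^esub>}" using torsion_free[OF _ _ w(1)] w(2) by auto
  then have "\<exists>N. ?P N \<and> (\<forall>N'. ?P N' \<longrightarrow> N \<subseteq> N' \<longrightarrow> N' = N)"
    by (rule acc_on_maximal_image[OF acc_M, of ?P _ "\<lambda>N. N"]) auto
  then obtain N where N: "msub N" "\<And>a. a \<in> carrier R \<Longrightarrow> a \<bullet> w \<in> N \<Longrightarrow> a = \<zero>"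
    and max: "\<And>N'. ?P N' \<Longrightarrow> N \<subseteq> N' \<Longrightarrow> N' = N" by blast
  let ?T = "carrier R - {\<zero>}"
  have ex: "\<exists>t\<in>?T. t \<bullet> v \<in> plus_cyclic N w" if v: "v \<in> carrier M" for v
  proof (cases "v \<in> N")
    case True
    have "\<one> \<in> ?T" using R.primeideal_props(2)[OF zero_prime] by auto
    moreover have "\<one> \<bullet> v \<in> plus_cyclic N w" using True plus_cyclic_superset[OF N(1) w(1)] v by auto
    ultimately show ?thesis by blast
  next
    case False
    then have "plus_cyclic N v \<noteq> N" using plus_cyclic_mem[OF N(1) v] by blast
    then have "\<not> ?P (plus_cyclic N v)" using max plus_cyclic_superset[OF N(1) v] by blast
    then obtain a where a: "a \<in> carrier R" "a \<bullet> w \<in> plus_cyclic N v" "a \<noteq> \<zero>"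
      using plus_cyclic_sub[OF N(1) v] by blast
    then obtain m r where mr: "a \<bullet> w = m \<boxplus> r \<bullet> v" "m \<in> N" "r \<in> carrier R" by (auto simp: plus_cyclic_def)
    have mc: "m \<in> carrier M" using N mr by auto
    have "r \<noteq> \<zero>"
    proof
      assume "r = \<zero>"
      then have "a \<bullet> w \<in> N" using mr mc v by simp
      then show False using N(2) a by blast
    qed
    moreover have "r \<bullet> v = \<ominus>\<^bsub>M\<^esub> m \<boxplus> (m \<boxplus> r \<bullet> v)" using mr(3) mc v by algebra
    then have "r \<bullet> v = \<ominus>\<^bsub>M\<^esub> m \<boxplus> a \<bullet> w" using mr(1) by simp
    then have "r \<bullet> v \<in> plus_cyclic N w" using plus_cyclicI[OF sub_neg[OF N(1) mr(2)] a(1)] by simp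
    ultimately show ?thesis using mr(3) by blast
  qed
  have "\<exists>t\<in>?T. \<forall>v\<in>carrier M. t \<bullet> v \<in> plus_cyclic N w"
    by (rule common_multiplier[OF M_fin_gen plus_cyclic_sub[OF N(1) w(1)] _ _ _ ex])
       (use R.primeideal_props(2)[OF zero_prime] integral[OF d2] in auto)
  then obtain t where t: "t \<in> carrier R" "t \<noteq> \<zero>" "\<And>v. v \<in> carrier M \<Longrightarrow> t \<bullet> v \<in> plus_cyclic N w" by blast
  then have "\<forall>v. \<exists>c. v \<in> carrier M \<longrightarrow> c \<in> carrier R \<and> (\<exists>m\<in>N. t \<bullet> v = m \<boxplus> c \<bullet> w)"
    by (fastforce simp: plus_cyclic_def)
  then obtain h where h: "\<And>v. v \<in> carrier M \<Longrightarrow> h v \<in> carrier R"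
    "\<And>v. v \<in> carrier M \<Longrightarrow> \<exists>m\<in>N. t \<bullet> v = m \<boxplus> h v \<bullet> w" by metis
  have uniq: "h v = c" if v: "v \<in> carrier M" and c: "c \<in> carrier R" and m: "m \<in> N" "t \<bullet> v = m \<boxplus> c \<bullet> w" for v c m
  proof -
    obtain m' where m': "m' \<in> N" "t \<bullet> v = m' \<boxplus> h v \<bullet> w" using h(2)[OF v] by blast
    have k: "m \<in> carrier M" "m' \<in> carrier M" "h v \<in> carrier R" using N(1) m m' h v by auto
    have "(h v \<ominus> c) \<bullet> w = (m' \<boxplus> h v \<bullet> w) \<boxminus> (m \<boxplus> c \<bullet> w) \<boxplus> (m \<boxminus> m')" using k c w(1) by algebra
    also have "\<dots> = m \<boxminus> m'" unfolding m'(2)[symmetric] m(2)[symmetric] using t(1) v k by algebra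
    finally have "(h v \<ominus> c) \<bullet> w \<in> N" using N(1) m m' by auto
    then have "h v \<ominus> c = \<zero>" using N(2) k c by blast
    then show ?thesis using k c by (simp add: R.r_right_minus_eq)
  qed
  have "is_form R M h" unfolding is_form_def
  proof (intro conjI ballI)
    fix x y assume xy: "x \<in> carrier M" "y \<in> carrier M"
    obtain m m' where m: "m \<in> N" "t \<bullet> x = m \<boxplus> h x \<bullet> w" "m' \<in> N" "t \<bullet> y = m' \<boxplus> h y \<bullet> w"
      using h(2) xy by meson
    have k: "m \<in> carrier M" "m' \<in> carrier M" "h x \<in> carrier R" "h y \<in> carrier R" using N(1) m h xy by auto
    have "t \<bullet> (x \<boxplus> y) = t \<bullet> x \<boxplus> t \<bullet> y" using t(1) xy by algebra
    also have "\<dots> = (m \<boxplus> m') \<boxplus> (h x \<oplus> h y) \<bullet> w" unfolding m(2,4) using k w(1) by algebra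
    finally show "h (x \<boxplus> y) = h x \<oplus> h y" using uniq[of "x \<boxplus> y" "h x \<oplus> h y" "m \<boxplus> m'"] xy k m N(1) by auto
  next
    fix a x assume a: "a \<in> carrier R" and x: "x \<in> carrier M"
    obtain m where m: "m \<in> N" "t \<bullet> x = m \<boxplus> h x \<bullet> w" using h(2) x by meson
    have k: "m \<in> carrier M" "h x \<in> carrier R" using N(1) m h x by auto
    have "t \<bullet> (a \<bullet> x) = a \<bullet> t \<bullet> x" using t(1) x a by algebra
    also have "\<dots> = a \<bullet> m \<boxplus> (a \<otimes> h x) \<bullet> w" unfolding m(2) using k w(1) a by algebra
    finally show "h (a \<bullet> x) = a \<otimes> h x" using uniq[of "a \<bullet> x" "a \<otimes> h x" "a \<bullet> m"] x a k m N(1) by auto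
  qed (use h in auto)
  moreover have "h w = t" using uniq[OF w(1) t(1) sub_zero[OF N(1)]] t(1) w(1) by simp
  ultimately show ?thesis using t(2) by blast
qed

lemma finprod_nonzero:
  assumes "finite S" "\<And>i. i \<in> S \<Longrightarrow> f i \<in> carrier R - {\<zero>}"
  shows "(\<Otimes>\<^bsub>R\<^esub>i\<in>S. f i) \<in> carrier R - {\<zero>}"
  using assms
proof (induction S)
  case empty then show ?case using R.primeideal_props(2)[OF zero_prime] by simp
next
  case (insert j S)
  then have "(\<Otimes>\<^bsub>R\<^esub>i\<in>insert j S. f i) = f j \<otimes> (\<Otimes>\<^bsub>R\<^esub>i\<in>S. f i)" by (intro R.finprod_insert) auto
  moreover have "f j \<in> carrier R - {\<zero>}" "(\<Otimes>\<^bsub>R\<^esub>i\<in>S. f i) \<in> carrier R - {\<zero>}" using insert by auto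
  ultimately show ?case using integral[OF d2, of "f j" "\<Otimes>\<^bsub>R\<^esub>i\<in>S. f i"] by auto
qed

text \<open>Forms multiply to multilinear forms, so when those are multiples of a single one any two
  forms are proportional, and a nonzero form is injective.\<close>

lemma rank_one:
  assumes n: "n \<ge> 1" and gen: "\<And>l. multilinear R M n l \<Longrightarrow> \<exists>b\<in>carrier R. \<forall>x\<in>{..<n} \<rightarrow>\<^sub>E carrier M. l x = b \<otimes> mu x"
    and mu: "multilinear R M n mu"
    and g: "is_form R M g" and v: "v \<in> carrier M" "g v \<noteq> \<zero>"
    and w: "w \<in> carrier M" "g w = \<zero>"
  shows "w = \<zero>\<^bsub>M\<^esub>"
proof (rule ccontr)
  assume "w \<noteq> \<zero>\<^bsub>M\<^esub>"
  then obtain h where h: "is_form R M h" "h w \<noteq> \<zero>" using torsionless[OF w(1)] by blast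
  \<comment> \<open>The products \<open>g ... g = F mu\<close> and \<open>h g ... g = B mu\<close>
    are compared at \<open>(w, v, ..., v)\<close>. The second is nonzero there, hence so is
    \<open>mu\<close>; the first vanishes, so \<open>F = 0\<close>. At \<open>(v, ..., v)\<close>
    this contradicts that \<open>g v\<close> is nonzero.\<close>
  define f where "f i = (if i = 0 then h else g)" for i :: nat
  have "multilinear R M n (\<lambda>x. \<Otimes>\<^bsub>R\<^esub>i\<in>{..<n}. g (x i))" by (rule multilinear_product) (rule g)
  from gen[OF this] obtain F where F: "F \<in> carrier R" "\<And>x. x \<in> {..<n} \<rightarrow>\<^sub>E carrier M \<Longrightarrow> (\<Otimes>\<^bsub>R\<^esub>i\<in>{..<n}. g (x i)) = F \<otimes> mu x"
    by blast
  have "multilinear R M n (\<lambda>x. \<Otimes>\<^bsub>R\<^esub>i\<in>{..<n}. f i (x i))" by (rule multilinear_product) (simp add: f_def g h)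
  from gen[OF this] obtain B where B: "B \<in> carrier R" "\<And>x. x \<in> {..<n} \<rightarrow>\<^sub>E carrier M \<Longrightarrow> (\<Otimes>\<^bsub>R\<^esub>i\<in>{..<n}. f i (x i)) = B \<otimes> mu x"
    by blast
  define x where "x = (\<lambda>i\<in>{..<n}. if i = 0 then w else v)"
  define y where "y = (\<lambda>i\<in>{..<n}. v)"
  have x: "x \<in> {..<n} \<rightarrow>\<^sub>E carrier M" and y: "y \<in> {..<n} \<rightarrow>\<^sub>E carrier M" using v w by (auto simp: x_def y_def)
  have mx: "mu x \<in> carrier R" "mu y \<in> carrier R" using mu x y unfolding multilinear_def by auto
  note gc = is_formD(1)[OF g] and hc = is_formD(1)[OF h(1)]
  have "(\<Otimes>\<^bsub>R\<^esub>i\<in>{..<n}. f i (x i)) \<in> carrier R - {\<zero>}"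
    by (rule finprod_nonzero) (use h v w gc hc in \<open>auto simp: f_def x_def\<close>)
  then have Bx: "B \<otimes> mu x \<noteq> \<zero>" using B(2)[OF x] by auto
  have "(\<Otimes>\<^bsub>R\<^esub>i\<in>{..<n}. g (x i)) = \<zero>"
  proof -
    have "{..<n} = insert 0 {1..<n}" using n by auto
    then have "(\<Otimes>\<^bsub>R\<^esub>i\<in>{..<n}. g (x i)) = (\<Otimes>\<^bsub>R\<^esub>i\<in>insert 0 {1..<n}. g (x i))" by simp
    also have "\<dots> = g (x 0) \<otimes> (\<Otimes>\<^bsub>R\<^esub>i\<in>{1..<n}. g (x i))"
      by (rule R.finprod_insert) (use gc v w n in \<open>auto simp: x_def\<close>)
    also have "g (x 0) = \<zero>" using w n by (simp add: x_def)
    also have "\<zero> \<otimes> (\<Otimes>\<^bsub>R\<^esub>i\<in>{1..<n}. g (x i)) = \<zero>"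
      by (rule R.l_null, rule R.finprod_closed) (use gc v w in \<open>auto simp: x_def\<close>)
    finally show ?thesis .
  qed
  then have "F \<otimes> mu x = \<zero>" using F(2)[OF x] by simp
  moreover have "mu x \<noteq> \<zero>" using Bx B by auto
  ultimately have "F = \<zero>" using integral[OF d2 F(1) mx(1)] by blast
  then have "(\<Otimes>\<^bsub>R\<^esub>i\<in>{..<n}. g (y i)) = \<zero>" using F(2)[OF y] mx by simp
  moreover have "(\<Otimes>\<^bsub>R\<^esub>i\<in>{..<n}. g (y i)) \<in> carrier R - {\<zero>}"
    by (rule finprod_nonzero) (use v gc in \<open>auto simp: y_def\<close>)
  ultimately show False by auto
qed

end

section \<open>Divisibility up to denominators at a prime of height one\<close>

context isolated_cm
begin

text \<open>The local ring at \<open>p\<close> is a field or a discrete valuation ring. In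
  elementary terms: two incomparable elements lie in \<open>p\<close>, and dividing both by
  \<open>q\<close> gives another incomparable pair whose first member \<open>a'\<close> has a larger
  ideal \<open>K a'\<close>. The chain condition makes \<open>a'\<close> a local multiple of
  \<open>a\<close>, which puts a denominator into \<open>p\<close>.\<close>

lemma locally_comparable:
  assumes d: "d \<ge> 2" and p: "primeideal p R"
    and q: "q \<in> p" "\<And>r. r \<in> p \<Longrightarrow> \<exists>t\<in>carrier R - p. \<exists>b\<in>carrier R. t \<otimes> r = b \<otimes> q"
    and ab: "a \<in> carrier R" "b \<in> carrier R"
  shows "\<exists>s\<in>carrier R - p. \<exists>r\<in>carrier R. s \<otimes> a = r \<otimes> b \<or> s \<otimes> b = r \<otimes> a"
proof (rule ccontr)
  assume nc: "\<not> ?thesis"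
  note pp = primeideal_props[OF p]
  have 1: "\<one> \<in> carrier R - p" by (rule compl_prime(1)[OF p])
  have mul: "s \<otimes> t \<in> carrier R - p" if "s \<in> carrier R - p" "t \<in> carrier R - p" for s t
    using compl_prime(2)[OF p that] .
  have qc: "q \<in> carrier R" using ideal_carr[OF pp(1) q(1)] .
  define bad where "bad z \<longleftrightarrow> fst z \<in> carrier R \<and> snd z \<in> carrier R \<and>
    \<not> (\<exists>s\<in>carrier R - p. \<exists>r\<in>carrier R. s \<otimes> fst z = r \<otimes> snd z \<or> s \<otimes> snd z = r \<otimes> fst z)" for z
  define K where "K r = {x \<in> carrier R. \<exists>t\<in>carrier R - p. \<exists>y\<in>carrier R. t \<otimes> x = r \<otimes> y}" for r
  have K: "ideal (K r) R" if r: "r \<in> carrier R" for r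
  proof (rule idealI')
    show "\<zero> \<in> K r" unfolding K_def using 1 r by (auto intro!: bexI[of _ \<one>] bexI[of _ \<zero>])
  next
    fix x x' assume "x \<in> K r" "x' \<in> K r"
    then obtain t y t' y' where h: "x \<in> carrier R" "t \<in> carrier R - p" "y \<in> carrier R" "t \<otimes> x = r \<otimes> y"
      "x' \<in> carrier R" "t' \<in> carrier R - p" "y' \<in> carrier R" "t' \<otimes> x' = r \<otimes> y'" by (auto simp: K_def)
    have c: "t \<in> carrier R" "t' \<in> carrier R" using h by auto
    have "(t \<otimes> t') \<otimes> (x \<oplus> x') = t' \<otimes> (t \<otimes> x) \<oplus> t \<otimes> (t' \<otimes> x')" using h(1,5) c by algebra
    also have "\<dots> = r \<otimes> (t' \<otimes> y \<oplus> t \<otimes> y')" unfolding h(4,8) using h(3,7) c r by algebra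
    finally show "x \<oplus> x' \<in> K r" unfolding K_def using h mul[OF h(2,6)] c
      by (intro CollectI conjI bexI[of _ "t \<otimes> t'"] bexI[of _ "t' \<otimes> y \<oplus> t \<otimes> y'"]) auto
  next
    fix a x assume a: "a \<in> carrier R" and "x \<in> K r"
    then obtain t y where h: "x \<in> carrier R" "t \<in> carrier R - p" "y \<in> carrier R" "t \<otimes> x = r \<otimes> y"
      by (auto simp: K_def)
    have c: "t \<in> carrier R" using h by auto
    have "t \<otimes> (a \<otimes> x) = a \<otimes> (t \<otimes> x)" using h(1) c a by algebra
    also have "\<dots> = r \<otimes> (a \<otimes> y)" unfolding h(4) using h(3) a r by algebra
    finally show "a \<otimes> x \<in> K r" unfolding K_def using h a
      by (intro CollectI conjI bexI[of _ t] bexI[of _ "a \<otimes> y"]) auto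
  qed (auto simp: K_def)
  have "bad (a, b)" using ab nc by (simp add: bad_def)
  then have "\<exists>z. bad z \<and> (\<forall>z'. bad z' \<longrightarrow> K (fst z) \<subseteq> K (fst z') \<longrightarrow> K (fst z') = K (fst z))"
    by (rule acc_on_maximal_image[OF acc, of bad _ "\<lambda>z. K (fst z)"]) (auto simp: bad_def K)
  then obtain z where z: "bad z" and max: "\<And>z'. bad z' \<Longrightarrow> K (fst z) \<subseteq> K (fst z') \<Longrightarrow> K (fst z') = K (fst z)" by blast
  define a b where "a = fst z" and "b = snd z"
  have ab: "a \<in> carrier R" "b \<in> carrier R"
    and nc: "\<And>s r. s \<in> carrier R - p \<Longrightarrow> r \<in> carrier R \<Longrightarrow> s \<otimes> a \<noteq> r \<otimes> b \<and> s \<otimes> b \<noteq> r \<otimes> a"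
    using z by (auto simp: bad_def a_def b_def)
  \<comment> \<open>Outside \<open>p\<close> the element \<open>a\<close> could serve as
    denominator, and \<open>a b = b a\<close> would compare the pair.\<close>
  have "a \<in> p" using nc[of a b] ab by (auto simp: m_comm)
  moreover have "b \<in> p" using nc[of b a] ab by (auto simp: m_comm)
  ultimately obtain t a' u b' where t: "t \<in> carrier R - p" "a' \<in> carrier R" "t \<otimes> a = a' \<otimes> q"
    and u: "u \<in> carrier R - p" "b' \<in> carrier R" "u \<otimes> b = b' \<otimes> q" using q(2) by meson
  have c: "t \<in> carrier R" "u \<in> carrier R" using t u by auto
  have "bad (a', b')"
  proof -
    have False if h: "s \<in> carrier R - p" "r \<in> carrier R" "s \<otimes> a' = r \<otimes> b'" for s r
    proof -
      have sc: "s \<in> carrier R" using h by simp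
      have "(s \<otimes> t \<otimes> u) \<otimes> a = s \<otimes> u \<otimes> (t \<otimes> a)" using sc c ab by algebra
      also have "\<dots> = u \<otimes> q \<otimes> (s \<otimes> a')" unfolding t(3) using sc c t(2) qc by algebra
      also have "\<dots> = u \<otimes> r \<otimes> (b' \<otimes> q)" unfolding h(3) using c h(2) u(2) qc by algebra
      also have "\<dots> = (u \<otimes> r \<otimes> u) \<otimes> b" unfolding u(3)[symmetric] using c h(2) ab by algebra
      finally show False using nc[OF mul[OF mul[OF h(1) t(1)] u(1)], of "u \<otimes> r \<otimes> u"] c h(2) by simp
    qed
    moreover have False if h: "s \<in> carrier R - p" "r \<in> carrier R" "s \<otimes> b' = r \<otimes> a'" for s r
    proof -
      have sc: "s \<in> carrier R" using h by simp
      have "(s \<otimes> t \<otimes> u) \<otimes> b = s \<otimes> t \<otimes> (u \<otimes> b)" using sc c ab by algebra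
      also have "\<dots> = t \<otimes> q \<otimes> (s \<otimes> b')" unfolding u(3) using sc c u(2) qc by algebra
      also have "\<dots> = t \<otimes> r \<otimes> (a' \<otimes> q)" unfolding h(3) using c h(2) t(2) qc by algebra
      also have "\<dots> = (t \<otimes> r \<otimes> t) \<otimes> a" unfolding t(3)[symmetric] using c h(2) ab by algebra
      finally show False using nc[OF mul[OF mul[OF h(1) t(1)] u(1)], of "t \<otimes> r \<otimes> t"] c h(2) by simp
    qed
    ultimately show ?thesis unfolding bad_def fst_conv snd_conv using t(2) u(2) by blast
  qed
  moreover have "K a \<subseteq> K a'"
  proof
    fix x assume "x \<in> K a"
    then obtain s y where h: "x \<in> carrier R" "s \<in> carrier R - p" "y \<in> carrier R" "s \<otimes> x = a \<otimes> y"
      by (auto simp: K_def)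
    have sc: "s \<in> carrier R" using h by auto
    have "(t \<otimes> s) \<otimes> x = t \<otimes> (s \<otimes> x)" using h(1) c sc by algebra
    also have "\<dots> = (t \<otimes> a) \<otimes> y" unfolding h(4) using c ab h(3) by algebra
    also have "\<dots> = a' \<otimes> (q \<otimes> y)" unfolding t(3) using t(2) qc h(3) by algebra
    finally show "x \<in> K a'" unfolding K_def using h mul[OF t(1) h(2)] qc
      by (intro CollectI conjI bexI[of _ "t \<otimes> s"] bexI[of _ "q \<otimes> y"]) auto
  qed
  ultimately have "K a' = K a" using max[of "(a', b')"] by (simp add: a_def)
  moreover have "a' \<in> K a'" unfolding K_def using t(2) 1 by (intro CollectI conjI bexI[of _ \<one>]) auto
  ultimately have "a' \<in> K a" by simp
  then obtain s y where h: "s \<in> carrier R - p" "y \<in> carrier R" "s \<otimes> a' = a \<otimes> y" by (auto simp: K_def)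
  have sc: "s \<in> carrier R" using h by simp
  have "a \<otimes> (s \<otimes> t \<ominus> y \<otimes> q) = s \<otimes> (t \<otimes> a) \<ominus> y \<otimes> q \<otimes> a" using sc c h(2) qc ab by algebra
  also have "\<dots> = q \<otimes> (s \<otimes> a') \<ominus> y \<otimes> q \<otimes> a" unfolding t(3) using sc t(2) h(2) qc ab by algebra
  also have "\<dots> = \<zero>" unfolding h(3) using h(2) qc ab by algebra
  finally have "a \<otimes> (s \<otimes> t \<ominus> y \<otimes> q) = \<zero>" .
  moreover have "a \<noteq> \<zero>" using nc[OF 1, of \<zero>] ab by auto
  ultimately have eq: "s \<otimes> t \<ominus> y \<otimes> q = \<zero>" using integral[OF d ab(1)] sc c h(2) qc by auto
  have "s \<otimes> t = (s \<otimes> t \<ominus> y \<otimes> q) \<oplus> y \<otimes> q" using sc c h(2) qc by algebra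
  also have "\<dots> = y \<otimes> q" unfolding eq using h(2) qc by simp
  finally have "s \<otimes> t \<in> p" using ideal.I_l_closed[OF pp(1) q(1) h(2)] by simp
  then show False using mul[OF h(1) t(1)] by simp
qed

end

section \<open>Derivations\<close>

context cring
begin

text \<open>Derivations without a base field. The equation for the connection is solved at this
  level; linearity over the field comes back with \<open>derivations\<close>.\<close>

definition is_deriv :: "('a \<Rightarrow> 'a) \<Rightarrow> bool"
  where "is_deriv D \<longleftrightarrow> (\<forall>a\<in>carrier R. D a \<in> carrier R) \<and>
    (\<forall>a\<in>carrier R. \<forall>b\<in>carrier R. D (a \<oplus> b) = D a \<oplus> D b) \<and>
    (\<forall>a\<in>carrier R. \<forall>b\<in>carrier R. D (a \<otimes> b) = a \<otimes> D b \<oplus> D a \<otimes> b)"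

lemma is_derivD:
  assumes "is_deriv D"
  shows "a \<in> carrier R \<Longrightarrow> D a \<in> carrier R"
    "a \<in> carrier R \<Longrightarrow> b \<in> carrier R \<Longrightarrow> D (a \<oplus> b) = D a \<oplus> D b"
    "a \<in> carrier R \<Longrightarrow> b \<in> carrier R \<Longrightarrow> D (a \<otimes> b) = a \<otimes> D b \<oplus> D a \<otimes> b"
  using assms by (auto simp: is_deriv_def)

lemma deriv_zero: assumes D: "is_deriv D" shows "D \<zero> = \<zero>"
proof -
  have "D \<zero> = D (\<zero> \<otimes> \<zero>)" by simp
  also have "\<dots> = \<zero>" using is_derivD(1)[OF D] is_derivD(3)[OF D, of \<zero> \<zero>] by simp
  finally show ?thesis .
qed

lemma deriv_one: assumes D: "is_deriv D" shows "D \<one> = \<zero>"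
proof -
  have c: "D \<one> \<in> carrier R" using is_derivD(1)[OF D] by simp
  have "D \<one> = D (\<one> \<otimes> \<one>)" by simp
  also have "\<dots> = D \<one> \<oplus> D \<one>" by (subst is_derivD(3)[OF D]) (use c in simp_all)
  finally have e: "D \<one> = D \<one> \<oplus> D \<one>" .
  have "D \<one> = (D \<one> \<oplus> D \<one>) \<ominus> D \<one>" using c by algebra
  also have "\<dots> = D \<one> \<ominus> D \<one>" by (simp only: e[symmetric])
  also have "\<dots> = \<zero>" using c by (simp add: minus_eq r_neg)
  finally show ?thesis .
qed

lemma deriv_minus:
  assumes D: "is_deriv D" and a: "a \<in> carrier R" shows "D (\<ominus> a) = \<ominus> D a"
proof -
  have c: "D a \<in> carrier R" "D (\<ominus> a) \<in> carrier R" using is_derivD(1)[OF D] a by auto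
  have "D a \<oplus> D (\<ominus> a) = \<zero>" using is_derivD(2)[OF D a, of "\<ominus> a"] a deriv_zero[OF D] by (simp add: r_neg)
  then have "\<ominus> D a \<oplus> (D a \<oplus> D (\<ominus> a)) = \<ominus> D a" using c by simp
  then show ?thesis using c by (simp add: a_assoc[symmetric] l_neg)
qed

lemma deriv_diff:
  assumes D: "is_deriv D" and "a \<in> carrier R" "b \<in> carrier R" shows "D (a \<ominus> b) = D a \<ominus> D b"
  using assms by (simp add: minus_eq is_derivD(2)[OF D] deriv_minus)

lemma deriv_of_nat: fixes n :: nat assumes D: "is_deriv D" shows "D ([n] \<cdot> \<one>) = \<zero>"
  by (induction n) (simp_all add: deriv_zero[OF D] deriv_one[OF D] is_derivD(2)[OF D])

text \<open>The extra factor \<open>x\<close> avoids the exponent \<open>n - 1\<close>.\<close>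

lemma deriv_power:
  fixes n :: nat
  assumes D: "is_deriv D" and x: "x \<in> carrier R"
  shows "x \<otimes> D (x [^] n) = ([n] \<cdot> \<one>) \<otimes> (x [^] n \<otimes> D x)"
proof (induction n)
  case 0 show ?case using x is_derivD(1)[OF D x] by (simp add: deriv_one[OF D])
next
  case (Suc n)
  have c: "D x \<in> carrier R" "x [^] n \<in> carrier R" "D (x [^] n) \<in> carrier R" "[n] \<cdot> \<one> \<in> carrier R"
    using x is_derivD(1)[OF D] by auto
  have "x \<otimes> D (x [^] Suc n) = x \<otimes> (x [^] n \<otimes> D x \<oplus> D (x [^] n) \<otimes> x)"
    using x c by (simp add: is_derivD(3)[OF D])
  also have "\<dots> = x [^] n \<otimes> x \<otimes> D x \<oplus> x \<otimes> (x \<otimes> D (x [^] n))" using x c by algebra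
  also have "\<dots> = ([n] \<cdot> \<one> \<oplus> \<one>) \<otimes> (x [^] n \<otimes> x \<otimes> D x)" unfolding Suc using x c by algebra
  finally show ?case by simp
qed

end

section \<open>Local generators and the equation for the connection\<close>

context cm_module
begin

text \<open>\<open>M\<close> embeds by \<open>g\<close> as an ideal, and at \<open>p\<close> any two
  values of \<open>g\<close> are comparable, so an element with the largest \<open>K w\<close>
  generates \<open>M\<close> there. Finite generation gives one denominator \<open>s\<close> for all
  of \<open>M\<close>, and \<rho> is the coordinate with respect to \<open>w0\<close>, scaled by
  \<open>s\<close>.\<close>

lemma cyclic_at_prime:
  assumes p: "primeideal p R"
    and q: "q \<in> p" "\<And>r. r \<in> p \<Longrightarrow> \<exists>t\<in>carrier R - p. \<exists>b\<in>carrier R. t \<otimes> r = b \<otimes> q"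
    and g: "is_form R M g" "\<And>w. w \<in> carrier M \<Longrightarrow> g w = \<zero> \<Longrightarrow> w = \<zero>\<^bsub>M\<^esub>"
    and v0: "v0 \<in> carrier M" "v0 \<noteq> \<zero>\<^bsub>M\<^esub>"
  shows "\<exists>s\<in>carrier R - p. \<exists>w0\<in>carrier M. \<exists>\<rho>. is_form R M \<rho> \<and> \<rho> w0 = s \<and> (\<forall>v\<in>carrier M. s \<bullet> v = \<rho> v \<bullet> w0)"
proof -
  have 1: "\<one> \<in> carrier R - p" by (rule R.compl_prime(1)[OF p])
  have mul: "s \<otimes> t \<in> carrier R - p" if "s \<in> carrier R - p" "t \<in> carrier R - p" for s t
    using R.compl_prime(2)[OF p that] .
  have nz: "s \<noteq> \<zero>" if "s \<in> carrier R - p" for s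
    using that R.ideal_zero[OF R.primeideal_props(1)[OF p]] by blast
  define K where "K w = {x \<in> carrier M. \<exists>s\<in>carrier R - p. \<exists>r\<in>carrier R. s \<bullet> x = r \<bullet> w}" for w
  have K: "msub (K w)" if w: "w \<in> carrier M" for w
  proof (rule submoduleI')
    show "\<zero>\<^bsub>M\<^esub> \<in> K w" unfolding K_def using 1 w by (auto intro!: bexI[of _ \<one>] bexI[of _ \<zero>])
  next
    fix x x' assume "x \<in> K w" "x' \<in> K w"
    then obtain s r s' r' where h: "x \<in> carrier M" "s \<in> carrier R - p" "r \<in> carrier R" "s \<bullet> x = r \<bullet> w"
      "x' \<in> carrier M" "s' \<in> carrier R - p" "r' \<in> carrier R" "s' \<bullet> x' = r' \<bullet> w" by (auto simp: K_def)
    have c: "s \<in> carrier R" "s' \<in> carrier R" using h by auto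
    have "(s \<otimes> s') \<bullet> (x \<boxplus> x') = s' \<bullet> (s \<bullet> x) \<boxplus> s \<bullet> (s' \<bullet> x')" using h(1,5) c by algebra
    also have "\<dots> = (s' \<otimes> r \<oplus> s \<otimes> r') \<bullet> w" unfolding h(4,8) using h(3,7) c w by algebra
    finally show "x \<boxplus> x' \<in> K w" unfolding K_def using h mul[OF h(2,6)] c
      by (intro CollectI conjI bexI[of _ "s \<otimes> s'"] bexI[of _ "s' \<otimes> r \<oplus> s \<otimes> r'"]) auto
  next
    fix a x assume a: "a \<in> carrier R" and "x \<in> K w"
    then obtain s r where h: "x \<in> carrier M" "s \<in> carrier R - p" "r \<in> carrier R" "s \<bullet> x = r \<bullet> w" by (auto simp: K_def)
    have c: "s \<in> carrier R" using h by auto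
    have "s \<bullet> (a \<bullet> x) = a \<bullet> (s \<bullet> x)" using h(1) c a by algebra
    also have "\<dots> = (a \<otimes> r) \<bullet> w" unfolding h(4) using h(3) a w by algebra
    finally show "a \<bullet> x \<in> K w" unfolding K_def using h a
      by (intro CollectI conjI bexI[of _ s] bexI[of _ "a \<otimes> r"]) auto
  qed (auto simp: K_def)
  have self: "w \<in> K w" if "w \<in> carrier M" for w
    unfolding K_def using 1 that by (intro CollectI conjI bexI[of _ \<one>]) auto
  let ?P = "\<lambda>w. w \<in> carrier M \<and> w \<noteq> \<zero>\<^bsub>M\<^esub>"
  have "\<exists>w. ?P w \<and> (\<forall>w'. ?P w' \<longrightarrow> K w \<subseteq> K w' \<longrightarrow> K w' = K w)"
    by (rule acc_on_maximal_image[OF acc_M, of ?P v0]) (use v0 K in auto)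
  then obtain w0 where w0: "w0 \<in> carrier M" "w0 \<noteq> \<zero>\<^bsub>M\<^esub>"
    and max: "\<And>w. ?P w \<Longrightarrow> K w0 \<subseteq> K w \<Longrightarrow> K w = K w0" by blast
  note gD = is_formD[OF g(1)]
  have geq: "x = y" if "x \<in> carrier M" "y \<in> carrier M" "g x = g y" for x y
  proof -
    have "g (x \<boxminus> y) = \<zero>" using form_diff[OF g(1) that(1,2)] that(3) gD(1)[OF that(2)] by (simp add: R.minus_eq R.r_neg)
    then have "x \<boxminus> y = \<zero>\<^bsub>M\<^esub>" using g(2) that by simp
    then have "(x \<boxminus> y) \<boxplus> y = y" using that by simp
    moreover have "(x \<boxminus> y) \<boxplus> y = x" using that(1,2) by algebra
    ultimately show ?thesis by simp
  qed
  have all: "v \<in> K w0" if v: "v \<in> carrier M" for v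
  proof -
    obtain s r where s: "s \<in> carrier R - p" "r \<in> carrier R" and "s \<otimes> g v = r \<otimes> g w0 \<or> s \<otimes> g w0 = r \<otimes> g v"
      using locally_comparable[OF d2 p q gD(1)[OF v] gD(1)[OF w0(1)]] by blast
    have sc: "s \<in> carrier R" using s by simp
    from \<open>s \<otimes> g v = r \<otimes> g w0 \<or> s \<otimes> g w0 = r \<otimes> g v\<close> show ?thesis
    proof
      assume "s \<otimes> g v = r \<otimes> g w0"
      then have "s \<bullet> v = r \<bullet> w0" using geq[of "s \<bullet> v" "r \<bullet> w0"] gD(3) s sc v w0 by simp
      then show ?thesis using s v by (auto simp: K_def)
    next
      assume "s \<otimes> g w0 = r \<otimes> g v"
      then have sw: "s \<bullet> w0 = r \<bullet> v" using geq[of "s \<bullet> w0" "r \<bullet> v"] gD(3) s sc v w0 by simp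
      have "v \<noteq> \<zero>\<^bsub>M\<^esub>" using torsion_free[OF sc nz[OF s(1)] w0(1)] w0(2) sw s by auto
      moreover have "K w0 \<subseteq> K v"
      proof
        fix x assume "x \<in> K w0"
        then obtain s' r' where h: "x \<in> carrier M" "s' \<in> carrier R - p" "r' \<in> carrier R" "s' \<bullet> x = r' \<bullet> w0" by (auto simp: K_def)
        have c: "s' \<in> carrier R" using h by auto
        have "(s \<otimes> s') \<bullet> x = s \<bullet> (s' \<bullet> x)" using h(1) c sc by algebra
        also have "\<dots> = r' \<bullet> (s \<bullet> w0)" unfolding h(4) using sc h(3) w0(1) by algebra
        also have "\<dots> = (r' \<otimes> r) \<bullet> v" unfolding sw using s(2) h(3) v by algebra
        finally show "x \<in> K v" unfolding K_def using h s mul[OF s(1) h(2)]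
          by (intro CollectI conjI bexI[of _ "s \<otimes> s'"] bexI[of _ "r' \<otimes> r"]) auto
      qed
      ultimately have "K v = K w0" using max v by blast
      then show ?thesis using self[OF v] by simp
    qed
  qed
  have "\<exists>t\<in>carrier R - p. \<forall>v\<in>carrier M. t \<bullet> v \<in> plus_cyclic {\<zero>\<^bsub>M\<^esub>} w0"
  proof (rule common_multiplier[OF M_fin_gen plus_cyclic_sub[OF zero_sub w0(1)] _ 1 mul])
    fix v assume v: "v \<in> carrier M"
    obtain s r where h: "s \<in> carrier R - p" "r \<in> carrier R" "s \<bullet> v = r \<bullet> w0" using all[OF v] by (auto simp: K_def)
    then have "s \<bullet> v \<in> plus_cyclic {\<zero>\<^bsub>M\<^esub>} w0" using plus_cyclicI[of "\<zero>\<^bsub>M\<^esub>" "{\<zero>\<^bsub>M\<^esub>}" r w0] w0 by simp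
    then show "\<exists>t\<in>carrier R - p. t \<bullet> v \<in> plus_cyclic {\<zero>\<^bsub>M\<^esub>} w0" using h by blast
  qed auto
  then obtain s where s: "s \<in> carrier R - p" "\<And>v. v \<in> carrier M \<Longrightarrow> s \<bullet> v \<in> plus_cyclic {\<zero>\<^bsub>M\<^esub>} w0" by blast
  have sc: "s \<in> carrier R" using s by simp
  have "\<exists>r. r \<in> carrier R \<and> s \<bullet> v = r \<bullet> w0" if "v \<in> carrier M" for v
    using s(2)[OF that] w0(1) unfolding plus_cyclic_def by auto
  then obtain \<rho> where \<rho>: "\<And>v. v \<in> carrier M \<Longrightarrow> \<rho> v \<in> carrier R" "\<And>v. v \<in> carrier M \<Longrightarrow> s \<bullet> v = \<rho> v \<bullet> w0" by metis
  have uniq: "a = b" if "a \<in> carrier R" "b \<in> carrier R" "a \<bullet> w0 = b \<bullet> w0" for a b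
  proof -
    have "(a \<ominus> b) \<bullet> w0 = a \<bullet> w0 \<boxminus> b \<bullet> w0" using that(1,2) w0(1) by algebra
    also have "\<dots> = \<zero>\<^bsub>M\<^esub>" using that w0 by (simp add: M.minus_eq M.r_neg)
    finally have "a \<ominus> b = \<zero>" using torsion_free[of "a \<ominus> b" w0] that w0 by auto
    then show ?thesis using that by (simp add: R.r_right_minus_eq)
  qed
  have "is_form R M \<rho>" unfolding is_form_def
  proof (intro conjI ballI)
    fix x y assume xy: "x \<in> carrier M" "y \<in> carrier M"
    have "\<rho> (x \<boxplus> y) \<bullet> w0 = s \<bullet> (x \<boxplus> y)" using \<rho>(2) xy by simp
    also have "\<dots> = s \<bullet> x \<boxplus> s \<bullet> y" using sc xy by algebra
    also have "\<dots> = (\<rho> x \<oplus> \<rho> y) \<bullet> w0" using \<rho> xy w0 by (simp add: smult_l_distr)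
    finally show "\<rho> (x \<boxplus> y) = \<rho> x \<oplus> \<rho> y" using uniq \<rho>(1) xy by simp
  next
    fix a x assume a: "a \<in> carrier R" and x: "x \<in> carrier M"
    have "\<rho> (a \<bullet> x) \<bullet> w0 = s \<bullet> (a \<bullet> x)" using \<rho>(2) a x by simp
    also have "\<dots> = a \<bullet> (s \<bullet> x)" using sc a x by algebra
    also have "\<dots> = (a \<otimes> \<rho> x) \<bullet> w0" using \<rho> a x w0 by (simp add: smult_assoc1)
    finally show "\<rho> (a \<bullet> x) = a \<otimes> \<rho> x" using uniq \<rho>(1) a x by simp
  qed (use \<rho> in auto)
  moreover have "\<rho> w0 = s" using uniq[of "\<rho> w0" s] \<rho> w0 sc by simp
  ultimately show ?thesis using s(1) w0(1) \<rho>(2) by blast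
qed

lemma prime_power_mem:
  assumes "primeideal p R" "s \<in> carrier R" "s [^] (n::nat) \<in> p"
  shows "s \<in> p"
  using assms(3)
proof (induction n)
  case 0 then show ?case using R.primeideal_props(2)[OF assms(1)] by simp
next
  case (Suc n)
  then show ?case using R.primeideal_props(4)[OF assms(1), of "s [^] n" s] assms(2) by auto
qed

text \<open>Let the form \<open>g\<close> identify \<open>M\<close> with an ideal, with \<open>g\<^sup>n = F \<mu>\<close>. The equation below for \<open>v\<close> says
  that \<open>g v = D (g w) - (1/n) (D F / F) g w\<close>, and it has a solution locally at each prime \<open>p\<close> of
  height one: if \<open>w\<^sub>0\<close> generates \<open>M\<close> at \<open>p\<close>, then \<open>\<mu> (w\<^sub>0, \<dots>, w\<^sub>0)\<close> is a unit at \<open>p\<close>.\<close>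

lemma connection_equation:
  assumes n: "n \<ge> 1" and gen: "\<And>l. multilinear R M n l \<Longrightarrow> \<exists>b\<in>carrier R. \<forall>x\<in>{..<n} \<rightarrow>\<^sub>E carrier M. l x = b \<otimes> mu x"
    and mu: "multilinear R M n mu" and nu: "[n] \<cdot> \<one> \<in> Units R"
    and v0: "v0 \<in> carrier M" "v0 \<noteq> \<zero>\<^bsub>M\<^esub>"
  shows "\<exists>g F. is_form R M g \<and> (\<forall>w\<in>carrier M. g w = \<zero> \<longrightarrow> w = \<zero>\<^bsub>M\<^esub>) \<and> F \<in> carrier R \<and> F \<noteq> \<zero> \<and>
    (\<forall>D. R.is_deriv D \<longrightarrow> (\<forall>w\<in>carrier M. \<exists>v\<in>carrier M.
      [n] \<cdot> \<one> \<otimes> F \<otimes> g v = [n] \<cdot> \<one> \<otimes> F \<otimes> D (g w) \<ominus> D F \<otimes> g w))"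
proof -
  obtain g where g: "is_form R M g" "g v0 \<noteq> \<zero>" using torsionless[OF v0] by blast
  note gD = is_formD[OF g(1)]
  have inj: "w = \<zero>\<^bsub>M\<^esub>" if "w \<in> carrier M" "g w = \<zero>" for w
    by (rule rank_one[OF n gen mu g(1) v0(1) g(2) that])
  \<comment> \<open>Only the diagonal of \<open>mu\<close> matters from here on: for every form
    \<open>h\<close>, the power \<open>h w ^ n\<close> is a constant times
    \<open>m w\<close>.\<close>
  define const where "const w = (\<lambda>i\<in>{..<n}. w)" for w :: 'c
  have const: "const w \<in> {..<n} \<rightarrow>\<^sub>E carrier M" if "w \<in> carrier M" for w using that by (auto simp: const_def)
  define m where "m w = mu (const w)" for w
  have mc: "m w \<in> carrier R" if "w \<in> carrier M" for w using mu const[OF that] unfolding m_def multilinear_def by blast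
  have power: "\<exists>F\<in>carrier R. \<forall>w\<in>carrier M. h w [^] n = F \<otimes> m w" if h: "is_form R M h" for h
  proof -
    have "multilinear R M n (\<lambda>x. \<Otimes>\<^bsub>R\<^esub>i\<in>{..<n}. h (x i))" by (rule multilinear_product) (rule h)
    from gen[OF this] obtain F where F: "F \<in> carrier R" "\<And>x. x \<in> {..<n} \<rightarrow>\<^sub>E carrier M \<Longrightarrow> (\<Otimes>\<^bsub>R\<^esub>i\<in>{..<n}. h (x i)) = F \<otimes> mu x"
      by blast
    have "h w [^] n = F \<otimes> m w" if w: "w \<in> carrier M" for w
    proof -
      have "(\<Otimes>\<^bsub>R\<^esub>i\<in>{..<n}. h (const w i)) = (\<Otimes>\<^bsub>R\<^esub>i\<in>{..<n}. h w)"
        by (rule R.finprod_cong') (use is_formD(1)[OF h w] in \<open>auto simp: const_def\<close>)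
      also have "\<dots> = h w [^] n" using R.finprod_const[of "h w" "{..<n}"] is_formD(1)[OF h w] by simp
      finally show ?thesis using F(2)[OF const[OF w]] by (simp add: m_def)
    qed
    then show ?thesis using F(1) by blast
  qed
  obtain F where F: "F \<in> carrier R" "\<And>w. w \<in> carrier M \<Longrightarrow> g w [^] n = F \<otimes> m w" using power[OF g(1)] by blast
  have Fnz: "F \<noteq> \<zero>"
  proof
    assume "F = \<zero>"
    then have "g v0 [^] n \<in> {\<zero>}" using F(2)[OF v0(1)] mc[OF v0(1)] by simp
    then have "g v0 \<in> {\<zero>}" by (rule prime_power_mem[OF zero_prime gD(1)[OF v0(1)]])
    then show False using g(2) by simp
  qed
  define nn where "nn = [n] \<cdot> \<one>"
  have nn: "nn \<in> carrier R" "nn \<in> Units R" using nu by (auto simp: nn_def)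
  have nnz: "nn \<noteq> \<zero>"
  proof
    assume "nn = \<zero>"
    then have "\<one> = inv nn \<otimes> \<zero>" using R.Units_l_inv[OF nn(2)] by simp
    then show False using nn(2) R.primeideal_props(2)[OF zero_prime] by simp
  qed
  have nF: "nn \<otimes> F \<noteq> \<zero>" "nn \<otimes> F \<in> carrier R" using integral[OF d2 nn(1) F(1)] nnz Fnz nn F by auto
  have "\<exists>v\<in>carrier M. nn \<otimes> F \<otimes> g v = nn \<otimes> F \<otimes> D (g w) \<ominus> D F \<otimes> g w"
    if D: "R.is_deriv D" and w: "w \<in> carrier M" for D w
  proof -
    note DD = R.is_derivD[OF D]
    define u where "u = nn \<otimes> F \<otimes> D (g w) \<ominus> D F \<otimes> g w"
    have uc: "u \<in> carrier R" unfolding u_def using nF(2) DD(1) gD(1) w F(1) by simp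
    \<comment> \<open>The domain consists of the denominators \<open>r\<close> for which
      \<open>r u / (nn F)\<close> lies in the ideal \<open>g M\<close>, and \<open>v\<close> is the
      corresponding element of \<open>M\<close>. A multiplier for \<open>G\<close> solves the
      equation.\<close>
    define G where "G = {(r, v). r \<in> carrier R \<and> v \<in> carrier M \<and> r \<otimes> u = nn \<otimes> F \<otimes> g v}"
    have lin: "lin_graph G" unfolding lin_graph_def
    proof (intro conjI allI impI)
      show "(\<zero>, \<zero>\<^bsub>M\<^esub>) \<in> G" using form_zero[OF g(1)] uc nF(2) by (simp add: G_def)
      show "G \<subseteq> carrier R \<times> carrier M" by (auto simp: G_def)
    next
      fix r v r' v' assume "(r, v) \<in> G" "(r', v') \<in> G"
      then show "(r \<oplus> r', v \<boxplus> v') \<in> G" using gD uc nF(2) by (auto simp: G_def R.l_distr R.r_distr)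
    next
      fix a r v assume a: "a \<in> carrier R" and "(r, v) \<in> G"
      then have rv: "r \<in> carrier R" "v \<in> carrier M" "r \<otimes> u = nn \<otimes> F \<otimes> g v" by (auto simp: G_def)
      have "(a \<otimes> r) \<otimes> u = a \<otimes> (r \<otimes> u)" using a rv(1) uc by algebra
      also have "\<dots> = nn \<otimes> F \<otimes> (a \<otimes> g v)" unfolding rv(3) using a nn(1) F(1) gD(1)[OF rv(2)] by algebra
      finally show "(a \<otimes> r, a \<bullet> v) \<in> G" using a rv gD(3)[OF a rv(2)] by (simp add: G_def)
    qed
    have fn: "functional_mod {\<zero>\<^bsub>M\<^esub>} G" unfolding functional_mod_def
    proof (intro allI impI)
      fix v assume "(\<zero>, v) \<in> G"
      then have v: "v \<in> carrier M" "nn \<otimes> F \<otimes> g v = \<zero>" using uc by (auto simp: G_def)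
      then have "g v = \<zero>" using integral[OF d2 nF(2) gD(1)[OF v(1)]] nF by auto
      then show "v \<in> {\<zero>\<^bsub>M\<^esub>}" using inj v by simp
    qed
    \<comment> \<open>One nonzero denominator is always available; at it the multiplier can be read
      off by cancelling \<open>g v0\<close>.\<close>
    have G0: "(nn \<otimes> F \<otimes> g v0, u \<bullet> v0) \<in> G"
    proof -
      have "nn \<otimes> F \<otimes> g v0 \<otimes> u = nn \<otimes> F \<otimes> (u \<otimes> g v0)" using nn(1) F(1) gD(1)[OF v0(1)] uc by algebra
      then show ?thesis using v0(1) gD(1)[OF v0(1)] gD(3)[OF uc v0(1)] uc nF(2) by (simp add: G_def)
    qed
    obtain y ys where ws: "ws = y # ys" "length ys = d - 1" using ws_length d2 by (cases ws) auto
    have "\<exists>v\<in>carrier M. nn \<otimes> F \<otimes> g v = u"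
    proof (cases "prime_chain R (fst ` G) (d - 1)")
      case False
      have "trivial_mod {\<zero>\<^bsub>M\<^esub>} G"
        by (rule trivial_mod_of_regular[OF zero_sub _ lin fn]) (use ws_regular ws False in auto)
      then obtain v where v: "v \<in> carrier M" "\<And>r x. (r, x) \<in> G \<Longrightarrow> cong_mod {\<zero>\<^bsub>M\<^esub>} x (r \<bullet> v)"
        unfolding trivial_mod_def by blast
      have c: "g v0 \<in> carrier R" "g v \<in> carrier R" using gD v0 v by auto
      have "u \<bullet> v0 \<boxminus> (nn \<otimes> F \<otimes> g v0) \<bullet> v = \<zero>\<^bsub>M\<^esub>" using v(2)[OF G0] by (simp add: cong_mod_def)
      then have "g (u \<bullet> v0 \<boxminus> (nn \<otimes> F \<otimes> g v0) \<bullet> v) = \<zero>" using form_zero[OF g(1)] by simp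
      then have "u \<otimes> g v0 \<ominus> nn \<otimes> F \<otimes> g v0 \<otimes> g v = \<zero>"
        using form_diff[OF g(1), of "u \<bullet> v0" "(nn \<otimes> F \<otimes> g v0) \<bullet> v"] gD(3) uc v0 v nF(2) c by simp
      moreover have "g v0 \<otimes> (u \<ominus> nn \<otimes> F \<otimes> g v) = u \<otimes> g v0 \<ominus> nn \<otimes> F \<otimes> g v0 \<otimes> g v"
        using uc c nn(1) F(1) by algebra
      ultimately have "u \<ominus> nn \<otimes> F \<otimes> g v = \<zero>"
        using integral[OF d2 c(1), of "u \<ominus> nn \<otimes> F \<otimes> g v"] g(2) uc nF(2) c by auto
      then have "u = nn \<otimes> F \<otimes> g v" using uc nF(2) c by (simp add: R.r_right_minus_eq)
      then show ?thesis using v(1) by blast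
    next
      case True
      then obtain C where C: "\<forall>i\<le>d - 1. primeideal (C i) R" "\<forall>i<d - 1. C i \<subset> C (Suc i)" "fst ` G \<subseteq> C 0"
        unfolding prime_chain_def by blast
      define p where "p = C 0"
      have p: "primeideal p R" "prime_chain R p (d - 1)" "fst ` G \<subseteq> p" using C by (auto simp: p_def prime_chain_def)
      have "p \<noteq> mm" by (rule chain_not_mm[OF p(2)]) (use d2 in simp)
      obtain q where q: "q \<in> p" "\<And>r. r \<in> p \<Longrightarrow> \<exists>t\<in>carrier R - p. \<exists>b\<in>carrier R. t \<otimes> r = b \<otimes> q"
        using height_one_local[OF p(1,2) \<open>p \<noteq> mm\<close>] by blast
      obtain s w0 \<rho> where s: "s \<in> carrier R - p" and w0: "w0 \<in> carrier M" and \<rho>: "is_form R M \<rho>" "\<rho> w0 = s"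
        and s\<rho>: "\<And>v. v \<in> carrier M \<Longrightarrow> s \<bullet> v = \<rho> v \<bullet> w0"
        using cyclic_at_prime[OF p(1) q g(1) inj v0] by blast
      have sc: "s \<in> carrier R" using s by simp
      obtain c where c: "c \<in> carrier R" "\<And>w. w \<in> carrier M \<Longrightarrow> \<rho> w [^] n = c \<otimes> m w" using power[OF \<rho>(1)] by blast
      define a0 where "a0 = m w0"
      have a0c: "a0 \<in> carrier R" unfolding a0_def by (rule mc[OF w0])
      \<comment> \<open>\<open>s^n = \<rho> (w0)^n = c a0\<close> is not in \<open>p\<close>, so
        neither is \<open>a0\<close>: the form \<open>mu\<close> is a unit on the local
        generator.\<close>
      have a0: "a0 \<notin> p"
      proof
        assume "a0 \<in> p"
        then have "c \<otimes> a0 \<in> p" using ideal.I_l_closed[OF R.primeideal_props(1)[OF p(1)] _ c(1)] by blast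
        then have "s [^] n \<in> p" using c(2)[OF w0] \<rho>(2) by (simp add: a0_def)
        then show False using prime_power_mem[OF p(1) sc] s by blast
      qed
      define x0 where "x0 = g w0"
      have x0: "x0 \<in> carrier R" unfolding x0_def by (rule gD(1)[OF w0])
      define r where "r = \<rho> w"
      have rc: "r \<in> carrier R" unfolding r_def by (rule is_formD(1)[OF \<rho>(1) w])
      define z where "z = g w"
      have z: "z \<in> carrier R" unfolding z_def by (rule gD(1)[OF w])
      \<comment> \<open>In local coordinates \<open>w = (r / s) w0\<close>. This relation and
        \<open>x0^n = F a0\<close> are differentiated. The second gives
        \<open>(1/n) (D a0 / a0) w0\<close> as the value of the connection at \<open>w0\<close>;
        Leibniz' rule, multiplied by \<open>nn a0 s\<close>, then gives the element of
        \<open>M\<close> below.\<close>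
      have "s \<otimes> z = r \<otimes> x0"
        using arg_cong[OF s\<rho>[OF w], of g] gD(3) sc w w0 rc by (simp add: z_def x0_def r_def)
      then have "D (s \<otimes> z) = D (r \<otimes> x0)" by simp
      then have e1: "s \<otimes> D z \<oplus> D s \<otimes> z = r \<otimes> D x0 \<oplus> D r \<otimes> x0" using DD(3) sc z rc x0 by simp
      note k = nn(1) F(1) DD(1)[OF F(1)] sc DD(1)[OF sc] z DD(1)[OF z] rc DD(1)[OF rc] x0 DD(1)[OF x0] a0c DD(1)[OF a0c]
      have e2: "x0 \<otimes> (F \<otimes> D a0 \<oplus> D F \<otimes> a0) = nn \<otimes> (F \<otimes> a0 \<otimes> D x0)"
        using R.deriv_power[OF D x0, of n] F(2)[OF w0] DD(3)[OF F(1) a0c] by (simp add: x0_def a0_def nn_def)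
      have "(nn \<otimes> a0 \<otimes> s) \<otimes> u = nn \<otimes> a0 \<otimes> (nn \<otimes> F \<otimes> (s \<otimes> D z \<oplus> D s \<otimes> z)) \<ominus> nn \<otimes> a0 \<otimes> (nn \<otimes> F \<otimes> (D s \<otimes> z)) \<ominus> nn \<otimes> a0 \<otimes> D F \<otimes> (s \<otimes> z)"
        unfolding u_def z_def[symmetric] using k by algebra
      also have "\<dots> = nn \<otimes> r \<otimes> (nn \<otimes> (F \<otimes> a0 \<otimes> D x0)) \<oplus> nn \<otimes> a0 \<otimes> nn \<otimes> F \<otimes> (D r \<otimes> x0)
          \<ominus> nn \<otimes> a0 \<otimes> (nn \<otimes> F \<otimes> (D s \<otimes> z)) \<ominus> nn \<otimes> a0 \<otimes> D F \<otimes> (r \<otimes> x0)"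
        unfolding e1 \<open>s \<otimes> z = r \<otimes> x0\<close> using k by algebra
      also have "\<dots> = nn \<otimes> F \<otimes> ((r \<otimes> D a0 \<oplus> nn \<otimes> a0 \<otimes> D r) \<otimes> x0 \<ominus> (nn \<otimes> a0 \<otimes> D s) \<otimes> z)"
        unfolding e2[symmetric] using k by algebra
      also have "\<dots> = nn \<otimes> F \<otimes> g ((r \<otimes> D a0 \<oplus> nn \<otimes> a0 \<otimes> D r) \<bullet> w0 \<boxminus> (nn \<otimes> a0 \<otimes> D s) \<bullet> w)"
        using form_diff[OF g(1), of "(r \<otimes> D a0 \<oplus> nn \<otimes> a0 \<otimes> D r) \<bullet> w0" "(nn \<otimes> a0 \<otimes> D s) \<bullet> w"] gD(3) k w w0
        by (simp add: x0_def z_def)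
      finally have "(nn \<otimes> a0 \<otimes> s, (r \<otimes> D a0 \<oplus> nn \<otimes> a0 \<otimes> D r) \<bullet> w0 \<boxminus> (nn \<otimes> a0 \<otimes> D s) \<bullet> w) \<in> G"
        using k w w0 by (simp add: G_def)
      \<comment> \<open>A denominator outside \<open>p\<close> lies in the domain, contrary to the
        choice of \<open>p\<close>.\<close>
      then have "nn \<otimes> a0 \<otimes> s \<in> p" using p(3) by force
      then have "nn \<otimes> a0 \<in> p" using R.primeideal_props(4)[OF p(1), of "nn \<otimes> a0" s] nn(1) a0c sc s by simp
      then have "nn \<in> p" using R.primeideal_props(4)[OF p(1) nn(1) a0c] a0 by blast
      then have "inv nn \<otimes> nn \<in> p" using ideal.I_l_closed[OF R.primeideal_props(1)[OF p(1)]] nn(2) by blast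
      then show ?thesis using R.primeideal_props(2)[OF p(1)] nn(2) by (simp add: R.Units_l_inv)
    qed
    then show ?thesis unfolding u_def by blast
  qed
  note sol = this
  show ?thesis
    by (rule exI[of _ g], rule exI[of _ F])
       (intro conjI ballI allI impI g(1) inj F(1) Fnz; (assumption | rule sol[unfolded nn_def]; assumption))
qed

end

section \<open>Connections from forms\<close>

lemma derivation_is_deriv:
  assumes "cring A" "D \<in> derivations K A"
  shows "cring.is_deriv A D"
  using assms by (auto simp: cring.is_deriv_def derivations_def lin_maps_def)

text \<open>In use \<open>a = D (D' x)\<close>, \<open>b = D F\<close>, \<open>c = D' x\<close>,
  \<open>p = D' F\<close>, \<open>q = D x\<close> and \<open>r = D (D' F)\<close>, with
  \<open>x = g w\<close>. The last summand is symmetric under exchange of \<open>D\<close> and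
  \<open>D'\<close>, which is why it drops out of the commutator. With independent variables the
  statement is a polynomial identity.\<close>

lemma (in cring) connection_square_identity:
  assumes "n \<in> carrier R" "F \<in> carrier R" "a \<in> carrier R" "b \<in> carrier R" "c \<in> carrier R"
    "p \<in> carrier R" "q \<in> carrier R" "r \<in> carrier R" "x \<in> carrier R"
  shows "n \<otimes> F \<otimes> ((n \<otimes> F \<otimes> a \<oplus> n \<otimes> b \<otimes> c) \<ominus> (p \<otimes> q \<oplus> r \<otimes> x)) \<ominus> (n \<oplus> \<one>) \<otimes> b \<otimes> (n \<otimes> F \<otimes> c \<ominus> p \<otimes> x)
    = n \<otimes> F \<otimes> (n \<otimes> F \<otimes> a \<ominus> r \<otimes> x) \<oplus> ((n \<oplus> \<one>) \<otimes> (b \<otimes> p \<otimes> x) \<ominus> n \<otimes> F \<otimes> (p \<otimes> q \<oplus> b \<otimes> c))"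
  using assms by algebra

lemma (in cring) connection_commutator_identity:
  assumes "e \<in> carrier R" "a \<in> carrier R" "a' \<in> carrier R" "r \<in> carrier R" "r' \<in> carrier R" "x \<in> carrier R" "s \<in> carrier R"
  shows "(e \<otimes> (e \<otimes> a \<ominus> r \<otimes> x) \<oplus> s) \<ominus> (e \<otimes> (e \<otimes> a' \<ominus> r' \<otimes> x) \<oplus> s) = e \<otimes> (e \<otimes> (a \<ominus> a') \<ominus> (r \<ominus> r') \<otimes> x)"
  using assms by algebra

text \<open>The connection is \<open>D - (1 / nn) (D F / F)\<close> on the ideal \<open>g M\<close>. Integrability is verified after
  multiplication by \<open>(nn F)\<^sup>2\<close>.\<close>

lemma integrable_connection_of_form:
  fixes K :: "'k ring" and R :: "('k, 'a) module" (structure) and M :: "('a, 'm) module"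
  assumes alg: "algebra K R" and mod: "module R M"
    and g: "is_form R M g" and inj: "\<And>w. w \<in> carrier M \<Longrightarrow> g w = \<zero> \<Longrightarrow> w = \<zero>\<^bsub>M\<^esub>"
    and nn: "nn \<in> carrier R" "\<And>D. cring.is_deriv R D \<Longrightarrow> D nn = \<zero>" and F: "F \<in> carrier R"
    and reg: "\<And>x. x \<in> carrier R \<Longrightarrow> nn \<otimes> F \<otimes> x = \<zero> \<Longrightarrow> x = \<zero>"
    and ex: "\<And>D w. cring.is_deriv R D \<Longrightarrow> w \<in> carrier M \<Longrightarrow>
      \<exists>v\<in>carrier M. nn \<otimes> F \<otimes> g v = nn \<otimes> F \<otimes> D (g w) \<ominus> D F \<otimes> g w"
  shows "\<exists>nabla. integrable_connection K R M nabla"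
proof -
  interpret module R M by (rule mod)
  interpret A: algebra K R by (rule alg)
  interpret Kr: cring K by (rule A.R_cring)
  note gD = is_formD[OF g]
  let ?e = "nn \<otimes> F"
  let ?Der = "derivations K R"
  have e: "?e \<in> carrier R" using nn F by simp
  have der: "R.is_deriv D" if "D \<in> ?Der" for D by (rule derivation_is_deriv[OF R.is_cring that])
  have DI: "D \<in> ?Der" if "D \<in> extensional (carrier R)" "R.is_deriv D"
    "\<And>c x. c \<in> carrier K \<Longrightarrow> x \<in> carrier R \<Longrightarrow> D (c \<odot>\<^bsub>R\<^esub> x) = c \<odot>\<^bsub>R\<^esub> D x" for D
    using that by (auto simp: derivations_def lin_maps_def R.is_deriv_def PiE_def)
  have DK: "D (c \<odot>\<^bsub>R\<^esub> x) = c \<odot>\<^bsub>R\<^esub> D x" if "D \<in> ?Der" "c \<in> carrier K" "x \<in> carrier R" for D c x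
    using that by (auto simp: derivations_def lin_maps_def)
  have eq: "v = v'" if v: "v \<in> carrier M" "v' \<in> carrier M" and h: "?e \<otimes> g v = ?e \<otimes> g v'" for v v'
  proof -
    have c: "g v \<in> carrier R" "g v' \<in> carrier R" using gD v by auto
    have "?e \<otimes> (g v \<ominus> g v') = ?e \<otimes> g v \<ominus> ?e \<otimes> g v'" using nn(1) F c by algebra
    also have "\<dots> = \<zero>" using h c e by (simp add: R.minus_eq R.r_neg)
    finally have "g v \<ominus> g v' = \<zero>" using reg c by simp
    then have "g (v \<boxminus> v') = \<zero>" using form_diff[OF g v] by simp
    then have "v \<boxminus> v' = \<zero>\<^bsub>M\<^esub>" using inj v by simp
    then have "(v \<boxminus> v') \<boxplus> v' = v'" using v by simp
    moreover have "(v \<boxminus> v') \<boxplus> v' = v" using v by algebra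
    ultimately show ?thesis by simp
  qed
  \<comment> \<open>By \<open>eq\<close> there is only one such value, so identities for
    \<open>N\<close> are verified after applying \<open>g\<close> and multiplying by
    \<open>nn F\<close>.\<close>
  define N where "N D w = (SOME v. v \<in> carrier M \<and> ?e \<otimes> g v = ?e \<otimes> D (g w) \<ominus> D F \<otimes> g w)" for D w
  have N: "N D w \<in> carrier M" "?e \<otimes> g (N D w) = ?e \<otimes> D (g w) \<ominus> D F \<otimes> g w" if "D \<in> ?Der" "w \<in> carrier M" for D w
  proof -
    have "\<exists>v. v \<in> carrier M \<and> ?e \<otimes> g v = ?e \<otimes> D (g w) \<ominus> D F \<otimes> g w" using ex[OF der[OF that(1)] that(2)] by blast
    then have "N D w \<in> carrier M \<and> ?e \<otimes> g (N D w) = ?e \<otimes> D (g w) \<ominus> D F \<otimes> g w" unfolding N_def by (rule someI_ex)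
    then show "N D w \<in> carrier M" "?e \<otimes> g (N D w) = ?e \<otimes> D (g w) \<ominus> D F \<otimes> g w" by auto
  qed
  have Nadd: "N D (v \<boxplus> w) = N D v \<boxplus> N D w" if D: "D \<in> ?Der" and v: "v \<in> carrier M" and w: "w \<in> carrier M" for D v w
  proof (rule eq)
    note DD = R.is_derivD[OF der[OF D]]
    have c: "g v \<in> carrier R" "g w \<in> carrier R" using gD v w by auto
    have "?e \<otimes> g (N D (v \<boxplus> w)) = ?e \<otimes> (D (g v) \<oplus> D (g w)) \<ominus> D F \<otimes> (g v \<oplus> g w)"
      using N(2)[OF D M.a_closed[OF v w]] gD(2)[OF v w] DD(2)[OF c] by simp
    also have "\<dots> = (?e \<otimes> D (g v) \<ominus> D F \<otimes> g v) \<oplus> (?e \<otimes> D (g w) \<ominus> D F \<otimes> g w)"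
      using nn(1) F c DD(1)[OF F] DD(1)[OF c(1)] DD(1)[OF c(2)] by algebra
    also have "\<dots> = ?e \<otimes> g (N D v) \<oplus> ?e \<otimes> g (N D w)" using N[OF D v] N[OF D w] by simp
    also have "\<dots> = ?e \<otimes> g (N D v \<boxplus> N D w)" using N(1)[OF D v] N(1)[OF D w] gD e by (simp add: R.r_distr)
    finally show "?e \<otimes> g (N D (v \<boxplus> w)) = ?e \<otimes> g (N D v \<boxplus> N D w)" .
  qed (use N D v w in auto)
  have Nleib: "N D (a \<bullet> w) = a \<bullet> N D w \<boxplus> D a \<bullet> w" if D: "D \<in> ?Der" and a: "a \<in> carrier R" and w: "w \<in> carrier M" for D a w
  proof (rule eq)
    note DD = R.is_derivD[OF der[OF D]]
    have c: "g w \<in> carrier R" "g (N D w) \<in> carrier R" using gD w N(1)[OF D w] by auto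
    have "?e \<otimes> g (N D (a \<bullet> w)) = ?e \<otimes> (a \<otimes> D (g w) \<oplus> D a \<otimes> g w) \<ominus> D F \<otimes> (a \<otimes> g w)"
      using N(2)[OF D smult_closed[OF a w]] gD(3)[OF a w] DD(3)[OF a c(1)] by simp
    also have "\<dots> = a \<otimes> (?e \<otimes> D (g w) \<ominus> D F \<otimes> g w) \<oplus> ?e \<otimes> (D a \<otimes> g w)"
      using nn(1) F a c DD(1)[OF F] DD(1)[OF c(1)] DD(1)[OF a] by algebra
    also have "\<dots> = a \<otimes> (?e \<otimes> g (N D w)) \<oplus> ?e \<otimes> (D a \<otimes> g w)" using N[OF D w] by simp
    also have "\<dots> = ?e \<otimes> (a \<otimes> g (N D w) \<oplus> D a \<otimes> g w)" using nn(1) F a c DD(1)[OF a] by algebra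
    also have "\<dots> = ?e \<otimes> g (a \<bullet> N D w \<boxplus> D a \<bullet> w)"
      using gD(2)[of "a \<bullet> N D w" "D a \<bullet> w"] gD(3)[OF a N(1)[OF D w]] gD(3)[OF DD(1)[OF a] w] a w DD(1)[OF a] N(1)[OF D w] by simp
    finally show "?e \<otimes> g (N D (a \<bullet> w)) = ?e \<otimes> g (a \<bullet> N D w \<boxplus> D a \<bullet> w)" .
  qed (use N D a w R.is_derivD(1)[OF der[OF D]] in auto)
  have cR: "c \<odot>\<^bsub>R\<^esub> x \<in> carrier R" if "c \<in> carrier K" "x \<in> carrier R" for c x
    using A.smult_closed that by simp
  \<comment> \<open>Constants have derivative zero, so linearity of \<open>N D\<close> over the
    field is contained in the Leibniz rule.\<close>
  have Dc: "D (c \<odot>\<^bsub>R\<^esub> \<one>) = \<zero>" if D: "D \<in> ?Der" and c: "c \<in> carrier K" for D c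
    using DK[OF D c R.one_closed] R.deriv_one[OF der[OF D]] c by simp
  have add_der: "(\<lambda>x\<in>carrier R. D x \<oplus> D' x) \<in> ?Der" if D: "D \<in> ?Der" and D': "D' \<in> ?Der" for D D'
  proof (rule DI)
    note d = R.is_derivD[OF der[OF D]] and d' = R.is_derivD[OF der[OF D']]
    show "R.is_deriv (\<lambda>x\<in>carrier R. D x \<oplus> D' x)"
      unfolding R.is_deriv_def
    proof (intro conjI ballI)
      fix a b assume ab: "a \<in> carrier R" "b \<in> carrier R"
      note k = ab d(1)[OF ab(1)] d(1)[OF ab(2)] d'(1)[OF ab(1)] d'(1)[OF ab(2)]
      have "D a \<oplus> D b \<oplus> (D' a \<oplus> D' b) = D a \<oplus> D' a \<oplus> (D b \<oplus> D' b)" using k by algebra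
      then show "(\<lambda>x\<in>carrier R. D x \<oplus> D' x) (a \<oplus> b) = (\<lambda>x\<in>carrier R. D x \<oplus> D' x) a \<oplus> (\<lambda>x\<in>carrier R. D x \<oplus> D' x) b"
        using ab d(2)[OF ab] d'(2)[OF ab] by simp
      have "a \<otimes> D b \<oplus> D a \<otimes> b \<oplus> (a \<otimes> D' b \<oplus> D' a \<otimes> b) = a \<otimes> (D b \<oplus> D' b) \<oplus> (D a \<oplus> D' a) \<otimes> b" using k by algebra
      then show "(\<lambda>x\<in>carrier R. D x \<oplus> D' x) (a \<otimes> b) =
        a \<otimes> (\<lambda>x\<in>carrier R. D x \<oplus> D' x) b \<oplus> (\<lambda>x\<in>carrier R. D x \<oplus> D' x) a \<otimes> b"
        using ab d(3)[OF ab] d'(3)[OF ab] by simp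
    qed (use d(1) d'(1) in auto)
    fix c x assume "c \<in> carrier K" "x \<in> carrier R"
    then show "(\<lambda>x\<in>carrier R. D x \<oplus> D' x) (c \<odot>\<^bsub>R\<^esub> x) = c \<odot>\<^bsub>R\<^esub> (\<lambda>x\<in>carrier R. D x \<oplus> D' x) x"
      using DK[OF D] DK[OF D'] cR d(1) d'(1) A.smult_r_distr by simp
  qed auto
  have smult_der: "(\<lambda>x\<in>carrier R. a \<otimes> D x) \<in> ?Der" if D: "D \<in> ?Der" and a: "a \<in> carrier R" for D a
  proof (rule DI)
    note d = R.is_derivD[OF der[OF D]]
    show "R.is_deriv (\<lambda>x\<in>carrier R. a \<otimes> D x)"
      unfolding R.is_deriv_def
    proof (intro conjI ballI)
      fix b c assume ab: "b \<in> carrier R" "c \<in> carrier R"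
      note k = ab a d(1)[OF ab(1)] d(1)[OF ab(2)]
      show "(\<lambda>x\<in>carrier R. a \<otimes> D x) (b \<oplus> c) = (\<lambda>x\<in>carrier R. a \<otimes> D x) b \<oplus> (\<lambda>x\<in>carrier R. a \<otimes> D x) c"
        using k d(2)[OF ab] by (simp add: R.r_distr)
      have "a \<otimes> (b \<otimes> D c \<oplus> D b \<otimes> c) = b \<otimes> (a \<otimes> D c) \<oplus> a \<otimes> D b \<otimes> c" using k by algebra
      then show "(\<lambda>x\<in>carrier R. a \<otimes> D x) (b \<otimes> c) =
        b \<otimes> (\<lambda>x\<in>carrier R. a \<otimes> D x) c \<oplus> (\<lambda>x\<in>carrier R. a \<otimes> D x) b \<otimes> c"
        using ab d(3)[OF ab] by simp
    qed (use d(1) a in auto)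
    fix c x assume cx: "c \<in> carrier K" "x \<in> carrier R"
    have "c \<odot>\<^bsub>R\<^esub> (a \<otimes> D x) = c \<odot>\<^bsub>R\<^esub> (D x \<otimes> a)" using a d(1)[OF cx(2)] by (simp add: R.m_comm)
    also have "\<dots> = (c \<odot>\<^bsub>R\<^esub> D x) \<otimes> a" using A.smult_assoc2[OF cx(1) d(1)[OF cx(2)] a] by simp
    also have "\<dots> = a \<otimes> (c \<odot>\<^bsub>R\<^esub> D x)" using a cR[OF cx(1) d(1)[OF cx(2)]] by (simp add: R.m_comm)
    finally show "(\<lambda>x\<in>carrier R. a \<otimes> D x) (c \<odot>\<^bsub>R\<^esub> x) = c \<odot>\<^bsub>R\<^esub> (\<lambda>x\<in>carrier R. a \<otimes> D x) x"
      using DK[OF D cx] cR[OF cx] cx by simp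
  qed auto
  have comm_der: "commutator R D D' \<in> ?Der" if D: "D \<in> ?Der" and D': "D' \<in> ?Der" for D D'
    unfolding commutator_def
  proof (rule DI)
    note d = R.is_derivD[OF der[OF D]] and d' = R.is_derivD[OF der[OF D']]
    let ?C = "\<lambda>x\<in>carrier R. D (D' x) \<ominus> D' (D x)"
    show "R.is_deriv ?C"
      unfolding R.is_deriv_def
    proof (intro conjI ballI)
      fix a b assume ab: "a \<in> carrier R" "b \<in> carrier R"
      note c = d(1)[OF ab(1)] d(1)[OF ab(2)] d'(1)[OF ab(1)] d'(1)[OF ab(2)]
      note k = ab c d(1)[OF c(3)] d(1)[OF c(4)] d'(1)[OF c(1)] d'(1)[OF c(2)]
      have "D (D' (a \<oplus> b)) = D (D' a) \<oplus> D (D' b)" "D' (D (a \<oplus> b)) = D' (D a) \<oplus> D' (D b)"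
        using ab c d(2) d'(2) by simp_all
      moreover have "(D (D' a) \<oplus> D (D' b)) \<ominus> (D' (D a) \<oplus> D' (D b)) = (D (D' a) \<ominus> D' (D a)) \<oplus> (D (D' b) \<ominus> D' (D b))"
        using k by algebra
      ultimately show "?C (a \<oplus> b) = ?C a \<oplus> ?C b" using ab by simp
      have 1: "D (D' (a \<otimes> b)) = (a \<otimes> D (D' b) \<oplus> D a \<otimes> D' b) \<oplus> (D' a \<otimes> D b \<oplus> D (D' a) \<otimes> b)"
        unfolding d'(3)[OF ab] using d(2)[of "a \<otimes> D' b" "D' a \<otimes> b"] d(3) ab c by simp
      have 2: "D' (D (a \<otimes> b)) = (a \<otimes> D' (D b) \<oplus> D' a \<otimes> D b) \<oplus> (D a \<otimes> D' b \<oplus> D' (D a) \<otimes> b)"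
        unfolding d(3)[OF ab] using d'(2)[of "a \<otimes> D b" "D a \<otimes> b"] d'(3) ab c by simp
      have "D (D' (a \<otimes> b)) \<ominus> D' (D (a \<otimes> b)) = a \<otimes> (D (D' b) \<ominus> D' (D b)) \<oplus> (D (D' a) \<ominus> D' (D a)) \<otimes> b"
        unfolding 1 2 using k by algebra
      then show "?C (a \<otimes> b) = a \<otimes> ?C b \<oplus> ?C a \<otimes> b" using ab by simp
    qed (use d(1) d'(1) in auto)
    fix c x assume cx: "c \<in> carrier K" "x \<in> carrier R"
    have k: "D (D' x) \<in> carrier R" "D' (D x) \<in> carrier R" using d(1) d'(1) cx by auto
    have "?C (c \<odot>\<^bsub>R\<^esub> x) = c \<odot>\<^bsub>R\<^esub> D (D' x) \<ominus> c \<odot>\<^bsub>R\<^esub> D' (D x)"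
      using cR[OF cx] DK[OF D] DK[OF D'] d(1) d'(1) cx by simp
    also have "\<dots> = c \<odot>\<^bsub>R\<^esub> (D (D' x) \<ominus> D' (D x))"
      using k cx by (simp add: R.minus_eq A.smult_r_distr A.smult_r_minus)
    finally show "?C (c \<odot>\<^bsub>R\<^esub> x) = c \<odot>\<^bsub>R\<^esub> ?C x" using cx by simp
  qed auto
  have Nder_add: "N (\<lambda>x\<in>carrier R. D x \<oplus> D' x) w = N D w \<boxplus> N D' w"
    if D: "D \<in> ?Der" and D': "D' \<in> ?Der" and w: "w \<in> carrier M" for D D' w
  proof (rule eq)
    note d = R.is_derivD[OF der[OF D]] and d' = R.is_derivD[OF der[OF D']]
    have c: "g w \<in> carrier R" using gD w by auto
    have "?e \<otimes> g (N (\<lambda>x\<in>carrier R. D x \<oplus> D' x) w) = ?e \<otimes> (D (g w) \<oplus> D' (g w)) \<ominus> (D F \<oplus> D' F) \<otimes> g w"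
      using N(2)[OF add_der[OF D D'] w] c F by simp
    also have "\<dots> = (?e \<otimes> D (g w) \<ominus> D F \<otimes> g w) \<oplus> (?e \<otimes> D' (g w) \<ominus> D' F \<otimes> g w)"
      using nn(1) F c d(1)[OF F] d(1)[OF c] d'(1)[OF F] d'(1)[OF c] by algebra
    also have "\<dots> = ?e \<otimes> g (N D w) \<oplus> ?e \<otimes> g (N D' w)" using N(2)[OF D w] N(2)[OF D' w] by simp
    also have "\<dots> = ?e \<otimes> g (N D w \<boxplus> N D' w)" using N(1)[OF D w] N(1)[OF D' w] gD e by (simp add: R.r_distr)
    finally show "?e \<otimes> g (N (\<lambda>x\<in>carrier R. D x \<oplus> D' x) w) = ?e \<otimes> g (N D w \<boxplus> N D' w)" .
  qed (use N(1) D D' add_der w in auto)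
  have Nder_smult: "N (\<lambda>x\<in>carrier R. a \<otimes> D x) w = a \<bullet> N D w"
    if D: "D \<in> ?Der" and a: "a \<in> carrier R" and w: "w \<in> carrier M" for D a w
  proof (rule eq)
    note d = R.is_derivD[OF der[OF D]]
    have c: "g w \<in> carrier R" using gD w by auto
    have "?e \<otimes> g (N (\<lambda>x\<in>carrier R. a \<otimes> D x) w) = ?e \<otimes> (a \<otimes> D (g w)) \<ominus> (a \<otimes> D F) \<otimes> g w"
      using N(2)[OF smult_der[OF D a] w] c F by simp
    also have "\<dots> = a \<otimes> (?e \<otimes> D (g w) \<ominus> D F \<otimes> g w)"
      using nn(1) F c d(1)[OF F] d(1)[OF c] a by algebra
    also have "\<dots> = a \<otimes> (?e \<otimes> g (N D w))" using N(2)[OF D w] by simp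
    also have "\<dots> = ?e \<otimes> (a \<otimes> g (N D w))" using nn(1) F a gD(1)[OF N(1)[OF D w]] by algebra
    also have "\<dots> = ?e \<otimes> g (a \<bullet> N D w)" using gD(3)[OF a N(1)[OF D w]] by simp
    finally show "?e \<otimes> g (N (\<lambda>x\<in>carrier R. a \<otimes> D x) w) = ?e \<otimes> g (a \<bullet> N D w)" .
  qed (use N(1) D a smult_der w in auto)
  have comm: "N D (N D' w) \<boxminus> N D' (N D w) = N (commutator R D D') w"
    if D: "D \<in> ?Der" and D': "D' \<in> ?Der" and w: "w \<in> carrier M" for D D' w
  proof (rule eq)
    \<comment> \<open>The part of the composition of \<open>N D\<close> and \<open>N D'\<close> that
      is symmetric in \<open>D\<close> and \<open>D'\<close>.\<close>
    define sym where "sym D D' = (nn \<oplus> \<one>) \<otimes> (D F \<otimes> D' F \<otimes> g w) \<ominus> ?e \<otimes> (D' F \<otimes> D (g w) \<oplus> D F \<otimes> D' (g w))" for D D'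
    have two: "?e \<otimes> (?e \<otimes> g (N D (N D' w))) =
        ?e \<otimes> (?e \<otimes> D (D' (g w)) \<ominus> D (D' F) \<otimes> g w) \<oplus> sym D D'"
      if D: "D \<in> ?Der" and D': "D' \<in> ?Der" for D D'
    proof -
      note d = R.is_derivD[OF der[OF D]] and d' = R.is_derivD[OF der[OF D']]
      note Nw = N[OF D' w]
      have c: "g w \<in> carrier R" "g (N D' w) \<in> carrier R" using gD w Nw by auto
      note k = nn(1) F c d(1)[OF F] d(1)[OF c(1)] d(1)[OF c(2)] d'(1)[OF F] d'(1)[OF c(1)]
        d(1)[OF d'(1)[OF F]] d(1)[OF d'(1)[OF c(1)]]
      \<comment> \<open>Differentiating the equation for \<open>N D' w\<close> brings in this
        derivative, which is the source of the coefficient \<open>nn + 1\<close>.\<close>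
      have De: "D ?e = nn \<otimes> D F" using d(3)[OF nn(1) F] nn(2)[OF der[OF D]] k by simp
      have "D (?e \<otimes> g (N D' w)) = D (?e \<otimes> D' (g w) \<ominus> D' F \<otimes> g w)" using Nw(2) by simp
      moreover have "D (?e \<otimes> g (N D' w)) = ?e \<otimes> D (g (N D' w)) \<oplus> nn \<otimes> D F \<otimes> g (N D' w)"
        using d(3)[OF e c(2)] De by simp
      moreover have "D (?e \<otimes> D' (g w) \<ominus> D' F \<otimes> g w) =
          (?e \<otimes> D (D' (g w)) \<oplus> nn \<otimes> D F \<otimes> D' (g w)) \<ominus> (D' F \<otimes> D (g w) \<oplus> D (D' F) \<otimes> g w)"
        using R.deriv_diff[OF der[OF D], of "?e \<otimes> D' (g w)" "D' F \<otimes> g w"] d(3)[OF e d'(1)[OF c(1)]] d(3)[OF d'(1)[OF F] c(1)] De k e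
        by simp
      ultimately have 1: "?e \<otimes> D (g (N D' w)) \<oplus> nn \<otimes> D F \<otimes> g (N D' w) =
          (?e \<otimes> D (D' (g w)) \<oplus> nn \<otimes> D F \<otimes> D' (g w)) \<ominus> (D' F \<otimes> D (g w) \<oplus> D (D' F) \<otimes> g w)" by simp
      have "?e \<otimes> (?e \<otimes> g (N D (N D' w))) = ?e \<otimes> (?e \<otimes> D (g (N D' w)) \<ominus> D F \<otimes> g (N D' w))"
        using N(2)[OF D Nw(1)] by simp
      also have "\<dots> = ?e \<otimes> (?e \<otimes> D (g (N D' w)) \<oplus> nn \<otimes> D F \<otimes> g (N D' w)) \<ominus> (nn \<oplus> \<one>) \<otimes> D F \<otimes> (?e \<otimes> g (N D' w))"
        using nn(1) F c d(1)[OF F] d(1)[OF c(2)] by algebra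
      also have "\<dots> = ?e \<otimes> ((?e \<otimes> D (D' (g w)) \<oplus> nn \<otimes> D F \<otimes> D' (g w)) \<ominus> (D' F \<otimes> D (g w) \<oplus> D (D' F) \<otimes> g w))
          \<ominus> (nn \<oplus> \<one>) \<otimes> D F \<otimes> (?e \<otimes> D' (g w) \<ominus> D' F \<otimes> g w)"
        unfolding 1 Nw(2) ..
      also have "\<dots> = ?e \<otimes> (?e \<otimes> D (D' (g w)) \<ominus> D (D' F) \<otimes> g w) \<oplus> sym D D'"
        unfolding sym_def by (rule R.connection_square_identity) (use k in auto)
      finally show ?thesis .
    qed
    note d = R.is_derivD[OF der[OF D]] and d' = R.is_derivD[OF der[OF D']]
    have c: "g w \<in> carrier R" using gD w by auto
    note k = nn(1) F c d(1)[OF F] d(1)[OF c(1)] d'(1)[OF F] d'(1)[OF c(1)]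
        d(1)[OF d'(1)[OF F]] d(1)[OF d'(1)[OF c(1)]] d'(1)[OF d(1)[OF F]] d'(1)[OF d(1)[OF c(1)]]
    have Nc: "N D (N D' w) \<in> carrier M" "N D' (N D w) \<in> carrier M" "N (commutator R D D') w \<in> carrier M"
      using N(1) D D' w comm_der by auto
    have cc: "commutator R D D' (g w) = D (D' (g w)) \<ominus> D' (D (g w))" "commutator R D D' F = D (D' F) \<ominus> D' (D F)"
      using c F by (simp_all add: commutator_def)
    have gc: "g (N D (N D' w)) \<in> carrier R" "g (N D' (N D w)) \<in> carrier R" using gD Nc by auto
    have "?e \<otimes> (?e \<otimes> g (N D (N D' w) \<boxminus> N D' (N D w))) =
        ?e \<otimes> (?e \<otimes> g (N D (N D' w))) \<ominus> ?e \<otimes> (?e \<otimes> g (N D' (N D w)))"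
      unfolding form_diff[OF g Nc(1,2)] using gc nn(1) F by algebra
    also have "\<dots> = ?e \<otimes> (?e \<otimes> (D (D' (g w)) \<ominus> D' (D (g w))) \<ominus> (D (D' F) \<ominus> D' (D F)) \<otimes> g w)"
    proof -
      have "sym D' D = sym D D'" unfolding sym_def using k by (simp add: R.m_ac R.a_ac)
      moreover have "sym D D' \<in> carrier R" unfolding sym_def using k by simp
      ultimately show ?thesis unfolding two[OF D D'] two[OF D' D]
        using R.connection_commutator_identity[of ?e "D (D' (g w))" "D' (D (g w))" "D (D' F)" "D' (D F)" "g w" "sym D D'"] k e
        by simp
    qed
    also have "\<dots> = ?e \<otimes> (?e \<otimes> g (N (commutator R D D') w))"
      using N(2)[OF comm_der[OF D D'] w] cc by simp
    finally have f: "?e \<otimes> (?e \<otimes> g (N D (N D' w) \<boxminus> N D' (N D w))) = ?e \<otimes> (?e \<otimes> g (N (commutator R D D') w))" .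
    have h: "g (N D (N D' w) \<boxminus> N D' (N D w)) \<in> carrier R" "g (N (commutator R D D') w) \<in> carrier R" using gD Nc by auto
    let ?x = "?e \<otimes> g (N D (N D' w) \<boxminus> N D' (N D w))" and ?y = "?e \<otimes> g (N (commutator R D D') w)"
    have xy: "?x \<in> carrier R" "?y \<in> carrier R" using h e by auto
    \<comment> \<open>Of the two factors \<open>nn F\<close>, one is cancelled here and the other by
      \<open>eq\<close>.\<close>
    have "?e \<otimes> (?x \<ominus> ?y) = ?e \<otimes> ?x \<ominus> ?e \<otimes> ?y" using nn(1) F h by algebra
    also have "\<dots> = \<zero>" using f xy e by (simp add: R.minus_eq R.r_neg)
    finally have "?x \<ominus> ?y = \<zero>" using reg xy by simp
    then show "?x = ?y" using xy by (simp add: R.r_right_minus_eq)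
  qed (use N(1) D D' w comm_der in auto)
  define nabla where "nabla = (\<lambda>D\<in>?Der. \<lambda>w\<in>carrier M. N D w)"
  have nb: "nabla D = (\<lambda>w\<in>carrier M. N D w)" if "D \<in> ?Der" for D using that by (simp add: nabla_def)
  have conn: "connection K R M nabla" unfolding connection_def
  proof (intro conjI ballI)
    show "nabla \<in> lin_maps R (der_module K R) (end_module K R M)"
      unfolding lin_maps_def
    proof (intro CollectI conjI ballI)
      have "(\<lambda>w\<in>carrier M. N D w) \<in> lin_maps K (restrict_scalars R M) (restrict_scalars R M)" if D: "D \<in> ?Der" for D
        unfolding lin_maps_def
      proof (intro CollectI conjI ballI)
        fix c x assume c: "c \<in> carrier K" and "x \<in> carrier (restrict_scalars R M)"
        then have x: "x \<in> carrier M" by (simp add: restrict_scalars_def)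
        have c1: "c \<odot>\<^bsub>R\<^esub> \<one> \<in> carrier R" using cR c by simp
        show "(\<lambda>w\<in>carrier M. N D w) (c \<odot>\<^bsub>restrict_scalars R M\<^esub> x) = c \<odot>\<^bsub>restrict_scalars R M\<^esub> (\<lambda>w\<in>carrier M. N D w) x"
          using Nleib[OF D c1 x] Dc[OF D c] c1 x N(1)[OF D x] by (simp add: restrict_scalars_def)
      qed (use N(1)[OF D] Nadd[OF D] in \<open>auto simp: restrict_scalars_def\<close>)
      then show "nabla \<in> carrier (der_module K R) \<rightarrow>\<^sub>E carrier (end_module K R M)"
        by (auto simp: nabla_def der_module_def end_module_def fun_module_def)
    next
      fix D D' assume "D \<in> carrier (der_module K R)" "D' \<in> carrier (der_module K R)"
      then have D: "D \<in> ?Der" "D' \<in> ?Der" by (simp_all add: der_module_def fun_module_def)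
      show "nabla (D \<oplus>\<^bsub>der_module K R\<^esub> D') = nabla D \<oplus>\<^bsub>end_module K R M\<^esub> nabla D'"
        using D add_der[OF D] Nder_add[OF D]
        by (simp add: der_module_def end_module_def fun_module_def nb cong: restrict_cong)
    next
      fix a D assume a: "a \<in> carrier R" and "D \<in> carrier (der_module K R)"
      then have D: "D \<in> ?Der" by (simp_all add: der_module_def fun_module_def)
      show "nabla (a \<odot>\<^bsub>der_module K R\<^esub> D) = a \<odot>\<^bsub>end_module K R M\<^esub> nabla D"
        using D a smult_der[OF D a] Nder_smult[OF D a]
        by (simp add: der_module_def end_module_def fun_module_def nb cong: restrict_cong)
    qed
    fix D a x assume "D \<in> ?Der" "a \<in> carrier R" "x \<in> carrier M"
    then show "nabla D (a \<bullet> x) = a \<bullet> nabla D x \<boxplus> D a \<bullet> x" using Nleib by (simp add: nb)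
  qed
  have "commutator M (nabla D) (nabla D') = nabla (commutator R D D')" if D: "D \<in> ?Der" and D': "D' \<in> ?Der" for D D'
    unfolding nb[OF D] nb[OF D'] nb[OF comm_der[OF D D']] commutator_def[of M]
    by (rule restrict_ext) (use comm[OF D D'] N(1)[OF D] N(1)[OF D'] in simp)
  then show ?thesis using conn unfolding integrable_connection_def by blast
qed

section \<open>Injective resolutions in dimension one\<close>

lemma (in module) trivial_mod_zeroI:
  "v \<in> carrier M \<Longrightarrow> (\<And>r w. (r, w) \<in> G \<Longrightarrow> w = r \<bullet> v) \<Longrightarrow> G \<subseteq> carrier R \<times> carrier M \<Longrightarrow> trivial_mod {\<zero>\<^bsub>M\<^esub>} G"
  by (rule trivial_modI, assumption) (auto simp: cong_mod_def M.minus_eq M.r_neg)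

lemma (in module) cong_zero: "cong_mod {\<zero>\<^bsub>M\<^esub>} v w \<longleftrightarrow> v \<in> carrier M \<and> w \<in> carrier M \<and> v = w"
proof
  assume *: "cong_mod {\<zero>\<^bsub>M\<^esub>} v w"
  then have c: "v \<in> carrier M" "w \<in> carrier M" "v \<boxminus> w = \<zero>\<^bsub>M\<^esub>" by (auto simp: cong_mod_def)
  have "v = (v \<boxminus> w) \<boxplus> w" using c(1,2) by algebra
  then show "v \<in> carrier M \<and> w \<in> carrier M \<and> v = w" using c by simp
qed (auto simp: cong_mod_def M.minus_eq M.r_neg)

lemma (in module) trivial_mod_zeroD:
  assumes "trivial_mod {\<zero>\<^bsub>M\<^esub>} G"
  shows "\<exists>v\<in>carrier M. \<forall>r w. (r, w) \<in> G \<longrightarrow> w = r \<bullet> v"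
  using assms unfolding trivial_mod_def cong_zero by blast

text \<open>Baer's form of injectivity. The domain is an ideal, so it can be made a module with
  elements in the type of \<open>R\<close>, as \<open>injective_module\<close> asks of its test
  modules.\<close>

lemma (in cring) injective_extend:
  assumes E: "injective_module R E" and G: "module.lin_graph R E G" "module.functional_mod R {\<zero>\<^bsub>E\<^esub>} G"
  shows "\<exists>v\<in>carrier E. \<forall>r w. (r, w) \<in> G \<longrightarrow> w = r \<odot>\<^bsub>E\<^esub> v"
proof -
  interpret E: module R E using E by (simp add: injective_module_def)
  interpret S: module R "self_module R" by (rule module_self)
  note D = E.lin_graphD[OF G(1)]
  let ?J = "fst ` G"
  have J: "ideal ?J R" by (rule E.lin_graph_dom_ideal[OF G(1)])
  define P where "P = (self_module R)\<lparr>carrier := ?J\<rparr>"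
  have P: "module R P" unfolding P_def
    by (rule submodule.submodule_is_module[OF _ S.module_axioms]) (simp add: submodule_self_iff J)
  have Pc: "carrier P = ?J" "add P = add R" "smult P = monoid.mult R" by (simp_all add: P_def)
  have Jc: "r \<in> carrier R" if "r \<in> ?J" for r using ideal_carr[OF J that] .
  define f where "f = (\<lambda>r\<in>?J. r)"
  define g where "g = (\<lambda>r\<in>?J. SOME w. (r, w) \<in> G)"
  have gG: "(r, g r) \<in> G" if "r \<in> ?J" for r
  proof -
    have "\<exists>w. (r, w) \<in> G" using that by force
    then have "(r, SOME w. (r, w) \<in> G) \<in> G" by (rule someI_ex)
    then show ?thesis using that by (simp add: g_def)
  qed
  have geq: "g r = w" if "(r, w) \<in> G" for r w
  proof -
    have "r \<in> ?J" using that by force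
    then show ?thesis using E.functional_modD[OF G gG that] by (simp add: E.cong_zero)
  qed
  have f: "f \<in> lin_maps R P (self_module R)" unfolding lin_maps_def Pc
    using Jc ideal_add[OF J] ideal.I_l_closed[OF J] by (auto simp: f_def)
  have fi: "inj_on f (carrier P)" by (auto simp: inj_on_def f_def Pc)
  have g: "g \<in> lin_maps R P E" unfolding lin_maps_def Pc
  proof (intro CollectI conjI ballI)
    show "g \<in> ?J \<rightarrow>\<^sub>E carrier E" using D(2)[OF gG] by (auto simp: g_def)
    fix r s assume "r \<in> ?J" "s \<in> ?J"
    then show "g (r \<oplus> s) = g r \<oplus>\<^bsub>E\<^esub> g s" using geq[OF D(4)[OF gG gG]] by blast
  next
    fix a r assume "a \<in> carrier R" "r \<in> ?J"
    then show "g (a \<otimes> r) = a \<odot>\<^bsub>E\<^esub> g r" using geq[OF D(5)[OF _ gG]] by blast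
  qed
  have "\<exists>h\<in>lin_maps R (self_module R) E. \<forall>x\<in>carrier P. h (f x) = g x"
    using E P S.module_axioms f fi g unfolding injective_module_def by blast
  then obtain h where h: "h \<in> lin_maps R (self_module R) E" "\<And>x. x \<in> ?J \<Longrightarrow> h (f x) = g x" unfolding Pc by blast
  have "w = r \<odot>\<^bsub>E\<^esub> h \<one>" if rw: "(r, w) \<in> G" for r w
  proof -
    have r: "r \<in> ?J" using rw by force
    have "w = h r" using geq[OF rw] h(2)[OF r] r by (simp add: f_def)
    also have "\<dots> = h (r \<odot>\<^bsub>self_module R\<^esub> \<one>)" using Jc[OF r] by simp
    also have "\<dots> = r \<odot>\<^bsub>E\<^esub> h \<one>" using lin_mapsD(3)[OF h(1) Jc[OF r], of \<one>] by simp
    finally show ?thesis .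
  qed
  moreover have "h \<one> \<in> carrier E" using lin_mapsD(1)[OF h(1), of \<one>] by simp
  ultimately show ?thesis by blast
qed

text \<open>The class of \<open>s\<close> is a nonzero element of the socle of \<open>R / x R\<close>.\<close>

locale dim_one = noeth_local R mm for R (structure) and mm +
  fixes x s
  assumes x_mm: "x \<in> mm" and x_regular: "\<And>a. a \<in> carrier R \<Longrightarrow> x \<otimes> a = \<zero> \<Longrightarrow> a = \<zero>"
    and x_primes: "\<And>p. primeideal p R \<Longrightarrow> x \<in> p \<Longrightarrow> p = mm"
    and s: "s \<in> carrier R" "s \<notin> PIdl x" "\<And>r. r \<in> mm \<Longrightarrow> r \<otimes> s \<in> PIdl x"
begin

lemma x_carr: "x \<in> carrier R" using x_mm mm_carr by simp

lemma socle_multiplier: "a \<in> carrier R \<Longrightarrow> a \<otimes> s \<in> PIdl x \<Longrightarrow> a \<in> mm"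
proof (rule ccontr)
  assume a: "a \<in> carrier R" "a \<otimes> s \<in> PIdl x" "a \<notin> mm"
  then have u: "a \<in> Units R" using nonunits by blast
  then have "inv a \<otimes> (a \<otimes> s) \<in> PIdl x" using ideal.I_l_closed[OF cgenideal_ideal[OF x_carr] a(2)] by simp
  then show False using u a s by (simp add: m_assoc[symmetric])
qed

text \<open>The kernel of \<open>x\<close> on \<open>Z\<close> is an injective module over \<open>R / x R\<close>.\<close>

definition x_injective :: "('a, 'e) module \<Rightarrow> 'e set \<Rightarrow> bool"
  where "x_injective E Z \<longleftrightarrow> (\<forall>G. module.lin_graph R E G \<longrightarrow> module.functional_mod R {\<zero>\<^bsub>E\<^esub>} G \<longrightarrow>
    G \<subseteq> carrier R \<times> Z \<longrightarrow> (x, \<zero>\<^bsub>E\<^esub>) \<in> G \<longrightarrow> (\<exists>v\<in>Z. \<forall>r w. (r, w) \<in> G \<longrightarrow> w = r \<odot>\<^bsub>E\<^esub> v))"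

text \<open>The map from \<open>s R + x R\<close> to \<open>E / N\<close> with
  \<open>s \<mapsto> e\<close> and \<open>x \<mapsto> 0\<close> is well defined: if
  \<open>a s\<close> is in \<open>x R\<close>, then \<open>a\<close> is in \<open>mm\<close> and
  kills \<open>e\<close> modulo \<open>N\<close>.\<close>

lemma socle_graph:
  assumes E: "module R E" and N: "submodule N R E"
    and e: "e \<in> carrier E" "\<And>r. r \<in> mm \<Longrightarrow> r \<odot>\<^bsub>E\<^esub> e \<in> N"
  defines "G \<equiv> {(a \<otimes> s \<oplus> b \<otimes> x, a \<odot>\<^bsub>E\<^esub> e) |a b. a \<in> carrier R \<and> b \<in> carrier R}"
  shows "module.lin_graph R E G" "module.functional_mod R N G" "(x, \<zero>\<^bsub>E\<^esub>) \<in> G" "(s, e) \<in> G"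
proof -
  interpret E: module R E by (rule E)
  have GI: "(a \<otimes> s \<oplus> b \<otimes> x, a \<odot>\<^bsub>E\<^esub> e) \<in> G" if "a \<in> carrier R" "b \<in> carrier R" for a b using that by (auto simp: G_def)
  show "E.lin_graph G" unfolding E.lin_graph_def
  proof (intro conjI allI impI)
    show "G \<subseteq> carrier R \<times> carrier E" using s(1) x_carr e(1) by (auto simp: G_def)
    show "(\<zero>, \<zero>\<^bsub>E\<^esub>) \<in> G" using GI[of \<zero> \<zero>] s(1) x_carr e(1) by simp
  next
    fix r w r' w' assume "(r, w) \<in> G" "(r', w') \<in> G"
    then obtain a b a' b' where h: "r = a \<otimes> s \<oplus> b \<otimes> x" "w = a \<odot>\<^bsub>E\<^esub> e" "r' = a' \<otimes> s \<oplus> b' \<otimes> x" "w' = a' \<odot>\<^bsub>E\<^esub> e"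
      "a \<in> carrier R" "b \<in> carrier R" "a' \<in> carrier R" "b' \<in> carrier R" by (auto simp: G_def)
    have "r \<oplus> r' = (a \<oplus> a') \<otimes> s \<oplus> (b \<oplus> b') \<otimes> x" unfolding h(1,3) using h(5-8) s(1) x_carr by algebra
    moreover have "w \<oplus>\<^bsub>E\<^esub> w' = (a \<oplus> a') \<odot>\<^bsub>E\<^esub> e" unfolding h(2,4) using h(5-8) e(1) by (simp add: E.smult_l_distr)
    ultimately show "(r \<oplus> r', w \<oplus>\<^bsub>E\<^esub> w') \<in> G" using GI h(5-8) by simp
  next
    fix c r w assume c: "c \<in> carrier R" and "(r, w) \<in> G"
    then obtain a b where h: "r = a \<otimes> s \<oplus> b \<otimes> x" "w = a \<odot>\<^bsub>E\<^esub> e" "a \<in> carrier R" "b \<in> carrier R" by (auto simp: G_def)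
    have "c \<otimes> r = (c \<otimes> a) \<otimes> s \<oplus> (c \<otimes> b) \<otimes> x" unfolding h(1) using h(3-4) c s(1) x_carr by algebra
    moreover have "c \<odot>\<^bsub>E\<^esub> w = (c \<otimes> a) \<odot>\<^bsub>E\<^esub> e" unfolding h(2) using h(3) c e(1) by (simp add: E.smult_assoc1)
    ultimately show "(c \<otimes> r, c \<odot>\<^bsub>E\<^esub> w) \<in> G" using GI h(3-4) c by simp
  qed
  show "E.functional_mod N G" unfolding E.functional_mod_def
  proof (intro allI impI)
    fix w assume "(\<zero>, w) \<in> G"
    then obtain a b where h: "\<zero> = a \<otimes> s \<oplus> b \<otimes> x" "w = a \<odot>\<^bsub>E\<^esub> e" "a \<in> carrier R" "b \<in> carrier R"
      unfolding G_def by blast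
    have "a \<otimes> s = (a \<otimes> s \<oplus> b \<otimes> x) \<oplus> (\<ominus> b) \<otimes> x" using h(3,4) s(1) x_carr by algebra
    also have "\<dots> = (\<ominus> b) \<otimes> x" unfolding h(1)[symmetric] using h(4) x_carr by simp
    finally have "a \<otimes> s \<in> PIdl x" using h(4) unfolding cgenideal_def by blast
    then have "a \<in> mm" using socle_multiplier h by blast
    then show "w \<in> N" using e(2) h(2) by simp
  qed
  show "(x, \<zero>\<^bsub>E\<^esub>) \<in> G" using GI[of \<zero> \<one>] s(1) x_carr e(1) by simp
  show "(s, e) \<in> G" using GI[of \<one> \<zero>] s(1) x_carr e(1) by simp
qed

text \<open>The map \<open>s \<mapsto> e\<close>, \<open>x \<mapsto> 0\<close> extends to the whole
  ring, and its value at 1 is the quotient of \<open>e\<close> by \<open>s\<close>.\<close>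

lemma socle_divide:
  assumes E: "module R E" and Z: "submodule Z R E" and inj: "x_injective E Z"
    and e: "e \<in> Z" "\<And>r. r \<in> mm \<Longrightarrow> r \<odot>\<^bsub>E\<^esub> e = \<zero>\<^bsub>E\<^esub>"
  shows "\<exists>v\<in>Z. e = s \<odot>\<^bsub>E\<^esub> v \<and> x \<odot>\<^bsub>E\<^esub> v = \<zero>\<^bsub>E\<^esub>"
proof -
  interpret E: module R E by (rule E)
  have ec: "e \<in> carrier E" using E.sub_carr[OF Z e(1)] .
  let ?G = "{(a \<otimes> s \<oplus> b \<otimes> x, a \<odot>\<^bsub>E\<^esub> e) |a b. a \<in> carrier R \<and> b \<in> carrier R}"
  have "\<And>r. r \<in> mm \<Longrightarrow> r \<odot>\<^bsub>E\<^esub> e \<in> {\<zero>\<^bsub>E\<^esub>}" using e(2) by simp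
  note G = socle_graph[OF E E.zero_sub ec this]
  have "?G \<subseteq> carrier R \<times> Z" using E.sub_smult[OF Z _ e(1)] s(1) x_carr by auto
  from inj[unfolded x_injective_def, rule_format, OF G(1,2) this G(3)]
  obtain v where v: "v \<in> Z" "\<forall>r w. (r, w) \<in> ?G \<longrightarrow> w = r \<odot>\<^bsub>E\<^esub> v" by blast
  then show ?thesis using v(2)[rule_format, OF G(3)] v(2)[rule_format, OF G(4)] by metis
qed

text \<open>A map from \<open>mm\<close> to \<open>Z\<close> is the multiplication by some \<open>e\<close> in \<open>E\<close>. As \<open>mm\<close> kills \<open>\<delta> e\<close>,
  this is \<open>s\<close> times an element that lifts to some \<open>e\<^sub>4\<close> with \<open>x e\<^sub>4 = 0\<close>, and then \<open>e - s e\<^sub>4\<close> is in \<open>Z\<close>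
  and induces the same map.\<close>

lemma x_injective_kernel:
  assumes E: "injective_module R E" and E': "module R E'" and \<delta>: "\<delta> \<in> lin_maps R E E'"
    and Z: "Z = {z \<in> carrier E. \<delta> z = \<zero>\<^bsub>E'\<^esub>}" and div: "\<And>z. z \<in> Z \<Longrightarrow> \<exists>z'\<in>Z. z = x \<odot>\<^bsub>E\<^esub> z'"
    and inj: "x_injective E' (\<delta> ` carrier E)"
  shows "x_injective E Z"
  unfolding x_injective_def
proof (intro allI impI)
  interpret E: module R E using E by (simp add: injective_module_def)
  interpret E': module R E' by (rule E')
  note d = lin_maps_props[OF E.module_axioms E' \<delta>]
  have Zs: "submodule Z R E" unfolding Z by (rule E.lin_map_kernel_sub[OF E' \<delta>])
  note Z's = E'.lin_map_image_sub[OF E.module_axioms \<delta>]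
  \<comment> \<open>The devissage runs inside \<open>Z\<close>, so that the multiplier it produces
    belongs to \<open>Z\<close>. The condition that the relation contains \<open>(x, 0)\<close>
    leaves \<open>mm\<close> as the only prime domain.\<close>
  define ZM where "ZM = E\<lparr>carrier := Z\<rparr>"
  have ZM: "module R ZM" unfolding ZM_def by (rule submodule.submodule_is_module[OF Zs E.module_axioms])
  interpret ZM: module R ZM by (rule ZM)
  have Zc: "carrier ZM = Z" "add ZM = add E" "smult ZM = smult E" "zero ZM = zero E" by (simp_all add: ZM_def)
  have ZE: "Z \<subseteq> carrier E" by (auto simp: Z)
  have linE: "ZM.lin_graph G \<longleftrightarrow> E.lin_graph G \<and> G \<subseteq> carrier R \<times> Z" for G
    unfolding ZM.lin_graph_def E.lin_graph_def Zc using ZE by blast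
  have fnE: "ZM.functional_mod {\<zero>\<^bsub>ZM\<^esub>} G \<longleftrightarrow> E.functional_mod {\<zero>\<^bsub>E\<^esub>} G" for G
    unfolding ZM.functional_mod_def E.functional_mod_def Zc ..
  fix G assume G: "E.lin_graph G" "E.functional_mod {\<zero>\<^bsub>E\<^esub>} G" "G \<subseteq> carrier R \<times> Z" "(x, \<zero>\<^bsub>E\<^esub>) \<in> G"
  have "ZM.trivial_mod {\<zero>\<^bsub>ZM\<^esub>} G"
  proof (rule ZM.trivial_mod_devissage[where P = "\<lambda>G. (x, \<zero>\<^bsub>E\<^esub>) \<in> G", OF acc ZM.zero_sub])
    fix G c assume "ZM.lin_graph G" "(x, \<zero>\<^bsub>E\<^esub>) \<in> G" "c \<in> carrier R"
    moreover from this have "(c \<otimes> x, c \<odot>\<^bsub>E\<^esub> \<zero>\<^bsub>E\<^esub>) \<in> G" using E.lin_graphD(5) linE by blast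
    ultimately show "(x, \<zero>\<^bsub>E\<^esub>) \<in> {(r, w). r \<in> carrier R \<and> (r \<otimes> c, w) \<in> G}" using x_carr by (simp add: m_comm)
  next
    fix G assume "ZM.lin_graph G" "ZM.functional_mod {\<zero>\<^bsub>ZM\<^esub>} G" and x0: "(x, \<zero>\<^bsub>E\<^esub>) \<in> G" and pr: "primeideal (fst ` G) R"
    then have G: "E.lin_graph G" "E.functional_mod {\<zero>\<^bsub>E\<^esub>} G" "G \<subseteq> carrier R \<times> Z" using linE fnE by auto
    note D = E.lin_graphD[OF G(1)]
    have dom: "fst ` G = mm" using x_primes[OF pr] x0 by force
    obtain e where e: "e \<in> carrier E" "\<And>r w. (r, w) \<in> G \<Longrightarrow> w = r \<odot>\<^bsub>E\<^esub> e" using injective_extend[OF E G(1,2)] by blast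
    have "r \<odot>\<^bsub>E'\<^esub> \<delta> e = \<zero>\<^bsub>E'\<^esub>" if "r \<in> mm" for r
    proof -
      obtain w where rw: "(r, w) \<in> G" using \<open>r \<in> mm\<close> dom by force
      have "r \<odot>\<^bsub>E'\<^esub> \<delta> e = \<delta> w" using d(3)[OF D(1)[OF rw] e(1)] e(2)[OF rw] by simp
      then show ?thesis using rw G(3) Z by auto
    qed
    then obtain v where v: "v \<in> \<delta> ` carrier E" "\<delta> e = s \<odot>\<^bsub>E'\<^esub> v" "x \<odot>\<^bsub>E'\<^esub> v = \<zero>\<^bsub>E'\<^esub>"
      using socle_divide[OF E' Z's inj, of "\<delta> e"] e(1) by blast
    obtain e3 where e3: "e3 \<in> carrier E" "v = \<delta> e3" using v(1) by blast
    \<comment> \<open>The lift \<open>e3\<close> of \<open>v\<close> is killed by \<open>x\<close>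
      only modulo \<open>Z\<close>; divisibility of \<open>Z\<close> by \<open>x\<close> corrects
      it.\<close>
    have "x \<odot>\<^bsub>E\<^esub> e3 \<in> Z" using v(3) e3 d(3)[OF x_carr] x_carr by (simp add: Z)
    then obtain z3 where z3: "z3 \<in> Z" "x \<odot>\<^bsub>E\<^esub> e3 = x \<odot>\<^bsub>E\<^esub> z3" using div by blast
    have z3c: "z3 \<in> carrier E" "\<delta> z3 = \<zero>\<^bsub>E'\<^esub>" using z3 Z by auto
    define e4 where "e4 = e3 \<ominus>\<^bsub>E\<^esub> z3"
    have e4c: "e4 \<in> carrier E" unfolding e4_def using e3 z3c by simp
    have "x \<odot>\<^bsub>E\<^esub> e4 = x \<odot>\<^bsub>E\<^esub> e3 \<ominus>\<^bsub>E\<^esub> x \<odot>\<^bsub>E\<^esub> z3" unfolding e4_def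
      using x_carr e3(1) z3c(1) by (simp add: E.M.minus_eq E.smult_r_distr E.smult_r_minus)
    also have "\<dots> = \<zero>\<^bsub>E\<^esub>" unfolding z3(2) using x_carr z3c by (simp add: E.M.minus_eq E.M.r_neg)
    finally have xe4: "x \<odot>\<^bsub>E\<^esub> e4 = \<zero>\<^bsub>E\<^esub>" .
    have de4: "\<delta> e4 = v" unfolding e4_def using d(5)[OF e3(1) z3c(1)] z3c e3 d(1)[OF e3(1)] by (simp add: E'.M.minus_eq)
    define z where "z = e \<ominus>\<^bsub>E\<^esub> s \<odot>\<^bsub>E\<^esub> e4"
    have zc: "z \<in> carrier E" unfolding z_def using e s(1) e4c by simp
    have "\<delta> z = \<delta> e \<ominus>\<^bsub>E'\<^esub> s \<odot>\<^bsub>E'\<^esub> v" unfolding z_def using d(5)[OF e(1)] d(3)[OF s(1) e4c] s(1) e4c de4 by simp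
    also have "\<dots> = \<zero>\<^bsub>E'\<^esub>" unfolding v(2) using s(1) d(1)[OF e3(1)] e3 by (simp add: E'.M.minus_eq E'.M.r_neg)
    finally have zZ: "z \<in> Z" using zc Z by simp
    show "ZM.trivial_mod {\<zero>\<^bsub>ZM\<^esub>} G"
    proof (rule ZM.trivial_mod_zeroI)
      show "z \<in> carrier ZM" using zZ Zc by simp
      show "G \<subseteq> carrier R \<times> carrier ZM" using G(3) Zc by simp
      fix r w assume rw: "(r, w) \<in> G"
      have r: "r \<in> mm" "r \<in> carrier R" using rw dom D(1)[OF rw] by force+
      obtain b where b: "b \<in> carrier R" "r \<otimes> s = b \<otimes> x" using s(3)[OF r(1)] by (auto simp: cgenideal_def)
      have "r \<odot>\<^bsub>E\<^esub> (s \<odot>\<^bsub>E\<^esub> e4) = b \<odot>\<^bsub>E\<^esub> (x \<odot>\<^bsub>E\<^esub> e4)"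
        using r s(1) b x_carr e4c by (simp add: E.smult_assoc1[symmetric])
      then have "r \<odot>\<^bsub>E\<^esub> (s \<odot>\<^bsub>E\<^esub> e4) = \<zero>\<^bsub>E\<^esub>" using xe4 b by simp
      then have "r \<odot>\<^bsub>E\<^esub> z = r \<odot>\<^bsub>E\<^esub> e" unfolding z_def
        using r(2) e(1) s(1) e4c by (simp add: E.M.minus_eq E.smult_r_distr E.smult_r_minus)
      then show "w = r \<odot>\<^bsub>ZM\<^esub> z" using e(2)[OF rw] Zc by simp
    qed
  qed (use G linE fnE in auto)
  then show "\<exists>v\<in>Z. \<forall>r w. (r, w) \<in> G \<longrightarrow> w = r \<odot>\<^bsub>E\<^esub> v"
    using ZM.trivial_mod_zeroD[of G] unfolding Zc by blast
qed

text \<open>As \<open>x\<close> is regular, \<open>x \<mapsto> e\<close> defines a map on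
  \<open>x R\<close>, and its extension to \<open>R\<close> divides \<open>e\<close> by
  \<open>x\<close>.\<close>

lemma injective_divisible:
  assumes E: "injective_module R E" and e: "e \<in> carrier E"
  shows "\<exists>e'\<in>carrier E. e = x \<odot>\<^bsub>E\<^esub> e'"
proof -
  interpret E: module R E using E by (simp add: injective_module_def)
  define G where "G = {(a \<otimes> x, a \<odot>\<^bsub>E\<^esub> e) |a. a \<in> carrier R}"
  have lin: "E.lin_graph G" unfolding E.lin_graph_def
  proof (intro conjI allI impI)
    show "G \<subseteq> carrier R \<times> carrier E" using x_carr e by (auto simp: G_def)
    show "(\<zero>, \<zero>\<^bsub>E\<^esub>) \<in> G" using x_carr e by (auto simp: G_def intro!: exI[of _ \<zero>])
  next
    fix r w r' w' assume "(r, w) \<in> G" "(r', w') \<in> G"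
    then show "(r \<oplus> r', w \<oplus>\<^bsub>E\<^esub> w') \<in> G" using x_carr e
      by (auto simp: G_def l_distr[symmetric] E.smult_l_distr[symmetric])
  next
    fix c r w assume "c \<in> carrier R" "(r, w) \<in> G"
    then show "(c \<otimes> r, c \<odot>\<^bsub>E\<^esub> w) \<in> G" using x_carr e
      by (auto simp: G_def m_assoc[symmetric] E.smult_assoc1[symmetric])
  qed
  have "E.functional_mod {\<zero>\<^bsub>E\<^esub>} G" unfolding E.functional_mod_def
  proof (intro allI impI)
    fix w assume "(\<zero>, w) \<in> G"
    then obtain a where a: "a \<in> carrier R" "\<zero> = a \<otimes> x" "w = a \<odot>\<^bsub>E\<^esub> e" by (auto simp: G_def)
    then have "a = \<zero>" using x_regular[of a] x_carr by (simp add: m_comm)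
    then show "w \<in> {\<zero>\<^bsub>E\<^esub>}" using a(3) e by simp
  qed
  then obtain v where v: "v \<in> carrier E" "\<And>r w. (r, w) \<in> G \<Longrightarrow> w = r \<odot>\<^bsub>E\<^esub> v" using injective_extend[OF E lin] by blast
  have "(\<one> \<otimes> x, \<one> \<odot>\<^bsub>E\<^esub> e) \<in> G" unfolding G_def by blast
  from v(2)[OF this] show ?thesis using v(1) x_carr e by auto
qed

text \<open>Downward induction along the resolution. At its end the image is a whole injective
  module; each earlier image is the kernel of the next differential and is divisible by
  \<open>x\<close> as an image of an injective module, so \<open>x_injective_kernel\<close> applies.
  The descent stops at the first image, as the resolved module itself need not be divisible.\<close>

lemma x_injective_resolution:
  assumes res: "injective_resolution R M E \<eta> \<delta>" and fin: "\<forall>i>r. carrier (E i) = {\<zero>\<^bsub>E i\<^esub>}"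
  shows "x_injective (E 1) (\<delta> 0 ` carrier (E 0))"
proof -
  have E: "injective_module R (E i)" for i using res by (simp add: injective_resolution_def)
  have Em: "module R (E i)" for i using E[of i] by (simp add: injective_module_def)
  have \<delta>: "\<delta> i \<in> lin_maps R (E i) (E (Suc i))" for i using res by (simp add: injective_resolution_def)
  have ex: "\<delta> i ` carrier (E i) = {z \<in> carrier (E (Suc i)). \<delta> (Suc i) z = \<zero>\<^bsub>E (Suc (Suc i))\<^esub>}" for i
    using res by (simp add: injective_resolution_def)
  have "x_injective (E (Suc i)) (\<delta> i ` carrier (E i))" if "i \<le> r" for i
    using that
  proof (induction i rule: inc_induct)
    case base
    have "\<delta> r ` carrier (E r) = carrier (E (Suc r))"
    proof -
      have "\<delta> (Suc r) z = \<zero>\<^bsub>E (Suc (Suc r))\<^esub>" if "z \<in> carrier (E (Suc r))" for z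
        using lin_mapsD(1)[OF \<delta>[of "Suc r"] that] fin by simp
      then show ?thesis unfolding ex by blast
    qed
    then show ?case unfolding x_injective_def using injective_extend[OF E] by auto
  next
    case (step i)
    show ?case
    proof (rule x_injective_kernel[OF E Em \<delta> ex])
      fix z assume "z \<in> \<delta> i ` carrier (E i)"
      then obtain e where e: "e \<in> carrier (E i)" "z = \<delta> i e" by blast
      obtain e' where e': "e' \<in> carrier (E i)" "e = x \<odot>\<^bsub>E i\<^esub> e'" using injective_divisible[OF E e(1)] by blast
      then have "z = x \<odot>\<^bsub>E (Suc i)\<^esub> \<delta> i e'" using e lin_mapsD(3)[OF \<delta>[of i] x_carr e'(1)] by simp
      then show "\<exists>z'\<in>\<delta> i ` carrier (E i). z = x \<odot>\<^bsub>E (Suc i)\<^esub> z'" using e'(1) by blast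
    qed (rule step.IH)
  qed
  from this[of 0] show ?thesis by simp
qed

end

section \<open>Self-injectivity of \<open>R / x R\<close>\<close>

context dim_one
begin

sublocale S: noeth_local_module R "self_module R" mm by (rule noeth_local_self)

text \<open>\<open>R / x R\<close> is injective over itself.\<close>

definition self_extension :: bool
  where "self_extension \<longleftrightarrow> (\<forall>G. S.lin_graph G \<longrightarrow> (\<forall>w. (\<zero>, w) \<in> G \<longrightarrow> w \<in> PIdl x) \<longrightarrow>
    (\<exists>w\<in>PIdl x. (x, w) \<in> G) \<longrightarrow> (\<exists>v\<in>carrier R. \<forall>r a. (r, a) \<in> G \<longrightarrow> a \<ominus> r \<otimes> v \<in> PIdl x))"

text \<open>With \<open>x e0 = \<eta> 1\<close>, the map
  \<open>a \<mapsto> a (\<delta> 0 e0)\<close> embeds \<open>R / x R\<close> as a direct summand of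
  the kernel of \<open>x\<close> on the image of \<open>\<delta> 0\<close>. The retraction is the
  connecting map, which sends \<open>\<delta> 0 g\<close> to the \<open>v\<close> with
  \<open>x g = \<eta> v\<close>. Extension of maps passes to direct summands.\<close>

lemma self_extension_of_resolution:
  assumes res: "injective_resolution R (self_module R) E \<eta> \<delta>" and fin: "\<forall>i>r. carrier (E i) = {\<zero>\<^bsub>E i\<^esub>}"
  shows self_extension
  unfolding self_extension_def
proof (intro allI impI)
  note [simp del] = One_nat_def
  have E: "injective_module R (E i)" for i using res by (simp add: injective_resolution_def)
  interpret E0: module R "E 0" using E[of 0] by (simp add: injective_module_def)
  interpret E1: module R "E 1" using E[of 1] by (simp add: injective_module_def)
  have \<delta>: "\<delta> 0 \<in> lin_maps R (E 0) (E 1)" using res by (simp add: injective_resolution_def One_nat_def)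
  have \<eta>: "\<eta> \<in> lin_maps R (self_module R) (E 0)" "inj_on \<eta> (carrier R)"
    "\<eta> ` carrier R = {z \<in> carrier (E 0). \<delta> 0 z = \<zero>\<^bsub>E 1\<^esub>}" using res by (simp_all add: injective_resolution_def)
  note d = lin_maps_props[OF E0.module_axioms E1.module_axioms \<delta>]
  note h = lin_maps_props[OF S.module_axioms E0.module_axioms \<eta>(1), simplified]
  have xi: "x_injective (E 1) (\<delta> 0 ` carrier (E 0))" by (rule x_injective_resolution[OF res fin])
  have h1: "\<eta> a = a \<odot>\<^bsub>E 0\<^esub> \<eta> \<one>" if "a \<in> carrier R" for a using h(3)[OF that one_closed] that by simp
  obtain e0 where e0: "e0 \<in> carrier (E 0)" "\<eta> \<one> = x \<odot>\<^bsub>E 0\<^esub> e0" using injective_divisible[OF E h(1)[OF one_closed]] by blast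
  have dh: "\<delta> 0 (\<eta> a) = \<zero>\<^bsub>E 1\<^esub>" if "a \<in> carrier R" for a using \<eta>(3) that by blast
  have xd: "x \<odot>\<^bsub>E 1\<^esub> \<delta> 0 e0 = \<zero>\<^bsub>E 1\<^esub>" using d(3)[OF x_carr e0(1)] e0(2) dh[OF one_closed] by simp
  have de0: "\<delta> 0 e0 \<in> carrier (E 1)" using d(1) e0 by simp
  have kill: "a \<odot>\<^bsub>E 1\<^esub> \<delta> 0 e0 = \<zero>\<^bsub>E 1\<^esub>" if aP: "a \<in> PIdl x" for a
  proof -
    obtain b where b: "b \<in> carrier R" "a = b \<otimes> x" using aP unfolding cgenideal_def by blast
    then show ?thesis using de0 x_carr xd by (simp add: E1.smult_assoc1 del: One_nat_def)
  qed
  fix G assume G: "S.lin_graph G" "\<forall>w. (\<zero>, w) \<in> G \<longrightarrow> w \<in> PIdl x" "\<exists>w\<in>PIdl x. (x, w) \<in> G"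
  note D = S.lin_graphD[OF G(1), simplified]
  define H where "H = {(r, a \<odot>\<^bsub>E 1\<^esub> \<delta> 0 e0) |r a. (r, a) \<in> G}"
  have HI: "(r, a \<odot>\<^bsub>E 1\<^esub> \<delta> 0 e0) \<in> H" if "(r, a) \<in> G" for r a using that by (auto simp: H_def)
  have lin: "E1.lin_graph H" unfolding E1.lin_graph_def
  proof (intro conjI allI impI)
    show "H \<subseteq> carrier R \<times> carrier (E 1)" using D(1,2) de0 by (auto simp: H_def)
    show "(\<zero>, \<zero>\<^bsub>E 1\<^esub>) \<in> H" using HI[OF D(3)] de0 by simp
  next
    fix r w r' w' assume "(r, w) \<in> H" "(r', w') \<in> H"
    then obtain a a' where k: "(r, a) \<in> G" "w = a \<odot>\<^bsub>E 1\<^esub> \<delta> 0 e0" "(r', a') \<in> G" "w' = a' \<odot>\<^bsub>E 1\<^esub> \<delta> 0 e0" by (auto simp: H_def)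
    then show "(r \<oplus> r', w \<oplus>\<^bsub>E 1\<^esub> w') \<in> H" using HI[OF D(4)[OF k(1,3)]] D(2)[OF k(1)] D(2)[OF k(3)] de0
      by (simp add: E1.smult_l_distr)
  next
    fix c r w assume c: "c \<in> carrier R" and "(r, w) \<in> H"
    then obtain a where k: "(r, a) \<in> G" "w = a \<odot>\<^bsub>E 1\<^esub> \<delta> 0 e0" by (auto simp: H_def)
    then show "(c \<otimes> r, c \<odot>\<^bsub>E 1\<^esub> w) \<in> H" using HI[OF D(5)[OF c k(1)]] D(2)[OF k(1)] de0 c
      by (simp add: E1.smult_assoc1)
  qed
  have fn: "E1.functional_mod {\<zero>\<^bsub>E 1\<^esub>} H" unfolding E1.functional_mod_def using G(2) kill by (auto simp: H_def)
  have Hc: "H \<subseteq> carrier R \<times> \<delta> 0 ` carrier (E 0)"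
  proof
    fix z assume "z \<in> H"
    then obtain r a where k: "z = (r, a \<odot>\<^bsub>E 1\<^esub> \<delta> 0 e0)" "(r, a) \<in> G" by (auto simp: H_def)
    then have "a \<odot>\<^bsub>E 1\<^esub> \<delta> 0 e0 = \<delta> 0 (a \<odot>\<^bsub>E 0\<^esub> e0)" "a \<odot>\<^bsub>E 0\<^esub> e0 \<in> carrier (E 0)" using d(3) D(2) e0 by auto
    then show "z \<in> carrier R \<times> \<delta> 0 ` carrier (E 0)" using k D(1) by auto
  qed
  obtain w where w: "w \<in> PIdl x" "(x, w) \<in> G" using G(3) by blast
  have xH: "(x, \<zero>\<^bsub>E 1\<^esub>) \<in> H" using HI[OF w(2)] kill[OF w(1)] by simp
  from xi[unfolded x_injective_def, rule_format, OF lin fn Hc xH]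
  obtain z where z: "z \<in> \<delta> 0 ` carrier (E 0)" "\<And>r w. (r, w) \<in> H \<Longrightarrow> w = r \<odot>\<^bsub>E 1\<^esub> z" by blast
  from z(1) obtain g where g: "g \<in> carrier (E 0)" "z = \<delta> 0 g" by blast
  have "\<delta> 0 (x \<odot>\<^bsub>E 0\<^esub> g) = \<zero>\<^bsub>E 1\<^esub>" using z(2)[OF xH] d(3)[OF x_carr g(1)] g(2) by simp
  then have "x \<odot>\<^bsub>E 0\<^esub> g \<in> \<eta> ` carrier R" using \<eta>(3) g x_carr by blast
  then obtain v where v: "v \<in> carrier R" "x \<odot>\<^bsub>E 0\<^esub> g = \<eta> v" by blast
  have "a \<ominus> r \<otimes> v \<in> PIdl x" if ra: "(r, a) \<in> G" for r a
  proof -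
    have c: "r \<in> carrier R" "a \<in> carrier R" using D(1,2) ra by auto
    let ?y = "a \<odot>\<^bsub>E 0\<^esub> e0 \<ominus>\<^bsub>E 0\<^esub> r \<odot>\<^bsub>E 0\<^esub> g"
    have yc: "?y \<in> carrier (E 0)" using c e0 g by simp
    have "\<delta> 0 ?y = a \<odot>\<^bsub>E 1\<^esub> \<delta> 0 e0 \<ominus>\<^bsub>E 1\<^esub> r \<odot>\<^bsub>E 1\<^esub> \<delta> 0 g"
      using d(5)[of "a \<odot>\<^bsub>E 0\<^esub> e0" "r \<odot>\<^bsub>E 0\<^esub> g"] d(3) c e0 g by simp
    also have "\<dots> = \<zero>\<^bsub>E 1\<^esub>" using z(2)[OF HI[OF ra]] g c de0 d(1)[OF g(1)] by (simp add: E1.M.minus_eq E1.M.r_neg)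
    finally have "?y \<in> \<eta> ` carrier R" using \<eta>(3) yc by blast
    then obtain t where t: "t \<in> carrier R" "?y = \<eta> t" by blast
    have "\<eta> (a \<ominus> r \<otimes> v) = \<eta> a \<ominus>\<^bsub>E 0\<^esub> r \<odot>\<^bsub>E 0\<^esub> \<eta> v" using h(5)[of a "r \<otimes> v"] h(3)[of r v] c v by simp
    also have "\<eta> a = x \<odot>\<^bsub>E 0\<^esub> (a \<odot>\<^bsub>E 0\<^esub> e0)"
      using h1[OF c(2)] e0 c x_carr by (simp add: E0.smult_assoc1[symmetric] m_comm)
    also have "r \<odot>\<^bsub>E 0\<^esub> \<eta> v = x \<odot>\<^bsub>E 0\<^esub> (r \<odot>\<^bsub>E 0\<^esub> g)"
      using v(2)[symmetric] g c x_carr by (simp add: E0.smult_assoc1[symmetric] m_comm)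
    also have "x \<odot>\<^bsub>E 0\<^esub> (a \<odot>\<^bsub>E 0\<^esub> e0) \<ominus>\<^bsub>E 0\<^esub> x \<odot>\<^bsub>E 0\<^esub> (r \<odot>\<^bsub>E 0\<^esub> g) = x \<odot>\<^bsub>E 0\<^esub> ?y"
      using c e0 g x_carr by (simp add: E0.M.minus_eq E0.smult_r_distr E0.smult_r_minus)
    also have "\<dots> = \<eta> (x \<otimes> t)" using t h(3)[OF x_carr t(1)] by simp
    finally have "a \<ominus> r \<otimes> v = x \<otimes> t" using \<eta>(2) c v t x_carr by (auto simp: inj_on_def)
    then show ?thesis using t x_carr by (auto simp: cgenideal_def m_comm)
  qed
  then show "\<exists>v\<in>carrier R. \<forall>r a. (r, a) \<in> G \<longrightarrow> a \<ominus> r \<otimes> v \<in> PIdl x" using v(1) by blast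
qed

text \<open>\<open>self_extension\<close> applied to \<open>s \<mapsto> t\<close> makes
  \<open>t\<close> congruent to some \<open>s v\<close>. If \<open>v\<close> were in
  \<open>mm\<close>, then \<open>v s\<close>, and with it \<open>t\<close>, would be in
  \<open>x R\<close>. So \<open>v\<close> is a unit, and \<open>s\<close> is a multiple of
  \<open>t\<close> in turn.\<close>

lemma socle_simple:
  assumes self_extension and t: "t \<in> carrier R" "\<And>r. r \<in> mm \<Longrightarrow> r \<otimes> t \<in> PIdl x" "t \<notin> PIdl x"
  shows "\<exists>c\<in>carrier R. s \<ominus> c \<otimes> t \<in> PIdl x"
proof -
  note I = cgenideal_ideal[OF x_carr]
  have Is: "submodule (PIdl x) R (self_module R)" using I submodule_self_iff by simp
  let ?G = "{(a \<otimes> s \<oplus> b \<otimes> x, a \<odot>\<^bsub>self_module R\<^esub> t) |a b. a \<in> carrier R \<and> b \<in> carrier R}"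
  have "t \<in> carrier (self_module R)" "\<And>r. r \<in> mm \<Longrightarrow> r \<odot>\<^bsub>self_module R\<^esub> t \<in> PIdl x" using t by simp_all
  note G = socle_graph[OF S.module_axioms Is this]
  have "\<exists>w\<in>PIdl x. (x, w) \<in> ?G" using G(3) ideal_zero[OF I] by auto
  from assms(1)[unfolded self_extension_def, rule_format, OF G(1) _ this] G(2)
  obtain v where v: "v \<in> carrier R" "\<forall>r a. (r, a) \<in> ?G \<longrightarrow> a \<ominus> r \<otimes> v \<in> PIdl x"
    unfolding S.functional_mod_def by blast
  have tv: "t \<ominus> s \<otimes> v \<in> PIdl x" using v(2)[rule_format, OF G(4)] .
  have "v \<notin> mm"
  proof
    assume "v \<in> mm"
    then have "v \<otimes> s \<in> PIdl x" using s(3) by blast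
    then have "(t \<ominus> s \<otimes> v) \<oplus> v \<otimes> s \<in> PIdl x" using ideal_add[OF I tv] by blast
    moreover have "(t \<ominus> s \<otimes> v) \<oplus> v \<otimes> s = t" using t(1) s(1) v(1) by algebra
    ultimately show False using t by simp
  qed
  then have u: "v \<in> Units R" using nonunits v by blast
  have ic: "inv v \<in> carrier R" "(\<ominus> (inv v)) \<in> carrier R" using u by auto
  have "(\<ominus> (inv v)) \<otimes> (t \<ominus> s \<otimes> v) \<in> PIdl x" by (rule ideal.I_l_closed[OF I tv ic(2)])
  moreover have "(\<ominus> (inv v)) \<otimes> (t \<ominus> s \<otimes> v) = (inv v \<otimes> v) \<otimes> s \<ominus> inv v \<otimes> t" using ic(1) v(1) s(1) t(1) by algebra
  ultimately show ?thesis using u ic s(1) by auto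
qed

end

section \<open>The canonical module modulo \<open>x\<close>\<close>

locale dim_one_module = R?: dim_one R mm x s + noeth_local_module R M mm
  for R (structure) and M (structure) and mm x s +
  assumes xM_regular: "\<And>v. v \<in> carrier M \<Longrightarrow> x \<bullet> v = \<zero>\<^bsub>M\<^esub> \<Longrightarrow> v = \<zero>\<^bsub>M\<^esub>"
begin

lemma xM_cancel:
  assumes "v \<in> carrier M" "w \<in> carrier M" "x \<bullet> v = x \<bullet> w" shows "v = w"
proof -
  have "x \<bullet> (v \<boxminus> w) = x \<bullet> v \<boxminus> x \<bullet> w" using assms(1,2) x_carr by algebra
  also have "\<dots> = \<zero>\<^bsub>M\<^esub>" using assms x_carr by (simp add: M.minus_eq M.r_neg)
  finally have "v \<boxminus> w = \<zero>\<^bsub>M\<^esub>" using xM_regular assms by simp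
  moreover have "v = (v \<boxminus> w) \<boxplus> w" using assms(1,2) by algebra
  ultimately show ?thesis using assms by simp
qed

text \<open>The connecting map again: \<open>\<eta> u = x e\<close>, with \<open>e\<close> corrected
  so that \<open>mm\<close> kills \<open>\<delta> 0 e\<close>. Division of this socle element by
  \<open>s\<close>, within the kernel of \<open>x\<close> on the image of \<open>\<delta> 0\<close>,
  is carried back to division of \<open>u\<close> by \<open>s\<close> modulo
  \<open>x M\<close>.\<close>

lemma socle_lift:
  assumes res: "injective_resolution R M E \<eta> \<delta>" and fin: "\<forall>i>r. carrier (E i) = {\<zero>\<^bsub>E i\<^esub>}"
    and u: "u \<in> carrier M" "\<And>r. r \<in> mm \<Longrightarrow> \<exists>w\<in>carrier M. r \<bullet> u = x \<bullet> w"
  shows "\<exists>w\<in>carrier M. \<exists>w1\<in>carrier M. s \<bullet> w = u \<boxplus> x \<bullet> w1"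
proof -
  note [simp del] = One_nat_def
  have E: "injective_module R (E i)" for i using res by (simp add: injective_resolution_def)
  interpret E0: module R "E 0" using E[of 0] by (simp add: injective_module_def)
  interpret E1: module R "E 1" using E[of 1] by (simp add: injective_module_def)
  have \<delta>: "\<delta> 0 \<in> lin_maps R (E 0) (E 1)" using res by (simp add: injective_resolution_def One_nat_def)
  have \<eta>: "\<eta> \<in> lin_maps R M (E 0)" "inj_on \<eta> (carrier M)"
    "\<eta> ` carrier M = {z \<in> carrier (E 0). \<delta> 0 z = \<zero>\<^bsub>E 1\<^esub>}" using res by (simp_all add: injective_resolution_def)
  note d = lin_maps_props[OF E0.module_axioms E1.module_axioms \<delta>]
  note h = lin_maps_props[OF module_axioms E0.module_axioms \<eta>(1)]
  have dh: "\<delta> 0 (\<eta> a) = \<zero>\<^bsub>E 1\<^esub>" if "a \<in> carrier M" for a using \<eta>(3) that by blast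
  have xi: "x_injective (E 1) (\<delta> 0 ` carrier (E 0))" by (rule x_injective_resolution[OF res fin])
  obtain e where e: "e \<in> carrier (E 0)" "\<eta> u = x \<odot>\<^bsub>E 0\<^esub> e" using injective_divisible[OF E h(1)[OF u(1)]] by blast
  \<comment> \<open>If \<open>r u = x w\<close>, then \<open>r e\<close> and \<open>\<eta> w\<close>
    differ by an element killed by \<open>x\<close>. These differences form a linear map on
    \<open>mm\<close>, hence equal \<open>r f\<close> for some \<open>f\<close>, and
    \<open>r (e - f)\<close> is \<open>\<eta> w\<close> itself.\<close>
  define G where "G = {(r, r \<odot>\<^bsub>E 0\<^esub> e \<ominus>\<^bsub>E 0\<^esub> \<eta> w) |r w. r \<in> mm \<and> w \<in> carrier M \<and> r \<bullet> u = x \<bullet> w}"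
  have GI: "(r, r \<odot>\<^bsub>E 0\<^esub> e \<ominus>\<^bsub>E 0\<^esub> \<eta> w) \<in> G" if "r \<in> mm" "w \<in> carrier M" "r \<bullet> u = x \<bullet> w" for r w
    using that by (auto simp: G_def)
  have lin: "E0.lin_graph G" unfolding E0.lin_graph_def
  proof (intro conjI allI impI)
    show "G \<subseteq> carrier R \<times> carrier (E 0)" using mm_carr h(1) e by (auto simp: G_def)
    have "(\<zero>, \<zero> \<odot>\<^bsub>E 0\<^esub> e \<ominus>\<^bsub>E 0\<^esub> \<eta> \<zero>\<^bsub>M\<^esub>) \<in> G" by (rule GI) (use u x_carr R.ideal_zero[OF mm_ideal] in auto)
    then show "(\<zero>, \<zero>\<^bsub>E 0\<^esub>) \<in> G" using h(4) e by (simp add: E0.M.minus_eq)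
  next
    fix r y r' y' assume "(r, y) \<in> G" "(r', y') \<in> G"
    then obtain w w' where k: "y = r \<odot>\<^bsub>E 0\<^esub> e \<ominus>\<^bsub>E 0\<^esub> \<eta> w" "r \<in> mm" "w \<in> carrier M" "r \<bullet> u = x \<bullet> w"
      "y' = r' \<odot>\<^bsub>E 0\<^esub> e \<ominus>\<^bsub>E 0\<^esub> \<eta> w'" "r' \<in> mm" "w' \<in> carrier M" "r' \<bullet> u = x \<bullet> w'" by (auto simp: G_def)
    have c: "r \<in> carrier R" "r' \<in> carrier R" "\<eta> w \<in> carrier (E 0)" "\<eta> w' \<in> carrier (E 0)" using k mm_carr h(1) by auto
    have "(r \<oplus> r', (r \<oplus> r') \<odot>\<^bsub>E 0\<^esub> e \<ominus>\<^bsub>E 0\<^esub> \<eta> (w \<boxplus> w')) \<in> G"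
      by (rule GI) (use k c u x_carr R.ideal_add[OF mm_ideal] in \<open>auto simp: smult_l_distr smult_r_distr\<close>)
    moreover have "(r \<oplus> r') \<odot>\<^bsub>E 0\<^esub> e \<ominus>\<^bsub>E 0\<^esub> (\<eta> w \<oplus>\<^bsub>E 0\<^esub> \<eta> w') = y \<oplus>\<^bsub>E 0\<^esub> y'"
      unfolding k(1,5) using c e(1) by algebra
    ultimately show "(r \<oplus> r', y \<oplus>\<^bsub>E 0\<^esub> y') \<in> G" using h(2)[OF k(3,7)] by simp
  next
    fix a r y assume a: "a \<in> carrier R" and "(r, y) \<in> G"
    then obtain w where k: "y = r \<odot>\<^bsub>E 0\<^esub> e \<ominus>\<^bsub>E 0\<^esub> \<eta> w" "r \<in> mm" "w \<in> carrier M" "r \<bullet> u = x \<bullet> w" by (auto simp: G_def)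
    have c: "r \<in> carrier R" "\<eta> w \<in> carrier (E 0)" using k mm_carr h(1) by auto
    have "(a \<otimes> r) \<bullet> u = x \<bullet> a \<bullet> w"
    proof -
      have "(a \<otimes> r) \<bullet> u = a \<bullet> (r \<bullet> u)" using a c u by (simp add: smult_assoc1)
      also have "\<dots> = x \<bullet> a \<bullet> w" unfolding k(4) using a k(3) x_carr by algebra
      finally show ?thesis .
    qed
    then have "(a \<otimes> r, (a \<otimes> r) \<odot>\<^bsub>E 0\<^esub> e \<ominus>\<^bsub>E 0\<^esub> \<eta> (a \<bullet> w)) \<in> G"
      by (intro GI) (use k a ideal.I_l_closed[OF mm_ideal] in auto)
    moreover have "(a \<otimes> r) \<odot>\<^bsub>E 0\<^esub> e \<ominus>\<^bsub>E 0\<^esub> a \<odot>\<^bsub>E 0\<^esub> \<eta> w = a \<odot>\<^bsub>E 0\<^esub> y"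
      unfolding k(1) using c e(1) a by algebra
    ultimately show "(a \<otimes> r, a \<odot>\<^bsub>E 0\<^esub> y) \<in> G" using h(3)[OF a k(3)] by simp
  qed
  have fn: "E0.functional_mod {\<zero>\<^bsub>E 0\<^esub>} G" unfolding E0.functional_mod_def
  proof (intro allI impI)
    fix y assume "(\<zero>, y) \<in> G"
    then obtain w where k: "y = \<zero> \<odot>\<^bsub>E 0\<^esub> e \<ominus>\<^bsub>E 0\<^esub> \<eta> w" "w \<in> carrier M" "\<zero> \<bullet> u = x \<bullet> w" by (auto simp: G_def)
    then have "w = \<zero>\<^bsub>M\<^esub>" using xM_regular[of w] u by simp
    then show "y \<in> {\<zero>\<^bsub>E 0\<^esub>}" using k(1) h(4) e by (simp add: E0.M.minus_eq)
  qed
  obtain f where f: "f \<in> carrier (E 0)" "\<And>r y. (r, y) \<in> G \<Longrightarrow> y = r \<odot>\<^bsub>E 0\<^esub> f" using injective_extend[OF E lin fn] by blast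
  define e1 where "e1 = e \<ominus>\<^bsub>E 0\<^esub> f"
  have e1c: "e1 \<in> carrier (E 0)" unfolding e1_def using e f by simp
  have re1: "r \<odot>\<^bsub>E 0\<^esub> e1 = \<eta> w" if "r \<in> mm" "w \<in> carrier M" "r \<bullet> u = x \<bullet> w" for r w
  proof -
    have c: "r \<in> carrier R" "\<eta> w \<in> carrier (E 0)" using that mm_carr h(1) by auto
    have "r \<odot>\<^bsub>E 0\<^esub> e1 = (r \<odot>\<^bsub>E 0\<^esub> e \<ominus>\<^bsub>E 0\<^esub> \<eta> w) \<ominus>\<^bsub>E 0\<^esub> r \<odot>\<^bsub>E 0\<^esub> f \<oplus>\<^bsub>E 0\<^esub> \<eta> w"
      unfolding e1_def using c e(1) f(1) by algebra
    also have "\<dots> = r \<odot>\<^bsub>E 0\<^esub> f \<ominus>\<^bsub>E 0\<^esub> r \<odot>\<^bsub>E 0\<^esub> f \<oplus>\<^bsub>E 0\<^esub> \<eta> w" using f(2)[OF GI[OF that]] by simp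
    also have "\<dots> = \<eta> w" using c f(1) by algebra
    finally show ?thesis .
  qed
  have xe1: "x \<odot>\<^bsub>E 0\<^esub> e1 = \<eta> u" by (rule re1[OF x_mm u(1)]) simp
  have de1: "\<delta> 0 e1 \<in> \<delta> 0 ` carrier (E 0)" using e1c by blast
  have "r \<odot>\<^bsub>E 1\<^esub> \<delta> 0 e1 = \<zero>\<^bsub>E 1\<^esub>" if r: "r \<in> mm" for r
  proof -
    obtain w where w: "w \<in> carrier M" "r \<bullet> u = x \<bullet> w" using u(2)[OF r] by blast
    show ?thesis using d(3)[OF mm_carr[OF r] e1c] re1[OF r w] dh[OF w(1)] by simp
  qed
  moreover note E1.lin_map_image_sub[OF E0.module_axioms \<delta>]
  ultimately obtain z where "z \<in> \<delta> 0 ` carrier (E 0)" "\<delta> 0 e1 = s \<odot>\<^bsub>E 1\<^esub> z" "x \<odot>\<^bsub>E 1\<^esub> z = \<zero>\<^bsub>E 1\<^esub>"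
    using socle_divide[OF E1.module_axioms _ xi de1] by blast
  then obtain g where g: "g \<in> carrier (E 0)" "\<delta> 0 e1 = s \<odot>\<^bsub>E 1\<^esub> \<delta> 0 g" "x \<odot>\<^bsub>E 1\<^esub> \<delta> 0 g = \<zero>\<^bsub>E 1\<^esub>" by blast
  have "\<delta> 0 (x \<odot>\<^bsub>E 0\<^esub> g) = \<zero>\<^bsub>E 1\<^esub>" using d(3)[OF x_carr g(1)] g(3) by simp
  then have "x \<odot>\<^bsub>E 0\<^esub> g \<in> \<eta> ` carrier M" using \<eta>(3) g(1) x_carr by blast
  then obtain w where w: "w \<in> carrier M" "x \<odot>\<^bsub>E 0\<^esub> g = \<eta> w" by blast
  have "\<delta> 0 (s \<odot>\<^bsub>E 0\<^esub> g \<ominus>\<^bsub>E 0\<^esub> e1) = s \<odot>\<^bsub>E 1\<^esub> \<delta> 0 g \<ominus>\<^bsub>E 1\<^esub> \<delta> 0 e1"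
    using d(5)[of "s \<odot>\<^bsub>E 0\<^esub> g" e1] d(3) s(1) g(1) e1c by simp
  also have "\<dots> = \<zero>\<^bsub>E 1\<^esub>" unfolding g(2) using E1.smult_closed[OF s(1) d(1)[OF g(1)]] by (simp only: E1.M.minus_eq E1.M.r_neg)
  finally have "s \<odot>\<^bsub>E 0\<^esub> g \<ominus>\<^bsub>E 0\<^esub> e1 \<in> \<eta> ` carrier M" using \<eta>(3) s(1) g(1) e1c by blast
  then obtain w1 where w1: "w1 \<in> carrier M" "s \<odot>\<^bsub>E 0\<^esub> g \<ominus>\<^bsub>E 0\<^esub> e1 = \<eta> w1" by blast
  have "\<eta> (s \<bullet> w) = s \<odot>\<^bsub>E 0\<^esub> (x \<odot>\<^bsub>E 0\<^esub> g)" using h(3)[OF s(1) w(1)] w(2) by simp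
  also have "\<dots> = x \<odot>\<^bsub>E 0\<^esub> e1 \<oplus>\<^bsub>E 0\<^esub> x \<odot>\<^bsub>E 0\<^esub> (s \<odot>\<^bsub>E 0\<^esub> g \<ominus>\<^bsub>E 0\<^esub> e1)" using s(1) x_carr g(1) e1c by algebra
  also have "\<dots> = \<eta> (u \<boxplus> x \<bullet> w1)" unfolding xe1 w1(2) using h(2)[OF u(1)] h(3)[OF x_carr w1(1)] w1(1) x_carr by simp
  finally have "s \<bullet> w = u \<boxplus> x \<bullet> w1" using \<eta>(2) s(1) w u(1) w1(1) x_carr by (auto simp: inj_on_def)
  then show ?thesis using w(1) w1(1) by blast
qed

definition xM :: "'c set" where "xM = {x \<bullet> v |v. v \<in> carrier M}"

lemma xM_eq: "xM = plus_mult {\<zero>\<^bsub>M\<^esub>} x"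
proof -
  have "\<zero>\<^bsub>M\<^esub> \<boxplus> x \<bullet> v = x \<bullet> v" if "v \<in> carrier M" for v using that x_carr by simp
  then show ?thesis unfolding xM_def plus_mult_def by force
qed

lemma xM_sub: "msub xM" unfolding xM_eq by (rule plus_mult_sub[OF zero_sub x_carr])

text \<open>An associated prime of \<open>M / N\<close> contains \<open>x\<close>, which leaves only
  \<open>mm\<close>.\<close>

lemma socle_element:
  assumes N: "msub N" "xM \<subseteq> N" and v: "v \<in> carrier M" "v \<notin> N"
  shows "\<exists>c\<in>carrier R. c \<bullet> v \<notin> N \<and> (\<forall>r\<in>mm. r \<bullet> c \<bullet> v \<in> N)"
proof -
  obtain c where c: "c \<in> carrier R" "c \<bullet> v \<notin> N" "primeideal (colon N (c \<bullet> v)) R"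
    using associated_prime[OF acc N(1) v] by blast
  have "c \<bullet> v \<in> carrier M" using c v by simp
  then have "x \<bullet> c \<bullet> v \<in> N" using N(2) unfolding xM_def by blast
  then have "x \<in> colon N (c \<bullet> v)" using x_carr by (simp add: colon_def)
  then have "colon N (c \<bullet> v) = mm" using x_primes c(3) by blast
  then have "\<forall>r\<in>mm. r \<bullet> c \<bullet> v \<in> N" by (auto simp: colon_def)
  then show ?thesis using c by blast
qed

text \<open>Let \<open>s w\<close> generate the socle of \<open>M / x M\<close>. Then \<open>R / x R \<rightarrow> M / x M\<close>, \<open>a \<mapsto> a w\<close>, is injective on the
  socle, hence injective, hence split by \<open>self_extension\<close>; a complement has no socle.\<close>

lemma free_of_rank_one:
  assumes ext: self_extension
    and lift: "\<And>u. u \<in> carrier M \<Longrightarrow> (\<And>r. r \<in> mm \<Longrightarrow> \<exists>w\<in>carrier M. r \<bullet> u = x \<bullet> w) \<Longrightarrow>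
      \<exists>w\<in>carrier M. \<exists>w1\<in>carrier M. s \<bullet> w = u \<boxplus> x \<bullet> w1"
    and simple: "\<And>u v. u \<in> carrier M \<Longrightarrow> v \<in> carrier M \<Longrightarrow> u \<notin> xM \<Longrightarrow>
      (\<And>r. r \<in> mm \<Longrightarrow> r \<bullet> u \<in> xM) \<Longrightarrow> (\<And>r. r \<in> mm \<Longrightarrow> r \<bullet> v \<in> xM) \<Longrightarrow> \<exists>c\<in>carrier R. v \<boxminus> c \<bullet> u \<in> xM"
    and nz: "v0 \<in> carrier M" "v0 \<noteq> \<zero>\<^bsub>M\<^esub>"
  shows "\<exists>w\<in>carrier M. (\<forall>v\<in>carrier M. \<exists>a\<in>carrier R. v = a \<bullet> w) \<and> (\<forall>a\<in>carrier R. a \<bullet> w = \<zero>\<^bsub>M\<^esub> \<longrightarrow> a = \<zero>)"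
proof -
  note I = R.cgenideal_ideal[OF x_carr]
  have xMI: "x \<bullet> v \<in> xM" if "v \<in> carrier M" for v using that by (auto simp: xM_def)
  have PM: "a \<bullet> v \<in> xM" if "a \<in> PIdl x" "v \<in> carrier M" for a v
  proof -
    obtain b where b: "b \<in> carrier R" "a = b \<otimes> x" using \<open>a \<in> PIdl x\<close> by (auto simp: cgenideal_def)
    have "a \<bullet> v = x \<bullet> b \<bullet> v" unfolding b(2) using b(1) x_carr that(2) by algebra
    then show ?thesis using xMI b(1) that(2) by simp
  qed
  have "\<not> carrier M \<subseteq> xM"
  proof
    assume a: "carrier M \<subseteq> xM"
    have "carrier M \<subseteq> {\<zero>\<^bsub>M\<^esub>}"
    proof (rule nakayama[OF zero_sub x_mm order_refl])
      fix k assume "k \<in> carrier M"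
      then obtain v where "v \<in> carrier M" "k = x \<bullet> v" using a by (auto simp: xM_def)
      then show "\<exists>n\<in>{\<zero>\<^bsub>M\<^esub>}. \<exists>k'\<in>carrier M. k = n \<boxplus> x \<bullet> k'" using x_carr by auto
    qed
    then show False using nz by blast
  qed
  then obtain v1 where v1: "v1 \<in> carrier M" "v1 \<notin> xM" by blast
  obtain c1 where c1: "c1 \<in> carrier R" "c1 \<bullet> v1 \<notin> xM" "\<And>r. r \<in> mm \<Longrightarrow> r \<bullet> c1 \<bullet> v1 \<in> xM"
    using socle_element[OF xM_sub order_refl v1] by blast
  define u where "u = c1 \<bullet> v1"
  have u: "u \<in> carrier M" "u \<notin> xM" "\<And>r. r \<in> mm \<Longrightarrow> r \<bullet> u \<in> xM" using c1 v1 by (auto simp: u_def)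
  obtain w w1 where w: "w \<in> carrier M" "w1 \<in> carrier M" "s \<bullet> w = u \<boxplus> x \<bullet> w1"
    using lift[OF u(1)] u(3) unfolding xM_def by blast
  \<comment> \<open>Otherwise the kernel of \<open>a \<mapsto> a w\<close> modulo \<open>x\<close>
    contains a nonzero socle element of \<open>R / x R\<close>, hence \<open>s\<close>; but
    \<open>s w\<close> is congruent to \<open>u\<close>, which is nonzero.\<close>
  have faithful: "a \<in> PIdl x" if a: "a \<in> carrier R" "a \<bullet> w \<in> xM" for a
  proof (rule ccontr)
    assume na: "a \<notin> PIdl x"
    have Is: "submodule (PIdl x) R (self_module R)" using I R.submodule_self_iff by simp
    obtain c where c: "c \<in> carrier R" "c \<otimes> a \<notin> PIdl x" and pr: "primeideal (S.colon (PIdl x) (c \<otimes> a)) R"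
      using S.associated_prime[OF acc Is, of a] a na by auto
    have "x \<otimes> (c \<otimes> a) \<in> PIdl x" using ideal.I_r_closed[OF I R.cgenideal_self[OF x_carr]] c a by simp
    then have "S.colon (PIdl x) (c \<otimes> a) = mm" using x_primes[OF pr] x_carr by (simp add: S.colon_def)
    then have "r \<otimes> (c \<otimes> a) \<in> PIdl x" if "r \<in> mm" for r using that by (auto simp: S.colon_def)
    then obtain c2 where c2: "c2 \<in> carrier R" "s \<ominus> c2 \<otimes> (c \<otimes> a) \<in> PIdl x"
      using socle_simple[OF ext, of "c \<otimes> a"] c a by auto
    have "(s \<ominus> c2 \<otimes> (c \<otimes> a)) \<bullet> w \<in> xM" by (rule PM[OF c2(2) w(1)])
    moreover have "(c2 \<otimes> c) \<bullet> a \<bullet> w \<in> xM" by (rule sub_smult[OF xM_sub _ a(2)]) (use c c2 in simp)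
    ultimately have "(s \<ominus> c2 \<otimes> (c \<otimes> a)) \<bullet> w \<boxplus> (c2 \<otimes> c) \<bullet> a \<bullet> w \<in> xM" by (rule sub_add[OF xM_sub])
    moreover have "(s \<ominus> c2 \<otimes> (c \<otimes> a)) \<bullet> w \<boxplus> (c2 \<otimes> c) \<bullet> a \<bullet> w = s \<bullet> w" using s(1) c2(1) c(1) a(1) w(1) by algebra
    ultimately have "u \<boxplus> x \<bullet> w1 \<in> xM" using w(3) by simp
    moreover have "u = (u \<boxplus> x \<bullet> w1) \<boxminus> x \<bullet> w1" using u(1) w(2) x_carr by algebra
    ultimately have "u \<in> xM" using sub_diff[OF xM_sub _ xMI[OF w(2)]] by metis
    then show False using u(2) by blast
  qed
  let ?N = "plus_cyclic xM w"
  have N: "msub ?N" by (rule plus_cyclic_sub[OF xM_sub w(1)])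
  have xN: "xM \<subseteq> ?N" by (rule plus_cyclic_superset[OF xM_sub w(1)])
  have all: "carrier M \<subseteq> ?N"
  proof (rule ccontr)
    assume "\<not> carrier M \<subseteq> ?N"
    then obtain y where y: "y \<in> carrier M" "y \<notin> ?N" by blast
    obtain c where c: "c \<in> carrier R" "c \<bullet> y \<notin> ?N" "\<And>r. r \<in> mm \<Longrightarrow> r \<bullet> c \<bullet> y \<in> ?N"
      using socle_element[OF N xN y] by blast
    define v where "v = c \<bullet> y"
    have v: "v \<in> carrier M" "v \<notin> ?N" "\<And>r. r \<in> mm \<Longrightarrow> r \<bullet> v \<in> ?N" using c y by (auto simp: v_def)
    \<comment> \<open>For a socle element \<open>v\<close> of \<open>M / (x M + R w)\<close>, each
      \<open>r v\<close> with \<open>r\<close> in \<open>mm\<close> is some \<open>a w\<close>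
      modulo \<open>x M\<close>. The map \<open>r \<mapsto> a\<close> extends to the multiplication
      by some \<open>b\<close>, and \<open>v - b w\<close> is in the socle of
      \<open>M / x M\<close>, so it is a multiple of \<open>u\<close>, that is, of
      \<open>s w\<close>.\<close>
    define G where "G = {(r, a). r \<in> mm \<and> a \<in> carrier R \<and> r \<bullet> v \<boxminus> a \<bullet> w \<in> xM}"
    have lin: "S.lin_graph G" unfolding S.lin_graph_def
    proof (intro conjI allI impI; simp)
      show "G \<subseteq> carrier R \<times> carrier R" using mm_carr by (auto simp: G_def)
      show "(\<zero>, \<zero>) \<in> G" using R.ideal_zero[OF mm_ideal] v w xM_sub by (simp add: G_def M.minus_eq)
    next
      fix r a r' a' assume "(r, a) \<in> G" "(r', a') \<in> G"
      then have k: "r \<in> mm" "a \<in> carrier R" "r \<bullet> v \<boxminus> a \<bullet> w \<in> xM" "r' \<in> mm" "a' \<in> carrier R" "r' \<bullet> v \<boxminus> a' \<bullet> w \<in> xM"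
        by (auto simp: G_def)
      note rc = mm_carr[OF k(1)] mm_carr[OF k(4)]
      have "(r \<oplus> r') \<bullet> v \<boxminus> (a \<oplus> a') \<bullet> w = (r \<bullet> v \<boxminus> a \<bullet> w) \<boxplus> (r' \<bullet> v \<boxminus> a' \<bullet> w)"
        using rc k(2,5) v(1) w(1) by algebra
      then show "(r \<oplus> r', a \<oplus> a') \<in> G" using k sub_add[OF xM_sub k(3,6)] R.ideal_add[OF mm_ideal] by (simp add: G_def)
    next
      fix b r a assume b: "b \<in> carrier R" and "(r, a) \<in> G"
      then have k: "r \<in> mm" "a \<in> carrier R" "r \<bullet> v \<boxminus> a \<bullet> w \<in> xM" by (auto simp: G_def)
      note rc = mm_carr[OF k(1)]
      have "(b \<otimes> r) \<bullet> v \<boxminus> (b \<otimes> a) \<bullet> w = b \<bullet> (r \<bullet> v \<boxminus> a \<bullet> w)"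
        using rc k(2) v(1) w(1) b by algebra
      then show "(b \<otimes> r, b \<otimes> a) \<in> G" using k b sub_smult[OF xM_sub b k(3)] ideal.I_l_closed[OF mm_ideal k(1) b] by (simp add: G_def)
    qed
    have fn: "a \<in> PIdl x" if "(\<zero>, a) \<in> G" for a
    proof -
      have k: "a \<in> carrier R" "\<zero> \<bullet> v \<boxminus> a \<bullet> w \<in> xM" using that by (auto simp: G_def)
      have "a \<bullet> w = \<ominus>\<^bsub>M\<^esub> (\<zero> \<bullet> v \<boxminus> a \<bullet> w)" using k(1) v(1) w(1) by algebra
      then have "a \<bullet> w \<in> xM" using sub_neg[OF xM_sub k(2)] by simp
      then show ?thesis using faithful k by blast
    qed
    have "x \<bullet> v \<boxminus> \<zero> \<bullet> w \<in> xM" using xMI[OF v(1)] v(1) w(1) x_carr by (simp add: M.minus_eq)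
    then have "(x, \<zero>) \<in> G" using x_mm by (simp add: G_def)
    then have "\<exists>a\<in>PIdl x. (x, a) \<in> G" using R.ideal_zero[OF I] by blast
    then obtain b where b: "b \<in> carrier R" "\<And>r a. (r, a) \<in> G \<Longrightarrow> a \<ominus> r \<otimes> b \<in> PIdl x"
      using ext lin fn unfolding self_extension_def by blast
    define v' where "v' = v \<boxminus> b \<bullet> w"
    have v'c: "v' \<in> carrier M" unfolding v'_def using v b w by simp
    have "r \<bullet> v' \<in> xM" if r: "r \<in> mm" for r
    proof -
      obtain n a where na: "r \<bullet> v = n \<boxplus> a \<bullet> w" "n \<in> xM" "a \<in> carrier R" using v(3)[OF r] by (auto simp: plus_cyclic_def)
      have nc: "n \<in> carrier M" using sub_carr[OF xM_sub na(2)] .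
      have "r \<bullet> v \<boxminus> a \<bullet> w = n" unfolding na(1) using nc na(3) w(1) by algebra
      then have "(r, a) \<in> G" using r na by (simp add: G_def)
      then have "(a \<ominus> r \<otimes> b) \<bullet> w \<in> xM" using PM[OF b(2) w(1)] by blast
      then have "n \<boxplus> (a \<ominus> r \<otimes> b) \<bullet> w \<in> xM" by (rule sub_add[OF xM_sub na(2)])
      moreover have "r \<bullet> v' = r \<bullet> v \<boxminus> (r \<otimes> b) \<bullet> w" unfolding v'_def using mm_carr[OF r] v(1) b(1) w(1) by algebra
      moreover have "r \<bullet> v \<boxminus> (r \<otimes> b) \<bullet> w = n \<boxplus> (a \<ominus> r \<otimes> b) \<bullet> w"
        unfolding na(1) using nc na(3) mm_carr[OF r] b(1) w(1) by algebra
      ultimately show ?thesis by simp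
    qed
    then obtain t where t: "t \<in> carrier R" "v' \<boxminus> t \<bullet> u \<in> xM" using simple[OF u(1) v'c u(2,3)] by blast
    have "(v' \<boxminus> t \<bullet> u) \<boxminus> x \<bullet> t \<bullet> w1 \<in> xM" by (rule sub_diff[OF xM_sub t(2) xMI]) (use t w in simp)
    then have "((v' \<boxminus> t \<bullet> u) \<boxminus> x \<bullet> t \<bullet> w1) \<boxplus> (t \<otimes> s \<oplus> b) \<bullet> w \<in> ?N" by (rule plus_cyclicI) (use t s(1) b in simp)
    moreover have "((v' \<boxminus> t \<bullet> u) \<boxminus> x \<bullet> t \<bullet> w1) \<boxplus> (t \<otimes> s \<oplus> b) \<bullet> w = v"
    proof -
      have "((v' \<boxminus> t \<bullet> u) \<boxminus> x \<bullet> t \<bullet> w1) \<boxplus> (t \<otimes> s \<oplus> b) \<bullet> w = v' \<boxplus> b \<bullet> w \<boxplus> t \<bullet> (s \<bullet> w) \<boxminus> t \<bullet> (u \<boxplus> x \<bullet> w1)"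
        using v'c t(1) u(1) x_carr w(1,2) s(1) b(1) by algebra
      also have "\<dots> = v" unfolding w(3) v'_def using v(1) t(1) u(1) x_carr w(1,2) b(1) by algebra
      finally show ?thesis .
    qed
    ultimately show False using v(2) by simp
  qed
  let ?C = "plus_cyclic {\<zero>\<^bsub>M\<^esub>} w"
  have C: "msub ?C" by (rule plus_cyclic_sub[OF zero_sub w(1)])
  have Ci: "a \<bullet> w \<in> ?C" if "a \<in> carrier R" for a using plus_cyclicI[of "\<zero>\<^bsub>M\<^esub>" "{\<zero>\<^bsub>M\<^esub>}" a w] that w(1) by simp
  have "carrier M \<subseteq> ?C"
  proof (rule nakayama[OF C x_mm order_refl])
    fix k assume "k \<in> carrier M"
    then have "k \<in> ?N" using all by blast
    then obtain v a where va: "k = x \<bullet> v \<boxplus> a \<bullet> w" "v \<in> carrier M" "a \<in> carrier R" by (auto simp: plus_cyclic_def xM_def)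
    then have "k = a \<bullet> w \<boxplus> x \<bullet> v" using x_carr w(1) by (simp add: M.a_comm)
    then show "\<exists>n\<in>?C. \<exists>k'\<in>carrier M. k = n \<boxplus> x \<bullet> k'" using Ci va by blast
  qed
  then have "\<forall>v\<in>carrier M. \<exists>a\<in>carrier R. v = \<zero>\<^bsub>M\<^esub> \<boxplus> a \<bullet> w" unfolding plus_cyclic_def by blast
  moreover have "\<zero>\<^bsub>M\<^esub> \<boxplus> a \<bullet> w = a \<bullet> w" if "a \<in> carrier R" for a using that w(1) by simp
  ultimately have gen: "\<forall>v\<in>carrier M. \<exists>a\<in>carrier R. v = a \<bullet> w" by force
  \<comment> \<open>By \<open>faithful\<close> an annihilator of \<open>w\<close> is divisible by
    \<open>x\<close>, and the quotient kills \<open>w\<close> again, so Nakayama's lemma applies to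
    the set of annihilators.\<close>
  have "{a \<in> carrier R. a \<bullet> w = \<zero>\<^bsub>M\<^esub>} \<subseteq> {\<zero>\<^bsub>self_module R\<^esub>}"
  proof (rule S.nakayama[OF S.zero_sub x_mm])
    fix k assume k: "k \<in> {a \<in> carrier R. a \<bullet> w = \<zero>\<^bsub>M\<^esub>}"
    then have "k \<in> PIdl x" using faithful[of k] sub_zero[OF xM_sub] by simp
    then obtain b where b: "b \<in> carrier R" "k = b \<otimes> x" by (auto simp: cgenideal_def)
    have "x \<bullet> b \<bullet> w = (b \<otimes> x) \<bullet> w" using x_carr b(1) w(1) by algebra
    then have "b \<bullet> w = \<zero>\<^bsub>M\<^esub>" using xM_regular[of "b \<bullet> w"] b k w(1) by simp
    then show "\<exists>n\<in>{\<zero>\<^bsub>self_module R\<^esub>}. \<exists>k'\<in>{a \<in> carrier R. a \<bullet> w = \<zero>\<^bsub>M\<^esub>}. k = n \<oplus>\<^bsub>self_module R\<^esub> x \<odot>\<^bsub>self_module R\<^esub> k'"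
      using b x_carr by (auto simp: R.m_comm)
  qed auto
  then have "\<forall>a\<in>carrier R. a \<bullet> w = \<zero>\<^bsub>M\<^esub> \<longrightarrow> a = \<zero>" by auto
  then show ?thesis using gen w(1) by blast
qed

end

section \<open>Free resolutions\<close>

context cring
begin

lemma free_module_finite: "finite I \<Longrightarrow> carrier (free_module R I) = I \<rightarrow>\<^sub>E carrier R"
  by (auto simp: free_module_simps)

text \<open>Induction on a bound \<open>k\<close> for the support, clearing the entry at
  \<open>k\<close>.\<close>

lemma free_module_span:
  "mod_span R (free_module R {..<n :: nat}) (free_gen R {..<n} ` {..<n}) = carrier (free_module R {..<n})"
proof -
  let ?F = "free_module R {..<n}"
  interpret F: module R ?F by (rule module_free_module)
  let ?e = "free_gen R {..<n}"
  have sc: "?e ` {..<n} \<subseteq> carrier ?F" using free_gen_carrier[of _ "{..<n}"] by (simp add: image_subset_iff)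
  note S = F.mod_span_sub[OF sc]
  have "\<And>f. f \<in> carrier ?F \<Longrightarrow> (\<forall>i<n. k \<le> i \<longrightarrow> f i = \<zero>) \<Longrightarrow> f \<in> mod_span R ?F (?e ` {..<n})" for k
  proof (induction k)
    case 0
    have "f = \<zero>\<^bsub>?F\<^esub>"
      by (rule free_module_eqI[of _ "{..<n}" "carrier R" _ "carrier R"]) (use 0 in \<open>auto simp: free_module_simps\<close>)
    then show ?case using F.sub_zero[OF S] by simp
  next
    case (Suc k)
    have fE: "f \<in> {..<n} \<rightarrow>\<^sub>E carrier R" by (rule free_module_funcset[OF Suc.prems(1)])
    show ?case
    proof (cases "k < n")
      case False
      then show ?thesis using Suc.IH[of f] Suc.prems by simp
    next
      case True
      have fk: "f k \<in> carrier R" using free_module_mem[OF Suc.prems(1)] True by simp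
      let ?g = "f(k := \<zero>)"
      have gE: "?g \<in> {..<n} \<rightarrow>\<^sub>E carrier R" by (rule fun_upd_PiE_lessThan[OF fE True zero_closed])
      have g: "?g \<in> carrier ?F" using gE by (simp add: free_module_finite)
      have "?g \<in> mod_span R ?F (?e ` {..<n})"
        by (rule Suc.IH[OF g]) (use Suc.prems(2) in \<open>auto simp: le_Suc_eq Suc_le_eq\<close>)
      moreover have "f k \<odot>\<^bsub>?F\<^esub> ?e k \<in> mod_span R ?F (?e ` {..<n})"
        by (rule F.sub_smult[OF S fk subsetD[OF F.mod_span_superset]]) (use True in simp)
      ultimately have "?g \<oplus>\<^bsub>?F\<^esub> f k \<odot>\<^bsub>?F\<^esub> ?e k \<in> mod_span R ?F (?e ` {..<n})" by (rule F.sub_add[OF S])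
      moreover have "?g \<oplus>\<^bsub>?F\<^esub> f k \<odot>\<^bsub>?F\<^esub> ?e k = f"
        by (rule free_module_eqI[OF _ fE, of _ UNIV])
          (use fk True free_module_mem[OF Suc.prems(1)] in \<open>auto simp: free_module_simps free_gen_def\<close>)
      ultimately show ?thesis by simp
    qed
  qed
  then have "carrier ?F \<subseteq> mod_span R ?F (?e ` {..<n})" using leD by blast
  then show ?thesis using F.sub_carr[OF S] by blast
qed

lemma free_module_fin_gen: "fin_gen R (free_module R {..<n::nat})"
  unfolding fin_gen_def using free_module_span[of n] free_gen_carrier[of _ "{..<n}"]
  by (intro exI[of _ "free_gen R {..<n} ` {..<n}"]) auto

lemma free_module_agree:
  assumes N: "module R N" and f: "f \<in> lin_maps R (free_module R {..<n :: nat}) N" and g: "g \<in> lin_maps R (free_module R {..<n}) N"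
    and eq: "\<And>i. i < n \<Longrightarrow> f (free_gen R {..<n} i) = g (free_gen R {..<n} i)" and x: "x \<in> carrier (free_module R {..<n})"
  shows "f x = g x"
proof -
  let ?F = "free_module R {..<n}"
  interpret F: module R ?F by (rule module_free_module)
  interpret N: module R N by (rule N)
  note f = lin_maps_props[OF F.module_axioms N f] and g = lin_maps_props[OF F.module_axioms N g]
  have "submodule {x \<in> carrier ?F. f x = g x} R ?F" by (rule F.submoduleI') (use f g in auto)
  then have "mod_span R ?F (free_gen R {..<n} ` {..<n}) \<subseteq> {x \<in> carrier ?F. f x = g x}"
    by (rule F.mod_span_min) (use eq free_gen_carrier[of _ "{..<n}"] in auto)
  then show ?thesis using x free_module_span by blast
qed

end

section \<open>Linear combinations, and covering submodules by free modules\<close>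

context module
begin

definition lin_comb :: "nat \<Rightarrow> (nat \<Rightarrow> 'c) \<Rightarrow> (nat \<Rightarrow> 'a) \<Rightarrow> 'c"
  where "lin_comb n w = (\<lambda>f\<in>carrier (free_module R {..<n}). \<Oplus>\<^bsub>M\<^esub>i\<in>{..<n}. f i \<bullet> w i)"

lemma lin_comb_lin_maps:
  assumes w: "w \<in> {..<n} \<rightarrow> carrier M"
  shows "lin_comb n w \<in> lin_maps R (free_module R {..<n}) M"
proof -
  let ?F = "free_module R {..<n}"
  interpret F: module R ?F by (rule R.module_free_module)
  have c: "(\<lambda>i. f i \<bullet> w i) \<in> {..<n} \<rightarrow> carrier M" if "f \<in> carrier ?F" for f
    using R.free_module_mem[OF that] w by auto
  show ?thesis unfolding lin_maps_def
  proof (intro CollectI conjI ballI)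
    show "lin_comb n w \<in> carrier ?F \<rightarrow>\<^sub>E carrier M" using c by (auto simp: lin_comb_def intro!: M.finsum_closed)
  next
    fix f g assume f: "f \<in> carrier ?F" and g: "g \<in> carrier ?F"
    have "(\<Oplus>\<^bsub>M\<^esub>i\<in>{..<n}. (f \<oplus>\<^bsub>?F\<^esub> g) i \<bullet> w i) = (\<Oplus>\<^bsub>M\<^esub>i\<in>{..<n}. f i \<bullet> w i \<boxplus> g i \<bullet> w i)"
      by (rule M.finsum_cong') (use c[OF f] c[OF g] R.free_module_mem[OF f] R.free_module_mem[OF g] w in
        \<open>auto simp: R.free_module_simps smult_l_distr Pi_def\<close>)
    also have "\<dots> = (\<Oplus>\<^bsub>M\<^esub>i\<in>{..<n}. f i \<bullet> w i) \<boxplus> (\<Oplus>\<^bsub>M\<^esub>i\<in>{..<n}. g i \<bullet> w i)"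
      by (rule M.finsum_addf[OF c[OF f] c[OF g]])
    finally show "lin_comb n w (f \<oplus>\<^bsub>?F\<^esub> g) = lin_comb n w f \<boxplus> lin_comb n w g" using f g by (simp add: lin_comb_def)
  next
    fix a f assume a: "a \<in> carrier R" and f: "f \<in> carrier ?F"
    have "(\<Oplus>\<^bsub>M\<^esub>i\<in>{..<n}. (a \<odot>\<^bsub>?F\<^esub> f) i \<bullet> w i) = (\<Oplus>\<^bsub>M\<^esub>i\<in>{..<n}. a \<bullet> (f i \<bullet> w i))"
      by (rule M.finsum_cong') (use a c[OF f] R.free_module_mem[OF f] w in
        \<open>auto simp: R.free_module_simps smult_assoc1 Pi_def\<close>)
    also have "\<dots> = a \<bullet> (\<Oplus>\<^bsub>M\<^esub>i\<in>{..<n}. f i \<bullet> w i)"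
      by (rule finsum_smult_ldistr[OF _ a c[OF f], symmetric]) simp
    finally show "lin_comb n w (a \<odot>\<^bsub>?F\<^esub> f) = a \<bullet> lin_comb n w f" using a f by (simp add: lin_comb_def)
  qed
qed

lemma plus_cyclic_lin_comb:
  assumes w: "w \<in> {..<n} \<rightarrow> carrier M" and v: "v \<in> carrier M"
  shows "plus_cyclic (lin_comb n w ` carrier (free_module R {..<n})) v \<subseteq>
    lin_comb (Suc n) (w(n := v)) ` carrier (free_module R {..<Suc n})"
proof
  fix y assume "y \<in> plus_cyclic (lin_comb n w ` carrier (free_module R {..<n})) v"
  then obtain f a where f: "f \<in> carrier (free_module R {..<n})" and a: "a \<in> carrier R"
    and y: "y = lin_comb n w f \<boxplus> a \<bullet> v" by (auto simp: plus_cyclic_def)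
  let ?g = "f(n := a)"
  have g: "?g \<in> carrier (free_module R {..<Suc n})"
    using R.free_module_funcset[OF f] a by (auto simp: R.free_module_finite PiE_def extensional_def Pi_def less_Suc_eq)
  have c: "(\<lambda>i. f i \<bullet> w i) \<in> {..<n} \<rightarrow> carrier M" using R.free_module_mem[OF f] w by auto
  have "lin_comb (Suc n) (w(n := v)) ?g = (\<Oplus>\<^bsub>M\<^esub>i\<in>{..<Suc n}. ?g i \<bullet> (w(n := v)) i)" using g by (simp add: lin_comb_def)
  also have "\<dots> = a \<bullet> v \<boxplus> (\<Oplus>\<^bsub>M\<^esub>i\<in>{..<n}. ?g i \<bullet> (w(n := v)) i)"
    unfolding lessThan_Suc using c a v by (subst M.finsum_insert) auto
  also have "(\<Oplus>\<^bsub>M\<^esub>i\<in>{..<n}. ?g i \<bullet> (w(n := v)) i) = (\<Oplus>\<^bsub>M\<^esub>i\<in>{..<n}. f i \<bullet> w i)"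
    by (rule M.finsum_cong') (use c in auto)
  also have "\<dots> = lin_comb n w f" using f by (simp add: lin_comb_def)
  also have "a \<bullet> v \<boxplus> lin_comb n w f = y"
    unfolding y using lin_mapsD(1)[OF lin_comb_lin_maps[OF w] f] a v by (simp add: M.a_comm)
  finally show "y \<in> lin_comb (Suc n) (w(n := v)) ` carrier (free_module R {..<Suc n})" using g by blast
qed

text \<open>Among the finite tuples with span inside \<open>S\<close>, one with the largest span is
  chosen; appending an element of \<open>S\<close> does not enlarge it, so the span is
  \<open>S\<close>.\<close>

lemma submodule_image_free:
  assumes acc: "acc_on {N. msub N}" and S: "msub S"
  shows "\<exists>(n :: nat) \<delta>. \<delta> \<in> lin_maps R (free_module R {..<n}) M \<and> \<delta> ` carrier (free_module R {..<n}) = S"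
proof -
  define I where "I = (\<lambda>(n, w). lin_comb n w ` carrier (free_module R {..<n}))"
  define P where "P = (\<lambda>(n, w). w \<in> {..<n} \<rightarrow> carrier M \<and> I (n, w) \<subseteq> S)"
  have sub: "msub (I s)" if "P s" for s
    using that lin_map_image_sub[OF R.module_free_module lin_comb_lin_maps] by (cases s) (auto simp: I_def P_def)
  have P0: "P (0, \<lambda>_. \<zero>\<^bsub>M\<^esub>)" using sub_zero[OF S] by (auto simp: lin_comb_def I_def P_def)
  have "\<exists>s. P s \<and> (\<forall>t. P t \<longrightarrow> I s \<subseteq> I t \<longrightarrow> I t = I s)"
    by (rule acc_on_maximal_image[OF acc, where P = P]) (use sub P0 in auto)
  then obtain n w where nw: "P (n, w)" and max: "\<forall>t. P t \<longrightarrow> I (n, w) \<subseteq> I t \<longrightarrow> I t = I (n, w)" by auto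
  have w: "w \<in> {..<n} \<rightarrow> carrier M" and le: "I (n, w) \<subseteq> S" using nw by (auto simp: P_def)
  have I: "msub (I (n, w))" by (rule sub[OF nw])
  have "S \<subseteq> I (n, w)"
  proof
    fix v assume v: "v \<in> S"
    have vc: "v \<in> carrier M" by (rule sub_carr[OF S v])
    have pc: "plus_cyclic (I (n, w)) v \<subseteq> I (Suc n, w(n := v))" using plus_cyclic_lin_comb[OF w vc] by (simp add: I_def)
    have w': "w(n := v) \<in> {..<Suc n} \<rightarrow> carrier M" using w vc by (auto simp: Pi_def less_Suc_eq)
    have wS: "w i \<in> S" if "i < n" for i
    proof -
      have "lin_comb n w (free_gen R {..<n} i) \<in> S" using le R.free_gen_carrier[of i "{..<n}"] that by (auto simp: I_def)
      moreover have "lin_comb n w (free_gen R {..<n} i) = w i"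
      proof -
        have "lin_comb n w (free_gen R {..<n} i) = (\<Oplus>\<^bsub>M\<^esub>j\<in>{..<n}. free_gen R {..<n} i j \<bullet> w j)"
          using R.free_gen_carrier[of i "{..<n}"] that by (simp add: lin_comb_def)
        also have "\<dots> = (\<Oplus>\<^bsub>M\<^esub>j\<in>{..<n}. if i = j then w j else \<zero>\<^bsub>M\<^esub>)"
          by (rule M.finsum_cong') (use funcset_mem[OF w] that in \<open>auto simp: free_gen_def\<close>)
        also have "\<dots> = w i" by (rule M.finsum_singleton) (use w that in auto)
        finally show ?thesis .
      qed
      ultimately show ?thesis by simp
    qed
    have "I (Suc n, w(n := v)) \<subseteq> S"
    proof
      fix y assume "y \<in> I (Suc n, w(n := v))"
      then obtain f where f: "f \<in> carrier (free_module R {..<Suc n})" and "y = lin_comb (Suc n) (w(n := v)) f" by (auto simp: I_def)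
      then have y: "y = (\<Oplus>\<^bsub>M\<^esub>i\<in>{..<Suc n}. f i \<bullet> (w(n := v)) i)" by (simp add: lin_comb_def)
      have "(\<Oplus>\<^bsub>M\<^esub>i\<in>B. f i \<bullet> (w(n := v)) i) \<in> S" if "B \<subseteq> {..<Suc n}" for B
        using finite_subset[OF that finite_lessThan] that
      proof (induction B rule: finite_induct)
        case empty
        then show ?case using sub_zero[OF S] by simp
      next
        case (insert b B)
        have k: "f i \<bullet> (w(n := v)) i \<in> S" if "i < Suc n" for i
          by (rule sub_smult[OF S]) (use R.free_module_mem[OF f] that wS v in \<open>auto simp: less_Suc_eq\<close>)
        have "(\<Oplus>\<^bsub>M\<^esub>i\<in>insert b B. f i \<bullet> (w(n := v)) i) = f b \<bullet> (w(n := v)) b \<boxplus> (\<Oplus>\<^bsub>M\<^esub>i\<in>B. f i \<bullet> (w(n := v)) i)"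
          by (rule M.finsum_insert) (use insert k sub_carr[OF S] in auto)
        then show ?case using insert k sub_add[OF S] by auto
      qed
      then show "y \<in> S" unfolding y by blast
    qed
    then have P': "P (Suc n, w(n := v))" using w' by (auto simp: P_def)
    have sup: "I (n, w) \<subseteq> I (Suc n, w(n := v))" using plus_cyclic_superset[OF I vc] pc by blast
    have "I (Suc n, w(n := v)) = I (n, w)" using max[rule_format, OF P' sup] .
    then show "v \<in> I (n, w)" using plus_cyclic_mem[OF I vc] pc by blast
  qed
  then have "I (n, w) = S" using le by blast
  then show ?thesis using lin_comb_lin_maps[OF w]
    by (intro exI[of _ n] exI[of _ "lin_comb n w"]) (simp add: I_def)
qed

end

lemma (in module) free_resolution_exists:
  assumes acc: "acc_on {I. ideal I R}" and fg: "fin_gen R M"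
  shows "\<exists>F. free_resolution R M F"
proof -
  let ?F = "\<lambda>n :: nat. free_module R {..<n}"
  have step: "\<exists>n' \<delta>. \<delta> \<in> lin_maps R (?F n') (?F n) \<and> \<delta> ` carrier (?F n') = S" if "submodule S R (?F n)" for n S
  proof -
    interpret F: module R "?F n" by (rule R.module_free_module)
    show ?thesis by (rule F.submodule_image_free[OF F.acc_fin_gen[OF acc R.free_module_fin_gen] that])
  qed
  have "msub (carrier M)" by (rule submoduleI') auto
  then obtain n0 \<epsilon> where e: "\<epsilon> \<in> lin_maps R (?F n0) M" "\<epsilon> ` carrier (?F n0) = carrier M"
    using submodule_image_free[OF acc_fin_gen[OF acc fg]] by blast
  \<comment> \<open>A stage carries the ranks of target and source together with the differential,
    since the next stage must cover the kernel of the present one. The clause for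
    \<open>i = 0\<close> attaches the augmentation.\<close>
  define P where "P = (\<lambda>i::nat. \<lambda>(n :: nat, n' :: nat, \<delta>). \<delta> \<in> lin_maps R (?F n') (?F n) \<and>
    (i = 0 \<longrightarrow> n = n0 \<and> \<delta> ` carrier (?F n') = {x \<in> carrier (?F n0). \<epsilon> x = \<zero>\<^bsub>M\<^esub>}))"
  define Q where "Q = (\<lambda>_::nat. \<lambda>(n :: nat, n' :: nat, \<delta> :: (nat \<Rightarrow> 'a) \<Rightarrow> nat \<Rightarrow> 'a) (m :: nat, m' :: nat, \<delta>' :: (nat \<Rightarrow> 'a) \<Rightarrow> nat \<Rightarrow> 'a). m = n' \<and>
    \<delta>' ` carrier (?F m') = {x \<in> carrier (?F n'). \<delta> x = \<zero>\<^bsub>?F n\<^esub>})"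
  have "\<exists>s :: nat \<Rightarrow> nat \<times> nat \<times> ((nat \<Rightarrow> 'a) \<Rightarrow> nat \<Rightarrow> 'a). \<forall>i. P i (s i) \<and> Q i (s i) (s (Suc i))"
  proof (rule dependent_nat_choice)
    obtain n' \<delta> where "\<delta> \<in> lin_maps R (?F n') (?F n0)" "\<delta> ` carrier (?F n') = {x \<in> carrier (?F n0). \<epsilon> x = \<zero>\<^bsub>M\<^esub>}"
      using step[OF module.lin_map_kernel_sub[OF R.module_free_module module_axioms e(1)]] by blast
    then have "P 0 (n0, n', \<delta>)" by (simp add: P_def)
    then show "\<exists>s. P 0 s" by blast
  next
    fix s i assume "P i s"
    then obtain n n' \<delta> where s: "s = (n, n', \<delta>)" and d: "\<delta> \<in> lin_maps R (?F n') (?F n)" by (cases s) (auto simp: P_def)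
    obtain m \<delta>' where "\<delta>' \<in> lin_maps R (?F m) (?F n')" "\<delta>' ` carrier (?F m) = {x \<in> carrier (?F n'). \<delta> x = \<zero>\<^bsub>?F n\<^esub>}"
      using step[OF module.lin_map_kernel_sub[OF R.module_free_module R.module_free_module d]] by blast
    then have "P (Suc i) (n', m, \<delta>') \<and> Q i s (n', m, \<delta>')" by (simp add: P_def Q_def s)
    then show "\<exists>t. P (Suc i) t \<and> Q i s t" by blast
  qed
  then obtain s where s: "\<forall>i. P i (s i) \<and> Q i (s i) (s (Suc i))" by (rule exE)
  define n where "n i = fst (s i)" for i
  define \<delta> where "\<delta> i = snd (snd (s i))" for i
  have si: "s i = (n i, n (Suc i), \<delta> i)" for i
    using s[rule_format, of i] by (auto simp: Q_def n_def \<delta>_def split: prod.splits)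
  have p: "\<delta> i \<in> lin_maps R (?F (n (Suc i))) (?F (n i))" for i
    using s[rule_format, of i] unfolding P_def si by simp
  have p0: "n 0 = n0" "\<delta> 0 ` carrier (?F (n (Suc 0))) = {x \<in> carrier (?F n0). \<epsilon> x = \<zero>\<^bsub>M\<^esub>}"
    using s[rule_format, of 0] unfolding P_def si by simp_all
  have q: "\<delta> (Suc i) ` carrier (?F (n (Suc (Suc i)))) = {x \<in> carrier (?F (n (Suc i))). \<delta> i x = \<zero>\<^bsub>?F (n i)\<^esub>}" for i
    using s[rule_format, of i] unfolding Q_def si by simp
  have "free_resolution R M (n, \<delta>, \<epsilon>)"
    unfolding free_resolution_def Let_def prod.case One_nat_def using e p p0 q by simp
  then show ?thesis by blast
qed

section \<open>Extensions of the residue field\<close>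

lemma (in noeth_local) residue_module_fin_gen:
  assumes mm: "max_ideal R = mm"
  shows "module R (residue_module R)" "fin_gen R (residue_module R)"
proof -
  interpret S: noeth_local_module R "self_module R" mm by (rule noeth_local_self)
  let ?N = "residue_module R"
  have N: "?N = quot_module R (self_module R) mm" by (simp add: residue_module_def mm)
  have sub: "submodule mm R (self_module R)" using submodule_self_iff mm_ideal by simp
  show mod: "module R ?N" unfolding N by (rule S.module_quot_module[OF sub])
  interpret N: module R ?N by (rule mod)
  let ?e = "mm +>\<^bsub>self_module R\<^esub> \<one>"
  have e: "{?e} \<subseteq> carrier ?N" unfolding N S.quot_carrier by simp
  have "carrier ?N \<subseteq> mod_span R ?N {?e}"
  proof
    fix p assume "p \<in> carrier ?N"
    then obtain a where a: "a \<in> carrier R" "p = mm +>\<^bsub>self_module R\<^esub> a" unfolding N S.quot_carrier by auto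
    have "a \<odot>\<^bsub>?N\<^esub> ?e = p" using S.quot_smult[OF sub a(1), of \<one>] a by (simp add: N)
    moreover have "a \<odot>\<^bsub>?N\<^esub> ?e \<in> mod_span R ?N {?e}"
      by (rule N.sub_smult[OF N.mod_span_sub[OF e] a(1) subsetD[OF N.mod_span_superset]]) simp
    ultimately show "p \<in> mod_span R ?N {?e}" by simp
  qed
  then have "mod_span R ?N {?e} = carrier ?N" using N.sub_carr[OF N.mod_span_sub[OF e]] by blast
  then show "fin_gen R ?N" unfolding fin_gen_def using e by (intro exI[of _ "{?e}"]) simp
qed

lemma (in cring) lin_ext_lin_maps:
  "l \<in> I \<rightarrow> carrier R \<Longrightarrow> (\<lambda>f\<in>carrier (free_module R I). lin_ext I l f) \<in> lin_maps R (free_module R I) (self_module R)"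
proof -
  assume l: "l \<in> I \<rightarrow> carrier R"
  interpret F: module R "free_module R I" by (rule module_free_module)
  show ?thesis unfolding lin_maps_def
    using lin_ext_add[OF _ _ l] lin_ext_smult[OF _ _ l] lin_ext_closed[OF _ l] by auto
qed

text \<open>The source is free, so the map can be lifted on its generators. The kernel of \<epsilon>
  then becomes the concrete condition that \<open>l f\<close> lies in \<open>mm\<close>.\<close>

lemma (in noeth_local) residue_map_lift:
  assumes mm: "max_ideal R = mm" and e: "\<epsilon> \<in> lin_maps R (free_module R {..<n :: nat}) (residue_module R)"
  shows "\<exists>l\<in>lin_maps R (free_module R {..<n}) (self_module R).
    \<forall>f\<in>carrier (free_module R {..<n}). \<epsilon> f = mm +>\<^bsub>self_module R\<^esub> l f"
proof -
  interpret S: noeth_local_module R "self_module R" mm by (rule noeth_local_self)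
  let ?N = "residue_module R" and ?F = "free_module R {..<n}"
  interpret F: module R ?F by (rule module_free_module)
  interpret N: module R ?N by (rule residue_module_fin_gen(1)[OF mm])
  have N: "?N = quot_module R (self_module R) mm" by (simp add: residue_module_def mm)
  have sub: "submodule mm R (self_module R)" using submodule_self_iff mm_ideal by simp
  have "\<forall>i\<in>{..<n}. \<exists>a\<in>carrier R. \<epsilon> (free_gen R {..<n} i) = mm +>\<^bsub>self_module R\<^esub> a"
    using lin_mapsD(1)[OF e] free_gen_carrier[of _ "{..<n}"] unfolding N S.quot_carrier by (force simp: image_iff)
  then obtain b where b: "\<forall>i\<in>{..<n}. b i \<in> carrier R \<and> \<epsilon> (free_gen R {..<n} i) = mm +>\<^bsub>self_module R\<^esub> b i" by metis
  then have bc: "b \<in> {..<n} \<rightarrow> carrier R" by auto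
  let ?l = "\<lambda>f\<in>carrier ?F. lin_ext {..<n} b f"
  have l: "?l \<in> lin_maps R ?F (self_module R)" by (rule lin_ext_lin_maps[OF bc])
  note lp = lin_maps_props[OF F.module_axioms S.module_axioms l, simplified]
  let ?p = "\<lambda>f\<in>carrier ?F. mm +>\<^bsub>self_module R\<^esub> ?l f"
  have p: "?p \<in> lin_maps R ?F ?N" unfolding lin_maps_def
  proof (intro CollectI conjI ballI)
    show "?p \<in> carrier ?F \<rightarrow>\<^sub>E carrier ?N" unfolding N S.quot_carrier using lp(1) by auto
    fix f g assume "f \<in> carrier ?F" "g \<in> carrier ?F"
    then show "?p (f \<oplus>\<^bsub>?F\<^esub> g) = ?p f \<oplus>\<^bsub>?N\<^esub> ?p g"
      using S.quot_add[OF sub, of "?l f" "?l g"] lp by (simp add: N)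
  next
    fix a f assume "a \<in> carrier R" "f \<in> carrier ?F"
    then show "?p (a \<odot>\<^bsub>?F\<^esub> f) = a \<odot>\<^bsub>?N\<^esub> ?p f"
      using S.quot_smult[OF sub, of a "?l f"] lp by (simp add: N)
  qed
  have "\<epsilon> f = ?p f" if "f \<in> carrier ?F" for f
    by (rule free_module_agree[OF N.module_axioms e p _ that])
      (use b free_gen_carrier[of _ "{..<n}"] lin_ext_gen[OF _ bc] in auto)
  then have "\<forall>f\<in>carrier ?F. \<epsilon> f = mm +>\<^bsub>self_module R\<^esub> ?l f" by simp
  then show ?thesis using l by blast
qed

lemma (in module) add_diff_self: "v \<in> carrier M \<Longrightarrow> w \<in> carrier M \<Longrightarrow> (v \<boxplus> w) \<boxminus> w = v" by algebra

context dim_one_module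
begin

text \<open>A socle element \<open>u\<close> of \<open>M / x M\<close> defines a map from \<open>mm\<close> to \<open>M\<close>, \<open>r \<mapsto> r u / x\<close>, and
  so a class in \<open>Ext\<^sup>1(R / mm, M)\<close>, which vanishes only if \<open>u\<close> is in \<open>x M\<close>.\<close>

lemma socle_one_dim:
  assumes mm: "max_ideal R = mm"
    and ext: "\<And>p q. module R (ext_module R 1 (residue_module R) M) \<Longrightarrow> p \<in> carrier (ext_module R 1 (residue_module R) M) \<Longrightarrow> q \<in> carrier (ext_module R 1 (residue_module R) M) \<Longrightarrow>
      p \<noteq> \<zero>\<^bsub>ext_module R 1 (residue_module R) M\<^esub> \<Longrightarrow> \<exists>c\<in>carrier R. q = c \<odot>\<^bsub>ext_module R 1 (residue_module R) M\<^esub> p"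
    and u: "u \<in> carrier M" "u \<notin> xM" "\<And>r. r \<in> mm \<Longrightarrow> r \<bullet> u \<in> xM"
    and v: "v \<in> carrier M" "\<And>r. r \<in> mm \<Longrightarrow> r \<bullet> v \<in> xM"
  shows "\<exists>c\<in>carrier R. v \<boxminus> c \<bullet> u \<in> xM"
proof -
  let ?N = "residue_module R"
  \<comment> \<open>\<open>ext_module\<close> refers to a chosen resolution, of which nothing but
    exactness is known.\<close>
  obtain n \<delta> \<epsilon> where s: "(SOME F. free_resolution R ?N F) = (n, \<delta>, \<epsilon>)" by (metis prod_cases3)
  have "\<exists>F. free_resolution R ?N F"
    by (rule module.free_resolution_exists[OF R.residue_module_fin_gen(1)[OF mm] acc R.residue_module_fin_gen(2)[OF mm]])
  then have "free_resolution R ?N (SOME F. free_resolution R ?N F)" by (rule someI_ex)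
  then have res: "free_resolution R ?N (n, \<delta>, \<epsilon>)" by (simp add: s)
  define F where "F = (\<lambda>i. free_module R {..<n i})"
  have mF: "module R (F i)" for i unfolding F_def by (rule R.module_free_module)
  interpret F0: module R "F 0" by (rule mF)
  interpret F1: module R "F (Suc 0)" by (rule mF)
  interpret F2: module R "F (Suc (Suc 0))" by (rule mF)
  interpret N: module R ?N by (rule R.residue_module_fin_gen(1)[OF mm])
  have N: "?N = quot_module R (self_module R) mm" by (simp add: residue_module_def mm)
  have sub: "submodule mm R (self_module R)" using R.submodule_self_iff mm_ideal by simp
  have \<epsilon>: "\<epsilon> \<in> lin_maps R (F 0) ?N" "\<epsilon> ` carrier (F 0) = carrier ?N"
    and d0: "\<delta> 0 \<in> lin_maps R (F (Suc 0)) (F 0)" "\<delta> 0 ` carrier (F (Suc 0)) = {x \<in> carrier (F 0). \<epsilon> x = \<zero>\<^bsub>?N\<^esub>}"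
    and d1: "\<delta> (Suc 0) \<in> lin_maps R (F (Suc (Suc 0))) (F (Suc 0))"
      "\<delta> (Suc 0) ` carrier (F (Suc (Suc 0))) = {x \<in> carrier (F (Suc 0)). \<delta> 0 x = \<zero>\<^bsub>F 0\<^esub>}"
    using res unfolding free_resolution_def F_def Let_def by auto
  from R.residue_map_lift[OF mm \<epsilon>(1)[unfolded F_def]] obtain l where
    l: "l \<in> lin_maps R (F 0) (self_module R)" "\<And>f. f \<in> carrier (F 0) \<Longrightarrow> \<epsilon> f = mm +>\<^bsub>self_module R\<^esub> l f"
    unfolding F_def by blast
  note lp = lin_maps_props[OF F0.module_axioms S.module_axioms l(1), simplified]
  note dp = lin_maps_props[OF F1.module_axioms F0.module_axioms d0(1)]
  have Nz: "\<zero>\<^bsub>?N\<^esub> = mm" by (simp add: N S.quot_zero)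
  have ker: "\<epsilon> f = \<zero>\<^bsub>?N\<^esub> \<longleftrightarrow> l f \<in> mm" if "f \<in> carrier (F 0)" for f
    using S.coset_eq_self_iff[OF sub] lp(1)[OF that] by (simp add: l(2)[OF that] Nz)
  have lmm: "l (\<delta> 0 y) \<in> mm" if "y \<in> carrier (F (Suc 0))" for y
    using ker[OF dp(1)[OF that]] d0(2) that by blast
  define Z where "Z = {\<phi> \<in> lin_maps R (F 1) M. \<forall>x\<in>carrier (F (Suc 1)). \<phi> (\<delta> 1 x) = \<zero>\<^bsub>M\<^esub>}"
  define B where "B = {\<lambda>x\<in>carrier (F 1). \<psi> (\<delta> 0 x) | \<psi>. \<psi> \<in> lin_maps R (F 0) M}"
  have E: "ext_module R 1 ?N M = quot_module R (fun_module (carrier (F 1)) Z M) B"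
    unfolding ext_module_def s by (simp add: F_def Z_def B_def)
  have Zc: "(\<lambda>x\<in>carrier (F 1). f x \<boxplus> g x) \<in> Z" "(\<lambda>x\<in>carrier (F 1). a \<bullet> f x) \<in> Z"
    if "f \<in> Z" "g \<in> Z" "a \<in> carrier R" for f g a
    using that lin_maps_closed(1,2)[OF mF module_axioms] lin_mapsD(1)[OF d1(1)] by (auto simp: Z_def)
  have z0: "(\<lambda>x\<in>carrier (F 1). \<zero>\<^bsub>M\<^esub>) \<in> lin_maps R (F 1) M" by (auto simp: lin_maps_def)
  have Z0: "(\<lambda>x\<in>carrier (F 1). \<zero>\<^bsub>M\<^esub>) \<in> Z" using z0 lin_mapsD(1)[OF d1(1)] by (auto simp: Z_def)
  let ?C = "fun_module (carrier (F 1)) Z M"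
  have ZE: "Z \<subseteq> carrier (F 1) \<rightarrow>\<^sub>E carrier M" unfolding Z_def lin_maps_def by blast
  have "module R ?C"
    by (rule module_fun_module[OF ZE Z0 Zc(1)[OF _ _ R.zero_closed] Zc(2)])
  then interpret C: module R ?C .
  have BI: "(\<lambda>x\<in>carrier (F 1). \<psi> (\<delta> 0 x)) \<in> B" if "\<psi> \<in> lin_maps R (F 0) M" for \<psi> using that by (auto simp: B_def)
  have B: "submodule B R ?C"
  proof (rule C.submoduleI'; unfold fun_module_simps)
    show "B \<subseteq> Z"
    proof
      fix \<phi> assume "\<phi> \<in> B"
      then obtain \<psi> where \<phi>: "\<phi> = (\<lambda>x\<in>carrier (F 1). \<psi> (\<delta> 0 x))" and \<psi>: "\<psi> \<in> lin_maps R (F 0) M" by (auto simp: B_def)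
      note pp = lin_maps_props[OF mF module_axioms \<psi>]
      have "\<phi> \<in> lin_maps R (F 1) M" unfolding \<phi> lin_maps_def using pp dp by auto
      moreover have "\<phi> (\<delta> 1 x) = \<zero>\<^bsub>M\<^esub>" if "x \<in> carrier (F (Suc 1))" for x
      proof -
        have "\<delta> 1 x \<in> carrier (F 1)" "\<delta> 0 (\<delta> 1 x) = \<zero>\<^bsub>F 0\<^esub>" using d1(2) that by auto
        then show ?thesis using pp(4) by (simp add: \<phi>)
      qed
      ultimately show "\<phi> \<in> Z" by (simp add: Z_def)
    qed
    have "(\<lambda>x\<in>carrier (F 1). (\<lambda>x\<in>carrier (F 0). \<zero>\<^bsub>M\<^esub>) (\<delta> 0 x)) \<in> B" by (rule BI) (auto simp: lin_maps_def)
    moreover have "(\<lambda>x\<in>carrier (F 1). (\<lambda>x\<in>carrier (F 0). \<zero>\<^bsub>M\<^esub>) (\<delta> 0 x)) = (\<lambda>x\<in>carrier (F 1). \<zero>\<^bsub>M\<^esub>)"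
      by (rule restrict_ext) (use dp(1) in simp)
    ultimately show "(\<lambda>x\<in>carrier (F 1). \<zero>\<^bsub>M\<^esub>) \<in> B" by simp
  next
    fix f g assume "f \<in> B" "g \<in> B"
    then obtain \<psi> \<psi>' where k: "f = (\<lambda>x\<in>carrier (F 1). \<psi> (\<delta> 0 x))" "\<psi> \<in> lin_maps R (F 0) M"
      "g = (\<lambda>x\<in>carrier (F 1). \<psi>' (\<delta> 0 x))" "\<psi>' \<in> lin_maps R (F 0) M" by (auto simp: B_def)
    have "(\<lambda>x\<in>carrier (F 1). (\<lambda>x\<in>carrier (F 0). \<psi> x \<boxplus> \<psi>' x) (\<delta> 0 x)) \<in> B"
      by (rule BI[OF lin_maps_closed(1)[OF mF module_axioms k(2,4)]])
    moreover have "(\<lambda>x\<in>carrier (F 1). (\<lambda>x\<in>carrier (F 0). \<psi> x \<boxplus> \<psi>' x) (\<delta> 0 x)) = (\<lambda>x\<in>carrier (F 1). f x \<boxplus> g x)"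
      by (rule restrict_ext) (use dp(1) in \<open>simp add: k\<close>)
    ultimately show "(\<lambda>x\<in>carrier (F 1). f x \<boxplus> g x) \<in> B" by simp
  next
    fix a f assume a: "a \<in> carrier R" and "f \<in> B"
    then obtain \<psi> where k: "f = (\<lambda>x\<in>carrier (F 1). \<psi> (\<delta> 0 x))" "\<psi> \<in> lin_maps R (F 0) M" by (auto simp: B_def)
    have "(\<lambda>x\<in>carrier (F 1). (\<lambda>x\<in>carrier (F 0). a \<bullet> \<psi> x) (\<delta> 0 x)) \<in> B"
      by (rule BI[OF lin_maps_closed(2)[OF mF module_axioms k(2) a]])
    moreover have "(\<lambda>x\<in>carrier (F 1). (\<lambda>x\<in>carrier (F 0). a \<bullet> \<psi> x) (\<delta> 0 x)) = (\<lambda>x\<in>carrier (F 1). a \<bullet> f x)"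
      by (rule restrict_ext) (use dp(1) in \<open>simp add: k\<close>)
    ultimately show "(\<lambda>x\<in>carrier (F 1). a \<bullet> f x) \<in> B" by simp
  qed
  have u3: "\<forall>r\<in>mm. r \<bullet> u \<in> xM" and v2: "\<forall>r\<in>mm. r \<bullet> v \<in> xM" using u(3) v(2) by blast+
  \<comment> \<open>The quotient of \<open>r u\<close> by \<open>x\<close>, unique because
    \<open>x\<close> is regular on \<open>M\<close>. Composed with \<open>l (\<delta> 0 y)\<close>,
    which has values in \<open>mm\<close>, it becomes a cocycle \<open>\<phi> u\<close> on
    \<open>F 1\<close>.\<close>
  define \<theta> where "\<theta> u r = (THE w. w \<in> carrier M \<and> x \<bullet> w = r \<bullet> u)" for u r
  have th: "\<theta> u r = w" if "w \<in> carrier M" "x \<bullet> w = r \<bullet> u" for u r w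
    unfolding \<theta>_def by (rule the_equality) (use that xM_cancel in auto)
  have thp: "\<theta> u r \<in> carrier M" "x \<bullet> \<theta> u r = r \<bullet> u" if h: "\<forall>r\<in>mm. r \<bullet> u \<in> xM" "r \<in> mm" for u r
  proof -
    obtain w where "w \<in> carrier M" "r \<bullet> u = x \<bullet> w" using h by (auto simp: xM_def)
    then show "\<theta> u r \<in> carrier M" "x \<bullet> \<theta> u r = r \<bullet> u" using th[of w r u] by auto
  qed
  define \<phi> where "\<phi> u = (\<lambda>y\<in>carrier (F 1). \<theta> u (l (\<delta> 0 y)))" for u
  have \<phi>Z: "\<phi> u \<in> Z" if u: "u \<in> carrier M" "\<forall>r\<in>mm. r \<bullet> u \<in> xM" for u
  proof -
    note t = thp[OF u(2)]
    have "\<theta> u (r \<oplus> r') = \<theta> u r \<boxplus> \<theta> u r'" if "r \<in> mm" "r' \<in> mm" for r r'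
      by (rule th) (use that t[of r] t[of r'] u(1) x_carr mm_carr in \<open>simp_all add: smult_l_distr smult_r_distr\<close>)
    moreover have "\<theta> u (a \<otimes> r) = a \<bullet> \<theta> u r" if a: "a \<in> carrier R" and r: "r \<in> mm" for a r
    proof (rule th)
      have "x \<bullet> a \<bullet> \<theta> u r = a \<bullet> (x \<bullet> \<theta> u r)" using a x_carr t(1)[OF r] by algebra
      also have "\<dots> = (a \<otimes> r) \<bullet> u" unfolding t(2)[OF r] using a r u(1) mm_carr by (simp add: smult_assoc1)
      finally show "x \<bullet> a \<bullet> \<theta> u r = (a \<otimes> r) \<bullet> u" .
    qed (use a t r in simp)
    ultimately have "\<phi> u \<in> lin_maps R (F 1) M" unfolding lin_maps_def \<phi>_def
      using t(1) lmm dp lp by auto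
    moreover have "\<theta> u \<zero> = \<zero>\<^bsub>M\<^esub>" by (rule th) (use u(1) x_carr in auto)
    then have "\<phi> u (\<delta> 1 y) = \<zero>\<^bsub>M\<^esub>" if "y \<in> carrier (F (Suc 1))" for y
    proof -
      have "\<delta> 1 y \<in> carrier (F 1)" "\<delta> 0 (\<delta> 1 y) = \<zero>\<^bsub>F 0\<^esub>" using d1(2) that by auto
      then show ?thesis using lp(4) \<open>\<theta> u \<zero> = \<zero>\<^bsub>M\<^esub>\<close> by (simp add: \<phi>_def)
    qed
    ultimately show ?thesis by (simp add: Z_def)
  qed
  \<comment> \<open>Suppose that \<open>\<phi> u\<close> comes from \<psi> on \<open>F 0\<close>,
    and let \<open>f\<close> map to 1 in the residue field. Then \<open>x f\<close> is in the image
    of \<open>\<delta> 0\<close>, and evaluating there gives \<open>l f u = x \<psi> f\<close>, with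
    \<open>l f\<close> a unit.\<close>
  have \<phi>B: "u \<in> xM" if u: "u \<in> carrier M" "\<forall>r\<in>mm. r \<bullet> u \<in> xM" and B: "\<phi> u \<in> B" for u
  proof -
    obtain \<psi> where \<psi>: "\<phi> u = (\<lambda>y\<in>carrier (F 1). \<psi> (\<delta> 0 y))" "\<psi> \<in> lin_maps R (F 0) M" using B by (auto simp: B_def)
    note pp = lin_maps_props[OF mF module_axioms \<psi>(2)]
    have "mm +>\<^bsub>self_module R\<^esub> \<one> \<in> \<epsilon> ` carrier (F 0)" unfolding \<epsilon>(2) N S.quot_carrier by simp
    then obtain f where f: "f \<in> carrier (F 0)" "mm +>\<^bsub>self_module R\<^esub> l f = mm +>\<^bsub>self_module R\<^esub> \<one>" using l(2) by auto
    have lf: "l f \<in> carrier R" using lp(1)[OF f(1)] .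
    have unit: "l f \<in> Units R"
    proof (rule nonunits[OF lf], rule notI)
      assume "l f \<in> mm"
      then have "mm +>\<^bsub>self_module R\<^esub> \<one> = mm" using f(2) S.coset_eq_self_iff[OF sub, of "l f"] lf by simp
      then have "\<one> \<in> mm" using S.coset_eq_self_iff[OF sub, of \<one>] by simp
      then show False using one_notin_mm by simp
    qed
    have xf: "x \<odot>\<^bsub>F 0\<^esub> f \<in> carrier (F 0)" using x_carr f(1) by simp
    have lxf: "l (x \<odot>\<^bsub>F 0\<^esub> f) = x \<otimes> l f" by (rule lp(3)[OF x_carr f(1)])
    have "x \<otimes> l f \<in> mm" by (rule ideal.I_r_closed[OF mm_ideal x_mm lf])
    then have "\<epsilon> (x \<odot>\<^bsub>F 0\<^esub> f) = \<zero>\<^bsub>?N\<^esub>" using ker[OF xf] lxf by simp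
    then have "x \<odot>\<^bsub>F 0\<^esub> f \<in> \<delta> 0 ` carrier (F 1)" using d0(2) xf by simp
    then obtain y where y: "y \<in> carrier (F 1)" "x \<odot>\<^bsub>F 0\<^esub> f = \<delta> 0 y" by blast
    have "\<theta> u (x \<otimes> l f) = l f \<bullet> u" by (rule th) (use u(1) lf x_carr in \<open>simp_all add: smult_assoc1\<close>)
    then have "\<phi> u y = l f \<bullet> u" using y lxf by (simp add: \<phi>_def)
    moreover have "\<phi> u y = x \<bullet> \<psi> f" using y pp(3)[OF x_carr f(1)] by (simp add: \<psi>(1))
    moreover have "x \<bullet> \<psi> f \<in> xM" unfolding xM_def using pp(1)[OF f(1)] by blast
    ultimately have "l f \<bullet> u \<in> xM" by simp
    then show ?thesis by (rule unit_smult_mem[OF xM_sub unit u(1)])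
  qed
  have pu: "\<phi> u \<in> carrier ?C" using \<phi>Z[OF u(1) u3] by (simp add: fun_module_simps)
  have pv: "\<phi> v \<in> carrier ?C" using \<phi>Z[OF v(1) v2] by (simp add: fun_module_simps)
  have "\<phi> u \<notin> B" using \<phi>B[OF u(1) u3] u(2) by blast
  then have nz: "B +>\<^bsub>?C\<^esub> \<phi> u \<noteq> \<zero>\<^bsub>ext_module R 1 ?N M\<^esub>"
    unfolding E C.quot_zero by (simp only: C.coset_eq_self_iff[OF B pu] not_False_eq_True)
  have mem: "B +>\<^bsub>?C\<^esub> \<phi> u \<in> carrier (ext_module R 1 ?N M)" "B +>\<^bsub>?C\<^esub> \<phi> v \<in> carrier (ext_module R 1 ?N M)"
    unfolding E C.quot_carrier by (rule imageI[OF pu], rule imageI[OF pv])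
  have "module R (ext_module R 1 ?N M)" unfolding E by (rule C.module_quot_module[OF B])
  from ext[OF this mem nz]
  obtain c where c: "c \<in> carrier R" "B +>\<^bsub>?C\<^esub> \<phi> v = c \<odot>\<^bsub>ext_module R 1 ?N M\<^esub> (B +>\<^bsub>?C\<^esub> \<phi> u)" by blast
  have cpu: "c \<odot>\<^bsub>?C\<^esub> \<phi> u \<in> carrier ?C" by (rule C.smult_closed[OF c(1) pu])
  have dB: "\<phi> v \<ominus>\<^bsub>?C\<^esub> c \<odot>\<^bsub>?C\<^esub> \<phi> u \<in> B"
    using c(2) unfolding E C.quot_smult[OF B c(1) pu] by (simp only: C.coset_eq_iff[OF B pv cpu])
  \<comment> \<open>The relation in Ext says that \<open>\<phi> v - c (\<phi> u)\<close> is a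
    coboundary. By linearity it equals \<open>\<phi> w\<close>, so the class of \<open>w\<close> is
    trivial.\<close>
  define w where "w = v \<boxminus> c \<bullet> u"
  have w: "w \<in> carrier M" using u v c by (simp add: w_def)
  have wx: "\<forall>r\<in>mm. r \<bullet> w \<in> xM"
  proof
    fix r assume r: "r \<in> mm"
    have "r \<bullet> w = r \<bullet> v \<boxminus> c \<bullet> (r \<bullet> u)" unfolding w_def using mm_carr[OF r] u(1) v(1) c(1) by algebra
    then show "r \<bullet> w \<in> xM" using sub_diff[OF xM_sub v(2)[OF r] sub_smult[OF xM_sub c(1) u(3)[OF r]]] by simp
  qed
  have pw: "\<phi> w \<in> carrier ?C" using \<phi>Z[OF w wx] by (simp add: fun_module_simps)
  have "\<phi> v = \<phi> w \<oplus>\<^bsub>?C\<^esub> c \<odot>\<^bsub>?C\<^esub> \<phi> u"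
  proof -
    have "\<theta> v r = \<theta> w r \<boxplus> c \<bullet> \<theta> u r" if r: "r \<in> mm" for r
    proof (rule th)
      note tu = thp[OF u3 r] and tw = thp[OF wx r]
      have "x \<bullet> (\<theta> w r \<boxplus> c \<bullet> \<theta> u r) = x \<bullet> \<theta> w r \<boxplus> c \<bullet> (x \<bullet> \<theta> u r)"
        using tu(1) tw(1) x_carr c(1) by algebra
      also have "\<dots> = r \<bullet> w \<boxplus> c \<bullet> (r \<bullet> u)" by (simp only: tu(2) tw(2))
      also have "\<dots> = r \<bullet> v" unfolding w_def using mm_carr[OF r] u(1) v(1) c(1) by algebra
      finally show "x \<bullet> (\<theta> w r \<boxplus> c \<bullet> \<theta> u r) = r \<bullet> v" .
    qed (use thp[OF u3 r] thp[OF wx r] c(1) in simp)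
    then show ?thesis unfolding fun_module_simps \<phi>_def
      by (intro restrict_ext) (use lmm in simp)
  qed
  then have "\<phi> v \<ominus>\<^bsub>?C\<^esub> c \<odot>\<^bsub>?C\<^esub> \<phi> u = \<phi> w" by (simp only: C.add_diff_self[OF pw cpu])
  then have "w \<in> xM" using \<phi>B[OF w wx] dB by simp
  then show ?thesis using c(1) by (auto simp: w_def)
qed

end

section \<open>Connections on the canonical module\<close>

text \<open>The regular element \<open>x\<close> lies in no prime but \<open>mm\<close>: a smaller
  prime would be minimal, and some \<open>t\<close> outside it would kill \<open>x\<close>. An
  associated prime of \<open>R / x R\<close> contains \<open>x\<close>, so it is \<open>mm\<close>,
  and it provides \<open>s\<close>.\<close>

lemma (in isolated_cm) dim_one_parameter:
  assumes "d = 1"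
  shows "\<exists>x s. dim_one R mm x s"
proof -
  interpret S: noeth_local_module R "self_module R" mm by (rule noeth_local_self)
  obtain x where x: "xs = [x]" using xs_length assms by (cases xs) auto
  have reg: "x \<in> mm" "\<And>a. a \<in> carrier R \<Longrightarrow> x \<otimes> a = \<zero> \<Longrightarrow> a = \<zero>"
    using xs_regular by (simp_all add: x)
  have xc: "x \<in> carrier R" using mm_carr reg by simp
  have primes: "p = mm" if p: "primeideal p R" "x \<in> p" for p
  proof (rule ccontr)
    assume "p \<noteq> mm"
    then have "p \<subset> mm" using prime_mm p by blast
    then have "prime_chain R p (Suc 0)"
      by (intro prime_chain_Suc[OF p(1) order_refl prime_chain_prime[OF primeideal_mm order_refl]])
    then obtain t where t: "t \<in> carrier R - p" "t \<otimes> x = \<zero>" using height_zero_local[OF p(1) _ p(2)] assms by auto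
    then have "t = \<zero>" using reg(2)[of t] xc by (simp add: m_comm)
    then show False using t ideal_zero[OF primeideal_props(1)[OF p(1)]] by simp
  qed
  note I = cgenideal_ideal[OF xc]
  have "PIdl x \<subseteq> mm" by (rule cgenideal_minimal[OF mm_ideal reg(1)])
  then have "\<one> \<notin> PIdl x" using one_notin_mm by blast
  moreover have Is: "submodule (PIdl x) R (self_module R)" using I submodule_self_iff by simp
  ultimately obtain s where s: "s \<in> carrier R" "s \<notin> PIdl x" and pr: "primeideal (S.colon (PIdl x) s) R"
    using S.associated_prime[OF acc Is, of \<one>] by auto
  have "x \<otimes> s \<in> PIdl x" using ideal.I_r_closed[OF I cgenideal_self[OF xc]] s by simp
  then have "S.colon (PIdl x) s = mm" using primes[OF pr] xc by (simp add: S.colon_def)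
  then have "r \<otimes> s \<in> PIdl x" if "r \<in> mm" for r using that by (auto simp: S.colon_def)
  then have "dim_one R mm x s"
    by (intro dim_one.intro noeth_local_axioms dim_one_axioms.intro) (use reg primes s in auto)
  then show ?thesis by blast
qed

text \<open>The parameter \<open>x\<close> comes from the ring, whereas the depth of
  \<open>M\<close> yields some other regular \<open>y\<close>. If \<open>x\<close> killed a nonzero
  element, an associated prime containing \<open>x\<close> would be \<open>mm\<close>, and so
  contain \<open>y\<close>.\<close>

lemma (in dim_one) dim_one_module_of_regular:
  assumes M: "noeth_local_module R M mm" and ws: "noeth_local_module.rel_regular M mm {\<zero>\<^bsub>M\<^esub>} ws" "ws \<noteq> []"
  shows "dim_one_module R M mm x s"
proof -
  interpret M: noeth_local_module R M mm by (rule M)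
  obtain y where y: "y \<in> mm" "\<And>v. v \<in> carrier M \<Longrightarrow> y \<odot>\<^bsub>M\<^esub> v = \<zero>\<^bsub>M\<^esub> \<Longrightarrow> v = \<zero>\<^bsub>M\<^esub>"
    using ws by (cases ws) auto
  have "v = \<zero>\<^bsub>M\<^esub>" if v: "v \<in> carrier M" "x \<odot>\<^bsub>M\<^esub> v = \<zero>\<^bsub>M\<^esub>" for v
  proof (rule ccontr)
    assume "v \<noteq> \<zero>\<^bsub>M\<^esub>"
    then have "v \<notin> {\<zero>\<^bsub>M\<^esub>}" by simp
    then obtain c where c: "c \<in> carrier R" "c \<odot>\<^bsub>M\<^esub> v \<notin> {\<zero>\<^bsub>M\<^esub>}" and pr: "primeideal (M.colon {\<zero>\<^bsub>M\<^esub>} (c \<odot>\<^bsub>M\<^esub> v)) R"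
      using M.associated_prime[OF acc M.zero_sub v(1)] by blast
    have "x \<odot>\<^bsub>M\<^esub> (c \<odot>\<^bsub>M\<^esub> v) = c \<odot>\<^bsub>M\<^esub> (x \<odot>\<^bsub>M\<^esub> v)" using v(1) c(1) x_carr
      by (simp add: M.smult_assoc1[symmetric] m_comm)
    then have "x \<in> M.colon {\<zero>\<^bsub>M\<^esub>} (c \<odot>\<^bsub>M\<^esub> v)" using x_carr v c by (simp add: M.colon_def)
    then have "M.colon {\<zero>\<^bsub>M\<^esub>} (c \<odot>\<^bsub>M\<^esub> v) = mm" using x_primes[OF pr] by simp
    then have "y \<in> M.colon {\<zero>\<^bsub>M\<^esub>} (c \<odot>\<^bsub>M\<^esub> v)" using y by simp
    then have "y \<odot>\<^bsub>M\<^esub> (c \<odot>\<^bsub>M\<^esub> v) = \<zero>\<^bsub>M\<^esub>" by (simp add: M.colon_def)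
    then show False using y(2) c v by auto
  qed
  then show ?thesis
    by (intro dim_one_module.intro dim_one_axioms M dim_one_module_axioms.intro)
qed

text \<open>A nonzero \<open>p\<close> is a nonzero scalar times the basis vector, and this scalar
  is invertible in the field.\<close>

lemma has_dim_one_generator:
  assumes K: "field K" and A: "algebra K A" and Q: "module A Q"
    and dim: "has_dim K (restrict_scalars A Q) 1"
    and p: "p \<in> carrier Q" "p \<noteq> \<zero>\<^bsub>Q\<^esub>" and q: "q \<in> carrier Q"
  shows "\<exists>c\<in>carrier A. q = c \<odot>\<^bsub>Q\<^esub> p"
proof -
  interpret K: field K by (rule K)
  interpret Q: module A Q by (rule Q)
  interpret A: algebra K A by (rule A)
  let ?V = "restrict_scalars A Q"
  let ?i = "\<lambda>a. a \<odot>\<^bsub>A\<^esub> \<one>\<^bsub>A\<^esub>"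
  have ic: "?i a \<in> carrier A" if "a \<in> carrier K" for a using that by simp
  interpret V: abelian_monoid ?V
    by (rule abelian_monoidI) (simp_all add: restrict_scalars_def Q.M.a_ac)
  obtain b where b: "b \<in> carrier Q" "\<And>v. v \<in> carrier Q \<Longrightarrow> \<exists>c\<in>carrier K. v = ?i c \<odot>\<^bsub>Q\<^esub> b"
  proof -
    obtain B where B: "is_basis K ?V B" "card B = 1" using dim unfolding has_dim_def by blast
    then obtain b where Bb: "B = {b}" using card_1_singletonE by blast
    have bc: "b \<in> carrier Q" using B(1) by (simp add: is_basis_def Bb restrict_scalars_def)
    have "\<exists>c\<in>carrier K. v = ?i c \<odot>\<^bsub>Q\<^esub> b" if v: "v \<in> carrier Q" for v
    proof -
      obtain c where c: "c \<in> {b} \<rightarrow>\<^sub>E carrier K" "v = (\<Oplus>\<^bsub>?V\<^esub>b\<in>{b}. c b \<odot>\<^bsub>?V\<^esub> b)"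
        using B(1) v unfolding is_basis_def Bb by (auto simp: restrict_scalars_def)
      have cb: "c b \<in> carrier K" using c(1) by auto
      have "c b \<odot>\<^bsub>?V\<^esub> b \<in> carrier ?V" using cb bc by (simp add: restrict_scalars_def)
      then have "v = c b \<odot>\<^bsub>?V\<^esub> b" unfolding c(2) by (subst V.finsum_insert) simp_all
      then show ?thesis using cb by (auto simp: restrict_scalars_def)
    qed
    then show ?thesis using that bc by blast
  qed
  obtain \<alpha> where \<alpha>: "\<alpha> \<in> carrier K" "p = ?i \<alpha> \<odot>\<^bsub>Q\<^esub> b" using b(2)[OF p(1)] by blast
  obtain \<beta> where \<beta>: "\<beta> \<in> carrier K" "q = ?i \<beta> \<odot>\<^bsub>Q\<^esub> b" using b(2)[OF q] by blast
  have "\<alpha> \<noteq> \<zero>\<^bsub>K\<^esub>" using p(2) \<alpha>(2) b(1) by auto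
  then have u: "\<alpha> \<in> Units K" using \<alpha>(1) K.field_Units by simp
  then have ac: "inv\<^bsub>K\<^esub> \<alpha> \<in> carrier K" by simp
  have "?i (inv\<^bsub>K\<^esub> \<alpha>) \<otimes>\<^bsub>A\<^esub> ?i \<alpha> = ?i (inv\<^bsub>K\<^esub> \<alpha> \<otimes>\<^bsub>K\<^esub> \<alpha>)"
    using A.smult_assoc2[OF ac Q.R.one_closed, of "?i \<alpha>"] \<alpha>(1) ac by (simp add: A.smult_assoc1)
  also have "\<dots> = \<one>\<^bsub>A\<^esub>" using u by simp
  finally have one: "?i (inv\<^bsub>K\<^esub> \<alpha>) \<otimes>\<^bsub>A\<^esub> ?i \<alpha> = \<one>\<^bsub>A\<^esub>" .
  have "?i (inv\<^bsub>K\<^esub> \<alpha>) \<odot>\<^bsub>Q\<^esub> p = (?i (inv\<^bsub>K\<^esub> \<alpha>) \<otimes>\<^bsub>A\<^esub> ?i \<alpha>) \<odot>\<^bsub>Q\<^esub> b"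
    unfolding \<alpha>(2) using ic[OF ac] ic[OF \<alpha>(1)] b(1) by (simp only: Q.smult_assoc1)
  then have "b = ?i (inv\<^bsub>K\<^esub> \<alpha>) \<odot>\<^bsub>Q\<^esub> p" using one b(1) by simp
  then have "q = (?i \<beta> \<otimes>\<^bsub>A\<^esub> ?i (inv\<^bsub>K\<^esub> \<alpha>)) \<odot>\<^bsub>Q\<^esub> p"
    using \<beta>(2) ic[OF \<beta>(1)] ic[OF ac] p(1) by (simp only: Q.smult_assoc1)
  then show ?thesis using ic[OF \<beta>(1)] ic[OF ac] by blast
qed

lemma of_nat_unit_of_algebra:
  fixes n :: nat
  assumes K: "field K" and A: "algebra K A" and n: "[n] \<cdot>\<^bsub>K\<^esub> \<one>\<^bsub>K\<^esub> \<noteq> \<zero>\<^bsub>K\<^esub>"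
  shows "[n] \<cdot>\<^bsub>A\<^esub> \<one>\<^bsub>A\<^esub> \<in> Units A"
proof -
  interpret K: field K by (rule K)
  interpret A: algebra K A by (rule A)
  let ?i = "\<lambda>a. a \<odot>\<^bsub>A\<^esub> \<one>\<^bsub>A\<^esub>"
  let ?n = "[n] \<cdot>\<^bsub>K\<^esub> \<one>\<^bsub>K\<^esub>"
  have nc: "?n \<in> carrier K" by simp
  then have u: "?n \<in> Units K" using n K.field_Units by simp
  then have ac: "inv\<^bsub>K\<^esub> ?n \<in> carrier K" by simp
  have "[m] \<cdot>\<^bsub>A\<^esub> \<one>\<^bsub>A\<^esub> = ?i ([m] \<cdot>\<^bsub>K\<^esub> \<one>\<^bsub>K\<^esub>)" for m :: nat
    by (induction m) (simp_all add: A.smult_l_distr)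
  then have e: "[n] \<cdot>\<^bsub>A\<^esub> \<one>\<^bsub>A\<^esub> = ?i ?n" .
  have "?i (inv\<^bsub>K\<^esub> ?n) \<otimes>\<^bsub>A\<^esub> ?i ?n = ?i (inv\<^bsub>K\<^esub> ?n \<otimes>\<^bsub>K\<^esub> ?n)"
    using A.smult_assoc2[OF ac A.one_closed, of "?i ?n"] nc ac by (simp add: A.smult_assoc1)
  also have "\<dots> = \<one>\<^bsub>A\<^esub>" using u by simp
  finally have l: "?i (inv\<^bsub>K\<^esub> ?n) \<otimes>\<^bsub>A\<^esub> ?i ?n = \<one>\<^bsub>A\<^esub>" .
  have c: "?i (inv\<^bsub>K\<^esub> ?n) \<in> carrier A" "?i ?n \<in> carrier A" using ac nc by simp_all
  then have "?i ?n \<otimes>\<^bsub>A\<^esub> ?i (inv\<^bsub>K\<^esub> ?n) = \<one>\<^bsub>A\<^esub>" using l A.m_comm by simp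
  then show ?thesis unfolding e Units_def using l c by blast
qed

lemma (in module) form_of_free_generator:
  assumes w: "w \<in> carrier M" "\<And>v. v \<in> carrier M \<Longrightarrow> \<exists>a\<in>carrier R. v = a \<bullet> w"
    "\<And>a. a \<in> carrier R \<Longrightarrow> a \<bullet> w = \<zero>\<^bsub>M\<^esub> \<Longrightarrow> a = \<zero>"
  shows "\<exists>g. is_form R M g \<and> (\<forall>v\<in>carrier M. v = g v \<bullet> w)"
proof -
  obtain g where g: "\<And>v. v \<in> carrier M \<Longrightarrow> g v \<in> carrier R \<and> v = g v \<bullet> w" using w(2) by metis
  have uniq: "a = b" if "a \<in> carrier R" "b \<in> carrier R" "a \<bullet> w = b \<bullet> w" for a b
  proof -
    have "(a \<ominus> b) \<bullet> w = a \<bullet> w \<boxminus> b \<bullet> w" using that(1,2) w(1) by algebra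
    then have "(a \<ominus> b) \<bullet> w = \<zero>\<^bsub>M\<^esub>" using that w(1) by (simp add: M.minus_eq M.r_neg)
    then have "a \<ominus> b = \<zero>" using w(3) that by simp
    then show ?thesis using that by (simp add: R.r_right_minus_eq)
  qed
  have "is_form R M g" unfolding is_form_def
  proof (intro conjI ballI)
    fix x y assume xy: "x \<in> carrier M" "y \<in> carrier M"
    note gx = g[OF xy(1)] and gy = g[OF xy(2)] and gs = g[OF M.a_closed[OF xy]]
    have "(g x \<oplus> g y) \<bullet> w = g x \<bullet> w \<boxplus> g y \<bullet> w" using gx gy w(1) by (simp add: smult_l_distr)
    then have "g (x \<boxplus> y) \<bullet> w = (g x \<oplus> g y) \<bullet> w" using gx gy gs by metis
    then show "g (x \<boxplus> y) = g x \<oplus> g y" using uniq gx gy gs by simp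
  next
    fix a x assume ax: "a \<in> carrier R" "x \<in> carrier M"
    note gx = g[OF ax(2)] and gs = g[OF smult_closed[OF ax]]
    have "(a \<otimes> g x) \<bullet> w = a \<bullet> g x \<bullet> w" using gx ax w(1) by (simp add: smult_assoc1)
    then have "g (a \<bullet> x) \<bullet> w = (a \<otimes> g x) \<bullet> w" using gx gs by metis
    then show "g (a \<bullet> x) = a \<otimes> g x" using uniq gx gs ax by simp
  qed (use g in blast)
  then show ?thesis using g by blast
qed

text \<open>The coordinate \<open>g\<close> identifies \<open>W\<close> with the ring, and the
  construction for forms is used with \<open>nn = F = 1\<close>, where its equation reads
  \<open>g u = D (g v)\<close>.\<close>

lemma integrable_connection_of_free_rank_one:
  fixes K :: "'k ring" and A :: "('k, 'a) module" and W :: "('a, 'm) module"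
  assumes alg: "algebra K A" and mod: "module A W"
    and w: "w \<in> carrier W" "\<And>v. v \<in> carrier W \<Longrightarrow> \<exists>a\<in>carrier A. v = a \<odot>\<^bsub>W\<^esub> w"
      "\<And>a. a \<in> carrier A \<Longrightarrow> a \<odot>\<^bsub>W\<^esub> w = \<zero>\<^bsub>W\<^esub> \<Longrightarrow> a = \<zero>\<^bsub>A\<^esub>"
  shows "\<exists>nabla. integrable_connection K A W nabla"
proof -
  interpret W: module A W by (rule mod)
  obtain g where g: "is_form A W g" "\<And>v. v \<in> carrier W \<Longrightarrow> v = g v \<odot>\<^bsub>W\<^esub> w"
    using W.form_of_free_generator[OF w] by blast
  show ?thesis
  proof (rule integrable_connection_of_form[OF alg mod g(1) _ _ _ W.R.one_closed, of "\<one>\<^bsub>A\<^esub>"])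
    fix v assume v: "v \<in> carrier W" "g v = \<zero>\<^bsub>A\<^esub>"
    then show "v = \<zero>\<^bsub>W\<^esub>" using g(2)[OF v(1)] w(1) by simp
  next
    fix D v assume D: "W.R.is_deriv D" and v: "v \<in> carrier W"
    have gc: "g v \<in> carrier A" using is_formD(1)[OF g(1) v] .
    have Dg: "D (g v) \<in> carrier A" using W.R.is_derivD(1)[OF D gc] .
    have "g (D (g v) \<odot>\<^bsub>W\<^esub> w) \<odot>\<^bsub>W\<^esub> w = D (g v) \<odot>\<^bsub>W\<^esub> w" using g(2)[of "D (g v) \<odot>\<^bsub>W\<^esub> w"] Dg w(1) by simp
    have "g w \<odot>\<^bsub>W\<^esub> w = w" using g(2)[OF w(1)] by simp
    then have "(g w \<ominus>\<^bsub>A\<^esub> \<one>\<^bsub>A\<^esub>) \<odot>\<^bsub>W\<^esub> w = \<zero>\<^bsub>W\<^esub>"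
      using is_formD(1)[OF g(1) w(1)] w(1) by (simp add: W.R.minus_eq W.smult_l_distr W.smult_l_minus W.M.r_neg)
    then have "g w \<ominus>\<^bsub>A\<^esub> \<one>\<^bsub>A\<^esub> = \<zero>\<^bsub>A\<^esub>" using w(3) is_formD(1)[OF g(1) w(1)] by simp
    then have "g w = \<one>\<^bsub>A\<^esub>" using is_formD(1)[OF g(1) w(1)] by (simp add: W.R.r_right_minus_eq)
    then have "g (D (g v) \<odot>\<^bsub>W\<^esub> w) = D (g v)" using is_formD(3)[OF g(1) Dg w(1)] Dg by simp
    then show "\<exists>u\<in>carrier W. \<one>\<^bsub>A\<^esub> \<otimes>\<^bsub>A\<^esub> \<one>\<^bsub>A\<^esub> \<otimes>\<^bsub>A\<^esub> g u =
        \<one>\<^bsub>A\<^esub> \<otimes>\<^bsub>A\<^esub> \<one>\<^bsub>A\<^esub> \<otimes>\<^bsub>A\<^esub> D (g v) \<ominus>\<^bsub>A\<^esub> D \<one>\<^bsub>A\<^esub> \<otimes>\<^bsub>A\<^esub> g v"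
      using Dg gc w(1) by (intro bexI[of _ "D (g v) \<odot>\<^bsub>W\<^esub> w"]) (simp_all add: W.R.deriv_one[OF D] W.R.minus_eq)
  qed (use W.R.deriv_one in simp_all)
qed

theorem theorem17:
  fixes k :: "'k ring" and A :: "('k, 'a) module" and W :: "('a, 'w) module" and d :: nat
  assumes "algebraically_closed k"
    and "\<And>n::nat. n > 0 \<Longrightarrow> [n] \<cdot>\<^bsub>k\<^esub> \<one>\<^bsub>k\<^esub> \<noteq> \<zero>\<^bsub>k\<^esub>"
    and "algebra k A"
    and "noetherian_ring A"
    and "complete_local_ring A"
    and "has_residue_field k A"
    and "cohen_macaulay_ring A"
    and "isolated_singularity A"
    and "krull_dim A = enat d" and "d \<ge> 1"
    and "canonical_module TYPE('e) k A W"
    and "(d = 1 \<and> gorenstein_ring TYPE('f) A) \<or> (d \<ge> 2 \<and> Q_gorenstein A W)"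
  shows "\<exists>nabla. integrable_connection k A W nabla"
proof -
  let ?m = "max_ideal A"
  note dim = \<open>krull_dim A = enat d\<close>
  have field: "field k" using \<open>algebraically_closed k\<close> by (simp add: algebraically_closed_def)
  have "local_ring A" using \<open>complete_local_ring A\<close> by (simp add: complete_local_ring_def)
  then interpret A: noeth_local A ?m using \<open>noetherian_ring A\<close> by (rule local_ring_noeth_local)
  interpret S: noeth_local_module A "self_module A" ?m by (rule A.noeth_local_self)
  have W: "module A W" "fin_gen A W" "depth A W = enat d"
    and W_ext: "has_dim k (restrict_scalars A (ext_module A d (residue_module A) W)) 1"
    using \<open>canonical_module TYPE('e) k A W\<close> dim by (simp_all add: canonical_module_def max_cohen_macaulay_def)
  interpret W: module A W by (rule W(1))
  have "noeth_local_module A W ?m"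
    by (intro noeth_local_module.intro A.noeth_local_axioms W.module_axioms noeth_local_module_axioms.intro
      W.acc_fin_gen[OF A.acc W(2)])
  then interpret W: noeth_local_module A W ?m .
  have depth_A: "depth A (self_module A) = enat d" using \<open>cohen_macaulay_ring A\<close> dim by (simp add: cohen_macaulay_ring_def)
  obtain xs where xs: "regular_sequence A (self_module A) xs" "set xs \<subseteq> ?m" "length xs = d"
    using enat_Sup_attained[OF depth_A[unfolded depth_def] \<open>d \<ge> 1\<close>] by blast
  obtain ws where ws: "regular_sequence A W ws" "set ws \<subseteq> ?m" "length ws = d"
    using enat_Sup_attained[OF W(3)[unfolded depth_def] \<open>d \<ge> 1\<close>] by blast
  note ws_reg = W.rel_regular_of_regular_sequence[OF ws(1,2)]
  \<comment> \<open>\<open>W\<close> is nonzero because a regular sequence generates a proper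
    submodule.\<close>
  obtain v0 where v0: "v0 \<in> carrier W" "v0 \<noteq> \<zero>\<^bsub>W\<^esub>"
  proof -
    let ?I = "mod_span A W {y \<odot>\<^bsub>W\<^esub> v | y v. y \<in> set ws \<and> v \<in> carrier W}"
    have ne: "?I \<noteq> carrier W" using ws(1) by (simp add: regular_sequence_def Let_def)
    have sub: "submodule ?I A W" by (rule W.mod_span_sub) (use ws(2) A.mm_carr in auto)
    then show ?thesis using ne that W.sub_carr[OF sub] W.sub_zero[OF sub] by blast
  qed
  have "isolated_cm A ?m d xs"
  proof (intro isolated_cm.intro A.noeth_local_axioms isolated_cm_axioms.intro)
    show "noeth_local_module.rel_regular (self_module A) ?m {\<zero>\<^bsub>A\<^esub>} xs"
      using S.rel_regular_of_regular_sequence[OF xs(1,2)] by simp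
  qed (use prime_chain_le_dim[OF dim] xs \<open>d \<ge> 1\<close> \<open>isolated_singularity A\<close> in \<open>auto simp: isolated_singularity_def\<close>)
  then interpret A: isolated_cm A ?m d xs .
  consider (one) "d = 1" "gorenstein_ring TYPE('f) A" | (two) "d \<ge> 2" "Q_gorenstein A W"
    using \<open>(d = 1 \<and> gorenstein_ring TYPE('f) A) \<or> (d \<ge> 2 \<and> Q_gorenstein A W)\<close> by blast
  then show ?thesis
  proof cases
    case two
    interpret cm_module A W ?m d xs ws
      by (intro cm_module.intro A.isolated_cm_axioms W.noeth_local_module_axioms cm_module_axioms.intro ws_reg ws(3) two(1) W(2))
    obtain n where n: "n \<ge> 1" "mod_iso A (dual_module A (dual_module A (tensor_power A W n))) (self_module A)"
      using two(2) unfolding Q_gorenstein_def by blast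
    obtain mu where mu: "multilinear A W n mu"
      "\<And>l. multilinear A W n l \<Longrightarrow> \<exists>b\<in>carrier A. \<forall>x\<in>{..<n} \<rightarrow>\<^sub>E carrier W. l x = b \<otimes>\<^bsub>A\<^esub> mu x"
      using W.multilinear_generator[OF n(2)] by blast
    let ?n = "[n] \<cdot>\<^bsub>A\<^esub> \<one>\<^bsub>A\<^esub>"
    \<comment> \<open>Characteristic zero enters here: it provides the factor \<open>1/n\<close> of
      the connection.\<close>
    have nu: "?n \<in> Units A"
      by (rule of_nat_unit_of_algebra[OF field \<open>algebra k A\<close>]) (use n assms(2) in simp)
    obtain g F where g: "is_form A W g" "\<And>w. w \<in> carrier W \<Longrightarrow> g w = \<zero>\<^bsub>A\<^esub> \<Longrightarrow> w = \<zero>\<^bsub>W\<^esub>"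
      and F: "F \<in> carrier A" "F \<noteq> \<zero>\<^bsub>A\<^esub>"
      and eq: "\<And>D w. A.is_deriv D \<Longrightarrow> w \<in> carrier W \<Longrightarrow> \<exists>v\<in>carrier W.
        ?n \<otimes>\<^bsub>A\<^esub> F \<otimes>\<^bsub>A\<^esub> g v = ?n \<otimes>\<^bsub>A\<^esub> F \<otimes>\<^bsub>A\<^esub> D (g w) \<ominus>\<^bsub>A\<^esub> D F \<otimes>\<^bsub>A\<^esub> g w"
      using connection_equation[OF n(1) mu(2) mu(1) nu v0] by blast
    show ?thesis
    proof (rule integrable_connection_of_form[OF \<open>algebra k A\<close> W(1) g _ _ F(1) _ eq])
      show "?n \<in> carrier A" by simp
      show "D ?n = \<zero>\<^bsub>A\<^esub>" if "A.is_deriv D" for D by (rule A.deriv_of_nat[OF that])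
      fix x assume x: "x \<in> carrier A" "?n \<otimes>\<^bsub>A\<^esub> F \<otimes>\<^bsub>A\<^esub> x = \<zero>\<^bsub>A\<^esub>"
      have "\<zero>\<^bsub>A\<^esub> \<otimes>\<^bsub>A\<^esub> inv\<^bsub>A\<^esub> ?n \<noteq> \<one>\<^bsub>A\<^esub>"
        using A.one_notin_mm A.ideal_zero[OF A.mm_ideal] A.Units_inv_closed[OF nu] by auto
      then have "?n \<noteq> \<zero>\<^bsub>A\<^esub>" using A.Units_r_inv[OF nu] by metis
      then show "x = \<zero>\<^bsub>A\<^esub>" using A.integral[OF two(1)] x F by (metis A.m_closed A.add.nat_pow_closed A.one_closed)
    qed
  next
    case one
    obtain x s where "dim_one A ?m x s" using A.dim_one_parameter[OF one(1)] by blast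
    then interpret D: dim_one A ?m x s .
    have "ws \<noteq> []" using ws(3) one(1) by auto
    then interpret dim_one_module A W ?m x s
      by (rule D.dim_one_module_of_regular[OF W.noeth_local_module_axioms ws_reg])
    obtain E :: "nat \<Rightarrow> ('a, 'f) module" and \<eta> \<delta> r where
      "injective_resolution A (self_module A) E \<eta> \<delta>" "\<forall>i>r. carrier (E i) = {\<zero>\<^bsub>E i\<^esub>}"
      using one(2) unfolding gorenstein_ring_def finite_injdim_def by blast
    then have self: D.self_extension by (rule D.self_extension_of_resolution)
    \<comment> \<open>The resolution of \<open>A\<close> has given self-injectivity of
      \<open>A / x A\<close>; that of \<open>W\<close> serves to divide socle elements by
      \<open>s\<close>. They may live in different types.\<close>
    obtain I :: "nat \<Rightarrow> ('a, 'e) module" and \<zeta> \<xi> t where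
      I: "injective_resolution A W I \<zeta> \<xi>" "\<forall>i>t. carrier (I i) = {\<zero>\<^bsub>I i\<^esub>}"
      using \<open>canonical_module TYPE('e) k A W\<close> unfolding canonical_module_def finite_injdim_def by blast
    \<comment> \<open>A module of dimension one over \<open>k\<close> is generated by each of its
      nonzero elements; the condition on Ext is used in this form.\<close>
    let ?E = "ext_module A 1 (residue_module A) W"
    have ext: "\<exists>c\<in>carrier A. q = c \<odot>\<^bsub>?E\<^esub> p" if "module A ?E" "p \<in> carrier ?E" "q \<in> carrier ?E" "p \<noteq> \<zero>\<^bsub>?E\<^esub>" for p q
      using has_dim_one_generator[OF field \<open>algebra k A\<close> that(1) _ that(2,4,3)] W_ext one(1) by simp
    obtain w where w: "w \<in> carrier W" "\<And>v. v \<in> carrier W \<Longrightarrow> \<exists>a\<in>carrier A. v = a \<odot>\<^bsub>W\<^esub> w"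
      "\<And>a. a \<in> carrier A \<Longrightarrow> a \<odot>\<^bsub>W\<^esub> w = \<zero>\<^bsub>W\<^esub> \<Longrightarrow> a = \<zero>\<^bsub>A\<^esub>"
      using free_of_rank_one[OF self socle_lift[OF I] socle_one_dim[OF refl ext] v0] by blast
    show ?thesis by (rule integrable_connection_of_free_rank_one[OF \<open>algebra k A\<close> W(1) w])
  qed
qed

end
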